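(* Let $\alpha\in[0,1)$ be fixed. If $\mathrm{P}\neq\mathrm{NP}$, then there is no polynomial-time approximation algorithm for FLaMECaST with cost parameter $\alpha$ on group-equally-spaced circular instances with one intermediate layer that achieves approximation factor $1+\frac{1}{n^2}$, where $n$ is the number of sources.
   Context: FLaMECaST: an instance $I=(S,T,C,\alpha)$ consists of a finite set $S$ of sources and a finite set $T$ of sinks, each with a fixed position in $\mathbb{R}^2$, capacities $C=(c_0,\dots,c_{\lambda+1})$ with integers $c_0\ge\dots\ge c_{\lambda+1}\ge 1$ ($\lambda$ = number of intermediate layers), and a parameter $\alpha\in[0,1]$. A topology is a rooted forest (edges directed from child to parent) of height at most $\lambda+1$ whose leaves are exactly $S$ and whose roots lie in $T$ (other vertices are Steiner vertices); the layer of a vertex is its distance to its root; the load $\ell(v)$ of a vertex is the number of sources in its subtree and the load of edge $uv$ ($u$ child) is $\ell(u)$; it is valid if $\ell(v)\le c_i$ for every vertex $v$ in layer $i$. An embedding maps sources and sinks to their positions and Steiner vertices to arbitrary points; edge cost is $\|\mathrm{pos}(u)-\mathrm{pos}(v)\|\cdot\ell(uv)^\alpha$, and the goal is a valid layout (topology plus embedding) of minimum total cost; an approximation algorithm with factor $\rho$ outputs a valid layout of cost at most $\rho$ times the minimum. A circular instance has all sources on a circle and all sinks at its center; it is group-equally-spaced if the sources are partitioned into groups, sources of one group share a position, and the group positions are evenly distributed on the circle. *)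

theory Defs
  imports "HOL-Analysis.Analysis" "HOL-Computational_Algebra.Polynomial"
begin

section \<open>Deterministic multi-tape Turing machines\<close>

text \<open>
  States and tape symbols are initial segments of the naturals. State 0 is the start state and
  state 1 the halting state; symbol 0 is the blank and the bits are the symbols 1 and 2. Tapes
  are infinite in both directions. The input is written on tape 0 from cell 0 on, and the output
  is the word on the last tape that starts in cell 0 and ends before the first blank.
\<close>

datatype move = Move_Left | Stay | Move_Right

record tm =
  num_tapes :: nat
  num_states :: nat
  num_symbols :: nat
  delta :: "nat \<Rightarrow> nat list \<Rightarrow> nat \<times> (nat \<times> move) list"

definition wf_tm :: "tm \<Rightarrow> bool" where
  "wf_tm M \<longleftrightarrow>
     num_tapes M \<ge> 1 \<and> num_states M \<ge> 2 \<and> num_symbols M \<ge> 3 \<and>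
     (\<forall>q<num_states M. \<forall>xs. length xs = num_tapes M \<and> set xs \<subseteq> {..<num_symbols M} \<longrightarrow>
        fst (delta M q xs) < num_states M \<and>
        length (snd (delta M q xs)) = num_tapes M \<and>
        fst ` set (snd (delta M q xs)) \<subseteq> {..<num_symbols M})"

type_synonym tape = "(int \<Rightarrow> nat) \<times> int"
type_synonym config = "nat \<times> tape list"

fun move_offset :: "move \<Rightarrow> int" where
  "move_offset Move_Left = -1"
| "move_offset Stay = 0"
| "move_offset Move_Right = 1"

fun read_tape :: "tape \<Rightarrow> nat" where
  "read_tape (f, i) = f i"

fun act_tape :: "nat \<times> move \<Rightarrow> tape \<Rightarrow> tape" where
  "act_tape (a, d) (f, i) = (f(i := a), i + move_offset d)"

definition tm_step :: "tm \<Rightarrow> config \<Rightarrow> config" where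
  "tm_step M c =
     (if fst c = 1 then c
      else let (q, as) = delta M (fst c) (map read_tape (snd c))
           in (q, map2 act_tape as (snd c)))"

definition bit_symbol :: "bool \<Rightarrow> nat" where
  "bit_symbol b = (if b then 2 else 1)"

definition blank_tape :: tape where
  "blank_tape = (\<lambda>_. 0, 0)"

definition input_tape :: "bool list \<Rightarrow> tape" where
  "input_tape w =
     (\<lambda>i. if 0 \<le> i \<and> i < int (length w) then bit_symbol (w ! nat i) else 0, 0)"

definition init_config :: "tm \<Rightarrow> bool list \<Rightarrow> config" where
  "init_config M w = (0, input_tape w # replicate (num_tapes M - 1) blank_tape)"

definition tape_holds :: "tape \<Rightarrow> bool list \<Rightarrow> bool" where
  "tape_holds t w \<longleftrightarrow>
     (\<forall>i<length w. fst t (int i) = bit_symbol (w ! i)) \<and> fst t (int (length w)) = 0"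

definition tm_run :: "tm \<Rightarrow> bool list \<Rightarrow> nat \<Rightarrow> config" where
  "tm_run M w t = (tm_step M ^^ t) (init_config M w)"

definition halts_within :: "tm \<Rightarrow> bool list \<Rightarrow> nat \<Rightarrow> bool" where
  "halts_within M w t \<longleftrightarrow> fst (tm_run M w t) = 1"

definition outputs :: "tm \<Rightarrow> bool list \<Rightarrow> bool list \<Rightarrow> bool" where
  "outputs M w y \<longleftrightarrow>
     (\<exists>t. fst (tm_run M w t) = 1 \<and> tape_holds (last (snd (tm_run M w t))) y)"

definition polytime_on :: "tm \<Rightarrow> bool list set \<Rightarrow> bool" where
  "polytime_on M W \<longleftrightarrow>
     (\<exists>p :: nat poly. \<forall>w\<in>W. halts_within M w (poly p (length w)))"


section \<open>The classes P and NP\<close>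

type_synonym language = "bool list set"

definition class_P :: "language set" where
  "class_P = {A. \<exists>M. wf_tm M \<and> polytime_on M UNIV \<and> (\<forall>w. outputs M w [w \<in> A])}"

text \<open>
  Self-delimiting code of a word: every bit is preceded by True, and a final False
  marks the end.
\<close>
definition enc_word :: "bool list \<Rightarrow> bool list" where
  "enc_word w = concat (map (\<lambda>b. [True, b]) w) @ [False]"

definition enc_pair :: "bool list \<Rightarrow> bool list \<Rightarrow> bool list" where
  "enc_pair x u = enc_word x @ u"

definition class_NP :: "language set" where
  "class_NP = {A. \<exists>R\<in>class_P. \<exists>q :: nat poly. \<forall>x.
     x \<in> A \<longleftrightarrow> (\<exists>u. length u \<le> poly q (length x) \<and> enc_pair x u \<in> R)}"


section \<open>FLaMECaST\<close>

type_synonym point = "real \<times> real"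

text \<open>The capacities are listed from layer 0 (the sinks) to the last layer.\<close>
record flamecast =
  sources :: "nat set"
  sinks :: "nat set"
  src_pos :: "nat \<Rightarrow> point"
  snk_pos :: "nat \<Rightarrow> point"
  caps :: "nat list"
  cost_exp :: real

definition flamecast_instance :: "flamecast \<Rightarrow> bool" where
  "flamecast_instance I \<longleftrightarrow>
     finite (sources I) \<and> finite (sinks I) \<and>
     length (caps I) \<ge> 2 \<and> sorted_wrt (\<ge>) (caps I) \<and> (\<forall>c\<in>set (caps I). c \<ge> 1) \<and>
     0 \<le> cost_exp I \<and> cost_exp I \<le> 1"

definition intermediate_layers :: "flamecast \<Rightarrow> nat" where
  "intermediate_layers I = length (caps I) - 2"

datatype vertex = Source nat | Sink nat | Steiner nat

text \<open>Arcs are pairs (child, parent).\<close>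
record layout =
  verts :: "vertex set"
  arcs :: "(vertex \<times> vertex) set"
  place :: "vertex \<Rightarrow> point"

definition rooted_forest :: "layout \<Rightarrow> bool" where
  "rooted_forest L \<longleftrightarrow>
     finite (verts L) \<and> arcs L \<subseteq> verts L \<times> verts L \<and>
     single_valued (arcs L) \<and> acyclic (arcs L)"

definition roots :: "layout \<Rightarrow> vertex set" where
  "roots L = {v \<in> verts L. \<forall>u. (v, u) \<notin> arcs L}"

definition leaves :: "layout \<Rightarrow> vertex set" where
  "leaves L = {v \<in> verts L. \<forall>u. (u, v) \<notin> arcs L}"

definition layer :: "layout \<Rightarrow> vertex \<Rightarrow> nat" where
  "layer L v = (THE k. \<exists>r\<in>roots L. (v, r) \<in> arcs L ^^ k)"

definition load :: "layout \<Rightarrow> vertex \<Rightarrow> nat" where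
  "load L v = card {s. Source s \<in> verts L \<and> (Source s, v) \<in> (arcs L)\<^sup>*}"

definition is_topology :: "flamecast \<Rightarrow> layout \<Rightarrow> bool" where
  "is_topology I L \<longleftrightarrow>
     rooted_forest L \<and>
     (\<forall>v\<in>verts L. layer L v \<le> intermediate_layers I + 1) \<and>
     leaves L = Source ` sources I \<and>
     roots L \<subseteq> Sink ` sinks I \<and>
     (\<forall>v\<in>verts L - leaves L - roots L. v \<in> range Steiner)"

definition valid_topology :: "flamecast \<Rightarrow> layout \<Rightarrow> bool" where
  "valid_topology I L \<longleftrightarrow>
     is_topology I L \<and> (\<forall>v\<in>verts L. load L v \<le> caps I ! layer L v)"

definition is_embedding :: "flamecast \<Rightarrow> layout \<Rightarrow> bool" where
  "is_embedding I L \<longleftrightarrow>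
     (\<forall>s\<in>sources I. place L (Source s) = src_pos I s) \<and>
     (\<forall>t\<in>sinks I. place L (Sink t) = snk_pos I t)"

definition valid_layout :: "flamecast \<Rightarrow> layout \<Rightarrow> bool" where
  "valid_layout I L \<longleftrightarrow> valid_topology I L \<and> is_embedding I L"

definition layout_cost :: "flamecast \<Rightarrow> layout \<Rightarrow> real" where
  "layout_cost I L =
     (\<Sum>(u, v)\<in>arcs L. norm (place L u - place L v) * real (load L u) powr cost_exp I)"

definition opt_cost :: "flamecast \<Rightarrow> real" where
  "opt_cost I = Inf (layout_cost I ` {L. valid_layout I L})"


section \<open>Group-equally-spaced circular instances\<close>

definition circle_point :: "point \<Rightarrow> real \<Rightarrow> real \<Rightarrow> point" where
  "circle_point c r \<phi> = (fst c + r * cos \<phi>, snd c + r * sin \<phi>)"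

definition circular :: "flamecast \<Rightarrow> point \<Rightarrow> real \<Rightarrow> bool" where
  "circular I c r \<longleftrightarrow>
     r > 0 \<and> (\<forall>s\<in>sources I. dist (src_pos I s) c = r) \<and> (\<forall>t\<in>sinks I. snk_pos I t = c)"

text \<open>
  The fibres of grp are the m groups; the group with index 0 lies at angle \<theta>.
\<close>
definition equally_spaced ::
    "flamecast \<Rightarrow> point \<Rightarrow> real \<Rightarrow> real \<Rightarrow> nat \<Rightarrow> (nat \<Rightarrow> nat) \<Rightarrow> bool" where
  "equally_spaced I c r \<theta> m grp \<longleftrightarrow>
     circular I c r \<and> grp ` sources I = {..<m} \<and>
     (\<forall>s\<in>sources I. src_pos I s = circle_point c r (\<theta> + 2 * pi * real (grp s) / real m))"

definition group_equally_spaced_circular :: "flamecast \<Rightarrow> bool" where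
  "group_equally_spaced_circular I \<longleftrightarrow> (\<exists>c r \<theta> m grp. equally_spaced I c r \<theta> m grp)"


section \<open>Encoding of instances and layouts as words\<close>

fun nat_bits :: "nat \<Rightarrow> bool list" where
  "nat_bits n = (if n = 0 then [] else odd n # nat_bits (n div 2))"

declare nat_bits.simps [simp del]

definition enc_words :: "bool list list \<Rightarrow> bool list" where
  "enc_words ws = concat (map enc_word ws)"

definition rat_words :: "rat \<Rightarrow> bool list list" where
  "rat_words x =
     (let (a, b) = quotient_of x in [[a < 0], nat_bits (nat \<bar>a\<bar>), nat_bits (nat b)])"

definition point_words :: "rat \<times> rat \<Rightarrow> bool list list" where
  "point_words p = rat_words (fst p) @ rat_words (snd p)"

definition rat_point :: "rat \<times> rat \<Rightarrow> point" where
  "rat_point p = (of_rat (fst p), of_rat (snd p))"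

definition list_words :: "('a \<Rightarrow> bool list list) \<Rightarrow> 'a list \<Rightarrow> bool list list" where
  "list_words f xs = nat_bits (length xs) # concat (map f xs)"

text \<open>
  Points equally spaced on a circle have irrational coordinates in general. The positions are
  therefore given by the centre and the position of group 0, both rational, together with the
  number of groups and the group index of each source. All sources and all sinks are listed
  one by one, numbers are in binary, and the fixed cost exponent is not part of the input.
\<close>
definition encodes_instance :: "bool list \<Rightarrow> flamecast \<Rightarrow> bool" where
  "encodes_instance w I \<longleftrightarrow>
     (\<exists>c p r \<theta> m grp ss ts.
        equally_spaced I (rat_point c) r \<theta> m grp \<and>
        circle_point (rat_point c) r \<theta> = rat_point p \<and>
        distinct ss \<and> set ss = sources I \<and> distinct ts \<and> set ts = sinks I \<and>
        w = enc_words (point_words c @ point_words p @ [nat_bits m] @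
              list_words (\<lambda>s. [nat_bits s, nat_bits (grp s)]) ss @
              list_words (\<lambda>t. [nat_bits t]) ts @
              list_words (\<lambda>c. [nat_bits c]) (caps I)))"

fun vertex_words :: "vertex \<Rightarrow> bool list list" where
  "vertex_words (Source s) = [nat_bits 0, nat_bits s]"
| "vertex_words (Sink t) = [nat_bits 1, nat_bits t]"
| "vertex_words (Steiner i) = [nat_bits 2, nat_bits i]"

text \<open>
  A layout is written as the list of its arcs followed by the positions of its Steiner vertices.
  The function pt says which point a word denotes; it is a parameter, so that no particular
  finite representation of points in the plane is imposed on the output.
\<close>
definition encodes_layout :: "(bool list \<Rightarrow> point) \<Rightarrow> bool list \<Rightarrow> layout \<Rightarrow> bool" where
  "encodes_layout pt y L \<longleftrightarrow>
     (\<exists>es ps.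
        set es = arcs L \<and> verts L = fst ` arcs L \<union> snd ` arcs L \<and>
        (\<forall>(i, u)\<in>set ps. place L (Steiner i) = pt u) \<and>
        {i. Steiner i \<in> verts L} \<subseteq> fst ` set ps \<and>
        y = enc_words (list_words (\<lambda>(u, v). vertex_words u @ vertex_words v) es @
              list_words (\<lambda>(i, u). [nat_bits i, u]) ps))"


section \<open>Approximation algorithms\<close>

text \<open>
  The algorithm has to run in polynomial time on every instance of the given class; nothing is
  demanded of its output on instances without a valid layout, nor of its behaviour on other words.
\<close>
definition polytime_approximation ::
    "(bool list \<Rightarrow> point) \<Rightarrow> flamecast set \<Rightarrow> (flamecast \<Rightarrow> real) \<Rightarrow> tm \<Rightarrow> bool" where
  "polytime_approximation pt \<I> \<rho> M \<longleftrightarrow>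
     wf_tm M \<and> polytime_on M {w. \<exists>I\<in>\<I>. encodes_instance w I} \<and>
     (\<forall>I\<in>\<I>. \<forall>w. encodes_instance w I \<and> (\<exists>L. valid_layout I L) \<longrightarrow>
        (\<exists>y L. outputs M w y \<and> encodes_layout pt y L \<and> valid_layout I L \<and>
               layout_cost I L \<le> \<rho> I * opt_cost I))"

end

theory Submission
  imports Defs
begin

text \<open>
  A polynomial-time approximation algorithm would decide every language in NP. The tableau of a
  verifier is a constraint satisfaction problem on cyclic positions in which every constraint relates
  two cells at a fixed distance. It becomes a bin packing problem with numbers of polynomial size,
  since each choice of a value is a pair of items whose digits force them into two prescribed bins.
  An item of the packing problem is a group of as many sources as its size, scaled by a power of the
  number m of groups, and a bin is a sink whose capacity is the size of the bin.

  If the sources of a group of size a share the cost of their group, each one has the price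
  \<open>a powr (\<alpha> - 1)\<close>, and by the scaling this is small against the distance between two groups.
  Hence the sources that are joined at a Steiner vertex pay at least the sum of their prices, and they
  pay noticeably more unless they are exactly one group. So the optimum is the sum of all prices if
  and only if the groups can be packed, and any layout within the factor \<open>1 + 1 / n\<^sup>2\<close> of the optimum
  tells this by whether every group has a single parent.
\<close>

section \<open>Turing machines\<close>

text \<open>Every source is listed, so the packing problem has to be hard for item sizes given in
  unary. This is what the cyclic positions are for: a tableau has polynomially many positions but
  only a constant number of kinds of constraints, each relating z to z + off. A kind of item gets a
  digit of its own, the position goes into the value of the digit, and as the number of digits
  depends on the verifier alone, the sizes stay polynomial.

  The factor results from two bounds. Let \<pi> be an upper bound of the prices. The sum of all n
  prices is at most n * \<pi>, while a layout that gives two sources of one group different parents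
  costs more than this sum plus \<pi> / n. The relative excess is therefore more than 1 / n^2,
  whatever \<pi> is.

  The output is tested by its arcs only, so nothing depends on how points are written down. The
  instance always has a valid layout, since single sources can be spread over the sinks and the
  total size is at most the total capacity; hence the algorithm must answer for words outside the
  language too.\<close>

lemma tm_step_halted: "fst c = 1 \<Longrightarrow> tm_step M c = c"
  by (simp add: tm_step_def)

lemma tm_run_halted:
  assumes "fst (tm_run M w t) = 1" "t \<le> t'"
  shows "tm_run M w t' = tm_run M w t"
proof -
  have "(tm_step M ^^ j) (tm_run M w t) = tm_run M w t" for j
    by (induction j) (simp_all add: tm_step_halted assms(1))
  moreover have "tm_run M w t' = (tm_step M ^^ (t' - t)) (tm_run M w t)"
    using assms(2) unfolding tm_run_def by (metis comp_apply funpow_add le_add_diff_inverse2)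
  ultimately show ?thesis by simp
qed

text \<open>Output and time bound are joined because the output relation says nothing about time. As
  a halted configuration no longer changes, the bound can be raised freely.\<close>

definition prod_in :: "tm \<Rightarrow> bool list \<Rightarrow> bool list \<Rightarrow> nat \<Rightarrow> bool" where
  "prod_in M w y t \<longleftrightarrow> fst (tm_run M w t) = 1 \<and> tape_holds (last (snd (tm_run M w t))) y"

lemma prod_in_mono: "prod_in M w y t \<Longrightarrow> t \<le> t' \<Longrightarrow> prod_in M w y t'"
  unfolding prod_in_def using tm_run_halted by metis

lemma prod_in_outputs: "prod_in M w y t \<Longrightarrow> outputs M w y"
  by (auto simp: prod_in_def outputs_def)

lemma prod_inI:
  assumes "halts_within M w t" "outputs M w y"
  shows "prod_in M w y t"
proof -
  from assms(2) obtain t' where t': "fst (tm_run M w t') = 1"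
    "tape_holds (last (snd (tm_run M w t'))) y" by (auto simp: outputs_def)
  have "tm_run M w t = tm_run M w t'"
    using assms(1) t'(1) tm_run_halted nat_le_linear unfolding halts_within_def by metis
  with t' show ?thesis by (simp add: prod_in_def)
qed

text \<open>An arbitrary transition function is made well-formed by halting on ill-formed values.\<close>
definition act_ok :: "nat \<Rightarrow> nat \<Rightarrow> nat \<Rightarrow> nat \<times> (nat \<times> move) list \<Rightarrow> bool" where
  "act_ok k n s r \<longleftrightarrow> fst r < n \<and> length (snd r) = k \<and> fst ` set (snd r) \<subseteq> {..<s}"

definition mk_tm ::
    "nat \<Rightarrow> nat \<Rightarrow> nat \<Rightarrow> (nat \<Rightarrow> nat list \<Rightarrow> nat \<times> (nat \<times> move) list) \<Rightarrow> tm" where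
  "mk_tm k n s raw =
     \<lparr>num_tapes = k, num_states = n, num_symbols = s,
      delta = \<lambda>q xs. if act_ok k n s (raw q xs) then raw q xs else (1, replicate k (0, Stay))\<rparr>"

lemma wf_mk_tm: "k \<ge> 1 \<Longrightarrow> n \<ge> 2 \<Longrightarrow> s \<ge> 3 \<Longrightarrow> wf_tm (mk_tm k n s raw)"
  by (auto simp: wf_tm_def mk_tm_def act_ok_def)

lemma mk_tm_sel [simp]:
  "num_tapes (mk_tm k n s raw) = k" "num_states (mk_tm k n s raw) = n"
  "num_symbols (mk_tm k n s raw) = s"
  by (simp_all add: mk_tm_def)

lemma tm_step_mk_tm:
  assumes "q \<noteq> 1" "act_ok k n s (raw q (map read_tape ts))"
  shows "tm_step (mk_tm k n s raw) (q, ts) =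
    (fst (raw q (map read_tape ts)), map2 act_tape (snd (raw q (map read_tape ts))) ts)"
  using assms by (simp add: tm_step_def mk_tm_def Let_def split: prod.splits)

section \<open>A programming language for Turing machines\<close>

text \<open>
  A register is a tape whose only non-blank cell is cell 0; its value is the head position.
  Register 0 is the head position on the input tape.
\<close>

datatype tst = NonZero nat | IsOne | NotEnd

datatype com = Inc nat | Dec nat | Emit bool | Seq com com | While tst com | Cond tst com com | Skip

fun tst_val :: "bool list \<Rightarrow> (nat \<Rightarrow> int) \<Rightarrow> tst \<Rightarrow> bool" where
  "tst_val x \<sigma> (NonZero r) \<longleftrightarrow> \<sigma> r \<noteq> 0"
| "tst_val x \<sigma> IsOne \<longleftrightarrow> fst (input_tape x) (\<sigma> 0) = 2"
| "tst_val x \<sigma> NotEnd \<longleftrightarrow> fst (input_tape x) (\<sigma> 0) \<noteq> 0"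

text \<open>Small steps act on a stack of commands still to be executed. Control and effect are kept
  apart because the stack will become the machine state and the store the tape contents.\<close>

fun ctl :: "(tst \<Rightarrow> bool) \<Rightarrow> com list \<Rightarrow> com list" where
  "ctl v [] = []"
| "ctl v (Seq a b # k) = a # b # k"
| "ctl v (While t c # k) = (if v t then c # While t c # k else k)"
| "ctl v (Cond t a b # k) = (if v t then a else b) # k"
| "ctl v (c # k) = k"

fun eff :: "com list \<Rightarrow> (nat \<Rightarrow> int) \<times> bool list \<Rightarrow> (nat \<Rightarrow> int) \<times> bool list" where
  "eff (Inc r # k) (\<sigma>, w) = (\<sigma>(r := \<sigma> r + 1), w)"
| "eff (Dec r # k) (\<sigma>, w) = (\<sigma>(r := \<sigma> r - 1), w)"
| "eff (Emit b # k) (\<sigma>, w) = (\<sigma>, w @ [b])"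
| "eff k s = s"

definition cstep :: "bool list \<Rightarrow> com list \<times> (nat \<Rightarrow> int) \<times> bool list
    \<Rightarrow> com list \<times> (nat \<Rightarrow> int) \<times> bool list" where
  "cstep x = (\<lambda>(k, s). (ctl (tst_val x (fst s)) k, eff k s))"

lemma cstep_simp: "cstep x (k, s) = (ctl (tst_val x (fst s)) k, eff k s)"
  by (simp add: cstep_def)

text \<open>The stack \<open>k\<close> below the command is arbitrary and the number of steps does
  not depend on it, so executions can be put one after another or into a loop.\<close>

definition exec :: "bool list \<Rightarrow> com \<Rightarrow> (nat \<Rightarrow> int) \<times> bool list \<Rightarrow> (nat \<Rightarrow> int) \<times> bool list
    \<Rightarrow> nat \<Rightarrow> bool" where
  "exec x c s s' t \<longleftrightarrow> (\<exists>t'\<le>t. \<forall>k. (cstep x ^^ t') (c # k, s) = (k, s'))"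

lemma exec_mono: "exec x c s s' t \<Longrightarrow> t \<le> t' \<Longrightarrow> exec x c s s' t'"
  unfolding exec_def using le_trans by blast

lemma exec_1: "(\<And>k. cstep x (c # k, s) = (k, s')) \<Longrightarrow> exec x c s s' 1"
  unfolding exec_def by (rule exI[of _ 1]) simp

lemma exec_Inc: "exec x (Inc r) (\<sigma>, w) (\<sigma>(r := \<sigma> r + 1), w) 1"
  by (rule exec_1) (simp add: cstep_simp)

lemma exec_Dec: "exec x (Dec r) (\<sigma>, w) (\<sigma>(r := \<sigma> r - 1), w) 1"
  by (rule exec_1) (simp add: cstep_simp)

lemma exec_Emit: "exec x (Emit b) (\<sigma>, w) (\<sigma>, w @ [b]) 1"
  by (rule exec_1) (simp add: cstep_simp)

lemma exec_Skip: "exec x Skip s s 1"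
  by (rule exec_1) (simp add: cstep_simp)

lemma cstep_chain:
  assumes "cstep x (c # k, s) = (k', s)" "(cstep x ^^ t) (k', s) = (k'', s')"
  shows "(cstep x ^^ Suc t) (c # k, s) = (k'', s')"
  using assms by (simp add: funpow_Suc_right del: funpow.simps)

lemma exec_Seq:
  assumes "exec x a s s' t" "exec x b s' s'' u"
  shows "exec x (Seq a b) s s'' (Suc (t + u))"
proof -
  from assms obtain t' u' where *: "t' \<le> t" "u' \<le> u"
    "\<forall>k. (cstep x ^^ t') (a # k, s) = (k, s')" "\<forall>k. (cstep x ^^ u') (b # k, s') = (k, s'')"
    unfolding exec_def by blast
  have "(cstep x ^^ Suc (u' + t')) (Seq a b # k, s) = (k, s'')" for k
    by (rule cstep_chain[where k' = "a # b # k"]) (simp_all add: cstep_simp funpow_add *)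
  with * show ?thesis unfolding exec_def by (intro exI[of _ "Suc (u' + t')"]) simp
qed

lemma exec_Cond:
  assumes "exec x (if tst_val x (fst s) t then a else b) s s' u"
  shows "exec x (Cond t a b) s s' (Suc u)"
proof -
  from assms obtain u' where *: "u' \<le> u"
    "\<forall>k. (cstep x ^^ u') ((if tst_val x (fst s) t then a else b) # k, s) = (k, s')"
    unfolding exec_def by blast
  have "(cstep x ^^ Suc u') (Cond t a b # k, s) = (k, s')" for k
    by (rule cstep_chain[OF _ *(2)[rule_format]]) (simp add: cstep_simp)
  with * show ?thesis unfolding exec_def by (intro exI[of _ "Suc u'"]) simp
qed

lemma exec_While_False:
  assumes "\<not> tst_val x (fst s) t"
  shows "exec x (While t c) s s 1"
  by (rule exec_1) (simp add: cstep_simp assms)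

lemma exec_While_True:
  assumes "tst_val x (fst s) t" "exec x c s s' u" "exec x (While t c) s' s'' v"
  shows "exec x (While t c) s s'' (Suc (u + v))"
proof -
  from assms(2,3) obtain u' v' where *: "u' \<le> u" "v' \<le> v"
    "\<forall>k. (cstep x ^^ u') (c # k, s) = (k, s')" "\<forall>k. (cstep x ^^ v') (While t c # k, s') = (k, s'')"
    unfolding exec_def by blast
  have "(cstep x ^^ Suc (v' + u')) (While t c # k, s) = (k, s'')" for k
    by (rule cstep_chain[where k' = "c # While t c # k"]) (simp_all add: cstep_simp funpow_add * assms(1))
  with * show ?thesis unfolding exec_def by (intro exI[of _ "Suc (v' + u')"]) simp
qed

text \<open>The sequence \<open>S\<close> lists the stores at the loop head. The induction runs over
  the number of remaining rounds because a loop execution is built from its end.\<close>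

lemma exec_While:
  assumes "\<And>i. i < n \<Longrightarrow> tst_val x (fst (S i)) t \<and> exec x c (S i) (S (Suc i)) u"
    "\<not> tst_val x (fst (S n)) t"
  shows "exec x (While t c) (S 0) (S n) (Suc (n * Suc u))"
proof -
  have "exec x (While t c) (S (n - j)) (S n) (Suc (j * Suc u))" if "j \<le> n" for j
    using that
  proof (induction j)
    case 0
    then show ?case using assms(2) exec_While_False by simp
  next
    case (Suc j)
    then have "exec x c (S (n - Suc j)) (S (n - j)) u" "tst_val x (fst (S (n - Suc j))) t"
      using assms(1)[of "n - Suc j"] by (simp_all add: Suc_diff_Suc)
    from exec_While_True[OF this(2,1) Suc.IH] Suc.prems show ?case by (simp add: ac_simps)
  qed
  from this[of n] show ?thesis by simp
qed

section \<open>Compilation of programs into Turing machines\<close>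

fun tbnd :: "nat \<Rightarrow> tst \<Rightarrow> bool" where
  "tbnd K (NonZero r) \<longleftrightarrow> 1 \<le> r \<and> r \<le> K"
| "tbnd K _ \<longleftrightarrow> True"

fun cbnd :: "nat \<Rightarrow> com \<Rightarrow> bool" where
  "cbnd K (Inc r) \<longleftrightarrow> r \<le> K"
| "cbnd K (Dec r) \<longleftrightarrow> r \<le> K"
| "cbnd K (Seq a b) \<longleftrightarrow> cbnd K a \<and> cbnd K b"
| "cbnd K (While t c) \<longleftrightarrow> tbnd K t \<and> cbnd K c"
| "cbnd K (Cond t a b) \<longleftrightarrow> tbnd K t \<and> cbnd K a \<and> cbnd K b"
| "cbnd K _ \<longleftrightarrow> True"

lemma tbnd_mono: "tbnd K t \<Longrightarrow> K \<le> K' \<Longrightarrow> tbnd K' t"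
  by (cases t) auto

lemma cbnd_mono: "cbnd K c \<Longrightarrow> K \<le> K' \<Longrightarrow> cbnd K' c"
  by (induction c) (auto intro: tbnd_mono)

text \<open>These are the stacks that can occur while \<open>c\<close> runs above \<open>k\<close>.
  The set is finite since a loop leaves only itself below its body, so stacks can serve as machine
  states.\<close>

fun conts :: "com \<Rightarrow> com list \<Rightarrow> com list set" where
  "conts (Seq a b) k = insert (Seq a b # k) (conts a (b # k) \<union> conts b k)"
| "conts (While t c) k = insert (While t c # k) (conts c (While t c # k))"
| "conts (Cond t a b) k = insert (Cond t a b # k) (conts a k \<union> conts b k)"
| "conts c k = {c # k}"

lemma finite_conts: "finite (conts c k)"
  by (induction c k rule: conts.induct) auto

lemma conts_start: "c # k \<in> conts c k"
  by (cases c) auto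

lemma conts_ctl: "k' \<in> conts c k \<Longrightarrow> ctl v k' \<in> insert k (conts c k)"
  by (induction c k rule: conts.induct) (auto simp: conts_start split: if_splits)

lemma conts_cbnd:
  "k' \<in> conts c k \<Longrightarrow> cbnd K c \<Longrightarrow> \<forall>d\<in>set k. cbnd K d \<Longrightarrow> k' \<noteq> [] \<and> (\<forall>d\<in>set k'. cbnd K d)"
  by (induction c k rule: conts.induct) auto

definition mark_fun :: "int \<Rightarrow> nat" where
  "mark_fun = (\<lambda>i. if i = 0 then 1 else 0)"

text \<open>A register is zero when its head is on the mark. The input tape has no mark, which is
  why \<open>tbnd\<close> admits \<open>NonZero r\<close> only for \<open>r \<ge> 1\<close>.\<close>

fun rd_tst :: "nat list \<Rightarrow> tst \<Rightarrow> bool" where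
  "rd_tst xs (NonZero r) \<longleftrightarrow> xs ! r \<noteq> 1"
| "rd_tst xs IsOne \<longleftrightarrow> xs ! 0 = 2"
| "rd_tst xs NotEnd \<longleftrightarrow> xs ! 0 \<noteq> 0"

fun com_act :: "nat \<Rightarrow> com list \<Rightarrow> nat \<Rightarrow> nat \<Rightarrow> nat \<times> move" where
  "com_act K (Inc r # k) i a = (a, if i = r then Move_Right else Stay)"
| "com_act K (Dec r # k) i a = (a, if i = r then Move_Left else Stay)"
| "com_act K (Emit b # k) i a = (if i = Suc K then (bit_symbol b, Move_Right) else (a, Stay))"
| "com_act K _ i a = (a, Stay)"

text \<open>Tape 0 is the input, tapes 1 to \<open>K\<close> are the registers and tape
  \<open>K + 1\<close> is the output. The start state 0 is spent on writing the marks of the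
  registers, since these tapes are blank initially; this is the additional step in the running time
  of \<open>com_tm\<close>.\<close>

definition com_raw :: "nat \<Rightarrow> (com list \<Rightarrow> nat) \<Rightarrow> (nat \<Rightarrow> com list) \<Rightarrow> com \<Rightarrow>
    nat \<Rightarrow> nat list \<Rightarrow> nat \<times> (nat \<times> move) list" where
  "com_raw K en de c q xs =
     (if q = 0 then (en [c], map (\<lambda>i. (if 1 \<le> i \<and> i \<le> K then 1 else xs ! i, Stay)) [0..<K + 2])
      else (en (ctl (rd_tst xs) (de q)), map (\<lambda>i. com_act K (de q) i (xs ! i)) [0..<K + 2]))"

definition com_tapes :: "nat \<Rightarrow> bool list \<Rightarrow> (nat \<Rightarrow> int) \<times> bool list \<Rightarrow> tape list" where
  "com_tapes K x = (\<lambda>(\<sigma>, w). map (\<lambda>i. if i = 0 then (fst (input_tape x), \<sigma> 0)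
      else if i \<le> K then (mark_fun, \<sigma> i) else (fst (input_tape w), int (length w))) [0..<K + 2])"

lemma com_tapes_nth:
  "i < K + 2 \<Longrightarrow> com_tapes K x (\<sigma>, w) ! i = (if i = 0 then (fst (input_tape x), \<sigma> 0)
      else if i \<le> K then (mark_fun, \<sigma> i) else (fst (input_tape w), int (length w)))"
  by (simp add: com_tapes_def del: upt_Suc)

lemma map2_act_upt:
  "map2 act_tape (map f [0..<n]) (map g [0..<n]) = map (\<lambda>i. act_tape (f i) (g i)) [0..<n]"
  by (simp add: map2_map_map)

lemma input_tape_le2: "fst (input_tape x) i \<le> 2"
  by (simp add: input_tape_def bit_symbol_def)

lemma input_tape_snoc:
  "(fst (input_tape w))(int (length w) := bit_symbol b) = fst (input_tape (w @ [b]))"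
  by (auto simp: input_tape_def nth_append fun_eq_iff nat_less_iff)

lemma rd_tst_com_tapes:
  assumes "tbnd K t"
  shows "rd_tst (map read_tape (com_tapes K x s)) t = tst_val x (fst s) t"
  using assms by (cases t; cases s) (auto simp: com_tapes_def mark_fun_def nth_append simp del: upt_Suc)

lemma ctl_cong: "(\<And>t. \<forall>d\<in>set k. cbnd K d \<Longrightarrow> tbnd K t \<Longrightarrow> v t = v' t) \<Longrightarrow> \<forall>d\<in>set k. cbnd K d
    \<Longrightarrow> ctl v k = ctl v' k"
  by (cases "(v, k)" rule: ctl.cases) auto

lemma com_act_com_tapes:
  assumes "\<forall>d\<in>set k. cbnd K d"
  shows "map2 act_tape (map (\<lambda>i. com_act K k i (map read_tape (com_tapes K x s) ! i)) [0..<K + 2])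
      (com_tapes K x s) = com_tapes K x (eff k s)"
proof -
  obtain \<sigma> w where s: "s = (\<sigma>, w)" by force
  have nth: "map read_tape (com_tapes K x s) ! i = read_tape (com_tapes K x s ! i)" if "i < K + 2" for i
    using that by (simp add: com_tapes_def s del: upt_Suc)
  show ?thesis
  proof (rule nth_equalityI)
    show "length (map2 act_tape (map (\<lambda>i. com_act K k i (map read_tape (com_tapes K x s) ! i)) [0..<K + 2])
      (com_tapes K x s)) = length (com_tapes K x (eff k s))"
      by (simp add: com_tapes_def split: prod.splits)
    fix i assume "i < length (map2 act_tape (map (\<lambda>i. com_act K k i (map read_tape (com_tapes K x s) ! i)) [0..<K + 2])
      (com_tapes K x s))"
    then have i: "i < K + 2" by simp
    then have len: "i < length (com_tapes K x s)" by (simp add: com_tapes_def s)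
    have "act_tape (com_act K k i (read_tape (com_tapes K x s ! i))) (com_tapes K x s ! i)
        = com_tapes K x (eff k s) ! i"
    proof (cases k)
      case Nil
      then show ?thesis using i by (simp add: s com_tapes_nth)
    next
      case (Cons c k')
      then show ?thesis using i assms unfolding s
        by (cases c) (simp_all add: com_tapes_nth flip: input_tape_snoc)
    qed
    then show "map2 act_tape (map (\<lambda>i. com_act K k i (map read_tape (com_tapes K x s) ! i)) [0..<K + 2])
      (com_tapes K x s) ! i = com_tapes K x (eff k s) ! i"
      using i len nth[OF i] by (simp del: upt_Suc)
  qed
qed

theorem com_tm:
  assumes "cbnd K c"
  shows "\<exists>M. wf_tm M \<and> (\<forall>x \<sigma> w t. exec x c (\<lambda>_. 0, []) (\<sigma>, w) t \<longrightarrow> prod_in M x w (Suc t))"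
proof -
  obtain e where e: "inj_on e (conts c [])" "e ` conts c [] = {0..<card (conts c [])}"
    using ex_bij_betw_finite_nat[OF finite_conts] unfolding bij_betw_def by metis
  define n where "n = card (conts c []) + 2"
  \<comment> \<open>The start state 0 and the halting state 1 are fixed by the machine model, so the
    empty stack is mapped to 1 and proper stacks are numbered from 2.\<close>
  define en where "en k = (if k = [] then 1 else e k + 2)" for k
  define de where "de q = inv_into (conts c []) e (q - 2)" for q
  let ?raw = "com_raw K en de c"
  define M where "M = mk_tm (K + 2) n 3 ?raw"
  have ne: "[] \<notin> conts c []" using conts_cbnd[OF _ assms] by fastforce
  have de: "de (en k) = k" if "k \<in> conts c []" for k
    using that ne e(1) by (auto simp: de_def en_def)
  have en_lt: "en k < n" if "k \<in> insert [] (conts c [])" for k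
    using that e(2) by (auto simp: en_def n_def)
  have wf: "wf_tm M" unfolding M_def by (rule wf_mk_tm) (auto simp: n_def)
  have sim: "tm_step M (en k, com_tapes K x s) = (let (k', s') = cstep x (k, s) in (en k', com_tapes K x s'))"
    if k: "k \<in> insert [] (conts c [])" for k x s
  proof (cases "k = []")
    case True
    then show ?thesis by (cases s) (simp add: tm_step_halted en_def cstep_simp)
  next
    case False
    with k have k: "k \<in> conts c []" by simp
    have bnd: "\<forall>d\<in>set k. cbnd K d" using conts_cbnd[OF k assms] by simp
    let ?xs = "map read_tape (com_tapes K x s)"
    have c: "ctl (rd_tst ?xs) k = ctl (tst_val x (fst s)) k"
      by (rule ctl_cong[OF rd_tst_com_tapes bnd])
    have raw: "?raw (en k) ?xs = (en (ctl (tst_val x (fst s)) k), map (\<lambda>i. com_act K k i (?xs ! i)) [0..<K + 2])"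
      using False by (simp add: com_raw_def de[OF k] c) (simp add: en_def)
    have "?xs ! i \<le> 2" if "i < K + 2" for i
      using that by (cases s) (auto simp: com_tapes_def input_tape_le2 mark_fun_def simp del: upt_Suc)
    then have "fst (com_act K k i (?xs ! i)) \<le> 2" if "i < K + 2" for i
      using that by (cases "(K, k, i, ?xs ! i)" rule: com_act.cases) (auto simp: bit_symbol_def)
    then have "act_ok (K + 2) n 3 (?raw (en k) ?xs)"
      using en_lt[OF conts_ctl[OF k]] unfolding act_ok_def raw by (force simp del: upt_Suc)
    with tm_step_mk_tm[of "en k" "K + 2" n 3 ?raw "com_tapes K x s"] False have "tm_step M (en k, com_tapes K x s) =
      (fst (?raw (en k) ?xs), map2 act_tape (snd (?raw (en k) ?xs)) (com_tapes K x s))"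
      unfolding M_def by (simp add: en_def del: upt_Suc)
    then show ?thesis unfolding raw fst_conv snd_conv com_act_com_tapes[OF bnd] by (simp add: cstep_simp)
  qed
  have closed: "fst (cstep x (k, s)) \<in> insert [] (conts c [])" if "k \<in> insert [] (conts c [])" for k x s
    using that conts_ctl[of k c "[]"] by (auto simp: cstep_simp)
  have sims: "(tm_step M ^^ t) (en k, com_tapes K x s) =
      (let (k', s') = (cstep x ^^ t) (k, s) in (en k', com_tapes K x s'))"
    if "k \<in> insert [] (conts c [])" for k x s t
    using that
  proof (induction t arbitrary: k s)
    case (Suc t)
    obtain k' s' where *: "cstep x (k, s) = (k', s')" by (metis surj_pair)
    with closed[OF Suc.prems] have "k' \<in> insert [] (conts c [])" by (metis fst_conv)
    from Suc.IH[OF this] sim[OF Suc.prems] show ?case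
      by (simp add: funpow_Suc_right * del: funpow.simps)
  qed simp
  have init: "tm_step M (init_config M x) = (en [c], com_tapes K x (\<lambda>_. 0, []))" for x
  proof -
    let ?ts = "input_tape x # replicate (K + 1) blank_tape"
    have ts: "?ts = map (\<lambda>i. if i = 0 then input_tape x else blank_tape) [0..<K + 2]"
      by (rule nth_equalityI) (auto simp: nth_Cons' simp del: upt_Suc replicate_Suc)
    have rd: "map read_tape ?ts ! i = (if i = 0 then fst (input_tape x) 0 else 0)" if "i < K + 2" for i
      unfolding ts using that by (auto simp: input_tape_def blank_tape_def simp del: upt_Suc)
    have "?raw 0 xs = (en [c], map (\<lambda>i. (if i = 0 then fst (input_tape x) 0
        else if i \<le> K then 1 else 0, Stay)) [0..<K + 2])"
      if "\<And>i. i < K + 2 \<Longrightarrow> xs ! i = (if i = 0 then fst (input_tape x) 0 else 0)" for xs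
      unfolding com_raw_def using that by (auto simp del: upt_Suc)
    from this[of "map read_tape ?ts"] rd have raw: "?raw 0 (map read_tape ?ts) =
      (en [c], map (\<lambda>i. (if i = 0 then fst (input_tape x) 0 else if i \<le> K then 1 else 0, Stay)) [0..<K + 2])"
      by blast
    have "act_ok (K + 2) n 3 (?raw 0 (map read_tape ?ts))"
      using en_lt[of "[c]"] conts_start[of c "[]"] input_tape_le2[of x 0] unfolding act_ok_def raw
      by (auto simp del: upt_Suc)
    then have "tm_step M (0, ?ts) = (en [c], map2 act_tape (map (\<lambda>i. (if i = 0 then fst (input_tape x) 0
        else if i \<le> K then 1 else 0, Stay)) [0..<K + 2]) ?ts)"
      unfolding M_def by (subst tm_step_mk_tm) (auto simp only: raw fst_conv snd_conv zero_neq_one)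
    also have "map2 act_tape (map (\<lambda>i. (if i = 0 then fst (input_tape x) 0
        else if i \<le> K then 1 else 0, Stay)) [0..<K + 2]) ?ts = com_tapes K x (\<lambda>_. 0, [])"
      unfolding ts map2_act_upt com_tapes_def prod.case
      by (rule map_cong) (auto simp: input_tape_def blank_tape_def mark_fun_def fun_eq_iff)
    finally show ?thesis by (simp add: init_config_def M_def)
  qed
  have "prod_in M x w (Suc t)" if ex: "exec x c (\<lambda>_. 0, []) (\<sigma>, w) t" for x \<sigma> w t
  proof -
    from ex obtain t' where t': "t' \<le> t" "(cstep x ^^ t') ([c], \<lambda>_. 0, []) = ([], \<sigma>, w)"
      unfolding exec_def by metis
    have "tm_run M x (Suc t') = (1, com_tapes K x (\<sigma>, w))"
      using sims[of "[c]" t' x "(\<lambda>_. 0, [])"] conts_start[of c "[]"] t'(2)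
      by (simp add: tm_run_def funpow_Suc_right init en_def del: funpow.simps)
    moreover have "tape_holds (last (com_tapes K x (\<sigma>, w))) w"
      by (simp add: com_tapes_def tape_holds_def input_tape_def)
    ultimately have "prod_in M x w (Suc t')" by (simp add: prod_in_def)
    with t'(1) show ?thesis by (auto intro: prod_in_mono)
  qed
  with wf show ?thesis by blast
qed

section \<open>Sequential composition of Turing machines\<close>

definition conf_ok :: "tm \<Rightarrow> config \<Rightarrow> bool" where
  "conf_ok M c \<longleftrightarrow> fst c < num_states M \<and> length (snd c) = num_tapes M \<and>
     (\<forall>t\<in>set (snd c). \<forall>i. fst t i < num_symbols M)"

lemma read_tape_eq: "read_tape t = fst t (snd t)"
  by (cases t) simp

lemma act_tape_eq: "act_tape (a, d) t = ((fst t)(snd t := a), snd t + move_offset d)"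
  by (cases t) simp

lemma act_tape_eq': "act_tape p t = ((fst t)(snd t := fst p), snd t + move_offset (snd p))"
  by (cases t; cases p) simp

lemma conf_ok_delta:
  assumes "wf_tm M" "conf_ok M c"
  shows "fst (delta M (fst c) (map read_tape (snd c))) < num_states M"
    "length (snd (delta M (fst c) (map read_tape (snd c)))) = num_tapes M"
    "fst ` set (snd (delta M (fst c) (map read_tape (snd c)))) \<subseteq> {..<num_symbols M}"
proof -
  have "length (map read_tape (snd c)) = num_tapes M"
    "set (map read_tape (snd c)) \<subseteq> {..<num_symbols M}" "fst c < num_states M"
    using assms(2) by (auto simp: conf_ok_def read_tape_eq)
  then show "fst (delta M (fst c) (map read_tape (snd c))) < num_states M"
    "length (snd (delta M (fst c) (map read_tape (snd c)))) = num_tapes M"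
    "fst ` set (snd (delta M (fst c) (map read_tape (snd c)))) \<subseteq> {..<num_symbols M}"
    using assms(1) unfolding wf_tm_def by blast+
qed

lemma tm_step_eq: "fst c \<noteq> 1 \<Longrightarrow> tm_step M c = (fst (delta M (fst c) (map read_tape (snd c))),
    map2 act_tape (snd (delta M (fst c) (map read_tape (snd c)))) (snd c))"
  by (simp add: tm_step_def split: prod.splits)

lemma map2_conv_nth:
  "length as = k \<Longrightarrow> length ts = k \<Longrightarrow> map2 f as ts = map (\<lambda>i. f (as ! i) (ts ! i)) [0..<k]"
  by (rule nth_equalityI) auto

lemma conf_ok_step:
  assumes "wf_tm M" "conf_ok M c"
  shows "conf_ok M (tm_step M c)"
proof (cases "fst c = 1")
  case True
  then show ?thesis using assms(2) by (simp add: tm_step_halted)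
next
  case False
  let ?d = "delta M (fst c) (map read_tape (snd c))"
  note d = conf_ok_delta[OF assms]
  have "fst (act_tape (snd ?d ! i) (snd c ! i)) j < num_symbols M" if "i < num_tapes M" for i j
  proof -
    have "fst (snd ?d ! i) < num_symbols M" "fst (snd c ! i) j < num_symbols M"
      using d(2,3) that assms(2) by (force simp: conf_ok_def)+
    then show ?thesis by (simp add: act_tape_eq')
  qed
  then show ?thesis using False d assms(2)
    by (auto simp: conf_ok_def tm_step_eq map2_conv_nth[where k = "num_tapes M"])
qed

lemma conf_ok_init: "wf_tm M \<Longrightarrow> conf_ok M (init_config M w)"
  by (auto simp: conf_ok_def init_config_def wf_tm_def blank_tape_def input_tape_def bit_symbol_def)

lemma tm_run_Suc: "tm_run M w (Suc t) = tm_step M (tm_run M w t)"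
  by (simp add: tm_run_def)

lemma conf_ok_run: "wf_tm M \<Longrightarrow> conf_ok M (tm_run M w t)"
  by (induction t) (simp_all add: conf_ok_init conf_ok_step tm_run_Suc, simp add: tm_run_def conf_ok_init)

text \<open>A head moves at most one cell per step. A cell at distance exactly \<open>t\<close> may
  be under the head after \<open>t\<close> steps, but has not been written yet.\<close>

lemma tape_unchanged_far:
  assumes "wf_tm M" "i < num_tapes M"
  shows "\<bar>snd (snd (tm_run M w t) ! i)\<bar> \<le> int t \<and>
    (\<forall>j. \<bar>j\<bar> \<ge> int t \<longrightarrow> fst (snd (tm_run M w t) ! i) j = fst (snd (init_config M w) ! i) j)"
proof (induction t)
  case 0
  then show ?case using assms(2) by (cases i) (auto simp: tm_run_def init_config_def input_tape_def blank_tape_def)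
next
  case (Suc t)
  show ?case
  proof (cases "fst (tm_run M w t) = 1")
    case True
    then show ?thesis using Suc by (auto simp: tm_run_Suc tm_step_halted)
  next
    case False
    let ?c = "tm_run M w t"
    let ?d = "delta M (fst ?c) (map read_tape (snd ?c))"
    have ok: "conf_ok M ?c" using assms(1) conf_ok_run by blast
    have "snd (tm_run M w (Suc t)) ! i = act_tape (snd ?d ! i) (snd ?c ! i)"
      using False conf_ok_delta(2)[OF assms(1) ok] ok assms(2)
      by (simp add: tm_run_Suc tm_step_eq conf_ok_def)
    moreover have "\<bar>move_offset (snd (snd ?d ! i))\<bar> \<le> 1" by (cases "snd (snd ?d ! i)") auto
    ultimately show ?thesis using Suc by (auto simp: act_tape_eq')
  qed
qed

text \<open>The cell \<open>length w + t\<close> is blank at the beginning and is not written within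
  \<open>t\<close> steps, while every symbol of the output is non-blank. The length of the input
  enters because a machine with a single tape writes its output over the input.\<close>

lemma prod_in_length:
  assumes "wf_tm M" "prod_in M w y t"
  shows "length y \<le> length w + t"
proof (rule ccontr)
  assume "\<not> length y \<le> length w + t"
  then have *: "length w + t < length y" by simp
  let ?c = "tm_run M w t"
  let ?j = "int (length w + t)"
  have k: "num_tapes M \<ge> 1" using assms(1) by (simp add: wf_tm_def)
  have "length (snd ?c) = num_tapes M" using conf_ok_run[OF assms(1)] by (simp add: conf_ok_def)
  then have l: "last (snd ?c) = snd ?c ! (num_tapes M - 1)" using k by (metis last_conv_nth list.size(3) not_one_le_zero)
  have "fst (last (snd ?c)) ?j = bit_symbol (y ! (length w + t))"
    using assms(2) * by (simp add: prod_in_def tape_holds_def del: of_nat_add)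
  moreover have "fst (last (snd ?c)) ?j = fst (snd (init_config M w) ! (num_tapes M - 1)) ?j"
    unfolding l using tape_unchanged_far[OF assms(1), of "num_tapes M - 1" w t] k by simp
  moreover have "fst (snd (init_config M w) ! (num_tapes M - 1)) ?j = 0"
    using k by (auto simp: init_config_def nth_Cons' input_tape_def blank_tape_def)
  ultimately show False by (simp add: bit_symbol_def split: if_splits)
qed

definition keep :: "nat list \<Rightarrow> (nat \<times> move) list" where
  "keep xs = map (\<lambda>a. (a, Stay)) xs"

definition mv_last :: "move \<Rightarrow> nat list \<Rightarrow> (nat \<times> move) list" where
  "mv_last d xs = keep (butlast xs) @ [(last xs, d)]"

definition mv_hd :: "move \<Rightarrow> nat \<Rightarrow> nat list \<Rightarrow> (nat \<times> move) list" where
  "mv_hd d a xs = (a, d) # keep (tl xs)"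

text \<open>
  The extra tape follows the head of the last tape of the first machine and marks the visited
  cells, with the symbol 2 in cell 0; this is how cell 0 is found when that machine has halted.
\<close>
definition comp_act :: "tm \<Rightarrow> tm \<Rightarrow> nat \<Rightarrow> nat list \<Rightarrow> nat \<Rightarrow> nat list \<Rightarrow>
    nat \<times> (nat \<times> move) list \<times> (nat \<times> move) \<times> (nat \<times> move) list" where
  "comp_act M1 M2 q xs z ys =
    (if q = 0 then (10, keep xs, (2, Stay), keep ys)
     else if q = 11 then (5, keep xs, (if z = 2 then 2 else 1, Stay), keep ys)
     else if q = 5 then
       (if z \<noteq> 0 then (5, mv_last Move_Left xs, (z, Move_Left), keep ys)
        else (2, keep xs, (z, Stay), keep ys))
     else if q = 2 then
       (if z \<noteq> 2 then (2, mv_last Move_Right xs, (z, Move_Right), keep ys)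
        else (3, keep xs, (z, Stay), keep ys))
     else if q = 3 then
       (if last xs \<noteq> 0 then (3, mv_last Move_Right xs, (z, Stay), mv_hd Move_Right (last xs) ys)
        else (4, keep xs, (z, Stay), mv_hd Move_Left (hd ys) ys))
     else if q = 4 then
       (if hd ys \<noteq> 0 then (4, keep xs, (z, Stay), mv_hd Move_Left (hd ys) ys)
        else (10 + num_states M1, keep xs, (z, Stay), mv_hd Move_Right (hd ys) ys))
     else if q < 10 + num_states M1 then
       (10 + fst (delta M1 (q - 10) xs), snd (delta M1 (q - 10) xs),
        (if z = 2 then 2 else 1, snd (last (snd (delta M1 (q - 10) xs)))), keep ys)
     else
       (let d = delta M2 (q - 10 - num_states M1) ys
        in (if fst d = 1 then 1 else 10 + num_states M1 + fst d, keep xs, (z, Stay), snd d)))"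

definition comp_raw :: "tm \<Rightarrow> tm \<Rightarrow> nat \<Rightarrow> nat list \<Rightarrow> nat \<times> (nat \<times> move) list" where
  "comp_raw M1 M2 q xs =
    (let r = comp_act M1 M2 q (take (num_tapes M1) xs) (xs ! num_tapes M1) (drop (Suc (num_tapes M1)) xs)
     in (fst r, fst (snd r) @ fst (snd (snd r)) # snd (snd (snd r))))"

definition comp_tm :: "tm \<Rightarrow> tm \<Rightarrow> tm" where
  "comp_tm M1 M2 = mk_tm (num_tapes M1 + Suc (num_tapes M2)) (10 + num_states M1 + num_states M2)
     (max (num_symbols M1) (num_symbols M2)) (comp_raw M1 M2)"

lemma wf_comp_tm: "wf_tm M1 \<Longrightarrow> wf_tm M2 \<Longrightarrow> wf_tm (comp_tm M1 M2)"
  unfolding comp_tm_def by (rule wf_mk_tm) (auto simp: wf_tm_def)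

definition syms_lt :: "nat \<Rightarrow> (nat \<times> move) list \<Rightarrow> bool" where
  "syms_lt s as \<longleftrightarrow> (\<forall>a\<in>set as. fst a < s)"

lemma comp_step:
  assumes "comp_act M1 M2 q (map read_tape ts) (read_tape z) (map read_tape us) = (q', as, a, bs)"
    "q \<noteq> 1" "length ts = num_tapes M1" "length us = num_tapes M2"
    "length as = num_tapes M1" "length bs = num_tapes M2" "q' < 10 + num_states M1 + num_states M2"
    "syms_lt (max (num_symbols M1) (num_symbols M2)) (a # as @ bs)"
  shows "tm_step (comp_tm M1 M2) (q, ts @ z # us) =
    (q', map2 act_tape as ts @ act_tape a z # map2 act_tape bs us)"
proof -
  have raw: "comp_raw M1 M2 q (map read_tape (ts @ z # us)) = (q', as @ a # bs)"
    using assms(1,3) by (simp add: comp_raw_def nth_append)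
  have "act_ok (num_tapes M1 + Suc (num_tapes M2)) (10 + num_states M1 + num_states M2)
     (max (num_symbols M1) (num_symbols M2)) (comp_raw M1 M2 q (map read_tape (ts @ z # us)))"
    using assms(5-8) unfolding raw act_ok_def syms_lt_def by auto
  from tm_step_mk_tm[of q _ _ _ "comp_raw M1 M2" "ts @ z # us", OF assms(2) this]
  show ?thesis using assms(3,5) unfolding comp_tm_def raw by simp
qed

lemma length_keep [simp]: "length (keep xs) = length xs"
  by (simp add: keep_def)

lemma length_mv_last [simp]: "xs \<noteq> [] \<Longrightarrow> length (mv_last d xs) = length xs"
  by (simp add: mv_last_def)

lemma length_mv_hd [simp]: "xs \<noteq> [] \<Longrightarrow> length (mv_hd d a xs) = length xs"
  by (simp add: mv_hd_def)

lemma map2_keep [simp]: "map2 act_tape (keep (map read_tape ts)) ts = ts"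
  by (induction ts) (auto simp: keep_def read_tape_eq act_tape_eq)

lemma map2_mv_last [simp]:
  "map2 act_tape (mv_last d (map read_tape (ts @ [(f, i)]))) (ts @ [(f, i)]) = ts @ [(f, i + move_offset d)]"
  by (simp add: mv_last_def flip: map_butlast)

lemma map2_mv_hd [simp]:
  "map2 act_tape (mv_hd d a (map read_tape ((f, i) # us))) ((f, i) # us) = (f(i := a), i + move_offset d) # us"
  by (simp add: mv_hd_def)

definition tapes_lt :: "nat \<Rightarrow> tape list \<Rightarrow> bool" where
  "tapes_lt s ts \<longleftrightarrow> (\<forall>t\<in>set ts. \<forall>i. fst t i < s)"

lemma syms_lt_intros:
  "syms_lt s []" "a < s \<Longrightarrow> syms_lt s as \<Longrightarrow> syms_lt s ((a, d) # as)"
  "syms_lt s as \<Longrightarrow> syms_lt s bs \<Longrightarrow> syms_lt s (as @ bs)"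
  "tapes_lt s ts \<Longrightarrow> syms_lt s (keep (map read_tape ts))"
  "tapes_lt s ts \<Longrightarrow> ts \<noteq> [] \<Longrightarrow> syms_lt s (mv_last d (map read_tape ts))"
  "tapes_lt s us \<Longrightarrow> a < s \<Longrightarrow> us \<noteq> [] \<Longrightarrow> syms_lt s (mv_hd d a (map read_tape us))"
  by (auto simp: syms_lt_def tapes_lt_def keep_def mv_last_def mv_hd_def read_tape_eq last_map
      dest: in_set_butlastD simp flip: map_butlast map_tl dest!: list.set_sel(2)[rotated])

definition vis :: "int \<Rightarrow> int \<Rightarrow> int \<Rightarrow> nat" where
  "vis a b = (\<lambda>j. if j = 0 then 2 else if a \<le> j \<and> j \<le> b then 1 else 0)"

lemma vis_le: "vis a b j \<le> 2"
  by (simp add: vis_def)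

lemma funpow_chain: "(f ^^ t) x = y \<Longrightarrow> (f ^^ u) y = z \<Longrightarrow> (f ^^ (t + u)) x = z"
  by (metis add.commute comp_apply funpow_add)

lemma funpow_iter:
  assumes "\<And>i. i < n \<Longrightarrow> f (S i) = S (Suc i)"
  shows "(f ^^ n) (S 0) = S n"
  using assms by (induction n) auto

context
  fixes M1 M2 :: tm
  assumes wf1: "wf_tm M1" and wf2: "wf_tm M2"
begin

abbreviation "cmpM \<equiv> comp_tm M1 M2"
abbreviation "smax \<equiv> max (num_symbols M1) (num_symbols M2)"

lemma smax3: "smax \<ge> 3" "num_states M1 \<ge> 2" "num_states M2 \<ge> 2" "num_tapes M1 \<ge> 1" "num_tapes M2 \<ge> 1"
  using wf1 wf2 by (auto simp: wf_tm_def)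

lemma vis_lt: "vis a b j < smax"
  using vis_le[of a b j] smax3 by linarith

text \<open>A cell is marked in the step that acts on it, so the head may be one cell outside of the
  marked range; the invariant \<open>a - 1 \<le> i \<le> b + 1\<close> allows for this. The range
  grows by at most one cell per step, which later bounds the way back.\<close>

lemma comp_phase1_step:
  assumes ok: "conf_ok M1 (q, ts)" "q \<noteq> 1" and i: "snd (last ts) = i"
    and ab: "a \<le> 0" "0 \<le> b" "a - 1 \<le> i" "i \<le> b + 1"
    and us: "tapes_lt smax us" "length us = num_tapes M2"
  shows "\<exists>a' b'. tm_step cmpM (10 + q, ts @ (vis a b, i) # us) =
      (10 + fst (tm_step M1 (q, ts)),
       snd (tm_step M1 (q, ts)) @ (vis a' b', snd (last (snd (tm_step M1 (q, ts))))) # us) \<and>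
    a' \<le> 0 \<and> 0 \<le> b' \<and> a' - 1 \<le> snd (last (snd (tm_step M1 (q, ts)))) \<and>
    snd (last (snd (tm_step M1 (q, ts)))) \<le> b' + 1 \<and> b' - a' \<le> b - a + 1"
proof -
  let ?d = "delta M1 q (map read_tape ts)"
  note d = conf_ok_delta[OF wf1 ok(1), simplified]
  have len: "length ts = num_tapes M1" "q < num_states M1" using ok(1) by (auto simp: conf_ok_def)
  then have ne: "ts \<noteq> []" "snd ?d \<noteq> []" using smax3 d(2) by auto
  let ?m = "snd (last (snd ?d))"
  have act: "comp_act M1 M2 (10 + q) (map read_tape ts) (read_tape (vis a b, i)) (map read_tape us) =
    (10 + fst ?d, snd ?d, (if vis a b i = 2 then 2 else 1, ?m), keep (map read_tape us))"
    using ok(2) len by (simp add: comp_act_def)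
  have st: "tm_step cmpM (10 + q, ts @ (vis a b, i) # us) =
     (10 + fst ?d, map2 act_tape (snd ?d) ts @ act_tape (if vis a b i = 2 then 2 else 1, ?m) (vis a b, i)
       # map2 act_tape (keep (map read_tape us)) us)"
    using d smax3 len us by (intro comp_step[OF act]) (auto simp: syms_lt_def[symmetric] intro!: syms_lt_intros,
      auto simp: syms_lt_def less_max_iff_disj)
  have m1: "tm_step M1 (q, ts) = (fst ?d, map2 act_tape (snd ?d) ts)"
    using ok(2) by (simp add: tm_step_eq)
  have l: "last (map2 act_tape (snd ?d) ts) = act_tape (last (snd ?d)) (last ts)"
    using ne d(2) len by (simp add: last_map last_zip)
  have l': "snd (last (map2 act_tape (snd ?d) ts)) = i + move_offset ?m"
    unfolding l using i by (simp add: act_tape_eq')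
  have mo: "-1 \<le> move_offset ?m" "move_offset ?m \<le> 1" by (cases ?m; simp)+
  define a' b' where "a' = min a i" and "b' = max b i"
  have "act_tape (if vis a b i = 2 then 2 else 1, ?m) (vis a b, i) = (vis a' b', i + move_offset ?m)"
    using ab by (auto simp: vis_def a'_def b'_def fun_eq_iff)
  with st m1 l' mo ab show ?thesis
    by (intro exI[of _ a'] exI[of _ b']) (auto simp: a'_def b'_def)
qed

lemma comp_phase1:
  assumes us: "tapes_lt smax us" "length us = num_tapes M2"
    and nh: "\<forall>t'<t. fst (tm_run M1 w t') \<noteq> 1"
  shows "\<exists>a b. (tm_step cmpM ^^ t) (10, snd (init_config M1 w) @ (vis 0 0, 0) # us) =
      (10 + fst (tm_run M1 w t), snd (tm_run M1 w t) @ (vis a b, snd (last (snd (tm_run M1 w t)))) # us) \<and>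
    a \<le> 0 \<and> 0 \<le> b \<and> a - 1 \<le> snd (last (snd (tm_run M1 w t))) \<and>
    snd (last (snd (tm_run M1 w t))) \<le> b + 1 \<and> b - a \<le> int t"
  using nh
proof (induction t)
  case 0
  have "snd (last (snd (init_config M1 w))) = 0" by (simp add: init_config_def input_tape_def blank_tape_def)
  then show ?case by (intro exI[of _ 0]) (simp add: tm_run_def init_config_def)
next
  case (Suc t)
  then obtain a b where *: "(tm_step cmpM ^^ t) (10, snd (init_config M1 w) @ (vis 0 0, 0) # us) =
      (10 + fst (tm_run M1 w t), snd (tm_run M1 w t) @ (vis a b, snd (last (snd (tm_run M1 w t)))) # us)"
    "a \<le> 0" "0 \<le> b" "a - 1 \<le> snd (last (snd (tm_run M1 w t)))"
    "snd (last (snd (tm_run M1 w t))) \<le> b + 1" "b - a \<le> int t"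
    using less_SucI by blast
  have "conf_ok M1 (fst (tm_run M1 w t), snd (tm_run M1 w t))" using conf_ok_run[OF wf1] by simp
  from comp_phase1_step[OF this _ refl *(2-5) us] Suc.prems *(1,6) show ?case
    by (fastforce simp: tm_run_Suc)
qed

text \<open>State 5 runs to the left until the first unmarked cell, so that the head is certainly
  left of cell 0; state 2 then runs to the right until it finds the symbol 2. The two heads move in
  lockstep, hence the output tape ends in cell 0 as well.\<close>

lemma comp_rewind:
  assumes ts: "length ts + 1 = num_tapes M1" "tapes_lt smax (ts @ [(f, i)])"
    and us: "tapes_lt smax us" "length us = num_tapes M2"
    and ab: "a \<le> 0" "0 \<le> b" "a \<le> i" "i \<le> b"
  shows "(tm_step cmpM ^^ (nat (i - a + 1) + 1 + nat (1 - a) + 1)) (5, (ts @ [(f, i)]) @ (vis a b, i) # us) =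
    (3, (ts @ [(f, 0)]) @ (vis a b, 0) # us)"
proof -
  have tsj: "tapes_lt smax (ts @ [(f, j)])" for j using ts(2) by (auto simp: tapes_lt_def)
  let ?S = "\<lambda>q j. (q, (ts @ [(f, j)]) @ (vis a b, j) # us)"
  have left: "tm_step cmpM (?S 5 j) = ?S 5 (j - 1)" if "vis a b j \<noteq> 0" for j
    using that ts us smax3 vis_lt tsj
    by (subst comp_step[where as = "mv_last Move_Left (map read_tape (ts @ [(f, j)]))"
          and a = "(vis a b j, Move_Left)" and bs = "keep (map read_tape us)"])
      (auto simp del: map_append list.map simp: comp_act_def intro!: syms_lt_intros)
  have turn: "tm_step cmpM (?S 5 (a - 1)) = ?S 2 (a - 1)"
    using ab ts us smax3 vis_lt tsj
    by (subst comp_step[where as = "keep (map read_tape (ts @ [(f, a - 1)]))"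
          and a = "(vis a b (a - 1), Stay)" and bs = "keep (map read_tape us)"])
      (auto simp del: map_append list.map simp: comp_act_def intro!: syms_lt_intros, auto simp: vis_def)
  have right: "tm_step cmpM (?S 2 j) = ?S 2 (j + 1)" if "j < 0" for j
    using that ts us smax3 vis_lt tsj
    by (subst comp_step[where as = "mv_last Move_Right (map read_tape (ts @ [(f, j)]))"
          and a = "(vis a b j, Move_Right)" and bs = "keep (map read_tape us)"])
      (auto simp del: map_append list.map simp: comp_act_def intro!: syms_lt_intros, auto simp: vis_def split: if_splits)
  have stop: "tm_step cmpM (?S 2 0) = ?S 3 0"
    using ts us smax3 vis_lt tsj
    by (subst comp_step[where as = "keep (map read_tape (ts @ [(f, 0)]))"
          and a = "(vis a b 0, Stay)" and bs = "keep (map read_tape us)"])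
      (auto simp del: map_append list.map simp: comp_act_def intro!: syms_lt_intros, auto simp: vis_def)
  have 1: "(tm_step cmpM ^^ nat (i - a + 1)) (?S 5 i) = ?S 5 (a - 1)"
    using funpow_iter[of "nat (i - a + 1)" "tm_step cmpM" "\<lambda>n. ?S 5 (i - int n)"] left ab
    by (force simp: vis_def algebra_simps)
  have 2: "(tm_step cmpM ^^ nat (1 - a)) (?S 2 (a - 1)) = ?S 2 0"
    using funpow_iter[of "nat (1 - a)" "tm_step cmpM" "\<lambda>n. ?S 2 (a - 1 + int n)"] right ab
    by (force simp: algebra_simps)
  have "(tm_step cmpM ^^ 1) (?S 5 (a - 1)) = ?S 2 (a - 1)" "(tm_step cmpM ^^ 1) (?S 2 0) = ?S 3 0"
    using turn stop by simp_all
  from funpow_chain[OF funpow_chain[OF funpow_chain[OF 1 this(1)] 2] this(2)] show ?thesis .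
qed

text \<open>State 3 copies up to the blank after the output; state 4 takes the head of the new input
  tape back, where the blank in cell -1 shows that the beginning has been passed.\<close>

lemma comp_copy:
  assumes ts: "length ts + 1 = num_tapes M1" "tapes_lt smax (ts @ [(f, 0)])" and z: "fst z (snd z) < smax"
    and y: "tape_holds (f, 0) y"
    and us: "tapes_lt smax us" "length us + 1 = num_tapes M2"
  shows "(tm_step cmpM ^^ (length y + 1 + length y + 1)) (3, (ts @ [(f, 0)]) @ z # blank_tape # us) =
    (10 + num_states M1, (ts @ [(f, int (length y))]) @ z # input_tape y # us)"
proof -
  have tsj: "tapes_lt smax (ts @ [(f, j)])" for j using ts(2) by (auto simp: tapes_lt_def)
  have flt: "f j < smax" for j using ts(2) by (auto simp: tapes_lt_def)
  let ?g = "\<lambda>n. fst (input_tape (take n y))"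
  have glt: "fst (input_tape v) j < smax" for v j
    using smax3 input_tape_le2[of v j] by linarith
  have usj: "tapes_lt smax ((fst (input_tape v), j) # us)" for v j
    using us(1) glt by (auto simp: tapes_lt_def)
  let ?S = "\<lambda>n. (3, (ts @ [(f, int n)]) @ z # (?g n, int n) # us)"
  have fw: "tm_step cmpM (?S n) = ?S (Suc n)" if n: "n < length y" for n
  proof -
    have fn: "f (int n) = bit_symbol (y ! n)" using y n by (simp add: tape_holds_def)
    then have "f (int n) \<noteq> 0" by (simp add: bit_symbol_def)
    moreover have "(?g n)(int n := f (int n)) = ?g (Suc n)"
      using input_tape_snoc[of "take n y" "y ! n"] n by (simp add: fn take_Suc_conv_app_nth)
    ultimately show ?thesis using ts us smax3 tsj usj flt z
      by (subst comp_step[where as = "mv_last Move_Right (map read_tape (ts @ [(f, int n)]))"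
          and a = "(fst z (snd z), Stay)" and bs = "mv_hd Move_Right (f (int n)) (map read_tape ((?g n, int n) # us))"])
       (auto simp del: map_append list.map simp: comp_act_def read_tape_eq[of z] last_map act_tape_eq intro!: syms_lt_intros)
  qed
  have turn: "tm_step cmpM (?S (length y)) = (4, (ts @ [(f, int (length y))]) @ z # (fst (input_tape y), int (length y) - 1) # us)"
  proof -
    have fn: "f (int (length y)) = 0" using y by (simp add: tape_holds_def)
    show ?thesis using ts us smax3 tsj usj[of y] flt glt[of y] z fn
      by (subst comp_step[where as = "keep (map read_tape (ts @ [(f, int (length y))]))"
          and a = "(fst z (snd z), Stay)" and bs = "mv_hd Move_Left (fst (input_tape y) (int (length y))) (map read_tape ((fst (input_tape y), int (length y)) # us))"])
       (auto simp del: map_append list.map simp: comp_act_def read_tape_eq[of z] last_map act_tape_eq list.map_sel intro!: syms_lt_intros)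
  qed
  let ?R = "\<lambda>j. (4, (ts @ [(f, int (length y))]) @ z # (fst (input_tape y), j) # us)"
  have bw: "tm_step cmpM (?R j) = ?R (j - 1)" if "fst (input_tape y) j \<noteq> 0" for j
    using ts us smax3 tsj usj[of y] flt glt[of y] z that
      by (subst comp_step[where as = "keep (map read_tape (ts @ [(f, int (length y))]))"
          and a = "(fst z (snd z), Stay)" and bs = "mv_hd Move_Left (fst (input_tape y) j) (map read_tape ((fst (input_tape y), j) # us))"])
       (auto simp del: map_append list.map simp: comp_act_def read_tape_eq[of z] last_map act_tape_eq list.map_sel intro!: syms_lt_intros)
  have stop: "tm_step cmpM (?R (-1)) = (10 + num_states M1, (ts @ [(f, int (length y))]) @ z # input_tape y # us)"
  proof -
    have fn: "fst (input_tape y) (-1) = 0" by (simp add: input_tape_def)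
    have eq: "(10 + num_states M1, (ts @ [(f, int (length y))]) @ z # input_tape y # us) =
      (10 + num_states M1, (ts @ [(f, int (length y))]) @ z # (fst (input_tape y), 0) # us)"
      by (simp add: input_tape_def)
    have "tm_step cmpM (?R (-1)) = (10 + num_states M1, (ts @ [(f, int (length y))]) @ z # (fst (input_tape y), 0) # us)"
      using ts us smax3 tsj usj[of y] flt glt[of y] z fn
      by (subst comp_step[where as = "keep (map read_tape (ts @ [(f, int (length y))]))"
          and a = "(fst z (snd z), Stay)" and bs = "mv_hd Move_Right (fst (input_tape y) (-1)) (map read_tape ((fst (input_tape y), -1) # us))"])
       (auto simp del: map_append list.map simp: comp_act_def read_tape_eq[of z] last_map act_tape_eq list.map_sel intro!: syms_lt_intros)
    from trans[OF this eq[symmetric]] show ?thesis .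
  qed
  have g0: "blank_tape = (?g 0, 0)" by (simp add: blank_tape_def input_tape_def fun_eq_iff)
  have 1: "(tm_step cmpM ^^ length y) (3, (ts @ [(f, 0)]) @ z # blank_tape # us) = ?S (length y)"
    using funpow_iter[of "length y" "tm_step cmpM" ?S] fw g0 by simp
  have 2: "(tm_step cmpM ^^ length y) (?R (int (length y) - 1)) = ?R (-1)"
    using funpow_iter[of "length y" "tm_step cmpM" "\<lambda>n. ?R (int (length y) - 1 - int n)"] bw
    by (force simp: input_tape_def bit_symbol_def algebra_simps)
  have "(tm_step cmpM ^^ 1) (?S (length y)) = ?R (int (length y) - 1)"
    "(tm_step cmpM ^^ 1) (?R (-1)) = (10 + num_states M1, (ts @ [(f, int (length y))]) @ z # input_tape y # us)"
    using turn stop by simp_all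
  from funpow_chain[OF funpow_chain[OF funpow_chain[OF 1 this(1)] 2] this(2)] show ?thesis .
qed

text \<open>The halting state of \<open>M2\<close> becomes that of the composition, while its other
  states are shifted past those of \<open>M1\<close>. So the simulation is stated up to the first
  halt only.\<close>

lemma comp_phase2:
  assumes ts: "length ts = num_tapes M1" "tapes_lt smax ts" "fst z (snd z) < smax"
    and nh: "\<forall>t'<t. fst (tm_run M2 w t') \<noteq> 1"
  shows "(tm_step cmpM ^^ t) (10 + num_states M1, ts @ z # snd (init_config M2 w)) =
      (let c = tm_run M2 w t in (if fst c = 1 then 1 else 10 + num_states M1 + fst c, ts @ z # snd c))"
  using nh
proof (induction t)
  case 0
  then show ?case by (simp add: tm_run_def init_config_def Let_def)
next
  case (Suc t)
  let ?c = "tm_run M2 w t"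
  let ?d = "delta M2 (fst ?c) (map read_tape (snd ?c))"
  have ok: "conf_ok M2 ?c" using conf_ok_run[OF wf2] .
  note d = conf_ok_delta[OF wf2 ok]
  have nh: "fst ?c \<noteq> 1" using Suc.prems by simp
  have act: "comp_act M1 M2 (10 + num_states M1 + fst ?c) (map read_tape ts) (read_tape z) (map read_tape (snd ?c)) =
    (if fst ?d = 1 then 1 else 10 + num_states M1 + fst ?d, keep (map read_tape ts), (fst z (snd z), Stay), snd ?d)"
    using smax3 by (auto simp: comp_act_def Let_def read_tape_eq[of z])
  have "tm_step cmpM (10 + num_states M1 + fst ?c, ts @ z # snd ?c) =
     (if fst ?d = 1 then 1 else 10 + num_states M1 + fst ?d, map2 act_tape (keep (map read_tape ts)) ts @
       act_tape (fst z (snd z), Stay) z # map2 act_tape (snd ?d) (snd ?c))"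
    using d smax3 ts ok by (intro comp_step[OF act]) (auto simp: conf_ok_def intro!: syms_lt_intros,
      auto simp: syms_lt_def less_max_iff_disj)
  also have "\<dots> = (let c = tm_run M2 w (Suc t) in (if fst c = 1 then 1 else 10 + num_states M1 + fst c, ts @ z # snd c))"
    using nh by (simp add: tm_run_Suc tm_step_eq Let_def act_tape_eq)
  finally show ?case using Suc nh by (simp add: Let_def)
qed

end

text \<open>The phases of the composed machine follow a run only as long as it has not halted, so
  time has to be counted up to the first halt.\<close>

lemma first_halt:
  assumes "prod_in M w y t"
  obtains t' where "t' \<le> t" "prod_in M w y t'" "\<forall>u<t'. fst (tm_run M w u) \<noteq> 1"
proof -
  define t' where "t' = (LEAST u. fst (tm_run M w u) = 1)"
  have h: "fst (tm_run M w t) = 1" using assms by (simp add: prod_in_def)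
  have h': "fst (tm_run M w t') = 1" "t' \<le> t" "\<forall>u<t'. fst (tm_run M w u) \<noteq> 1"
    using h unfolding t'_def by (auto intro: LeastI Least_le dest: not_less_Least)
  have "prod_in M w y t'" using assms tm_run_halted[OF h'(1,2)] by (simp add: prod_in_def)
  with h' that show ?thesis by blast
qed

theorem prod_in_comp:
  assumes wf: "wf_tm M1" "wf_tm M2" and p1: "prod_in M1 w y t1" and p2: "prod_in M2 y v t2"
  shows "prod_in (comp_tm M1 M2) w v (2 * length w + 5 * t1 + t2 + 10)"
proof -
  let ?C = "comp_tm M1 M2"
  let ?s = "max (num_symbols M1) (num_symbols M2)"
  from first_halt[OF p1] obtain u1 where u1: "u1 \<le> t1" "prod_in M1 w y u1" "\<forall>u<u1. fst (tm_run M1 w u) \<noteq> 1" .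
  from first_halt[OF p2] obtain u2 where u2: "u2 \<le> t2" "prod_in M2 y v u2" "\<forall>u<u2. fst (tm_run M2 y u) \<noteq> 1" .
  note s3 = smax3[OF wf]
  define us where "us = replicate (num_tapes M2 - 1) blank_tape"
  have us: "tapes_lt ?s us" "tapes_lt ?s (blank_tape # us)" "length us + 1 = num_tapes M2"
    using s3 by (auto simp: us_def tapes_lt_def blank_tape_def)
  have i1: "conf_ok M1 (init_config M1 w)" using conf_ok_init[OF wf(1)] .
  have init: "init_config ?C w = (0, snd (init_config M1 w) @ (\<lambda>_. 0, 0) # blank_tape # us)"
  proof -
    have "replicate (num_tapes M1 + num_tapes M2) blank_tape =
      replicate (num_tapes M1 - 1) blank_tape @ blank_tape # blank_tape # us"
      using s3 unfolding us_def by (metis (no_types, opaque_lifting) Suc_pred' add_Suc_right append_Cons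
        less_le_trans replicate_Suc replicate_add zero_less_one replicate_app_Cons_same add_Suc)
    then show ?thesis by (simp add: init_config_def comp_tm_def) (simp add: blank_tape_def)
  qed
  have act0: "comp_act M1 M2 0 (map read_tape (snd (init_config M1 w))) (read_tape (\<lambda>_. 0, 0)) (map read_tape (blank_tape # us)) =
    (10, keep (map read_tape (snd (init_config M1 w))), (2, Stay), keep (map read_tape (blank_tape # us)))"
    by (simp add: comp_act_def)
  have step0: "tm_step ?C (init_config ?C w) = (10, snd (init_config M1 w) @ (vis 0 0, 0) # blank_tape # us)"
  proof -
    have "tm_step ?C (0, snd (init_config M1 w) @ (\<lambda>_. 0, 0) # blank_tape # us) =
      (10, map2 act_tape (keep (map read_tape (snd (init_config M1 w)))) (snd (init_config M1 w)) @
        act_tape (2, Stay) (\<lambda>_. 0, 0) # map2 act_tape (keep (map read_tape (blank_tape # us))) (blank_tape # us))"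
      using us s3 i1 by (intro comp_step[OF act0])
        (auto simp del: list.map simp: conf_ok_def tapes_lt_def less_max_iff_disj intro!: syms_lt_intros)
    also have "act_tape (2, Stay) (\<lambda>_. 0, 0) = (vis 0 0, 0)" by (auto simp: vis_def)
    finally show ?thesis unfolding init by (simp only: map2_keep)
  qed
  from comp_phase1[OF wf us(2) _ u1(3)] us(3) obtain a b where ph1:
    "(tm_step ?C ^^ u1) (10, snd (init_config M1 w) @ (vis 0 0, 0) # blank_tape # us) =
      (10 + fst (tm_run M1 w u1), snd (tm_run M1 w u1) @ (vis a b, snd (last (snd (tm_run M1 w u1)))) # blank_tape # us)"
    and ab: "a \<le> 0" "0 \<le> b" "a - 1 \<le> snd (last (snd (tm_run M1 w u1)))"
    "snd (last (snd (tm_run M1 w u1))) \<le> b + 1" "b - a \<le> int u1"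
    by auto
  have ok1: "conf_ok M1 (tm_run M1 w u1)" using conf_ok_run[OF wf(1)] .
  then have "snd (tm_run M1 w u1) \<noteq> []" using s3 by (auto simp: conf_ok_def)
  then obtain ts f i where ts: "snd (tm_run M1 w u1) = ts @ [(f, i)]" by (metis append_butlast_last_id surj_pair)
  have lts: "length ts + 1 = num_tapes M1" and tlt: "tapes_lt ?s (ts @ [(f, j)])" for j
    using ok1 unfolding conf_ok_def ts by (auto simp: tapes_lt_def less_max_iff_disj)
  have q1: "fst (tm_run M1 w u1) = 1" using u1(2) by (simp add: prod_in_def)
  have hy: "tape_holds (f, 0) y" using u1(2) by (simp add: prod_in_def ts tape_holds_def)
  define a' b' where "a' = min a i" and "b' = max b i"
  have ab': "a' \<le> 0" "0 \<le> b'" "a' \<le> i" "i \<le> b'" "b' - a' \<le> int u1 + 1"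
    using ab by (auto simp: a'_def b'_def ts)
  have vlt: "vis a b j < ?s" for a b j using vis_lt[OF wf] .
  \<comment> \<open>The halting state 1 of \<open>M1\<close> appears as state 11. Its head may stand
    on a cell that is not marked yet; marking this cell first keeps the run to the left from
    stopping right there.\<close>
  have act11: "comp_act M1 M2 11 (map read_tape (ts @ [(f, i)])) (read_tape (vis a b, i)) (map read_tape (blank_tape # us)) =
    (5, keep (map read_tape (ts @ [(f, i)])), (if vis a b i = 2 then 2 else 1, Stay), keep (map read_tape (blank_tape # us)))"
    by (simp add: comp_act_def)
  have step11: "tm_step ?C (11, (ts @ [(f, i)]) @ (vis a b, i) # blank_tape # us) =
      (5, (ts @ [(f, i)]) @ (vis a' b', i) # blank_tape # us)"
  proof -
    have "tm_step ?C (11, (ts @ [(f, i)]) @ (vis a b, i) # blank_tape # us) =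
      (5, map2 act_tape (keep (map read_tape (ts @ [(f, i)]))) (ts @ [(f, i)]) @
       act_tape (if vis a b i = 2 then 2 else 1, Stay) (vis a b, i) #
       map2 act_tape (keep (map read_tape (blank_tape # us))) (blank_tape # us))"
      using us s3 lts tlt by (intro comp_step[OF act11])
        (auto simp del: list.map map_append intro!: syms_lt_intros)
    also have "act_tape (if vis a b i = 2 then 2 else 1, Stay) (vis a b, i) = (vis a' b', i)"
      using ab by (auto simp: vis_def a'_def b'_def ts fun_eq_iff)
    finally show ?thesis by (simp only: map2_keep)
  qed
  have us2: "length (blank_tape # us) = num_tapes M2" using us(3) by simp
  note rew = comp_rewind[OF wf lts tlt us(2) us2 ab'(1-4)]
  note cop = comp_copy[OF wf lts tlt, of "(vis a' b', 0)" y us, OF _ hy us(1,3)]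
  have inity: "input_tape y # us = snd (init_config M2 y)" by (simp add: init_config_def us_def)
  note ph2 = comp_phase2[OF wf, of "ts @ [(f, int (length y))]" "(vis a' b', 0)" u2 y, OF _ tlt _ u2(3)]
  have q2: "fst (tm_run M2 y u2) = 1" using u2(2) by (simp add: prod_in_def)
  define T where "T = 1 + u1 + 1 + (nat (i - a' + 1) + 1 + nat (1 - a') + 1) + (length y + 1 + length y + 1) + u2"
  have "(tm_step ?C ^^ T) (init_config ?C w) =
    (1, (ts @ [(f, int (length y))]) @ (vis a' b', 0) # snd (tm_run M2 y u2))"
    unfolding T_def
  proof (rule funpow_chain[OF funpow_chain[OF funpow_chain[OF funpow_chain[OF funpow_chain]]]])
    show "(tm_step ?C ^^ 1) (init_config ?C w) = (10, snd (init_config M1 w) @ (vis 0 0, 0) # blank_tape # us)"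
      using step0 by simp
    show "(tm_step ?C ^^ u1) (10, snd (init_config M1 w) @ (vis 0 0, 0) # blank_tape # us) =
      (11, (ts @ [(f, i)]) @ (vis a b, i) # blank_tape # us)" using ph1 by (simp add: q1 ts)
    show "(tm_step ?C ^^ 1) (11, (ts @ [(f, i)]) @ (vis a b, i) # blank_tape # us) =
      (5, (ts @ [(f, i)]) @ (vis a' b', i) # blank_tape # us)" using step11 by simp
    show "(tm_step ?C ^^ (nat (i - a' + 1) + 1 + nat (1 - a') + 1)) (5, (ts @ [(f, i)]) @ (vis a' b', i) # blank_tape # us)
      = (3, (ts @ [(f, 0)]) @ (vis a' b', 0) # blank_tape # us)" using rew .
    show "(tm_step ?C ^^ (length y + 1 + length y + 1)) (3, (ts @ [(f, 0)]) @ (vis a' b', 0) # blank_tape # us) =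
      (10 + num_states M1, (ts @ [(f, int (length y))]) @ (vis a' b', 0) # input_tape y # us)"
      using cop vlt by simp
    show "(tm_step ?C ^^ u2) (10 + num_states M1, (ts @ [(f, int (length y))]) @ (vis a' b', 0) # input_tape y # us) =
      (1, (ts @ [(f, int (length y))]) @ (vis a' b', 0) # snd (tm_run M2 y u2))"
      using ph2 vlt lts q2 unfolding inity by (simp add: Let_def)
  qed
  moreover have "snd (tm_run M2 y u2) \<noteq> []" using conf_ok_run[OF wf(2), of y u2] s3 by (auto simp: conf_ok_def)
  ultimately have "prod_in ?C w v T" using u2(2) by (simp add: prod_in_def tm_run_def[of ?C])
  \<comment> \<open>Three times \<open>t1\<close> come from the run of \<open>M1\<close> and the way
    over the marked cells and back, and twice \<open>length w + t1\<close> from copying the output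
    and returning to its start.\<close>
  moreover have "T \<le> 2 * length w + 5 * t1 + t2 + 10"
    using prod_in_length[OF wf(1) u1(2)] u1(1) u2(1) ab' unfolding T_def by linarith
  ultimately show ?thesis by (rule prod_in_mono)
qed

section \<open>Polynomial-time functions\<close>

definition ctx_size :: "('a \<Rightarrow> bool list) \<Rightarrow> ('a \<Rightarrow> nat list) \<Rightarrow> 'a \<Rightarrow> nat" where
  "ctx_size W \<Gamma> s = length (W s) + sum_list (\<Gamma> s)"

text \<open>Numbers count with their value and not with their length in binary, since registers are
  unary. The base is at least 2, so sums and constant factors can be absorbed into the
  exponent.\<close>

definition pbd :: "('a \<Rightarrow> bool list) \<Rightarrow> ('a \<Rightarrow> nat list) \<Rightarrow> ('a \<Rightarrow> nat) \<Rightarrow> bool" where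
  "pbd W \<Gamma> f \<longleftrightarrow> (\<exists>d. \<forall>s. f s \<le> (ctx_size W \<Gamma> s + 2) ^ d)"

lemma pbd_mono: "pbd W \<Gamma> g \<Longrightarrow> (\<And>s. f s \<le> g s) \<Longrightarrow> pbd W \<Gamma> f"
  unfolding pbd_def by (meson le_trans)

lemma pbd_const: "pbd W \<Gamma> (\<lambda>s. c)"
proof -
  have "c \<le> (n + 2) ^ c" for n :: nat
  proof -
    have "c \<le> 2 ^ c" by (rule less_imp_le) (rule less_exp)
    also have "\<dots> \<le> (n + 2) ^ c" by (rule power_mono) auto
    finally show ?thesis .
  qed
  then show ?thesis unfolding pbd_def by blast
qed

lemma pbd_size: "pbd W \<Gamma> (ctx_size W \<Gamma>)"
  unfolding pbd_def by (rule exI[of _ 1]) simp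

lemma pbd_add: "pbd W \<Gamma> f \<Longrightarrow> pbd W \<Gamma> g \<Longrightarrow> pbd W \<Gamma> (\<lambda>s. f s + g s)"
proof -
  assume "pbd W \<Gamma> f" "pbd W \<Gamma> g"
  then obtain d e where de: "\<And>s. f s \<le> (ctx_size W \<Gamma> s + 2) ^ d" "\<And>s. g s \<le> (ctx_size W \<Gamma> s + 2) ^ e"
    unfolding pbd_def by blast
  have "f s + g s \<le> (ctx_size W \<Gamma> s + 2) ^ (d + e + 1)" for s
  proof -
    let ?n = "ctx_size W \<Gamma> s + 2"
    have "?n ^ d \<le> ?n ^ (d + e)" "?n ^ e \<le> ?n ^ (d + e)" by (rule power_increasing; simp)+
    then have "f s + g s \<le> 2 * ?n ^ (d + e)" using de[of s] by linarith
    also have "\<dots> \<le> ?n * ?n ^ (d + e)" by (rule mult_right_mono) auto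
    finally show ?thesis by simp
  qed
  then show ?thesis unfolding pbd_def by blast
qed

lemma pbd_mult: "pbd W \<Gamma> f \<Longrightarrow> pbd W \<Gamma> g \<Longrightarrow> pbd W \<Gamma> (\<lambda>s. f s * g s)"
proof -
  assume "pbd W \<Gamma> f" "pbd W \<Gamma> g"
  then obtain d e where de: "\<And>s. f s \<le> (ctx_size W \<Gamma> s + 2) ^ d" "\<And>s. g s \<le> (ctx_size W \<Gamma> s + 2) ^ e"
    unfolding pbd_def by blast
  have "f s * g s \<le> (ctx_size W \<Gamma> s + 2) ^ (d + e)" for s
    unfolding power_add by (rule mult_mono) (use de in auto)
  then show ?thesis unfolding pbd_def by blast
qed

lemma pbd_power: "pbd W \<Gamma> f \<Longrightarrow> pbd W \<Gamma> (\<lambda>s. f s ^ k)"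
  by (induction k) (simp_all add: pbd_const[of _ _ 1, simplified] pbd_mult)

lemma pbd_Suc: "pbd W \<Gamma> f \<Longrightarrow> pbd W \<Gamma> (\<lambda>s. Suc (f s))"
  using pbd_add[OF _ pbd_const[of W \<Gamma> 1]] by simp

lemma pbd_subst:
  assumes "pbd W' \<Gamma>' f" "pbd W \<Gamma> B" "\<And>s. ctx_size W' \<Gamma>' (g s) \<le> B s"
  shows "pbd W \<Gamma> (\<lambda>s. f (g s))"
proof -
  from assms(1) obtain d where d: "\<And>s. f s \<le> (ctx_size W' \<Gamma>' s + 2) ^ d" unfolding pbd_def by blast
  have "f (g s) \<le> (B s + 2) ^ d" for s
    by (rule order_trans[OF d]) (rule power_mono, use assms(3)[of s] in auto)
  moreover have "pbd W \<Gamma> (\<lambda>s. (B s + 2) ^ d)" by (intro pbd_power pbd_add assms(2) pbd_const)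
  ultimately show ?thesis by (rule pbd_mono[rotated])
qed

lemmas pbd_intros = pbd_add pbd_mult pbd_Suc pbd_power pbd_const pbd_size

definition env_at :: "nat list \<Rightarrow> nat \<Rightarrow> nat list \<Rightarrow> (nat \<Rightarrow> int) \<Rightarrow> bool" where
  "env_at \<rho> b vs \<sigma> \<longleftrightarrow> map \<sigma> \<rho> = map int vs \<and> \<sigma> 0 = 0 \<and> (\<forall>r\<ge>b. \<sigma> r = 0)"

text \<open>
  The value of f is computed from the word W s and the numbers \<open>\<Gamma> s\<close>, which are found in the
  registers \<rho>; the result is put into register b, and the registers from b on serve as work space.
\<close>
definition pf :: "('a \<Rightarrow> bool list) \<Rightarrow> ('a \<Rightarrow> nat list) \<Rightarrow> ('a \<Rightarrow> nat) \<Rightarrow> bool" where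
  "pf W \<Gamma> f \<longleftrightarrow> pbd W \<Gamma> f \<and>
     (\<forall>\<rho> b. set \<rho> \<subseteq> {1..<b} \<and> 1 \<le> b \<longrightarrow>
        (\<exists>c K t. cbnd K c \<and> pbd W \<Gamma> t \<and>
           (\<forall>s \<sigma> w. env_at \<rho> b (\<Gamma> s) \<sigma> \<longrightarrow> exec (W s) c (\<sigma>, w) (\<sigma>(b := int (f s)), w) (t s))))"

text \<open>Output is appended and all registers are restored, so that emitting programs can simply
  be put in sequence.\<close>

definition em :: "('a \<Rightarrow> bool list) \<Rightarrow> ('a \<Rightarrow> nat list) \<Rightarrow> ('a \<Rightarrow> bool list) \<Rightarrow> bool" where
  "em W \<Gamma> f \<longleftrightarrow>
     (\<forall>\<rho> b. set \<rho> \<subseteq> {1..<b} \<and> 1 \<le> b \<longrightarrow>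
        (\<exists>c K t. cbnd K c \<and> pbd W \<Gamma> t \<and>
           (\<forall>s \<sigma> w. env_at \<rho> b (\<Gamma> s) \<sigma> \<longrightarrow> exec (W s) c (\<sigma>, w) (\<sigma>, w @ f s) (t s))))"

lemma pfI:
  assumes "pbd W \<Gamma> f"
    "\<And>\<rho> b. set \<rho> \<subseteq> {1..<b} \<Longrightarrow> 1 \<le> b \<Longrightarrow> \<exists>c K t. cbnd K c \<and> pbd W \<Gamma> t \<and>
      (\<forall>s \<sigma> w. env_at \<rho> b (\<Gamma> s) \<sigma> \<longrightarrow> exec (W s) c (\<sigma>, w) (\<sigma>(b := int (f s)), w) (t s))"
  shows "pf W \<Gamma> f"
  using assms unfolding pf_def by blast

lemma pfE:
  assumes "pf W \<Gamma> f" "set \<rho> \<subseteq> {1..<b}" "1 \<le> b"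
  obtains K c t where "cbnd K c" "pbd W \<Gamma> t"
    "\<forall>s \<sigma> w. env_at \<rho> b (\<Gamma> s) \<sigma> \<longrightarrow> exec (W s) c (\<sigma>, w) (\<sigma>(b := int (f s)), w) (t s)"
  using assms unfolding pf_def by metis

lemma emE:
  assumes "em W \<Gamma> f" "set \<rho> \<subseteq> {1..<b}" "1 \<le> b"
  obtains K c t where "cbnd K c" "pbd W \<Gamma> t"
    "\<forall>s \<sigma> w. env_at \<rho> b (\<Gamma> s) \<sigma> \<longrightarrow> exec (W s) c (\<sigma>, w) (\<sigma>, w @ f s) (t s)"
  using assms unfolding em_def by metis

lemma pf_pbd: "pf W \<Gamma> f \<Longrightarrow> pbd W \<Gamma> f"
  by (simp add: pf_def)

lemma pf_cong: "pf W \<Gamma> f \<Longrightarrow> (\<And>s. f s = g s) \<Longrightarrow> pf W \<Gamma> g"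
  by (subgoal_tac "f = g") auto

lemma em_cong: "em W \<Gamma> f \<Longrightarrow> (\<And>s. f s = g s) \<Longrightarrow> em W \<Gamma> g"
  by (subgoal_tac "f = g") auto

text \<open>The loops for copying, clearing and moving the input head all have this form: one
  register is counted down while a fixed vector \<open>\<delta>\<close> is added to the
  others.\<close>

lemma exec_loop_add:
  assumes "\<And>\<sigma> w. exec x c (\<sigma>, w) (\<lambda>q. \<sigma> q + \<delta> q, w) u" "\<delta> r = 0" "\<sigma> r = int n"
  shows "exec x (While (NonZero r) (Seq (Dec r) c)) (\<sigma>, w) ((\<lambda>q. \<sigma> q + int n * \<delta> q)(r := 0), w) (Suc (n * (u + 3)))"
proof -
  let ?S = "\<lambda>i. ((\<lambda>q. \<sigma> q + int i * \<delta> q)(r := int (n - i)), w)"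
  have "exec x (While (NonZero r) (Seq (Dec r) c)) (?S 0) (?S n) (Suc (n * Suc (Suc (1 + u))))"
  proof (rule exec_While)
    fix i assume i: "i < n"
    let ?\<tau> = "(\<lambda>q. \<sigma> q + int i * \<delta> q)(r := int (n - i))"
    have "exec x (Seq (Dec r) c) (?\<tau>, w) (\<lambda>q. (?\<tau>(r := ?\<tau> r - 1)) q + \<delta> q, w) (Suc (1 + u))"
      by (rule exec_Seq[OF exec_Dec assms(1)])
    moreover have "(\<lambda>q. (?\<tau>(r := ?\<tau> r - 1)) q + \<delta> q) = fst (?S (Suc i))"
      using i assms(2) by (auto simp: fun_eq_iff of_nat_diff algebra_simps)
    ultimately have "exec x (Seq (Dec r) c) (?S i) (?S (Suc i)) (Suc (1 + u))" by simp
    then show "tst_val x (fst (?S i)) (NonZero r) \<and> exec x (Seq (Dec r) c) (?S i) (?S (Suc i)) (Suc (1 + u))"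
      using i by simp
  qed simp
  moreover have "?S 0 = (\<sigma>, w)" using assms(3) by (auto simp: fun_eq_iff)
  moreover have "?S n = ((\<lambda>q. \<sigma> q + int n * \<delta> q)(r := 0), w)" by simp
  ultimately show ?thesis by (simp add: numeral_3_eq_3)
qed

lemma exec_incs: "exec x (Inc q) (\<sigma>, w) (\<lambda>p. \<sigma> p + (if p = q then 1 else 0), w) 1"
  "exec x (Dec q) (\<sigma>, w) (\<lambda>p. \<sigma> p + (if p = q then -1 else 0), w) 1"
proof -
  have "(\<lambda>p. \<sigma> p + (if p = q then 1 else 0)) = \<sigma>(q := \<sigma> q + 1)"
    "(\<lambda>p. \<sigma> p + (if p = q then -1 else 0)) = \<sigma>(q := \<sigma> q - 1)" by auto
  then show "exec x (Inc q) (\<sigma>, w) (\<lambda>p. \<sigma> p + (if p = q then 1 else 0), w) 1"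
    "exec x (Dec q) (\<sigma>, w) (\<lambda>p. \<sigma> p + (if p = q then -1 else 0), w) 1"
    using exec_Inc exec_Dec by simp_all
qed

definition clear :: "nat \<Rightarrow> com" where
  "clear r = While (NonZero r) (Seq (Dec r) Skip)"

definition move_to :: "nat \<Rightarrow> nat \<Rightarrow> com" where
  "move_to r q = While (NonZero r) (Seq (Dec r) (Inc q))"

lemma exec_clear: "\<sigma> r = int n \<Longrightarrow> exec x (clear r) (\<sigma>, w) (\<sigma>(r := 0), w) (Suc (n * 4))"
  using exec_loop_add[of x Skip "\<lambda>_. 0" 1 r \<sigma> n w] exec_Skip by (simp add: clear_def)

lemma exec_move_to:
  assumes "\<sigma> r = int n" "r \<noteq> q"
  shows "exec x (move_to r q) (\<sigma>, w) (\<sigma>(r := 0, q := \<sigma> q + int n), w) (Suc (n * 4))"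
proof -
  have "exec x (move_to r q) (\<sigma>, w) ((\<lambda>p. \<sigma> p + int n * (if p = q then 1 else 0))(r := 0), w) (Suc (n * (1 + 3)))"
    unfolding move_to_def by (rule exec_loop_add) (use assms exec_incs in auto)
  moreover have "(\<lambda>p. \<sigma> p + int n * (if p = q then 1 else 0))(r := 0) = \<sigma>(r := 0, q := \<sigma> q + int n)"
    using assms by auto
  ultimately show ?thesis by simp
qed

lemma nth_le_sum_list: "i < length xs \<Longrightarrow> xs ! i \<le> sum_list (xs :: nat list)"
  by (simp add: member_le_sum_list)

text \<open>A register can only be read by counting it down. The loop therefore makes two copies,
  and the second one is used up to restore the register.\<close>

lemma pf_var:
  assumes "\<And>s. i < length (\<Gamma> s) \<and> \<Gamma> s ! i = f s"
  shows "pf W \<Gamma> f"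
proof (rule pfI)
  have le: "f s \<le> ctx_size W \<Gamma> s" for s
    using nth_le_sum_list[of i "\<Gamma> s"] assms[of s] by (auto simp: ctx_size_def)
  show "pbd W \<Gamma> f" by (rule pbd_mono[OF pbd_size le])
  fix \<rho> b assume \<rho>: "set \<rho> \<subseteq> {1..<b}" "1 \<le> (b::nat)"
  let ?r = "\<rho> ! i"
  let ?c = "Seq (While (NonZero ?r) (Seq (Dec ?r) (Seq (Inc b) (Inc (b + 1))))) (move_to (b + 1) ?r)"
  have cp: "exec x (Seq (Inc b) (Inc (b + 1))) (\<sigma>, w) (\<lambda>p. \<sigma> p + (if p = b \<or> p = b + 1 then 1 else 0), w) 3" for x \<sigma> w
  proof -
    have "(\<lambda>p. \<sigma> p + (if p = b then 1 else 0) + (if p = b + 1 then 1 else 0)) = (\<lambda>p. \<sigma> p + (if p = b \<or> p = b + 1 then 1 else 0))"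
      by auto
    with exec_Seq[OF exec_incs(1)[of x b \<sigma> w] exec_incs(1)[of x "b + 1"]] show ?thesis by (simp add: numeral_3_eq_3)
  qed
  show "\<exists>c K t. cbnd K c \<and> pbd W \<Gamma> t \<and>
      (\<forall>s \<sigma> w. env_at \<rho> b (\<Gamma> s) \<sigma> \<longrightarrow> exec (W s) c (\<sigma>, w) (\<sigma>(b := int (f s)), w) (t s))"
  proof (cases "i < length \<rho>")
    \<comment> \<open>For a list of registers that is too short no store matches the environment,
      and any program will do.\<close>
    case False
    have "\<not> env_at \<rho> b (\<Gamma> s) \<sigma>" for s \<sigma>
      using False assms[of s] by (metis env_at_def length_map)
    then show ?thesis by (intro exI[of _ Skip] exI[of _ "0::nat"] exI[of _ "\<lambda>_. 0::nat"]) (simp add: pbd_const)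
  next
    case True
    then have r: "1 \<le> ?r" "?r < b" using subsetD[OF \<rho>(1) nth_mem[OF True]] by auto
    have ex: "exec (W s) ?c (\<sigma>, w) (\<sigma>(b := int (f s)), w) (Suc (Suc (f s * 6) + Suc (f s * 4)))"
      if e: "env_at \<rho> b (\<Gamma> s) \<sigma>" for s \<sigma> w
    proof -
      have "map \<sigma> \<rho> ! i = map int (\<Gamma> s) ! i" using e by (simp add: env_at_def)
      then have v: "\<sigma> ?r = int (f s)" using True assms[of s] by simp
      have z: "\<sigma> b = 0" "\<sigma> (b + 1) = 0" using e by (auto simp: env_at_def)
      let ?\<sigma> = "(\<lambda>p. \<sigma> p + int (f s) * (if p = b \<or> p = b + 1 then 1 else 0))(?r := 0)"
      have 1: "exec (W s) (While (NonZero ?r) (Seq (Dec ?r) (Seq (Inc b) (Inc (b + 1))))) (\<sigma>, w) (?\<sigma>, w) (Suc (f s * (3 + 3)))"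
        by (rule exec_loop_add[of _ _ "\<lambda>p. if p = b \<or> p = b + 1 then 1 else 0"]) (use r cp v in auto)
      have "?\<sigma> (b + 1) = int (f s)" using z r by simp
      from exec_Seq[OF 1 exec_move_to[of ?\<sigma> "b + 1" "f s" ?r "W s" w, OF this]] r
      have "exec (W s) ?c (\<sigma>, w) (?\<sigma>(b + 1 := 0, ?r := ?\<sigma> ?r + int (f s)), w) (Suc (Suc (f s * 6) + Suc (f s * 4)))"
        by simp
      moreover have "?\<sigma>(b + 1 := 0, ?r := ?\<sigma> ?r + int (f s)) = \<sigma>(b := int (f s))"
        using r z v by (auto simp: fun_eq_iff)
      ultimately show ?thesis by simp
    qed
    show ?thesis
    proof (intro exI conjI allI impI)
      show "cbnd (b + 1) ?c" using r by (simp add: move_to_def)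
      show "pbd W \<Gamma> (\<lambda>s. Suc (Suc (f s * 6) + Suc (f s * 4)))"
        by (intro pbd_intros pbd_mono[OF pbd_size le])
    qed (use ex in blast)
  qed
qed

lemma pf_zero: "pf W \<Gamma> (\<lambda>s. 0)"
proof (rule pfI)
  show "pbd W \<Gamma> (\<lambda>s. 0)" by (rule pbd_const)
  fix \<rho> b
  have "exec (W s) Skip (\<sigma>, w) (\<sigma>(b := int 0), w) 1" if "env_at \<rho> b (\<Gamma> s) \<sigma>" for s \<sigma> w
  proof -
    have "\<sigma>(b := int 0) = \<sigma>" using that by (auto simp: env_at_def)
    then show ?thesis using exec_Skip by simp
  qed
  then show "\<exists>c K t. cbnd K c \<and> pbd W \<Gamma> t \<and>
      (\<forall>s \<sigma> w. env_at \<rho> b (\<Gamma> s) \<sigma> \<longrightarrow> exec (W s) c (\<sigma>, w) (\<sigma>(b := int 0), w) (t s))"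
    by (intro exI[of _ Skip] exI[of _ 0] exI[of _ "\<lambda>_. 1"]) (simp add: pbd_const)
qed

lemma pf_Suc:
  assumes "pf W \<Gamma> f"
  shows "pf W \<Gamma> (\<lambda>s. Suc (f s))"
proof (rule pfI)
  show "pbd W \<Gamma> (\<lambda>s. Suc (f s))" using pbd_Suc pf_pbd[OF assms] by blast
  fix \<rho> b assume \<rho>: "set \<rho> \<subseteq> {1..<b}" "1 \<le> (b::nat)"
  obtain c K t where c: "cbnd K c" "pbd W \<Gamma> t"
    "\<forall>s \<sigma> w. env_at \<rho> b (\<Gamma> s) \<sigma> \<longrightarrow> exec (W s) c (\<sigma>, w) (\<sigma>(b := int (f s)), w) (t s)" by (rule pfE[OF assms \<rho>])
  have "exec (W s) (Seq c (Inc b)) (\<sigma>, w) (\<sigma>(b := int (Suc (f s))), w) (Suc (t s + 1))"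
    if e: "env_at \<rho> b (\<Gamma> s) \<sigma>" for s \<sigma> w
    using exec_Seq[OF c(3)[rule_format, OF e] exec_Inc[of "W s" b]] by (simp add: add.commute)
  moreover have "cbnd (K + b) (Seq c (Inc b))" using cbnd_mono[OF c(1)] by simp
  moreover have "pbd W \<Gamma> (\<lambda>s. Suc (t s + 1))" by (intro pbd_intros c(2))
  ultimately show "\<exists>c K t. cbnd K c \<and> pbd W \<Gamma> t \<and>
      (\<forall>s \<sigma> w. env_at \<rho> b (\<Gamma> s) \<sigma> \<longrightarrow> exec (W s) c (\<sigma>, w) (\<sigma>(b := int (Suc (f s))), w) (t s))" by blast
qed

lemma env_at_upd:
  assumes "env_at \<rho> b vs \<sigma>" "set \<rho> \<subseteq> {1..<b}" "1 \<le> b" "b \<le> r" "r < b'"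
  shows "env_at \<rho> b' vs (\<sigma>(r := v))"
proof -
  have "r \<notin> set \<rho>" using assms by auto
  then show ?thesis using assms by (auto simp: env_at_def)
qed

lemma env_at_mono: "env_at \<rho> b vs \<sigma> \<Longrightarrow> b \<le> b' \<Longrightarrow> env_at \<rho> b' vs \<sigma>"
  by (auto simp: env_at_def)

lemma env_at_Cons: "env_at \<rho> b vs \<sigma> \<Longrightarrow> \<sigma> r = int v \<Longrightarrow> env_at (r # \<rho>) b (v # vs) \<sigma>"
  by (auto simp: env_at_def)

text \<open>Bounded recursion; the bound on the values is what keeps the running time polynomial.\<close>
lemma pf_rec:
  assumes n: "pf W \<Gamma> n" and g: "pf W \<Gamma> g"
    and h: "pf (\<lambda>p. W (fst (fst p))) (\<lambda>p. snd p # snd (fst p) # \<Gamma> (fst (fst p))) (\<lambda>p. h (fst (fst p)) (snd (fst p)) (snd p))"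
    and B: "pbd W \<Gamma> B" "\<And>s i. i \<le> n s \<Longrightarrow> rec_nat (g s) (h s) i \<le> B s"
  shows "pf W \<Gamma> (\<lambda>s. rec_nat (g s) (h s) (n s))"
proof (rule pfI)
  show "pbd W \<Gamma> (\<lambda>s. rec_nat (g s) (h s) (n s))" by (rule pbd_mono[OF B(1)]) (simp add: B(2))
  fix \<rho> b assume \<rho>: "set \<rho> \<subseteq> {1..<b}" "1 \<le> (b::nat)"
  have \<rho>1: "set \<rho> \<subseteq> {1..<b + 1}" "1 \<le> b + 1" and \<rho>3: "set (b # (b + 2) # \<rho>) \<subseteq> {1..<b + 3}" "1 \<le> b + 3"
    using \<rho> by auto
  obtain cg Kg tg where cg: "cbnd Kg cg" "pbd W \<Gamma> tg"
    "\<forall>s \<sigma> w. env_at \<rho> b (\<Gamma> s) \<sigma> \<longrightarrow> exec (W s) cg (\<sigma>, w) (\<sigma>(b := int (g s)), w) (tg s)" by (rule pfE[OF g \<rho>])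
  obtain cn Kn tn where cn: "cbnd Kn cn" "pbd W \<Gamma> tn"
    "\<forall>s \<sigma> w. env_at \<rho> (b + 1) (\<Gamma> s) \<sigma> \<longrightarrow> exec (W s) cn (\<sigma>, w) (\<sigma>(b + 1 := int (n s)), w) (tn s)" by (rule pfE[OF n \<rho>1])
  obtain ch Kh th where ch: "cbnd Kh ch"
    "pbd (\<lambda>p. W (fst (fst p))) (\<lambda>p. snd p # snd (fst p) # \<Gamma> (fst (fst p))) th"
    "\<forall>p \<sigma> w. env_at (b # (b + 2) # \<rho>) (b + 3) (snd p # snd (fst p) # \<Gamma> (fst (fst p))) \<sigma> \<longrightarrow>
      exec (W (fst (fst p))) ch (\<sigma>, w) (\<sigma>(b + 3 := int (h (fst (fst p)) (snd (fst p)) (snd p))), w) (th p)" by (rule pfE[OF h \<rho>3])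
  from ch(2) obtain d where d: "\<forall>p. th p \<le> (length (W (fst (fst p))) + sum_list (snd p # snd (fst p) # \<Gamma> (fst (fst p))) + 2) ^ d"
    unfolding pbd_def ctx_size_def by blast
  let ?R = "\<lambda>s i. rec_nat (g s) (h s) i"
  define u where "u s = (ctx_size W \<Gamma> s + n s + B s + 2) ^ d" for s
  have th: "th ((s, i), ?R s i) \<le> u s" if "i \<le> n s" for s i
    by (rule order_trans[OF d[rule_format]]) (use that B(2)[OF that] in \<open>auto simp: u_def ctx_size_def intro!: power_mono\<close>)
  \<comment> \<open>Register \<open>b\<close> holds the current value, \<open>b + 1\<close> the
    number of remaining rounds, \<open>b + 2\<close> the index of the round and \<open>b + 3\<close>
    the next value.\<close>
  let ?body = "Seq ch (Seq (clear b) (Seq (move_to (b + 3) b) (Seq (Inc (b + 2)) (Dec (b + 1)))))"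
  let ?c = "Seq cg (Seq cn (Seq (While (NonZero (b + 1)) ?body) (clear (b + 2))))"
  define v where "v s = Suc (u s + Suc (Suc (B s * 4) + Suc (Suc (B s * 4) + 3)))" for s
  define t where "t s = Suc (tg s + Suc (tn s + Suc (Suc (n s * Suc (v s)) + Suc (n s * 4))))" for s
  have ex: "exec (W s) ?c (\<sigma>, w) (\<sigma>(b := int (?R s (n s))), w) (t s)" if e: "env_at \<rho> b (\<Gamma> s) \<sigma>" for s \<sigma> w
  proof -
    have z: "\<sigma> (b + 1) = 0" "\<sigma> (b + 2) = 0" "\<sigma> (b + 3) = 0" "\<sigma> b = 0" using e by (auto simp: env_at_def)
    let ?S = "\<lambda>i. (\<sigma>(b := int (?R s i), b + 1 := int (n s - i), b + 2 := int i), w)"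
    have 1: "exec (W s) cg (\<sigma>, w) (\<sigma>(b := int (g s)), w) (tg s)" by (rule cg(3)[rule_format, OF e])
    have 2: "exec (W s) cn (\<sigma>(b := int (g s)), w) (?S 0) (tn s)"
    proof -
      have "env_at \<rho> (b + 1) (\<Gamma> s) (\<sigma>(b := int (g s)))" by (rule env_at_upd[OF e \<rho>]) auto
      moreover have "\<sigma>(b := int (g s), b + 1 := int (n s)) = fst (?S 0)" using z by (auto simp: fun_eq_iff)
      ultimately show ?thesis using cn(3)[rule_format, of s "\<sigma>(b := int (g s))" w] by simp
    qed
    have 3: "exec (W s) (While (NonZero (b + 1)) ?body) (?S 0) (?S (n s)) (Suc (n s * Suc (v s)))"
    proof (rule exec_While)
      fix i assume i: "i < n s"
      let ?h = "int (?R s (Suc i))"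
      have e3: "env_at (b # (b + 2) # \<rho>) (b + 3) (?R s i # i # \<Gamma> s) (fst (?S i))"
        unfolding fst_conv
        by (intro env_at_Cons env_at_upd[of \<rho> "b + 2"] env_at_upd[of \<rho> "b + 1"] env_at_upd[of \<rho> b] e) (use \<rho> in auto)
      have h1: "exec (W s) ch (?S i) ((fst (?S i))(b + 3 := ?h), w) (u s)"
        using exec_mono[OF ch(3)[rule_format, of "((s, i), ?R s i)"] th] e3 i by simp
      have h2: "exec (W s) (clear b) ((fst (?S i))(b + 3 := ?h), w) ((fst (?S i))(b + 3 := ?h, b := 0), w) (Suc (B s * 4))"
        by (rule exec_mono[OF exec_clear[of _ _ "?R s i"]]) (use B(2)[of i s] i in auto)
      have h3: "exec (W s) (move_to (b + 3) b) ((fst (?S i))(b + 3 := ?h, b := 0), w)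
          ((fst (?S i))(b + 3 := 0, b := ?h), w) (Suc (B s * 4))"
      proof -
        have "exec (W s) (move_to (b + 3) b) ((fst (?S i))(b + 3 := ?h, b := 0), w)
          (((fst (?S i))(b + 3 := ?h, b := 0))(b + 3 := 0, b := ((fst (?S i))(b + 3 := ?h, b := 0)) b + ?h), w) (Suc (?R s (Suc i) * 4))"
          by (rule exec_move_to) auto
        moreover have "((fst (?S i))(b + 3 := ?h, b := 0))(b + 3 := 0, b := ((fst (?S i))(b + 3 := ?h, b := 0)) b + ?h)
          = (fst (?S i))(b + 3 := 0, b := ?h)" by (auto simp: fun_eq_iff)
        ultimately show ?thesis using exec_mono[where t' = "Suc (B s * 4)"] B(2)[of "Suc i" s] i by simp
      qed
      have h4: "exec (W s) (Seq (Inc (b + 2)) (Dec (b + 1))) ((fst (?S i))(b + 3 := 0, b := ?h), w) (?S (Suc i)) 3"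
      proof -
        let ?\<tau> = "(fst (?S i))(b + 3 := 0, b := ?h)"
        have "exec (W s) (Seq (Inc (b + 2)) (Dec (b + 1))) (?\<tau>, w)
          (?\<tau>(b + 2 := ?\<tau> (b + 2) + 1, b + 1 := (?\<tau>(b + 2 := ?\<tau> (b + 2) + 1)) (b + 1) - 1), w) (Suc (1 + 1))"
          by (rule exec_Seq[OF exec_Inc exec_Dec])
        moreover have "?\<tau>(b + 2 := ?\<tau> (b + 2) + 1, b + 1 := (?\<tau>(b + 2 := ?\<tau> (b + 2) + 1)) (b + 1) - 1) = fst (?S (Suc i))"
          using i z by (auto simp: fun_eq_iff of_nat_diff)
        ultimately show ?thesis by (simp add: numeral_3_eq_3)
      qed
      have "exec (W s) ?body (?S i) (?S (Suc i)) (v s)"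
        unfolding v_def by (rule exec_Seq[OF h1 exec_Seq[OF h2 exec_Seq[OF h3 h4]]])
      then show "tst_val (W s) (fst (?S i)) (NonZero (b + 1)) \<and> exec (W s) ?body (?S i) (?S (Suc i)) (v s)"
        using i by simp
    qed simp
    have 4: "exec (W s) (clear (b + 2)) (?S (n s)) (\<sigma>(b := int (?R s (n s))), w) (Suc (n s * 4))"
    proof -
      have "(fst (?S (n s)))(b + 2 := 0) = \<sigma>(b := int (?R s (n s)))" using z by (auto simp: fun_eq_iff)
      then show ?thesis using exec_clear[of "fst (?S (n s))" "b + 2" "n s" "W s" w] by simp
    qed
    show ?thesis unfolding t_def by (rule exec_Seq[OF 1 exec_Seq[OF 2 exec_Seq[OF 3 4]]])
  qed
  have "pbd W \<Gamma> t" unfolding t_def v_def u_def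
    by (intro pbd_intros cg(2) cn(2) pf_pbd[OF n] B(1))
  moreover have "cbnd (Kg + Kn + Kh + b + 3) ?c"
    using cbnd_mono[OF cg(1)] cbnd_mono[OF cn(1)] cbnd_mono[OF ch(1)] \<rho>(2) by (simp add: clear_def move_to_def)
  ultimately show "\<exists>c K t. cbnd K c \<and> pbd W \<Gamma> t \<and>
      (\<forall>s \<sigma> w. env_at \<rho> b (\<Gamma> s) \<sigma> \<longrightarrow> exec (W s) c (\<sigma>, w) (\<sigma>(b := int (rec_nat (g s) (h s) (n s))), w) (t s))"
    using ex by blast
qed

definition bit_at :: "bool list \<Rightarrow> nat \<Rightarrow> bool" where
  "bit_at x i \<longleftrightarrow> i < length x \<and> x ! i"

lemma input_tape_is_one: "fst (input_tape x) (int i) = 2 \<longleftrightarrow> bit_at x i"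
  by (simp add: input_tape_def bit_at_def bit_symbol_def)

lemma exec_inc2:
  "p \<noteq> q \<Longrightarrow> exec x (Seq (Inc p) (Inc q)) (\<sigma>, w) (\<lambda>r. \<sigma> r + (if r = p \<or> r = q then 1 else 0), w) 3"
proof -
  assume "p \<noteq> q"
  then have "(\<lambda>r. \<sigma> r + (if r = p then 1 else 0) + (if r = q then 1 else 0)) = (\<lambda>r. \<sigma> r + (if r = p \<or> r = q then 1 else 0))"
    by auto
  with exec_Seq[OF exec_incs(1)[of x p \<sigma> w] exec_incs(1)[of x q]] show ?thesis by (simp add: numeral_3_eq_3)
qed

definition back_to :: "nat \<Rightarrow> com" where
  "back_to r = While (NonZero r) (Seq (Dec r) (Dec 0))"

lemma exec_back_to:
  assumes "\<sigma> r = int n" "\<sigma> 0 = int n" "r \<noteq> 0"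
  shows "exec x (back_to r) (\<sigma>, w) (\<sigma>(r := 0, 0 := 0), w) (Suc (n * 4))"
proof -
  have "exec x (back_to r) (\<sigma>, w) ((\<lambda>p. \<sigma> p + int n * (if p = 0 then -1 else 0))(r := 0), w) (Suc (n * (1 + 3)))"
    unfolding back_to_def by (rule exec_loop_add) (use assms exec_incs in auto)
  moreover have "(\<lambda>p. \<sigma> p + int n * (if p = 0 then -1 else 0))(r := 0) = \<sigma>(r := 0, 0 := 0)"
    using assms by (auto simp: fun_eq_iff)
  ultimately show ?thesis by simp
qed

text \<open>The head of the input tape is moved like a register; a second counter remembers how far
  it has to go back.\<close>

lemma pf_bit:
  assumes "pf W \<Gamma> f"
  shows "pf W \<Gamma> (\<lambda>s. of_bool (bit_at (W s) (f s)))"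
proof (rule pfI)
  show "pbd W \<Gamma> (\<lambda>s. of_bool (bit_at (W s) (f s)))" by (rule pbd_mono[OF pbd_const[of _ _ 1]]) simp
  fix \<rho> b assume \<rho>: "set \<rho> \<subseteq> {1..<b}" "1 \<le> (b::nat)"
  then have \<rho>': "set \<rho> \<subseteq> {1..<b + 1}" "1 \<le> b + 1" by auto
  obtain c K t where c: "cbnd K c" "pbd W \<Gamma> t"
    "\<forall>s \<sigma> w. env_at \<rho> (b + 1) (\<Gamma> s) \<sigma> \<longrightarrow> exec (W s) c (\<sigma>, w) (\<sigma>(b + 1 := int (f s)), w) (t s)" by (rule pfE[OF assms \<rho>'])
  let ?c = "Seq c (Seq (While (NonZero (b + 1)) (Seq (Dec (b + 1)) (Seq (Inc 0) (Inc (b + 2)))))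
     (Seq (Cond IsOne (Inc b) Skip) (back_to (b + 2))))"
  define t' where "t' s = Suc (t s + Suc (Suc (f s * (3 + 3)) + Suc (Suc 1 + Suc (f s * 4))))" for s
  have "exec (W s) ?c (\<sigma>, w) (\<sigma>(b := int (of_bool (bit_at (W s) (f s)))), w) (t' s)"
    if e: "env_at \<rho> b (\<Gamma> s) \<sigma>" for s \<sigma> w
  proof -
    have z: "\<sigma> (b + 1) = 0" "\<sigma> (b + 2) = 0" "\<sigma> b = 0" "\<sigma> 0 = 0" using e by (auto simp: env_at_def)
    have 1: "exec (W s) c (\<sigma>, w) (\<sigma>(b + 1 := int (f s)), w) (t s)" by (rule c(3)[rule_format, OF env_at_mono[OF e]]) simp
    let ?\<tau> = "(\<lambda>q. (\<sigma>(b + 1 := int (f s))) q + int (f s) * (if q = 0 \<or> q = b + 2 then 1 else 0))(b + 1 := 0)"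
    have 2: "exec (W s) (While (NonZero (b + 1)) (Seq (Dec (b + 1)) (Seq (Inc 0) (Inc (b + 2))))) (\<sigma>(b + 1 := int (f s)), w)
      (?\<tau>, w) (Suc (f s * (3 + 3)))"
      by (rule exec_loop_add[of _ _ "\<lambda>q. if q = 0 \<or> q = b + 2 then 1 else 0"]) (use exec_inc2[of 0 "b + 2"] in auto)
    have \<tau>: "?\<tau> = \<sigma>(b + 2 := int (f s), 0 := int (f s))" using z \<rho>(2) by (auto simp: fun_eq_iff)
    let ?\<upsilon> = "\<sigma>(b + 2 := int (f s), 0 := int (f s), b := int (of_bool (bit_at (W s) (f s))))"
    have 3: "exec (W s) (Cond IsOne (Inc b) Skip) (?\<tau>, w) (?\<upsilon>, w) (Suc 1)"
    proof (rule exec_Cond)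
      have "(if tst_val (W s) (fst (?\<tau>, w)) IsOne then Inc b else Skip) = (if bit_at (W s) (f s) then Inc b else Skip)"
        unfolding fst_conv \<tau> by (simp add: input_tape_is_one)
      moreover have "exec (W s) (if bit_at (W s) (f s) then Inc b else Skip) (?\<tau>, w) (?\<upsilon>, w) 1"
      proof (cases "bit_at (W s) (f s)")
        case True
        have "?\<upsilon> = ?\<tau>(b := ?\<tau> b + 1)" unfolding \<tau> using z True \<rho>(2) by (auto simp: fun_eq_iff)
        then show ?thesis using exec_Inc[of "W s" b ?\<tau> w] True by simp
      next
        case False
        have "?\<upsilon> = ?\<tau>" unfolding \<tau> using z False \<rho>(2) by (auto simp: fun_eq_iff)
        then show ?thesis using exec_Skip[of "W s"] False by simp
      qed
      ultimately show "exec (W s) (if tst_val (W s) (fst (?\<tau>, w)) IsOne then Inc b else Skip) (?\<tau>, w) (?\<upsilon>, w) 1" by simp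
    qed
    have "exec (W s) (back_to (b + 2)) (?\<upsilon>, w) (?\<upsilon>(b + 2 := 0, 0 := 0), w) (Suc (f s * 4))"
      by (rule exec_back_to) (use \<rho>(2) in auto)
    moreover have "?\<upsilon>(b + 2 := 0, 0 := 0) = \<sigma>(b := int (of_bool (bit_at (W s) (f s))))"
      using z \<rho>(2) by (auto simp: fun_eq_iff)
    ultimately have 4: "exec (W s) (back_to (b + 2)) (?\<upsilon>, w) (\<sigma>(b := int (of_bool (bit_at (W s) (f s)))), w) (Suc (f s * 4))"
      by simp
    show ?thesis unfolding t'_def by (rule exec_Seq[OF 1 exec_Seq[OF 2 exec_Seq[OF 3 4]]])
  qed
  moreover have "pbd W \<Gamma> t'" unfolding t'_def by (intro pbd_intros c(2) pf_pbd[OF assms])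
  moreover have "cbnd (K + b + 2) ?c" using cbnd_mono[OF c(1)] by (simp add: back_to_def)
  ultimately show "\<exists>c K t. cbnd K c \<and> pbd W \<Gamma> t \<and>
      (\<forall>s \<sigma> w. env_at \<rho> b (\<Gamma> s) \<sigma> \<longrightarrow> exec (W s) c (\<sigma>, w) (\<sigma>(b := int (of_bool (bit_at (W s) (f s)))), w) (t s))"
    by blast
qed

lemma pf_length: "pf W \<Gamma> (\<lambda>s. length (W s))"
proof (rule pfI)
  have le: "length (W s) \<le> ctx_size W \<Gamma> s" for s by (simp add: ctx_size_def)
  show pb: "pbd W \<Gamma> (\<lambda>s. length (W s))" by (rule pbd_mono[OF pbd_size le])
  fix \<rho> b assume \<rho>: "set \<rho> \<subseteq> {1..<b}" "1 \<le> (b::nat)"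
  let ?c = "Seq (While NotEnd (Seq (Inc 0) (Seq (Inc b) (Inc (b + 1))))) (back_to (b + 1))"
  have "exec (W s) ?c (\<sigma>, w) (\<sigma>(b := int (length (W s))), w) (Suc (Suc (length (W s) * 6) + Suc (length (W s) * 4)))"
    if e: "env_at \<rho> b (\<Gamma> s) \<sigma>" for s \<sigma> w
  proof -
    have z: "\<sigma> (b + 1) = 0" "\<sigma> b = 0" "\<sigma> 0 = 0" using e by (auto simp: env_at_def)
    let ?n = "length (W s)"
    let ?S = "\<lambda>i. (\<sigma>(0 := int i, b := int i, b + 1 := int i), w)"
    have "exec (W s) (While NotEnd (Seq (Inc 0) (Seq (Inc b) (Inc (b + 1))))) (?S 0) (?S ?n) (Suc (?n * Suc (Suc (1 + 3))))"
    proof (rule exec_While)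
      fix i assume i: "i < ?n"
      let ?\<tau> = "\<sigma>(0 := int i, b := int i, b + 1 := int i)"
      have "exec (W s) (Seq (Inc 0) (Seq (Inc b) (Inc (b + 1)))) (?\<tau>, w)
        (\<lambda>r. (?\<tau>(0 := ?\<tau> 0 + 1)) r + (if r = b \<or> r = b + 1 then 1 else 0), w) (Suc (1 + 3))"
        by (rule exec_Seq[OF exec_Inc exec_inc2]) simp
      moreover have "(\<lambda>r. (?\<tau>(0 := ?\<tau> 0 + 1)) r + (if r = b \<or> r = b + 1 then 1 else 0)) = fst (?S (Suc i))"
        using \<rho>(2) z by (auto simp: fun_eq_iff)
      ultimately show "tst_val (W s) (fst (?S i)) NotEnd \<and> exec (W s) (Seq (Inc 0) (Seq (Inc b) (Inc (b + 1)))) (?S i) (?S (Suc i)) (Suc (1 + 3))"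
        using i \<rho>(2) by (simp add: input_tape_def bit_symbol_def)
    qed (use \<rho>(2) in \<open>simp add: input_tape_def\<close>)
    moreover have "?S 0 = (\<sigma>, w)" using z by (auto simp: fun_eq_iff)
    ultimately have 1: "exec (W s) (While NotEnd (Seq (Inc 0) (Seq (Inc b) (Inc (b + 1))))) (\<sigma>, w) (?S ?n) (Suc (?n * 6))"
      by (simp add: numeral_eq_Suc)
    have "exec (W s) (back_to (b + 1)) (?S ?n) ((fst (?S ?n))(b + 1 := 0, 0 := 0), w) (Suc (?n * 4))"
      using exec_back_to[of "fst (?S ?n)" "b + 1" ?n "W s" w] \<rho>(2) by simp
    moreover have "(fst (?S ?n))(b + 1 := 0, 0 := 0) = \<sigma>(b := int ?n)" using z \<rho>(2) by (auto simp: fun_eq_iff)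
    ultimately have 2: "exec (W s) (back_to (b + 1)) (?S ?n) (\<sigma>(b := int ?n), w) (Suc (?n * 4))" by simp
    show ?thesis by (rule exec_Seq[OF 1 2])
  qed
  moreover have "pbd W \<Gamma> (\<lambda>s. Suc (Suc (length (W s) * 6) + Suc (length (W s) * 4)))" by (intro pbd_intros pb)
  moreover have "cbnd (b + 1) ?c" by (simp add: back_to_def)
  ultimately show "\<exists>c K t. cbnd K c \<and> pbd W \<Gamma> t \<and>
      (\<forall>s \<sigma> w. env_at \<rho> b (\<Gamma> s) \<sigma> \<longrightarrow> exec (W s) c (\<sigma>, w) (\<sigma>(b := int (length (W s))), w) (t s))"
    by blast
qed

section \<open>Closure properties of polynomial-time functions\<close>

lemma pf_v0: "pf W (\<lambda>p. snd p # \<Gamma> p) (\<lambda>p. snd p)"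
  by (rule pf_var[of 0]) simp

lemma pf_v1: "pf W (\<lambda>p. A p # snd (fst p) # \<Gamma> p) (\<lambda>p. snd (fst p))"
  by (rule pf_var[of 1]) simp

lemma pf_v2: "pf W (\<lambda>p. A p # B p # snd (fst (fst p)) # \<Gamma> p) (\<lambda>p. snd (fst (fst p)))"
  by (rule pf_var[of 2]) simp

lemmas pf_vars = pf_v0 pf_v1 pf_v2

lemma pf_const: "pf W \<Gamma> (\<lambda>s. c)"
  by (induction c) (auto intro: pf_zero pf_Suc)

lemma ctx_size_push: "ctx_size W \<Gamma> (fst p) \<le> ctx_size (\<lambda>p. W (fst p)) (\<lambda>p. snd p # \<Gamma> (fst p)) p"
  by (simp add: ctx_size_def)

text \<open>Bound variables are pushed in front of the context, innermost first, and the state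
  becomes a nested pair. A function that does not mention the new variable uses its old program on
  the remaining registers.\<close>

lemma pf_weaken:
  assumes "pf W \<Gamma> f"
  shows "pf (\<lambda>p. W (fst p)) (\<lambda>p. snd p # \<Gamma> (fst p)) (\<lambda>p. f (fst p))"
proof (rule pfI)
  let ?W = "\<lambda>p. W (fst p)" and ?\<Gamma> = "\<lambda>p. snd p # \<Gamma> (fst p)"
  have pb: "pbd ?W ?\<Gamma> (\<lambda>p. t (fst p))" if "pbd W \<Gamma> t" for t
    using pbd_subst[OF that pbd_size ctx_size_push] .
  show "pbd ?W ?\<Gamma> (\<lambda>p. f (fst p))" using pb[OF pf_pbd[OF assms]] .
  fix \<rho> b assume \<rho>: "set \<rho> \<subseteq> {1..<b}" "1 \<le> (b::nat)"
  show "\<exists>c K t. cbnd K c \<and> pbd ?W ?\<Gamma> t \<and>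
      (\<forall>s \<sigma> w. env_at \<rho> b (?\<Gamma> s) \<sigma> \<longrightarrow> exec (?W s) c (\<sigma>, w) (\<sigma>(b := int (f (fst s))), w) (t s))"
  proof (cases \<rho>)
    case Nil
    then show ?thesis by (intro exI[of _ Skip] exI[of _ "0::nat"] exI[of _ "\<lambda>_. 0::nat"]) (simp add: pbd_const env_at_def)
  next
    case (Cons r \<rho>')
    then have \<rho>': "set \<rho>' \<subseteq> {1..<b}" using \<rho>(1) by simp
    obtain c K t where c: "cbnd K c" "pbd W \<Gamma> t"
      "\<forall>s \<sigma> w. env_at \<rho>' b (\<Gamma> s) \<sigma> \<longrightarrow> exec (W s) c (\<sigma>, w) (\<sigma>(b := int (f s)), w) (t s)"
      by (rule pfE[OF assms \<rho>' \<rho>(2)])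
    show ?thesis
      by (rule exI[of _ c], rule exI[of _ K], rule exI[of _ "\<lambda>p. t (fst p)"])
        (use c pb[OF c(2)] Cons in \<open>simp add: env_at_def\<close>)
  qed
qed

lemma pf_weaken2:
  "pf W \<Gamma> f \<Longrightarrow> pf (\<lambda>p. W (fst (fst p))) (\<lambda>p. snd p # snd (fst p) # \<Gamma> (fst (fst p))) (\<lambda>p. f (fst (fst p)))"
  using pf_weaken[OF pf_weaken] .

lemma pf_add:
  assumes "pf W \<Gamma> f" "pf W \<Gamma> g"
  shows "pf W \<Gamma> (\<lambda>s. f s + g s)"
proof -
  have r: "rec_nat (f s) (\<lambda>i r. Suc r) n = f s + n" for s n by (induction n) auto
  have "pf W \<Gamma> (\<lambda>s. rec_nat (f s) (\<lambda>i r. Suc r) (g s))"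
    by (rule pf_rec[OF assms(2,1), where B = "\<lambda>s. f s + g s"])
      (auto simp: r intro!: pf_Suc pf_vars pbd_add[OF pf_pbd[OF assms(1)] pf_pbd[OF assms(2)]])
  then show ?thesis by (simp add: r)
qed

lemma pf_mult:
  assumes "pf W \<Gamma> f" "pf W \<Gamma> g"
  shows "pf W \<Gamma> (\<lambda>s. f s * g s)"
proof -
  have r: "rec_nat 0 (\<lambda>i r. r + f s) n = f s * n" for s n by (induction n) auto
  have "pf W \<Gamma> (\<lambda>s. rec_nat 0 (\<lambda>i r. r + f s) (g s))"
    by (rule pf_rec[OF assms(2) pf_zero, where B = "\<lambda>s. f s * g s"])
      (auto simp: r intro!: pf_add pf_vars pbd_mult[OF pf_pbd[OF assms(1)] pf_pbd[OF assms(2)]] pf_weaken2[OF assms(1)])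
  then show ?thesis by (simp add: r)
qed

lemma pf_pred:
  assumes "pf W \<Gamma> f"
  shows "pf W \<Gamma> (\<lambda>s. f s - 1)"
proof -
  have r: "rec_nat 0 (\<lambda>i r. i) n = n - 1" for n by (cases n) auto
  have "pf W \<Gamma> (\<lambda>s. rec_nat 0 (\<lambda>i r. i) (f s))"
    by (rule pf_rec[OF assms pf_zero, where B = f]) (auto simp: r intro!: pf_vars pf_pbd assms)
  then show ?thesis by (simp add: r)
qed

lemma pf_diff:
  assumes "pf W \<Gamma> f" "pf W \<Gamma> g"
  shows "pf W \<Gamma> (\<lambda>s. f s - g s)"
proof -
  have r: "rec_nat (f s) (\<lambda>i r. r - 1) n = f s - n" for s n by (induction n) auto
  have "pf W \<Gamma> (\<lambda>s. rec_nat (f s) (\<lambda>i r. r - 1) (g s))"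
    by (rule pf_rec[OF assms(2,1), where B = f])
      (auto simp only: r diff_le_self intro!: pf_pred pf_vars pf_pbd assms)
  then show ?thesis by (simp only: r)
qed

lemma pf_if0:
  assumes "pf W \<Gamma> n" "pf W \<Gamma> f" "pf W \<Gamma> g"
  shows "pf W \<Gamma> (\<lambda>s. if n s = 0 then f s else g s)"
proof -
  have r: "rec_nat (f s) (\<lambda>i r. g s) n = (if n = 0 then f s else g s)" for s n by (cases n) auto
  have "pf W \<Gamma> (\<lambda>s. rec_nat (f s) (\<lambda>i r. g s) (n s))"
    by (rule pf_rec[OF assms(1,2), where B = "\<lambda>s. f s + g s"])
      (auto simp: r intro!: pbd_add[OF pf_pbd[OF assms(2)] pf_pbd[OF assms(3)]] pf_weaken2[OF assms(3)])
  then show ?thesis by (simp add: r)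
qed

abbreviation pp :: "('a \<Rightarrow> bool list) \<Rightarrow> ('a \<Rightarrow> nat list) \<Rightarrow> ('a \<Rightarrow> bool) \<Rightarrow> bool" where
  "pp W \<Gamma> P \<equiv> pf W \<Gamma> (\<lambda>s. of_bool (P s))"

lemma pf_if:
  assumes "pp W \<Gamma> P" "pf W \<Gamma> f" "pf W \<Gamma> g"
  shows "pf W \<Gamma> (\<lambda>s. if P s then f s else g s)"
  by (rule pf_cong[OF pf_if0[OF assms(1,3,2)]]) simp

lemma pp_eq0: "pf W \<Gamma> f \<Longrightarrow> pp W \<Gamma> (\<lambda>s. f s = 0)"
  by (rule pf_cong[OF pf_if0[OF _ pf_const[of _ _ 1] pf_zero]]) auto

lemma pp_not: "pp W \<Gamma> P \<Longrightarrow> pp W \<Gamma> (\<lambda>s. \<not> P s)"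
  by (rule pf_cong[OF pp_eq0]) auto

lemma pp_and: "pp W \<Gamma> P \<Longrightarrow> pp W \<Gamma> Q \<Longrightarrow> pp W \<Gamma> (\<lambda>s. P s \<and> Q s)"
  by (rule pf_cong[OF pf_mult[of W \<Gamma> "\<lambda>s. of_bool (P s)" "\<lambda>s. of_bool (Q s)"]]) auto

lemma pp_or: "pp W \<Gamma> P \<Longrightarrow> pp W \<Gamma> Q \<Longrightarrow> pp W \<Gamma> (\<lambda>s. P s \<or> Q s)"
  by (rule pf_cong[OF pp_not[OF pp_and[OF pp_not pp_not]]]) auto

lemma pp_imp: "pp W \<Gamma> P \<Longrightarrow> pp W \<Gamma> Q \<Longrightarrow> pp W \<Gamma> (\<lambda>s. P s \<longrightarrow> Q s)"
  by (rule pf_cong[OF pp_or[where P = "\<lambda>s. \<not> P s" and Q = Q, OF pp_not]]) auto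

lemma pp_le: "pf W \<Gamma> f \<Longrightarrow> pf W \<Gamma> g \<Longrightarrow> pp W \<Gamma> (\<lambda>s. f s \<le> g s)"
  by (rule pf_cong[OF pp_eq0[OF pf_diff]]) auto

lemma pp_less: "pf W \<Gamma> f \<Longrightarrow> pf W \<Gamma> g \<Longrightarrow> pp W \<Gamma> (\<lambda>s. f s < g s)"
  by (rule pf_cong[OF pp_not[OF pp_le[of W \<Gamma> g f]]]) auto

lemma pp_eq: "pf W \<Gamma> f \<Longrightarrow> pf W \<Gamma> g \<Longrightarrow> pp W \<Gamma> (\<lambda>s. f s = g s)"
  by (rule pf_cong[OF pp_and[OF pp_le pp_le, of W \<Gamma> f g g f]]) auto

lemma pp_iff: "pp W \<Gamma> P \<Longrightarrow> pp W \<Gamma> Q \<Longrightarrow> pp W \<Gamma> (\<lambda>s. P s \<longleftrightarrow> Q s)"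
  by (rule pf_cong[OF pp_eq[of W \<Gamma> "\<lambda>s. of_bool (P s)" "\<lambda>s. of_bool (Q s)"]]) auto

lemma pp_const: "pp W \<Gamma> (\<lambda>s. b)"
  by (rule pf_const)

text \<open>The bound that the recursion asks for comes from the polynomial bound on the summands.
  Bounded quantifiers, division and the length of binary numbers are then expressed as sums of
  values 0 and 1.\<close>

lemma pf_sum:
  assumes n: "pf W \<Gamma> n"
    and f: "pf (\<lambda>p. W (fst p)) (\<lambda>p. snd p # \<Gamma> (fst p)) (\<lambda>p. f (fst p) (snd p))"
  shows "pf W \<Gamma> (\<lambda>s. \<Sum>i<n s. f s i)"
proof -
  let ?W = "\<lambda>p. W (fst p)" and ?\<Gamma> = "\<lambda>p. snd p # \<Gamma> (fst p)"
  from pf_pbd[OF f] obtain d where d: "\<forall>p. f (fst p) (snd p) \<le> (ctx_size ?W ?\<Gamma> p + 2) ^ d"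
    unfolding pbd_def by blast
  let ?B = "\<lambda>s. n s * (ctx_size W \<Gamma> s + n s + 2) ^ d"
  have B: "pbd W \<Gamma> ?B" by (intro pbd_intros pf_pbd[OF n])
  have r: "rec_nat 0 (\<lambda>i r. r + f s i) n = (\<Sum>i<n. f s i)" for s n by (induction n) auto
  have bnd: "(\<Sum>i<k. f s i) \<le> ?B s" if "k \<le> n s" for s k
  proof -
    have "f s i \<le> (ctx_size W \<Gamma> s + n s + 2) ^ d" if "i < k" for i
    proof -
      have "f s i \<le> (ctx_size ?W ?\<Gamma> (s, i) + 2) ^ d" using d[rule_format, of "(s, i)"] by simp
      also have "\<dots> \<le> (ctx_size W \<Gamma> s + n s + 2) ^ d"
        by (rule power_mono) (use that \<open>k \<le> n s\<close> in \<open>auto simp: ctx_size_def\<close>)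
      finally show ?thesis .
    qed
    then have "(\<Sum>i<k. f s i) \<le> (\<Sum>i<k. (ctx_size W \<Gamma> s + n s + 2) ^ d)" by (intro sum_mono) simp
    also have "\<dots> \<le> ?B s" using that by simp
    finally show ?thesis .
  qed
  have sel: "pf (\<lambda>p. W (fst (fst p))) (\<lambda>p. snd p # snd (fst p) # \<Gamma> (fst (fst p))) (\<lambda>p. f (fst (fst p)) (snd (fst p)))"
    by (rule pf_weaken[OF f])
  have "pf W \<Gamma> (\<lambda>s. rec_nat 0 (\<lambda>i r. r + f s i) (n s))"
    by (rule pf_rec[OF n pf_zero _ B]) (auto simp only: r intro!: bnd pf_add pf_vars sel)
  then show ?thesis by (simp only: r)
qed

lemma pp_all:
  assumes "pf W \<Gamma> n" "pp (\<lambda>p. W (fst p)) (\<lambda>p. snd p # \<Gamma> (fst p)) (\<lambda>p. P (fst p) (snd p))"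
  shows "pp W \<Gamma> (\<lambda>s. \<forall>i<n s. P s i)"
  by (rule pf_cong[OF pp_eq0[OF pf_sum[OF assms(1) pp_not[OF assms(2)]]]]) auto

lemma pp_ex:
  assumes "pf W \<Gamma> n" "pp (\<lambda>p. W (fst p)) (\<lambda>p. snd p # \<Gamma> (fst p)) (\<lambda>p. P (fst p) (snd p))"
  shows "pp W \<Gamma> (\<lambda>s. \<exists>i<n s. P s i)"
  by (rule pf_cong[OF pp_not[OF pp_all[OF assms(1) pp_not[OF assms(2)]]]]) auto

lemma div_conv_sum: "0 < g \<Longrightarrow> f div g = (\<Sum>i<f. of_bool (Suc i * g \<le> f))" for f g :: nat
proof -
  assume g: "0 < g"
  have "i < f \<and> Suc i * g \<le> f \<longleftrightarrow> i < f div g" for i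
  proof -
    have "Suc i * g \<le> f \<longleftrightarrow> Suc i \<le> f div g" using g by (simp only: less_eq_div_iff_mult_less_eq)
    moreover have "f div g \<le> f" by simp
    ultimately show ?thesis by linarith
  qed
  then have "{i. i < f \<and> Suc i * g \<le> f} = {..<f div g}" by blast
  then have "(\<Sum>i<f. of_bool (Suc i * g \<le> f)) = card {..<f div g}"
    by (simp add: sum.If_cases of_bool_def Int_def)
  then show ?thesis by simp
qed

lemma pf_div:
  assumes "pf W \<Gamma> f" "pf W \<Gamma> g"
  shows "pf W \<Gamma> (\<lambda>s. f s div g s)"
proof -
  have "pf W \<Gamma> (\<lambda>s. if g s = 0 then 0 else (\<Sum>i<f s. of_bool (Suc i * g s \<le> f s)))"
    by (intro pf_if0 pf_sum pf_zero assms pp_le pf_mult pf_Suc pf_vars pf_weaken[OF assms(1)] pf_weaken[OF assms(2)])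
  then show ?thesis by (rule pf_cong) (simp add: div_conv_sum)
qed

lemma pf_mod:
  assumes "pf W \<Gamma> f" "pf W \<Gamma> g"
  shows "pf W \<Gamma> (\<lambda>s. f s mod g s)"
  unfolding modulo_nat_def by (intro pf_diff pf_mult pf_div assms)

lemma pp_odd: "pf W \<Gamma> f \<Longrightarrow> pp W \<Gamma> (\<lambda>s. odd (f s))"
  by (rule pf_cong[OF pf_mod[OF _ pf_const[of _ _ 2]]]) (auto simp: odd_iff_mod_2_eq_one)

lemma pf_power: "pf W \<Gamma> f \<Longrightarrow> pf W \<Gamma> (\<lambda>s. f s ^ k)"
  by (induction k) (auto intro: pf_mult pf_const[of _ _ 1, simplified])

lemma pf_poly: "pf W \<Gamma> f \<Longrightarrow> pf W \<Gamma> (\<lambda>s. poly p (f s))"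
  by (induction p) (auto intro!: pf_add pf_mult pf_const pf_zero)

lemma pf_min: "pf W \<Gamma> f \<Longrightarrow> pf W \<Gamma> g \<Longrightarrow> pf W \<Gamma> (\<lambda>s. min (f s) (g s))"
  unfolding min_def by (intro pf_if pp_le)

text \<open>\<open>C\<close> and \<open>F\<close> are fixed, so the program may contain one branch
  for every case. This is how finite data about the verifier get into a program without being
  computed by it.\<close>

lemma pf_cases:
  assumes "pf W \<Gamma> f" "\<And>k. k < C \<Longrightarrow> pf W \<Gamma> (F k)"
  shows "pf W \<Gamma> (\<lambda>s. if f s < C then F (f s) s else 0)"
  using assms(2)
proof (induction C)
  case 0
  then show ?case by (simp add: pf_zero)
next
  case (Suc C)
  have "pf W \<Gamma> (\<lambda>s. if f s = C then F C s else if f s < C then F (f s) s else 0)"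
    by (rule pf_if[OF pp_eq[OF assms(1) pf_const] Suc.prems Suc.IH]) (use Suc.prems in auto)
  then show ?case by (rule pf_cong) auto
qed

lemma pf_sum_fixed: "(\<And>k. k < C \<Longrightarrow> pf W \<Gamma> (F k)) \<Longrightarrow> pf W \<Gamma> (\<lambda>s. \<Sum>k<C. F k s)" for C :: nat
  by (induction C) (auto intro: pf_zero pf_add)

lemma pf_iterate_div2:
  assumes "pf W \<Gamma> v" "pf W \<Gamma> i"
  shows "pf W \<Gamma> (\<lambda>s. v s div 2 ^ i s)"
proof -
  have r: "rec_nat (v s) (\<lambda>i r. r div 2) n = v s div 2 ^ n" for s n
    by (induction n) (auto simp: div_mult2_eq[symmetric] mult.commute)
  have "pf W \<Gamma> (\<lambda>s. rec_nat (v s) (\<lambda>i r. r div 2) (i s))"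
    by (rule pf_rec[OF assms(2,1), where B = v])
      (auto simp only: r intro!: pf_div pf_vars pf_const pf_pbd assms div_le_dividend)
  then show ?thesis by (simp only: r)
qed

lemma nat_bits_0 [simp]: "nat_bits 0 = []"
  by (simp add: nat_bits.simps)

lemma nat_bits_conv: "nat_bits v = map (\<lambda>i. odd (v div 2 ^ i)) [0..<length (nat_bits v)]"
proof (induction v rule: nat_bits.induct)
  case (1 n)
  show ?case
  proof (cases "n = 0")
    case False
    have "map (\<lambda>i. odd (n div 2 ^ i)) [0..<Suc (length (nat_bits (n div 2)))] =
      odd n # map (\<lambda>i. odd (n div 2 div 2 ^ i)) [0..<length (nat_bits (n div 2))]"
      by (simp add: map_upt_Suc div_mult2_eq del: upt_Suc)
    then show ?thesis using 1[OF False] False by (simp add: nat_bits.simps[of n] del: upt_Suc)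
  qed simp
qed

lemma length_nat_bits_less: "i < length (nat_bits v) \<longleftrightarrow> v div 2 ^ i \<noteq> 0"
proof (induction v arbitrary: i rule: nat_bits.induct)
  case (1 n)
  show ?case
  proof (cases "n = 0")
    case False
    then show ?thesis
      by (cases i) (simp_all add: nat_bits.simps[of n] 1[OF False] div_mult2_eq)
  qed simp
qed

lemma length_nat_bits: "length (nat_bits v) = (\<Sum>i<v. of_bool (v div 2 ^ i \<noteq> 0))"
proof -
  have "length (nat_bits v) \<le> v"
  proof (rule ccontr)
    assume "\<not> length (nat_bits v) \<le> v"
    then have "v div 2 ^ v \<noteq> 0" using length_nat_bits_less[of v v] by simp
    moreover have "v < 2 ^ v" by (rule less_exp)
    ultimately show False by simp
  qed
  then have "{i. i < v \<and> v div 2 ^ i \<noteq> 0} = {..<length (nat_bits v)}"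
    unfolding length_nat_bits_less[symmetric] by auto
  moreover have "(\<Sum>i<v. of_bool (v div 2 ^ i \<noteq> 0)) = card {i. i < v \<and> v div 2 ^ i \<noteq> 0}"
    by (simp add: sum.If_cases of_bool_def Int_def)
  ultimately show ?thesis by simp
qed

lemma pf_length_nat_bits:
  assumes "pf W \<Gamma> v"
  shows "pf W \<Gamma> (\<lambda>s. length (nat_bits (v s)))"
  unfolding length_nat_bits
  by (intro pf_sum pp_not pp_eq0 pf_iterate_div2 pf_vars assms pf_weaken[OF assms])

section \<open>Polynomial-time output\<close>

lemma emI:
  assumes "\<And>\<rho> b. set \<rho> \<subseteq> {1..<b} \<Longrightarrow> 1 \<le> b \<Longrightarrow> \<exists>c K t. cbnd K c \<and> pbd W \<Gamma> t \<and>
      (\<forall>s \<sigma> w. env_at \<rho> b (\<Gamma> s) \<sigma> \<longrightarrow> exec (W s) c (\<sigma>, w) (\<sigma>, w @ f s) (t s))"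
  shows "em W \<Gamma> f"
  using assms unfolding em_def by blast

lemma em_append:
  assumes "em W \<Gamma> f" "em W \<Gamma> g"
  shows "em W \<Gamma> (\<lambda>s. f s @ g s)"
proof (rule emI)
  fix \<rho> b assume \<rho>: "set \<rho> \<subseteq> {1..<b}" "1 \<le> (b::nat)"
  obtain c K t where c: "cbnd K c" "pbd W \<Gamma> t"
    "\<forall>s \<sigma> w. env_at \<rho> b (\<Gamma> s) \<sigma> \<longrightarrow> exec (W s) c (\<sigma>, w) (\<sigma>, w @ f s) (t s)" by (rule emE[OF assms(1) \<rho>])
  obtain d L u where d: "cbnd L d" "pbd W \<Gamma> u"
    "\<forall>s \<sigma> w. env_at \<rho> b (\<Gamma> s) \<sigma> \<longrightarrow> exec (W s) d (\<sigma>, w) (\<sigma>, w @ g s) (u s)" by (rule emE[OF assms(2) \<rho>])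
  have "exec (W s) (Seq c d) (\<sigma>, w) (\<sigma>, w @ f s @ g s) (Suc (t s + u s))" if "env_at \<rho> b (\<Gamma> s) \<sigma>" for s \<sigma> w
    using exec_Seq[OF c(3)[rule_format, OF that] d(3)[rule_format, OF that]] by simp
  moreover have "cbnd (K + L) (Seq c d)" using cbnd_mono[OF c(1)] cbnd_mono[OF d(1)] by simp
  moreover have "pbd W \<Gamma> (\<lambda>s. Suc (t s + u s))" by (intro pbd_intros c(2) d(2))
  ultimately show "\<exists>c K t. cbnd K c \<and> pbd W \<Gamma> t \<and>
      (\<forall>s \<sigma> w. env_at \<rho> b (\<Gamma> s) \<sigma> \<longrightarrow> exec (W s) c (\<sigma>, w) (\<sigma>, w @ f s @ g s) (t s))" by blast
qed

lemma em_Nil: "em W \<Gamma> (\<lambda>s. [])"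
proof (rule emI)
  fix \<rho> b
  show "\<exists>c K t. cbnd K c \<and> pbd W \<Gamma> t \<and>
      (\<forall>s \<sigma> w. env_at \<rho> b (\<Gamma> s) \<sigma> \<longrightarrow> exec (W s) c (\<sigma>, w) (\<sigma>, w @ []) (t s))"
    by (intro exI[of _ Skip] exI[of _ 0] exI[of _ "\<lambda>_. 1"]) (simp add: pbd_const exec_Skip[unfolded One_nat_def])
qed

lemma em_one: "em W \<Gamma> (\<lambda>s. [b])"
proof (rule emI)
  fix \<rho> r
  show "\<exists>c K t. cbnd K c \<and> pbd W \<Gamma> t \<and>
      (\<forall>s \<sigma> w. env_at \<rho> r (\<Gamma> s) \<sigma> \<longrightarrow> exec (W s) c (\<sigma>, w) (\<sigma>, w @ [b]) (t s))"
    by (intro exI[of _ "Emit b"] exI[of _ 0] exI[of _ "\<lambda>_. 1"]) (use exec_Emit[unfolded One_nat_def] in \<open>simp add: pbd_const\<close>)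
qed

lemma em_const: "em W \<Gamma> (\<lambda>s. u)"
proof (induction u)
  case (Cons b u)
  from em_append[OF em_one[of W \<Gamma> b] Cons] show ?case by simp
qed (rule em_Nil)

lemma em_if:
  assumes P: "pp W \<Gamma> P" and f: "em W \<Gamma> f" and g: "em W \<Gamma> g"
  shows "em W \<Gamma> (\<lambda>s. if P s then f s else g s)"
proof (rule emI)
  fix \<rho> b assume \<rho>: "set \<rho> \<subseteq> {1..<b}" "1 \<le> (b::nat)"
  then have \<rho>': "set \<rho> \<subseteq> {1..<b + 1}" "1 \<le> b + 1" by auto
  obtain c K t where c: "cbnd K c" "pbd W \<Gamma> t"
    "\<forall>s \<sigma> w. env_at \<rho> b (\<Gamma> s) \<sigma> \<longrightarrow> exec (W s) c (\<sigma>, w) (\<sigma>(b := int (of_bool (P s))), w) (t s)"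
    by (rule pfE[OF P \<rho>])
  obtain d L u where d: "cbnd L d" "pbd W \<Gamma> u"
    "\<forall>s \<sigma> w. env_at \<rho> b (\<Gamma> s) \<sigma> \<longrightarrow> exec (W s) d (\<sigma>, w) (\<sigma>, w @ f s) (u s)" by (rule emE[OF f \<rho>])
  obtain e M v where e: "cbnd M e" "pbd W \<Gamma> v"
    "\<forall>s \<sigma> w. env_at \<rho> b (\<Gamma> s) \<sigma> \<longrightarrow> exec (W s) e (\<sigma>, w) (\<sigma>, w @ g s) (v s)" by (rule emE[OF g \<rho>])
  let ?c = "Seq c (Cond (NonZero b) (Seq (Dec b) d) e)"
  have "exec (W s) ?c (\<sigma>, w) (\<sigma>, w @ (if P s then f s else g s)) (Suc (t s + Suc (Suc (1 + (u s + v s)))))"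
    if en: "env_at \<rho> b (\<Gamma> s) \<sigma>" for s \<sigma> w
  proof (rule exec_Seq[OF c(3)[rule_format, OF en] exec_Cond])
    have z: "\<sigma> b = 0" using en by (simp add: env_at_def)
    show "exec (W s) (if tst_val (W s) (fst (\<sigma>(b := int (of_bool (P s))), w)) (NonZero b) then Seq (Dec b) d else e)
       (\<sigma>(b := int (of_bool (P s))), w) (\<sigma>, w @ (if P s then f s else g s)) (Suc (1 + (u s + v s)))"
    proof (cases "P s")
      case True
      have "(\<sigma>(b := 1))(b := (\<sigma>(b := 1)) b - 1) = \<sigma>" using z by auto
      then have "exec (W s) (Seq (Dec b) d) (\<sigma>(b := 1), w) (\<sigma>, w @ f s) (Suc (1 + u s))"
        using exec_Seq[OF exec_Dec[of "W s" b "\<sigma>(b := 1)" w]] d(3)[rule_format, OF en] by metis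
      from exec_mono[OF this] True show ?thesis by simp
    next
      case False
      have "\<sigma>(b := 0) = \<sigma>" using z by auto
      with False z exec_mono[OF e(3)[rule_format, OF en]] show ?thesis by simp
    qed
  qed
  moreover have "cbnd (K + L + M + b) ?c" using cbnd_mono[OF c(1)] cbnd_mono[OF d(1)] cbnd_mono[OF e(1)] \<rho>(2) by simp
  moreover have "pbd W \<Gamma> (\<lambda>s. Suc (t s + Suc (Suc (1 + (u s + v s)))))" by (intro pbd_intros c(2) d(2) e(2))
  ultimately show "\<exists>c K t. cbnd K c \<and> pbd W \<Gamma> t \<and>
      (\<forall>s \<sigma> w. env_at \<rho> b (\<Gamma> s) \<sigma> \<longrightarrow> exec (W s) c (\<sigma>, w) (\<sigma>, w @ (if P s then f s else g s)) (t s))" by blast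
qed

lemma em_concat:
  assumes n: "pf W \<Gamma> n" and f: "em (\<lambda>p. W (fst p)) (\<lambda>p. snd p # \<Gamma> (fst p)) (\<lambda>p. f (fst p) (snd p))"
  shows "em W \<Gamma> (\<lambda>s. concat (map (f s) [0..<n s]))"
proof (rule emI)
  fix \<rho> b assume \<rho>: "set \<rho> \<subseteq> {1..<b}" "1 \<le> (b::nat)"
  have \<rho>2: "set ((b + 1) # \<rho>) \<subseteq> {1..<b + 2}" "1 \<le> b + 2" using \<rho> by auto
  obtain c K t where c: "cbnd K c" "pbd W \<Gamma> t"
    "\<forall>s \<sigma> w. env_at \<rho> b (\<Gamma> s) \<sigma> \<longrightarrow> exec (W s) c (\<sigma>, w) (\<sigma>(b := int (n s)), w) (t s)"
    by (rule pfE[OF n \<rho>])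
  obtain d L u where d: "cbnd L d" "pbd (\<lambda>p. W (fst p)) (\<lambda>p. snd p # \<Gamma> (fst p)) u"
    "\<forall>p \<sigma> w. env_at ((b + 1) # \<rho>) (b + 2) (snd p # \<Gamma> (fst p)) \<sigma> \<longrightarrow> exec (W (fst p)) d (\<sigma>, w) (\<sigma>, w @ f (fst p) (snd p)) (u p)"
    by (rule emE[OF f \<rho>2])
  from d(2) obtain e where e: "\<forall>p. u p \<le> (ctx_size (\<lambda>p. W (fst p)) (\<lambda>p. snd p # \<Gamma> (fst p)) p + 2) ^ e"
    unfolding pbd_def by blast
  define v where "v s = (ctx_size W \<Gamma> s + n s + 2) ^ e" for s
  have uv: "u (s, i) \<le> v s" if "i < n s" for s i
    by (rule order_trans[OF e[rule_format]]) (use that in \<open>auto simp: v_def ctx_size_def intro!: power_mono\<close>)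
  let ?body = "Seq d (Seq (Inc (b + 1)) (Dec b))"
  let ?c = "Seq c (Seq (While (NonZero b) ?body) (clear (b + 1)))"
  define t' where "t' s = Suc (t s + Suc (Suc (n s * Suc (Suc (v s + 3))) + Suc (n s * 4)))" for s
  have "exec (W s) ?c (\<sigma>, w) (\<sigma>, w @ concat (map (f s) [0..<n s])) (t' s)" if en: "env_at \<rho> b (\<Gamma> s) \<sigma>" for s \<sigma> w
  proof -
    have z: "\<sigma> b = 0" "\<sigma> (b + 1) = 0" using en by (auto simp: env_at_def)
    let ?\<tau> = "\<lambda>i. \<sigma>(b := int (n s - i), b + 1 := int i)" and ?w = "\<lambda>i. w @ concat (map (f s) [0..<i])"
    let ?S = "\<lambda>i. (?\<tau> i, ?w i)"
    have "?S 0 = (\<sigma>(b := int (n s)), w)" using z by (auto simp: fun_eq_iff)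
    then have 1: "exec (W s) c (\<sigma>, w) (?S 0) (t s)" using c(3)[rule_format, OF en, of w] by (simp only:)
    have 2: "exec (W s) (While (NonZero b) ?body) (?S 0) (?S (n s)) (Suc (n s * Suc (Suc (v s + 3))))"
    proof (rule exec_While)
      fix i assume i: "i < n s"
      have "env_at ((b + 1) # \<rho>) (b + 2) (i # \<Gamma> s) (?\<tau> i)"
        by (intro env_at_Cons env_at_upd[of \<rho> "b + 1"] env_at_upd[of \<rho> b] en) (use \<rho> in auto)
      then have "exec (W s) d (?S i) (?\<tau> i, ?w i @ f s i) (u (s, i))" using d(3)[rule_format, of "(s, i)" "?\<tau> i" "?w i"] by simp
      then have h1: "exec (W s) d (?S i) (?\<tau> i, ?w (Suc i)) (v s)" using exec_mono[OF _ uv[OF i]] by simp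
      have "exec (W s) (Seq (Inc (b + 1)) (Dec b)) (?\<tau> i, ?w (Suc i))
        ((?\<tau> i)(b + 1 := ?\<tau> i (b + 1) + 1, b := ((?\<tau> i)(b + 1 := ?\<tau> i (b + 1) + 1)) b - 1), ?w (Suc i)) (Suc (1 + 1))"
        by (rule exec_Seq[OF exec_Inc exec_Dec])
      moreover have "(?\<tau> i)(b + 1 := ?\<tau> i (b + 1) + 1, b := ((?\<tau> i)(b + 1 := ?\<tau> i (b + 1) + 1)) b - 1) = ?\<tau> (Suc i)"
        using i by (auto simp: fun_eq_iff of_nat_diff)
      ultimately have h2: "exec (W s) (Seq (Inc (b + 1)) (Dec b)) (?\<tau> i, ?w (Suc i)) (?S (Suc i)) 3"
        by (simp add: numeral_3_eq_3)
      show "tst_val (W s) (fst (?S i)) (NonZero b) \<and> exec (W s) ?body (?S i) (?S (Suc i)) (Suc (v s + 3))"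
        using exec_Seq[OF h1 h2] i by simp
    qed simp
    have "(?\<tau> (n s))(b + 1 := 0) = \<sigma>" using z by (auto simp: fun_eq_iff)
    with exec_clear[of "?\<tau> (n s)" "b + 1" "n s" "W s" "?w (n s)"]
    have 3: "exec (W s) (clear (b + 1)) (?S (n s)) (\<sigma>, ?w (n s)) (Suc (n s * 4))" by simp
    show ?thesis unfolding t'_def by (rule exec_Seq[OF 1 exec_Seq[OF 2 3]])
  qed
  moreover have "cbnd (K + L + b + 1) ?c" using cbnd_mono[OF c(1)] cbnd_mono[OF d(1)] \<rho>(2) by (simp add: clear_def)
  moreover have "pbd W \<Gamma> t'" unfolding t'_def v_def by (intro pbd_intros c(2) pf_pbd[OF n])
  ultimately show "\<exists>c K t. cbnd K c \<and> pbd W \<Gamma> t \<and>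
      (\<forall>s \<sigma> w. env_at \<rho> b (\<Gamma> s) \<sigma> \<longrightarrow> exec (W s) c (\<sigma>, w) (\<sigma>, w @ concat (map (f s) [0..<n s])) (t s))" by blast
qed

lemma em_bool: "pp W \<Gamma> P \<Longrightarrow> em W \<Gamma> (\<lambda>s. [P s])"
  by (rule em_cong[OF em_if[OF _ em_const[of _ _ "[True]"] em_const[of _ _ "[False]"]]]) auto

lemma em_nat:
  assumes "pf W \<Gamma> v"
  shows "em W \<Gamma> (\<lambda>s. enc_word (nat_bits (v s)))"
proof -
  have "em W \<Gamma> (\<lambda>s. concat (map (\<lambda>i. [True] @ [odd (v s div 2 ^ i)]) [0..<length (nat_bits (v s))]) @ [False])"
    by (intro em_append em_concat em_const em_bool pp_odd pf_iterate_div2 pf_vars pf_length_nat_bits assms pf_weaken[OF assms])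
  moreover have "concat (map (\<lambda>i. [True] @ [odd (n div 2 ^ i)]) [0..<length (nat_bits n)]) @ [False] = enc_word (nat_bits n)" for n
    by (subst (2) nat_bits_conv) (simp add: enc_word_def comp_def)
  ultimately show ?thesis by simp
qed

theorem em_tm:
  assumes "em (\<lambda>x. x) (\<lambda>x. []) f"
  shows "\<exists>M d. wf_tm M \<and> (\<forall>x. prod_in M x (f x) ((length x + 2) ^ d))"
proof -
  obtain c K t where c: "cbnd K c" "pbd (\<lambda>x. x) (\<lambda>x. []) t"
    "\<forall>x \<sigma> w. env_at [] 1 [] \<sigma> \<longrightarrow> exec x c (\<sigma>, w) (\<sigma>, w @ f x) (t x)"
    by (rule emE[OF assms, of "[]" 1]) auto
  from com_tm[OF c(1)] obtain M where M: "wf_tm M"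
    "\<And>x \<sigma> w t. exec x c (\<lambda>_. 0, []) (\<sigma>, w) t \<Longrightarrow> prod_in M x w (Suc t)" by blast
  have "prod_in M x (f x) (Suc (t x))" for x
    using M(2)[of x "\<lambda>_. 0" "f x" "t x"] c(3)[rule_format, of "\<lambda>_. 0" x "[]"] by (simp add: env_at_def)
  moreover from pbd_Suc[OF c(2)] obtain d where "\<forall>x. Suc (t x) \<le> (length x + 2) ^ d"
    unfolding pbd_def ctx_size_def by auto
  ultimately show ?thesis using M(1) prod_in_mono by blast
qed

section \<open>Switch systems and bin packing\<close>

lemma digit_sum_Suc:
  "(\<Sum>k\<le>Suc U. a k * \<beta> ^ k) = a 0 + \<beta> * (\<Sum>k\<le>U. a (Suc k) * \<beta> ^ k)" for a :: "nat \<Rightarrow> nat"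
  by (subst sum.atMost_Suc_shift) (simp add: sum_distrib_left ac_simps)

text \<open>Reduction modulo \<beta> strips off one digit at a time; the leading digit, which may be
  large, is what remains at the end.\<close>

lemma digits_unique:
  fixes a b :: "nat \<Rightarrow> nat"
  assumes "\<And>k. k < U \<Longrightarrow> a k < \<beta> \<and> b k < \<beta>" "(\<Sum>k\<le>U. a k * \<beta> ^ k) = (\<Sum>k\<le>U. b k * \<beta> ^ k)" "k \<le> U"
  shows "a k = b k"
  using assms
proof (induction U arbitrary: a b k)
  case 0
  then show ?case by simp
next
  case (Suc U)
  let ?A = "\<Sum>k\<le>U. a (Suc k) * \<beta> ^ k" and ?B = "\<Sum>k\<le>U. b (Suc k) * \<beta> ^ k"
  have eq: "a 0 + \<beta> * ?A = b 0 + \<beta> * ?B" using Suc.prems(2) unfolding digit_sum_Suc .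
  have lt: "a 0 < \<beta>" "b 0 < \<beta>" using Suc.prems(1)[of 0] by auto
  have "a 0 = (a 0 + \<beta> * ?A) mod \<beta>" using lt by simp
  also have "\<dots> = b 0" unfolding eq using lt by simp
  finally have 0: "a 0 = b 0" .
  with eq lt have "?A = ?B" by simp
  with Suc.IH[of "\<lambda>k. a (Suc k)" "\<lambda>k. b (Suc k)"] Suc.prems(1) have *: "a (Suc k) = b (Suc k)" if "k \<le> U" for k
    using that by (metis Suc_less_eq)
  show ?case using 0 * Suc.prems(3) by (cases k) auto
qed

lemma digit_sum_less: "(\<And>k. k < U \<Longrightarrow> a k < \<beta>) \<Longrightarrow> (\<Sum>k<U. a k * \<beta> ^ k) < \<beta> ^ U" for a :: "nat \<Rightarrow> nat"
proof (induction U)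
  case (Suc U)
  have "(\<Sum>k<Suc U. a k * \<beta> ^ k) < \<beta> ^ U + a U * \<beta> ^ U" using Suc by simp
  also have "\<dots> = Suc (a U) * \<beta> ^ U" by simp
  also have "\<dots> \<le> \<beta> * \<beta> ^ U" by (rule mult_right_mono) (use Suc.prems[of U] in auto)
  finally show ?case by simp
qed simp

lemma div_mod_index: "z < n \<Longrightarrow> z' < n \<Longrightarrow> P * n + z = P' * n + z' \<longleftrightarrow> P = P' \<and> z = z'" for z n :: nat
proof -
  assume z: "z < n" "z' < n"
  have "(P * n + z) div n = P" "(P * n + z) mod n = z" "(P' * n + z') div n = P'" "(P' * n + z') mod n = z'"
    using z by (simp_all add: div_mult_self3)
  then show ?thesis by metis
qed

datatype itm = Mk nat nat | It nat nat bool

text \<open>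
  For every class k and position z there are two items, \<open>It k z True\<close> and \<open>It k z False\<close>. One of
  them has to go to the bin (P1 k, z), the other one to the bin (P2 k, z + sh k); the marker
  items identify the bins. The base-\<beta> digits of the item sizes enforce this, and the lowest part
  of the sizes imposes one linear inequality per bin.
\<close>
locale switch =
  fixes n U NB \<theta> :: nat and P1 P2 sh :: "nat \<Rightarrow> nat" and lw :: "nat \<Rightarrow> nat \<Rightarrow> bool \<Rightarrow> nat" and ml :: "nat \<Rightarrow> nat"
  assumes n0: "n > 0" and P1: "\<And>k. k < U \<Longrightarrow> P1 k < NB" and P2: "\<And>k. k < U \<Longrightarrow> P2 k < NB"
    and P12: "\<And>k. k < U \<Longrightarrow> P1 k \<noteq> P2 k" and sh: "\<And>k. k < U \<Longrightarrow> sh k < n"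
begin

lemma P12': "k < U \<Longrightarrow> P2 k \<noteq> P1 k"
  using P12 by metis

definition bk :: "nat \<Rightarrow> nat \<Rightarrow> nat" where "bk k z = (z + n - sh k) mod n"
definition fw :: "nat \<Rightarrow> nat \<Rightarrow> nat" where "fw k z = (z + sh k) mod n"

lemma bk_less [simp]: "bk k z < n" and fw_less [simp]: "fw k z < n"
  using n0 by (auto simp: bk_def fw_def)

lemma bk_fw: "k < U \<Longrightarrow> z < n \<Longrightarrow> bk k (fw k z) = z"
proof -
  assume k: "k < U" "z < n"
  have s: "sh k < n" using sh k by blast
  have "bk k (fw k z) = ((z + sh k) mod n + (n - sh k)) mod n" using s by (simp add: bk_def fw_def)
  also have "\<dots> = (z + sh k + (n - sh k)) mod n" by (simp add: mod_add_left_eq)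
  also have "\<dots> = z" using s k by simp
  finally show ?thesis .
qed

lemma fw_bk: "k < U \<Longrightarrow> z < n \<Longrightarrow> fw k (bk k z) = z"
proof -
  assume k: "k < U" "z < n"
  have s: "sh k < n" using sh k by blast
  have "fw k (bk k z) = (z + n - sh k + sh k) mod n" by (simp add: bk_def fw_def mod_add_left_eq)
  also have "\<dots> = z" using s k by simp
  finally show ?thesis .
qed

definition items :: "itm set" where
  "items = (\<lambda>(P, z). Mk P z) ` ({..<NB} \<times> {..<n}) \<union> (\<lambda>(k, z, w). It k z w) ` ({..<U} \<times> {..<n} \<times> UNIV)"

lemma finite_items: "finite items" by (simp add: items_def)

lemma Mk_in_items [simp]: "Mk P z \<in> items \<longleftrightarrow> P < NB \<and> z < n"
  by (auto simp: items_def)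

lemma It_in_items [simp]: "It k z w \<in> items \<longleftrightarrow> k < U \<and> z < n"
proof
  assume "k < U \<and> z < n"
  then have "(k, z, w) \<in> {..<U} \<times> {..<n} \<times> UNIV" by simp
  then show "It k z w \<in> items" unfolding items_def by (intro UnI2 image_eqI[of _ _ "(k, z, w)"]) auto
qed (auto simp: items_def)

definition cnt :: "nat \<Rightarrow> nat" where
  "cnt P = card {k. k < U \<and> P1 k = P} + card {k. k < U \<and> P2 k = P}"

lemma cnt_le: "cnt P \<le> U"
proof -
  have "cnt P = card ({k. k < U \<and> P1 k = P} \<union> {k. k < U \<and> P2 k = P})"
    unfolding cnt_def by (rule card_Un_disjoint[symmetric]) (auto dest: P12 P12')
  also have "\<dots> \<le> card {..<U}" by (rule card_mono) auto
  finally show ?thesis by simp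
qed

text \<open>In a correctly filled bin digit \<open>k\<close> adds up to \<open>2 * n\<close>: an
  item at position z contributes n + z and the marker of its bin n - z, while the marker of a bin
  without class \<open>k\<close> contributes all of \<open>2 * n\<close>. The summand n keeps two
  items of the same class out of one bin even at position 0. In the last digit an item counts 1 and
  a marker more than \<open>U\<close>, so that no bin has room for two markers.\<close>

fun vec :: "itm \<Rightarrow> nat \<Rightarrow> nat" where
  "vec (It k' z w) k = (if k < U then if k = k' then n + z else 0 else 1)"
| "vec (Mk P z) k = (if k < U then if P = P1 k then n - z else if P = P2 k then n - bk k z else 2 * n
     else 2 * U + 1 - cnt P)"

definition tgt :: "nat \<Rightarrow> nat" where "tgt k = (if k < U then 2 * n else 2 * U + 1)"
text \<open>At most \<open>2 * U + 1\<close> items with digits up to \<open>2 * n\<close> meet in a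
  bin, so the digits below the leading one are added without a carry.\<close>

definition bas :: nat where "bas = (2 * U + 1) * (2 * n) + 1"
definition high :: "itm \<Rightarrow> nat" where "high i = (\<Sum>k\<le>U. vec i k * bas ^ k)"
definition Hi :: nat where "Hi = (\<Sum>k\<le>U. tgt k * bas ^ k)"

fun low :: "itm \<Rightarrow> nat" where
  "low (Mk P z) = ml P"
| "low (It k z w) = lw k z w"

text \<open>With the factor \<open>\<theta> + 1\<close> the capacity forces the high parts of a bin
  to total at most \<open>Hi\<close>, and if they total exactly \<open>Hi\<close>, then
  \<open>\<theta>\<close> is left over for the low parts.\<close>

definition isize :: "itm \<Rightarrow> nat" where "isize i = (\<theta> + 1) * high i + low i"
definition cap :: nat where "cap = (\<theta> + 1) * Hi + \<theta>"

definition load_low :: "(nat \<Rightarrow> nat \<Rightarrow> bool) \<Rightarrow> nat \<Rightarrow> nat \<Rightarrow> nat" where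
  "load_low \<sigma> P z = ml P + (\<Sum>k | k < U \<and> P1 k = P. lw k z (\<sigma> k z))
     + (\<Sum>k | k < U \<and> P2 k = P. lw k (bk k z) (\<not> \<sigma> k (bk k z)))"

definition switch_sat :: bool where
  "switch_sat \<longleftrightarrow> (\<exists>\<sigma>. \<forall>P<NB. \<forall>z<n. load_low \<sigma> P z \<le> \<theta>)"

definition packable :: bool where
  "packable \<longleftrightarrow> (\<exists>f. (\<forall>i\<in>items. f i < NB * n) \<and> (\<forall>b<NB * n. (\<Sum>i | i \<in> items \<and> f i = b. isize i) \<le> cap))"

definition place_of :: "(nat \<Rightarrow> nat \<Rightarrow> bool) \<Rightarrow> itm \<Rightarrow> nat" where
  "place_of \<sigma> i = (case i of Mk P z \<Rightarrow> P * n + z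
     | It k z w \<Rightarrow> if w = \<sigma> k z then P1 k * n + z else P2 k * n + fw k z)"

lemma index_less: "P < NB \<Longrightarrow> z < n \<Longrightarrow> P * n + z < NB * n"
proof -
  assume "P < NB" "z < n"
  then have "P * n + z < Suc P * n" by simp
  also have "\<dots> \<le> NB * n" by (rule mult_right_mono) (use \<open>P < NB\<close> in auto)
  finally show ?thesis .
qed

lemma place_of_less: "i \<in> items \<Longrightarrow> place_of \<sigma> i < NB * n"
  by (cases i) (auto simp: place_of_def index_less P1 P2)

definition content :: "(nat \<Rightarrow> nat \<Rightarrow> bool) \<Rightarrow> nat \<Rightarrow> nat \<Rightarrow> itm set" where
  "content \<sigma> P z = insert (Mk P z) ((\<lambda>k. It k z (\<sigma> k z)) ` {k. k < U \<and> P1 k = P} \<union>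
     (\<lambda>k. It k (bk k z) (\<not> \<sigma> k (bk k z))) ` {k. k < U \<and> P2 k = P})"

lemma place_of_bin:
  assumes "P < NB" "z < n"
  shows "{i \<in> items. place_of \<sigma> i = P * n + z} = content \<sigma> P z"
proof (rule set_eqI)
  fix i
  show "i \<in> {i \<in> items. place_of \<sigma> i = P * n + z} \<longleftrightarrow> i \<in> content \<sigma> P z"
  proof (cases i)
    case (Mk P' z')
    then show ?thesis using assms by (auto simp: place_of_def content_def div_mod_index)
  next
    case (It k z' w)
    have "k < U \<Longrightarrow> z' < n \<Longrightarrow> fw k z' = z \<longleftrightarrow> z' = bk k z" using bk_fw fw_bk assms by metis
    then show ?thesis using assms It P12[of k] by (auto simp: place_of_def content_def div_mod_index)
  qed
qed

lemma sum_content: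
  "(\<Sum>i\<in>content \<sigma> P z. F i) = F (Mk P z) + (\<Sum>k | k < U \<and> P1 k = P. F (It k z (\<sigma> k z)))
     + (\<Sum>k | k < U \<and> P2 k = P. F (It k (bk k z) (\<not> \<sigma> k (bk k z))))" for F :: "itm \<Rightarrow> nat"
proof -
  let ?A = "(\<lambda>k. It k z (\<sigma> k z)) ` {k. k < U \<and> P1 k = P}"
  let ?B = "(\<lambda>k. It k (bk k z) (\<not> \<sigma> k (bk k z))) ` {k. k < U \<and> P2 k = P}"
  have "sum F (content \<sigma> P z) = F (Mk P z) + sum F (?A \<union> ?B)"
    unfolding content_def by (rule sum.insert) auto
  also have "sum F (?A \<union> ?B) = sum F ?A + sum F ?B"
    by (rule sum.union_disjoint) (auto dest: P12 P12')
  also have "sum F ?A = (\<Sum>k | k < U \<and> P1 k = P. F (It k z (\<sigma> k z)))"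
    by (subst sum.reindex) (auto simp: inj_on_def)
  also have "sum F ?B = (\<Sum>k | k < U \<and> P2 k = P. F (It k (bk k z) (\<not> \<sigma> k (bk k z))))"
    by (subst sum.reindex) (auto simp: inj_on_def)
  finally show ?thesis by simp
qed

lemma vec_content:
  assumes "P < NB" "z < n" "k \<le> U"
  shows "(\<Sum>i\<in>content \<sigma> P z. vec i k) = tgt k"
proof (cases "k < U")
  case True
  have "(\<Sum>k' | k' < U \<and> P1 k' = P. vec (It k' z (\<sigma> k' z)) k) = (if P1 k = P then n + z else 0)"
    using True by (subst sum.cong[OF refl, where h = "\<lambda>k'. if k' = k then n + z else 0"]) (auto simp: sum.delta')
  moreover have "(\<Sum>k' | k' < U \<and> P2 k' = P. vec (It k' (bk k' z) (\<not> \<sigma> k' (bk k' z))) k)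
      = (if P2 k = P then n + bk k z else 0)"
    using True by (subst sum.cong[OF refl, where h = "\<lambda>k'. if k' = k then n + bk k z else 0"]) (auto simp: sum.delta')
  ultimately show ?thesis
    unfolding sum_content using True assms P12[of k] bk_less[of k z] by (auto simp: tgt_def simp del: bk_less)
next
  case False
  then have "k = U" using assms(3) by simp
  then show ?thesis unfolding sum_content using cnt_le[of P] by (simp add: tgt_def cnt_def)
qed

lemma high_content:
  assumes "P < NB" "z < n"
  shows "(\<Sum>i\<in>content \<sigma> P z. high i) = Hi"
proof -
  have "(\<Sum>i\<in>content \<sigma> P z. high i) = (\<Sum>k\<le>U. (\<Sum>i\<in>content \<sigma> P z. vec i k) * bas ^ k)"
    unfolding high_def by (subst sum.swap) (simp add: sum_distrib_right)
  also have "\<dots> = Hi" unfolding Hi_def by (rule sum.cong) (use assms vec_content in auto)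
  finally show ?thesis .
qed

lemma low_content: "(\<Sum>i\<in>content \<sigma> P z. low i) = load_low \<sigma> P z"
  unfolding sum_content load_low_def by simp

lemma bin_cases: "b < NB * n \<Longrightarrow> \<exists>P z. P < NB \<and> z < n \<and> b = P * n + z"
  by (rule exI[of _ "b div n"], rule exI[of _ "b mod n"]) (use n0 in \<open>auto simp: less_mult_imp_div_less\<close>)

lemma sat_imp_packable: "switch_sat \<Longrightarrow> packable"
proof -
  assume switch_sat
  then obtain \<sigma> where \<sigma>: "\<And>P z. P < NB \<Longrightarrow> z < n \<Longrightarrow> load_low \<sigma> P z \<le> \<theta>" unfolding switch_sat_def by blast
  have "(\<Sum>i | i \<in> items \<and> place_of \<sigma> i = b. isize i) \<le> cap" if "b < NB * n" for b
  proof -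
    from bin_cases[OF that] obtain P z where Pz: "P < NB" "z < n" "b = P * n + z" by blast
    have "(\<Sum>i\<in>content \<sigma> P z. isize i) = (\<theta> + 1) * Hi + load_low \<sigma> P z"
      unfolding isize_def sum.distrib low_content sum_distrib_left[symmetric] high_content[OF Pz(1,2)] ..
    then show ?thesis using \<sigma>[OF Pz(1,2)] by (simp add: Pz(3) place_of_bin[OF Pz(1,2)] cap_def)
  qed
  then show ?thesis unfolding packable_def using place_of_less by blast
qed

lemma sum_over_bins:
  fixes F :: "itm \<Rightarrow> nat"
  assumes "\<forall>i\<in>items. f i < NB * n"
  shows "(\<Sum>b<NB * n. \<Sum>i | i \<in> items \<and> f i = b. F i) = (\<Sum>i\<in>items. F i)"
  using sum.group[of items "{..<NB * n}" f F] finite_items assms by auto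

text \<open>The high parts are counted with a constant switch setting. It fills the high part of
  every bin exactly, whether or not it obeys the inequalities on the low parts.\<close>

lemma total_high: "(\<Sum>i\<in>items. high i) = NB * n * Hi"
proof -
  have "(\<Sum>i\<in>items. high i) = (\<Sum>b<NB * n. \<Sum>i | i \<in> items \<and> place_of (\<lambda>_ _. True) i = b. high i)"
    by (rule sum_over_bins[symmetric]) (use place_of_less in blast)
  also have "\<dots> = (\<Sum>b<NB * n. Hi)"
  proof (rule sum.cong)
    fix b assume "b \<in> {..<NB * n}"
    then obtain P z where Pz: "P < NB" "z < n" "b = P * n + z" using bin_cases by (metis lessThan_iff)
    show "(\<Sum>i | i \<in> items \<and> place_of (\<lambda>_ _. True) i = b. high i) = Hi"
      using high_content[OF Pz(1,2)] by (simp add: Pz(3) place_of_bin[OF Pz(1,2)])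
  qed simp
  finally show ?thesis by simp
qed

lemma total_size_le:
  assumes "(\<Sum>i\<in>items. low i) \<le> NB * n * \<theta>"
  shows "(\<Sum>i\<in>items. isize i) \<le> NB * n * cap"
proof -
  have "(\<Sum>i\<in>items. isize i) = (\<theta> + 1) * (NB * n * Hi) + (\<Sum>i\<in>items. low i)"
    unfolding isize_def sum.distrib sum_distrib_left[symmetric] total_high ..
  also have "\<dots> \<le> (\<theta> + 1) * (NB * n * Hi) + NB * n * \<theta>" using assms by simp
  also have "\<dots> = NB * n * cap" by (simp add: cap_def algebra_simps)
  finally show ?thesis .
qed

lemma vec_le:
  assumes "i \<in> items" "k < U"
  shows "vec i k \<le> 2 * n"
proof (cases i)
  case (Mk P z)
  have "n - z \<le> 2 * n" "n - bk k z \<le> 2 * n" for z by linarith+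
  then show ?thesis unfolding Mk vec.simps using assms(2) by presburger
next
  case (It k' z w)
  then have "z < n" using assms(1) by simp
  then have "n + z \<le> 2 * n" by linarith
  then show ?thesis unfolding It vec.simps using assms(2) by presburger
qed

lemma vec_top: "1 \<le> vec i U"
proof (cases i)
  case (Mk P z)
  have "vec i U = 2 * U + 1 - cnt P" by (simp only: Mk vec.simps less_irrefl if_False)
  then show ?thesis using cnt_le[of P] by linarith
next
  case (It k z w)
  show ?thesis by (simp only: It vec.simps less_irrefl if_False order_refl)
qed

text \<open>Carries have to be excluded before digits can be compared. Every item contributes at
  least 1 to the leading digit, which bounds the number of items in \<open>S\<close>, and this in
  turn keeps the other digit sums below \<open>bas\<close>.\<close>

lemma exact_digits:
  assumes S: "S \<subseteq> items" and H: "(\<Sum>i\<in>S. high i) = Hi" and k: "k \<le> U"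
  shows "(\<Sum>i\<in>S. vec i k) = tgt k"
proof -
  let ?d = "\<lambda>k. \<Sum>i\<in>S. vec i k"
  have fin: "finite S" by (rule finite_subset[OF S finite_items])
  have eq: "(\<Sum>k\<le>U. ?d k * bas ^ k) = (\<Sum>k\<le>U. tgt k * bas ^ k)"
    using H unfolding high_def Hi_def by (subst (asm) sum.swap) (simp add: sum_distrib_right)
  have b0: "bas > 0" by (simp add: bas_def)
  have tl: "tgt k < bas" if "k < U" for k using that by (simp add: tgt_def bas_def)
  have "?d U * bas ^ U \<le> (\<Sum>k\<le>U. tgt k * bas ^ k)" unfolding eq[symmetric]
    by (rule member_le_sum[of U "{..U}" "\<lambda>k. ?d k * bas ^ k"]) auto
  also have "\<dots> = (\<Sum>k<U. tgt k * bas ^ k) + tgt U * bas ^ U"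
    by (simp add: lessThan_Suc_atMost[symmetric])
  also have "\<dots> < bas ^ U + tgt U * bas ^ U" using digit_sum_less[of U tgt bas, OF tl] by simp
  finally have "?d U * bas ^ U < Suc (tgt U) * bas ^ U" by simp
  then have "?d U < Suc (tgt U)" unfolding mult_less_cancel2 by blast
  then have dU: "?d U \<le> 2 * U + 1" by (simp add: tgt_def)
  have "card S \<le> ?d U" using sum_mono[of S "\<lambda>_. 1" "\<lambda>i. vec i U"] vec_top by simp
  with dU have cS: "card S \<le> 2 * U + 1" by simp
  have "?d k < bas" if "k < U" for k
  proof -
    have "?d k \<le> card S * (2 * n)" using sum_mono[of S "\<lambda>i. vec i k" "\<lambda>_. 2 * n"] vec_le that S by auto
    also have "\<dots> \<le> (2 * U + 1) * (2 * n)" by (rule mult_right_mono[OF cS]) simp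
    finally show ?thesis by (simp add: bas_def)
  qed
  then show ?thesis using digits_unique[OF _ eq k] tl by blast
qed

section \<open>From packings to switch settings\<close>

context
  fixes f
  assumes f: "\<forall>i\<in>items. f i < NB * n" and pk: "\<forall>b<NB * n. (\<Sum>i | i \<in> items \<and> f i = b. isize i) \<le> cap"
begin

definition bin :: "nat \<Rightarrow> itm set" where "bin b = {i \<in> items. f i = b}"

lemma finite_bin: "finite (bin b)" using finite_items by (simp add: bin_def)

text \<open>No bin exceeds \<open>Hi\<close> in the high parts, and all bins together contain
  \<open>Hi\<close> exactly as many times as there are bins. Hence there is no slack
  anywhere.\<close>

lemma bin_high_low:
  assumes "b < NB * n"
  shows "(\<Sum>i\<in>bin b. high i) = Hi" "(\<Sum>i\<in>bin b. low i) \<le> \<theta>"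
proof -
  have sz: "(\<theta> + 1) * (\<Sum>i\<in>bin b. high i) + (\<Sum>i\<in>bin b. low i) \<le> (\<theta> + 1) * Hi + \<theta>" if "b < NB * n" for b
  proof -
    have "(\<Sum>i\<in>bin b. isize i) \<le> cap" using pk that by (simp add: bin_def)
    then show ?thesis by (simp only: isize_def sum.distrib cap_def sum_distrib_left)
  qed
  have le: "(\<Sum>i\<in>bin b. high i) \<le> Hi" if "b < NB * n" for b
  proof (rule ccontr)
    assume "\<not> (\<Sum>i\<in>bin b. high i) \<le> Hi"
    then have "(\<theta> + 1) * (Hi + 1) \<le> (\<theta> + 1) * (\<Sum>i\<in>bin b. high i)" by (intro mult_left_mono) auto
    with sz[OF that] show False by simp
  qed
  show eq: "(\<Sum>i\<in>bin b. high i) = Hi"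
  proof (rule ccontr)
    assume "(\<Sum>i\<in>bin b. high i) \<noteq> Hi"
    with le[OF assms] have "(\<Sum>i\<in>bin b. high i) < Hi" by simp
    then have "(\<Sum>b<NB * n. \<Sum>i\<in>bin b. high i) < (\<Sum>b<NB * n. Hi)"
      by (intro sum_strict_mono_ex1) (use le assms in auto)
    moreover have "(\<Sum>b<NB * n. \<Sum>i\<in>bin b. high i) = NB * n * Hi"
      using sum_over_bins[OF f, of high] total_high by (simp add: bin_def)
    ultimately show False by simp
  qed
  show "(\<Sum>i\<in>bin b. low i) \<le> \<theta>" using sz[OF assms] eq by simp
qed

lemma bin_vec: "b < NB * n \<Longrightarrow> k \<le> U \<Longrightarrow> (\<Sum>i\<in>bin b. vec i k) = tgt k"
  by (rule exact_digits[OF _ bin_high_low(1)]) (simp_all add: bin_def)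

lemma bin_one_marker:
  assumes "Mk P z \<in> bin b" "Mk P' z' \<in> bin b" "b < NB * n"
  shows "P = P' \<and> z = z'"
proof (rule ccontr)
  assume "\<not> (P = P' \<and> z = z')"
  then have "(\<Sum>i\<in>{Mk P z, Mk P' z'}. vec i U) = (2 * U + 1 - cnt P) + (2 * U + 1 - cnt P')" by auto
  moreover have "(\<Sum>i\<in>{Mk P z, Mk P' z'}. vec i U) \<le> (\<Sum>i\<in>bin b. vec i U)"
    by (rule sum_mono2) (use assms finite_bin in auto)
  ultimately show False using bin_vec[OF assms(3), of U] cnt_le[of P] cnt_le[of P'] by (simp add: tgt_def)
qed

text \<open>The marker contributes n - y to digit \<open>k\<close>, so n + y is left for the items
  of class \<open>k\<close>. Each of them contributes at least n, and n + y < 2 * n, so there is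
  exactly one, and its position is y.\<close>

lemma bin_class:
  assumes "Mk P z \<in> bin b" "b < NB * n" "k < U" "P = P1 k \<and> y = z \<or> P = P2 k \<and> y = bk k z"
  shows "\<exists>w. It k y w \<in> bin b"
proof -
  have z: "z < n" "P < NB" using assms(1) by (auto simp: bin_def)
  have y: "y < n" using assms(4) z by auto
  let ?T = "{i \<in> bin b. \<exists>z w. i = It k z w}"
  have mk: "i = Mk P z" if "i \<in> bin b" "i \<notin> ?T" "vec i k \<noteq> 0" for i
    using that assms(3) bin_one_marker[OF assms(1) _ assms(2)] by (cases i) (auto split: if_splits)
  have "(\<Sum>i\<in>bin b. vec i k) = (\<Sum>i\<in>insert (Mk P z) ?T. vec i k)"
  proof (rule sum.mono_neutral_right[OF finite_bin])
    show "insert (Mk P z) ?T \<subseteq> bin b" using assms(1) by blast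
    show "\<forall>i\<in>bin b - insert (Mk P z) ?T. vec i k = 0" using mk by blast
  qed
  also have "\<dots> = vec (Mk P z) k + (\<Sum>i\<in>?T. vec i k)" by (rule sum.insert) (use finite_bin in auto)
  finally have "vec (Mk P z) k + (\<Sum>i\<in>?T. vec i k) = 2 * n" using bin_vec[OF assms(2), of k] assms(3) by (simp add: tgt_def)
  moreover have "vec (Mk P z) k = n - y" using assms(3,4) P12[of k] by auto
  ultimately have T: "(\<Sum>i\<in>?T. vec i k) = n + y" using y by simp
  then have ne: "?T \<noteq> {}" using n0 by (metis add_is_0 less_numeral_extra(3) sum.empty)
  have finT: "finite ?T" using finite_bin by simp
  have "(\<Sum>i\<in>?T. n) \<le> (\<Sum>i\<in>?T. vec i k)" by (rule sum_mono) (use assms(3) in auto)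
  then have c: "card ?T * n \<le> n + y" using T by simp
  have "n + y < 2 * n" using y by simp
  with c have "card ?T * n < 2 * n" by (rule le_less_trans)
  then have "card ?T < 2" unfolding mult_less_cancel2 by blast
  then have "card ?T = 1" using ne finT by (simp add: card_gt_0_iff le_antisym Suc_leI)
  then obtain i where i: "?T = {i}" by (auto simp: card_1_singleton_iff)
  then obtain z' w where iw: "i = It k z' w" "i \<in> bin b" by blast
  then have "z' = y" using T i assms(3) by simp
  with iw show ?thesis by blast
qed

lemma packing_sat: switch_sat
proof -
  \<comment> \<open>A packing may permute the bins, so a bin is recognized by its marker and not by
    its index.\<close>
  define \<sigma> where "\<sigma> k z = (f (It k z True) = f (Mk (P1 k) z))" for k z
  have inb: "i \<in> bin (f i) \<and> f i < NB * n" if "i \<in> items" for i using that f by (simp add: bin_def)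
  have split: "f (It k z (\<sigma> k z)) = f (Mk (P1 k) z) \<and> f (It k z (\<not> \<sigma> k z)) = f (Mk (P2 k) (fw k z))"
    if k: "k < U" "z < n" for k z
  proof -
    have i1: "Mk (P1 k) z \<in> items" and i2: "Mk (P2 k) (fw k z) \<in> items" using k P1 P2 by auto
    obtain w1 where w1: "It k z w1 \<in> bin (f (Mk (P1 k) z))"
      using bin_class[of "P1 k" z _ k z] inb[OF i1] k by blast
    obtain w2 where w2: "It k z w2 \<in> bin (f (Mk (P2 k) (fw k z)))"
      using bin_class[of "P2 k" "fw k z" _ k z] inb[OF i2] k bk_fw[OF k] by auto
    \<comment> \<open>A bin has only one marker, so these two bins differ. Each of them contains an
      item for (k, z), and there are just two such items, so they are separated.\<close>
    have ne: "f (Mk (P1 k) z) \<noteq> f (Mk (P2 k) (fw k z))"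
      using bin_one_marker[of "P1 k" z _ "P2 k" "fw k z"] inb[OF i1] inb[OF i2] P12[OF k(1)] by metis
    show ?thesis using w1 w2 ne by (cases w1; cases w2) (auto simp: \<sigma>_def bin_def)
  qed
  have "load_low \<sigma> P z \<le> \<theta>" if Pz: "P < NB" "z < n" for P z
  proof -
    have mk: "Mk P z \<in> items" using Pz by simp
    let ?b = "f (Mk P z)"
    \<comment> \<open>An inclusion suffices: further items in the bin could only increase the sum of
      the low parts.\<close>
    have "content \<sigma> P z \<subseteq> bin ?b"
    proof
      fix i assume "i \<in> content \<sigma> P z"
      then consider "i = Mk P z" | k where "k < U" "P1 k = P" "i = It k z (\<sigma> k z)"
        | k where "k < U" "P2 k = P" "i = It k (bk k z) (\<not> \<sigma> k (bk k z))"
        unfolding content_def by blast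
      then show "i \<in> bin ?b"
      proof cases
        case 1 then show ?thesis using inb[OF mk] by simp
      next
        case 2 then show ?thesis using split[of k z] Pz by (auto simp: bin_def)
      next
        case 3 then show ?thesis using split[of k "bk k z"] Pz fw_bk[of k z] by (auto simp: bin_def)
      qed
    qed
    then have "(\<Sum>i\<in>content \<sigma> P z. low i) \<le> (\<Sum>i\<in>bin ?b. low i)" by (rule sum_mono2[OF finite_bin]) simp
    then show ?thesis using bin_high_low(2)[of ?b] inb[OF mk] low_content by simp
  qed
  then show ?thesis unfolding switch_sat_def by blast
qed

end

theorem packable_iff: "packable \<longleftrightarrow> switch_sat"
  using sat_imp_packable packing_sat unfolding packable_def by blast

section \<open>Items as numbers, one for each group of sources\<close>

definition itm_of :: "nat \<Rightarrow> itm" where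
  "itm_of g = (let kd = g div n in if kd < NB then Mk kd (g mod n) else It ((kd - NB) div 2) (g mod n) (odd (kd - NB)))"

lemma bij_itm_of: "bij_betw itm_of {..<(NB + 2 * U) * n} items"
proof (rule bij_betw_byWitness[where f' = "\<lambda>i. case i of Mk P z \<Rightarrow> P * n + z | It k z w \<Rightarrow> (NB + 2 * k + of_bool w) * n + z"])
  have lt: "(NB + 2 * k + of_bool w) * n + z < (NB + 2 * U) * n" if "k < U" "z < n" for k z w
  proof -
    have "(NB + 2 * k + of_bool w) * n + z < Suc (NB + 2 * k + of_bool w) * n" using that by simp
    also have "\<dots> \<le> (NB + 2 * U) * n" by (rule mult_right_mono) (use that in auto)
    finally show ?thesis .
  qed
  have lt': "P * n + z < (NB + 2 * U) * n" if "P < NB" "z < n" for P z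
    using index_less[OF that] by (simp add: add_mult_distrib)
  show "\<forall>g\<in>{..<(NB + 2 * U) * n}. (case itm_of g of Mk P z \<Rightarrow> P * n + z | It k z w \<Rightarrow> (NB + 2 * k + of_bool w) * n + z) = g"
  proof
    fix g
    have "2 * (m div 2) + of_bool (odd m) = m" for m :: nat by simp
    then have "NB + 2 * ((m - NB) div 2) + of_bool (odd (m - NB)) = m" if "\<not> m < NB" for m
      using that by (metis add.assoc le_add_diff_inverse not_less)
    then show "(case itm_of g of Mk P z \<Rightarrow> P * n + z | It k z w \<Rightarrow> (NB + 2 * k + of_bool w) * n + z) = g"
      by (simp add: itm_of_def Let_def)
  qed
  show "\<forall>i\<in>items. itm_of (case i of Mk P z \<Rightarrow> P * n + z | It k z w \<Rightarrow> (NB + 2 * k + of_bool w) * n + z) = i"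
  proof
    fix i assume "i \<in> items"
    then show "itm_of (case i of Mk P z \<Rightarrow> P * n + z | It k z w \<Rightarrow> (NB + 2 * k + of_bool w) * n + z) = i"
      by (cases i) (auto simp: itm_of_def Let_def)
  qed
  show "itm_of ` {..<(NB + 2 * U) * n} \<subseteq> items"
  proof
    fix i assume "i \<in> itm_of ` {..<(NB + 2 * U) * n}"
    then obtain g where g: "g < (NB + 2 * U) * n" "i = itm_of g" by auto
    then have "g div n < NB + 2 * U" by (simp add: less_mult_imp_div_less)
    then show "i \<in> items" using g n0 by (auto simp: itm_of_def Let_def)
  qed
  show "(\<lambda>i. case i of Mk P z \<Rightarrow> P * n + z | It k z w \<Rightarrow> (NB + 2 * k + of_bool w) * n + z) ` items \<subseteq> {..<(NB + 2 * U) * n}"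
  proof
    fix g assume "g \<in> (\<lambda>i. case i of Mk P z \<Rightarrow> P * n + z | It k z w \<Rightarrow> (NB + 2 * k + of_bool w) * n + z) ` items"
    then obtain i where "i \<in> items" "g = (case i of Mk P z \<Rightarrow> P * n + z | It k z w \<Rightarrow> (NB + 2 * k + of_bool w) * n + z)" by auto
    then show "g \<in> {..<(NB + 2 * U) * n}" using lt lt' by (cases i) auto
  qed
qed

definition gsize :: "nat \<Rightarrow> nat" where "gsize g = isize (itm_of g)"

theorem packable_index:
  "packable \<longleftrightarrow> (\<exists>f. (\<forall>g<(NB + 2 * U) * n. f g < NB * n) \<and>
     (\<forall>b<NB * n. (\<Sum>g | g < (NB + 2 * U) * n \<and> f g = b. gsize g) \<le> cap))"
proof -
  let ?m = "(NB + 2 * U) * n"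
  note bij = bij_itm_of
  have sum: "(\<Sum>g | g < ?m \<and> f (itm_of g) = b. gsize g) = (\<Sum>i | i \<in> items \<and> f i = b. isize i)" for f and b :: nat
  proof -
    have "bij_betw itm_of {g. g < ?m \<and> f (itm_of g) = b} {i \<in> items. f i = b}"
      using bij by (auto simp: bij_betw_def inj_on_def image_iff)
    from sum.reindex_bij_betw[OF this, of isize] show ?thesis by (simp add: gsize_def)
  qed
  show ?thesis
  proof
    assume packable
    then obtain f where f: "\<forall>i\<in>items. f i < NB * n" "\<forall>b<NB * n. (\<Sum>i | i \<in> items \<and> f i = b. isize i) \<le> cap"
      unfolding packable_def by blast
    have "itm_of g \<in> items" if "g < ?m" for g using bij that by (auto simp: bij_betw_def)
    with f sum show "\<exists>f. (\<forall>g<?m. f g < NB * n) \<and> (\<forall>b<NB * n. (\<Sum>g | g < ?m \<and> f g = b. gsize g) \<le> cap)"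
      by (intro exI[of _ "\<lambda>g. f (itm_of g)"]) auto
  next
    assume "\<exists>f. (\<forall>g<?m. f g < NB * n) \<and> (\<forall>b<NB * n. (\<Sum>g | g < ?m \<and> f g = b. gsize g) \<le> cap)"
    then obtain f where f: "\<forall>g<?m. f g < NB * n" "\<forall>b<NB * n. (\<Sum>g | g < ?m \<and> f g = b. gsize g) \<le> cap" by blast
    define h where "h = f \<circ> inv_into {..<?m} itm_of"
    have h: "h (itm_of g) = f g" if "g < ?m" for g
      using bij that by (simp add: h_def bij_betw_def inv_into_f_f)
    have "{g. g < ?m \<and> h (itm_of g) = b} = {g. g < ?m \<and> f g = b}" for b using h by auto
    then have "(\<Sum>i | i \<in> items \<and> h i = b. isize i) = (\<Sum>g | g < ?m \<and> f g = b. gsize g)" for b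
      using sum[of h b] by simp
    moreover have "h i < NB * n" if "i \<in> items" for i
    proof -
      obtain g where "g < ?m" "i = itm_of g" using bij \<open>i \<in> items\<close> by (auto simp: bij_betw_def)
      then show ?thesis using h f(1) by simp
    qed
    ultimately show packable unfolding packable_def using f(2) by (intro exI[of _ h]) auto
  qed
qed

lemma total_gsize: "(\<Sum>g<(NB + 2 * U) * n. gsize g) = (\<Sum>i\<in>items. isize i)"
  unfolding gsize_def by (rule sum.reindex_bij_betw[OF bij_itm_of])

lemma isize_pos: "isize i \<ge> 1"
proof -
  have "bas ^ U > 0" by (simp add: bas_def)
  then have "1 \<le> vec i U * bas ^ U" using vec_top[of i] by (simp add: Suc_le_eq)
  also have "\<dots> \<le> high i" unfolding high_def by (rule member_le_sum[of U "{..U}" "\<lambda>k. vec i k * bas ^ k"]) auto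
  finally show ?thesis by (simp add: isize_def)
qed

end

lemma (in switch) total_low:
  "(\<Sum>i\<in>items. low i) = n * (\<Sum>P<NB. ml P) + (\<Sum>k<U. \<Sum>z<n. lw k z True + lw k z False)"
proof -
  let ?A = "(\<lambda>(P, z). Mk P z) ` ({..<NB} \<times> {..<n})" and ?B = "(\<lambda>(k, z, w). It k z w) ` ({..<U} \<times> {..<n} \<times> (UNIV :: bool set))"
  have "sum low items = sum low ?A + sum low ?B" unfolding items_def by (rule sum.union_disjoint) auto
  also have "sum low ?A = (\<Sum>(P, z)\<in>{..<NB} \<times> {..<n}. ml P)"
    by (subst sum.reindex) (auto simp: inj_on_def intro!: sum.cong)
  also have "\<dots> = n * (\<Sum>P<NB. ml P)"
    by (simp add: sum.cartesian_product[symmetric] sum_distrib_left)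
  also have "sum low ?B = (\<Sum>(k, z, w)\<in>{..<U} \<times> {..<n} \<times> UNIV. lw k z w)"
    by (subst sum.reindex) (auto simp: inj_on_def intro!: sum.cong)
  also have "\<dots> = (\<Sum>k<U. \<Sum>z<n. lw k z True + lw k z False)"
    by (simp add: sum.cartesian_product[symmetric] UNIV_bool add.commute)
  finally show ?thesis .
qed

section \<open>Constraint satisfaction as a switch system\<close>

text \<open>
  The bins 2 b and 2 b + 1 stand for the choice of the value b by c0 and by c1, and the bins 2 Q
  and 2 Q + 1 make sure that some value is chosen. A forbidden pair of values is a pair of items
  one of which has positive weight and fits only into the bin of a value that is not chosen.
\<close>
definition csp_h :: "nat \<Rightarrow> nat \<Rightarrow> nat" where "csp_h Q d = d * (Q * Q)"
definition csp_U :: "nat \<Rightarrow> nat \<Rightarrow> nat" where "csp_U Q d = 2 * Q + csp_h Q d"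
definition csp_P1 :: "nat \<Rightarrow> nat \<Rightarrow> nat" where
  "csp_P1 Q k = (if k < 2 * Q then k else 2 * ((k - 2 * Q) mod Q))"
definition csp_P2 :: "nat \<Rightarrow> nat \<Rightarrow> nat" where
  "csp_P2 Q k = (if k < 2 * Q then 2 * Q + k mod 2 else 2 * ((k - 2 * Q) div Q mod Q) + 1)"
definition csp_sh :: "nat \<Rightarrow> (nat \<Rightarrow> nat) \<Rightarrow> nat \<Rightarrow> nat" where
  "csp_sh Q off k = (if k < 2 * Q then 0 else off ((k - 2 * Q) div (Q * Q)))"
definition csp_lw :: "nat \<Rightarrow> nat \<Rightarrow> (nat \<Rightarrow> nat \<Rightarrow> nat \<Rightarrow> nat \<Rightarrow> bool) \<Rightarrow> nat \<Rightarrow> nat \<Rightarrow> bool \<Rightarrow> nat" where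
  "csp_lw Q d ok k z w = (if k < 2 * Q then (if w then csp_h Q d else 0)
     else of_bool (w \<and> \<not> ok ((k - 2 * Q) div (Q * Q)) z ((k - 2 * Q) mod Q) ((k - 2 * Q) div Q mod Q)))"
text \<open>The inequality of every bin has the bound \<open>Q * csp_h Q d\<close>. In the bin of a
  value the marker leaves room for \<open>csp_h Q d\<close>, which is either the item of the chosen
  value or all the unit weights of forbidden pairs. In the bins \<open>2 * Q\<close> and
  \<open>2 * Q + 1\<close> it leaves room for \<open>Q - 1\<close> values that are not chosen, so
  that at least one is chosen.\<close>

definition csp_ml :: "nat \<Rightarrow> nat \<Rightarrow> nat \<Rightarrow> nat" where
  "csp_ml Q d P = (if P < 2 * Q then (Q - 1) * csp_h Q d else csp_h Q d)"

lemma double_not_Suc_double: "2 * a \<noteq> Suc (2 * b)" "Suc (2 * b) \<noteq> 2 * a" for a b :: nat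
  by presburger+

locale csp =
  fixes n Q d :: nat and off :: "nat \<Rightarrow> nat" and ok :: "nat \<Rightarrow> nat \<Rightarrow> nat \<Rightarrow> nat \<Rightarrow> bool"
  assumes n0: "n > 0" and Q2: "Q \<ge> 2" and d1: "d \<ge> 1" and off: "\<And>j. j < d \<Longrightarrow> off j < n"
begin

abbreviation "h \<equiv> csp_h Q d"

lemma T_index_less: "k < csp_U Q d \<Longrightarrow> \<not> k < 2 * Q \<Longrightarrow> (k - 2 * Q) div (Q * Q) < d"
  by (rule less_mult_imp_div_less) (auto simp: csp_U_def csp_h_def)

sublocale switch n "csp_U Q d" "2 * Q + 2" "Q * h" "csp_P1 Q" "csp_P2 Q" "csp_sh Q off" "csp_lw Q d ok" "csp_ml Q d"
proof
  have m: "a mod Q < Q" for a using Q2 by simp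
  show "csp_P1 Q k < 2 * Q + 2" for k
    by (auto simp: csp_P1_def) (use m[of "k - 2 * Q"] in linarith)
  show "csp_P2 Q k < 2 * Q + 2" for k
    by (auto simp: csp_P2_def) (use m[of "(k - 2 * Q) div Q"] in linarith)
  show "csp_P1 Q k \<noteq> csp_P2 Q k" for k
    by (auto simp: csp_P1_def csp_P2_def double_not_Suc_double)
  show "csp_sh Q off k < n" if "k < csp_U Q d" for k
    using that n0 off T_index_less by (auto simp: csp_sh_def)
qed (rule n0)

lemma h_pos: "h > 0" using Q2 d1 by (simp add: csp_h_def)

definition csp_sat :: bool where
  "csp_sat \<longleftrightarrow> (\<exists>c0 c1. (\<forall>z<n. c0 z < Q \<and> c1 z < Q) \<and> (\<forall>j<d. \<forall>z<n. ok j z (c0 z) (c1 ((z + off j) mod n))))"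

lemma bk_X: "k < 2 * Q \<Longrightarrow> z < n \<Longrightarrow> bk k z = z"
  by (simp add: bk_def csp_sh_def)

lemma P2_top: "{k. k < csp_U Q d \<and> csp_P2 Q k = 2 * Q + s} = (\<lambda>b. 2 * b + s) ` {..<Q}" if "s < 2" for s
proof -
  have m: "a mod Q < Q" for a using Q2 by simp
  have "k < csp_U Q d \<and> csp_P2 Q k = 2 * Q + s \<longleftrightarrow> k < 2 * Q \<and> k mod 2 = s" for k
    using m[of "(k - 2 * Q) div Q"] that by (auto simp: csp_P2_def csp_U_def)
  moreover have "k < 2 * Q \<and> k mod 2 = s \<longleftrightarrow> k \<in> (\<lambda>b. 2 * b + s) ` {..<Q}" for k
  proof
    assume "k < 2 * Q \<and> k mod 2 = s"
    then have "k = 2 * (k div 2) + s" "k div 2 < Q" by auto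
    then show "k \<in> (\<lambda>b. 2 * b + s) ` {..<Q}" by blast
  qed (use that in auto)
  ultimately show ?thesis by blast
qed

lemma P1_top: "{k. k < csp_U Q d \<and> csp_P1 Q k = 2 * Q + s} = {}" for s
proof -
  have "a mod Q < Q" for a using Q2 by simp
  then have "2 * (a mod Q) < 2 * Q" for a by simp
  then have "csp_P1 Q k < 2 * Q" for k by (auto simp: csp_P1_def)
  then show ?thesis by (metis (mono_tags, lifting) empty_Collect_eq not_add_less1)
qed

lemma load_low_top:
  assumes "s < 2" "z < n"
  shows "load_low \<sigma> (2 * Q + s) z = h + (\<Sum>b<Q. if \<sigma> (2 * b + s) z then 0 else h)"
proof -
  have "(\<Sum>k\<in>(\<lambda>b. 2 * b + s) ` {..<Q}. csp_lw Q d ok k (bk k z) (\<not> \<sigma> k (bk k z)))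
    = (\<Sum>b<Q. if \<sigma> (2 * b + s) z then 0 else h)"
    by (subst sum.reindex) (use assms in \<open>auto simp: inj_on_def bk_X csp_lw_def intro!: sum.cong\<close>)
  then show ?thesis unfolding load_low_def P1_top P2_top[OF assms(1)] by (simp add: csp_ml_def)
qed

text \<open>The class of the pair (b, b') under constraint j; the order of the digits is the one in
  which \<open>csp_P1\<close>, \<open>csp_P2\<close> and \<open>csp_sh\<close> read them
  off.\<close>

definition tk :: "nat \<Rightarrow> nat \<Rightarrow> nat \<Rightarrow> nat" where "tk j b b' = 2 * Q + ((j * Q + b') * Q + b)"

lemma tk:
  assumes "j < d" "b < Q" "b' < Q"
  shows "tk j b b' < csp_U Q d" "\<not> tk j b b' < 2 * Q" "(tk j b b' - 2 * Q) mod Q = b"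
    "(tk j b b' - 2 * Q) div Q mod Q = b'" "(tk j b b' - 2 * Q) div (Q * Q) = j"
proof -
  have 1: "(j * Q + b') * Q + b < Suc (j * Q + b') * Q" using assms by simp
  have 2: "Suc (j * Q + b') \<le> Suc j * Q" using assms by simp
  have 3: "Suc j * Q \<le> d * Q" by (rule mult_right_mono) (use assms in auto)
  have "Suc (j * Q + b') * Q \<le> d * Q * Q" by (rule mult_right_mono) (use 2 3 in auto)
  with 1 show "tk j b b' < csp_U Q d" by (simp add: tk_def csp_U_def csp_h_def mult.assoc)
  show "(tk j b b' - 2 * Q) mod Q = b" using assms by (simp add: tk_def)
  have d: "(tk j b b' - 2 * Q) div Q = j * Q + b'" using assms by (simp add: tk_def)
  then show "(tk j b b' - 2 * Q) div Q mod Q = b'" "(tk j b b' - 2 * Q) div (Q * Q) = j"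
    using assms by (simp_all add: div_mult2_eq)
qed (simp add: tk_def)

text \<open>If both values of a forbidden pair were chosen, the bins of both would be full, and the
  unit item of the pair would fit into neither of them.\<close>

lemma sat_imp_csp: "switch_sat \<Longrightarrow> csp_sat"
proof -
  assume switch_sat
  then obtain \<sigma> where \<sigma>: "\<And>P z. P < 2 * Q + 2 \<Longrightarrow> z < n \<Longrightarrow> load_low \<sigma> P z \<le> Q * h" unfolding switch_sat_def by blast
  have ch: "\<exists>b<Q. \<sigma> (2 * b + s) z" if "s < 2" "z < n" for s z
  proof (rule ccontr)
    assume "\<not> (\<exists>b<Q. \<sigma> (2 * b + s) z)"
    then have "(\<Sum>b<Q. if \<sigma> (2 * b + s) z then 0 else h) = (\<Sum>b<Q. h)" by (intro sum.cong) auto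
    then show False using \<sigma>[of "2 * Q + s" z] load_low_top[OF that, of \<sigma>] that h_pos by simp
  qed
  define c where "c s z = (SOME b. b < Q \<and> \<sigma> (2 * b + s) z)" for s z
  have c: "c s z < Q \<and> \<sigma> (2 * c s z + s) z" if "s < 2" "z < n" for s z
    unfolding c_def using someI_ex[of "\<lambda>b. b < Q \<and> \<sigma> (2 * b + s) z"] ch[OF that] by blast
  have "ok j z (c 0 z) (c 1 ((z + off j) mod n))" if jz: "j < d" "z < n" for j z
  proof -
    define z' where "z' = (z + off j) mod n"
    have z': "z' < n" using n0 by (simp add: z'_def)
    define b b' where "b = c 0 z" and "b' = c 1 z'"
    have bb: "b < Q" "b' < Q" "\<sigma> (2 * b) z" "\<sigma> (2 * b' + 1) z'" using c[of 0 z] c[of 1 z'] jz z' by (auto simp: b_def b'_def)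
    let ?k = "tk j b b'"
    note k = tk[OF jz(1) bb(1,2)]
    have P1k: "csp_P1 Q ?k = 2 * b" and P2k: "csp_P2 Q ?k = 2 * b' + 1" using k by (simp_all add: csp_P1_def csp_P2_def)
    have fwk: "fw ?k z = z'" using k by (simp add: fw_def csp_sh_def z'_def)
    have bkk: "bk ?k z' = z" using bk_fw[OF k(1) jz(2)] fwk by simp
    let ?l = "csp_lw Q d ok"
    have s0: "?l (2 * b) z (\<sigma> (2 * b) z) + ?l ?k z (\<sigma> ?k z) \<le> (\<Sum>k | k < csp_U Q d \<and> csp_P1 Q k = 2 * b. ?l k z (\<sigma> k z))"
    proof -
      have "(\<Sum>k\<in>{2 * b, ?k}. ?l k z (\<sigma> k z)) \<le> (\<Sum>k | k < csp_U Q d \<and> csp_P1 Q k = 2 * b. ?l k z (\<sigma> k z))"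
        by (rule sum_mono2) (use bb k P1k in \<open>auto simp: csp_U_def csp_P1_def\<close>)
      moreover have "2 * b \<noteq> ?k" using bb k(2) by auto
      ultimately show ?thesis by simp
    qed
    have s1: "?l (2 * b' + 1) z' (\<sigma> (2 * b' + 1) z') \<le> (\<Sum>k | k < csp_U Q d \<and> csp_P1 Q k = 2 * b' + 1. ?l k z' (\<sigma> k z'))"
      using member_le_sum[of "2 * b' + 1" "{k. k < csp_U Q d \<and> csp_P1 Q k = 2 * b' + 1}" "\<lambda>k. ?l k z' (\<sigma> k z')"] bb
      by (auto simp: csp_U_def csp_P1_def)
    have s2: "?l ?k z (\<not> \<sigma> ?k z) \<le> (\<Sum>k | k < csp_U Q d \<and> csp_P2 Q k = 2 * b' + 1. ?l k (bk k z') (\<not> \<sigma> k (bk k z')))"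
      using member_le_sum[of ?k "{k. k < csp_U Q d \<and> csp_P2 Q k = 2 * b' + 1}" "\<lambda>k. ?l k (bk k z') (\<not> \<sigma> k (bk k z'))"] k P2k bkk
      by auto
    have x: "?l (2 * b) z (\<sigma> (2 * b) z) = h" "?l (2 * b' + 1) z' (\<sigma> (2 * b' + 1) z') = h"
      using bb by (simp_all add: csp_lw_def)
    have q: "Q * h = (Q - 1) * h + h" using Q2 by (metis Suc_diff_1 add.commute less_le_trans mult_Suc pos2)
    have "?l ?k z (\<sigma> ?k z) = 0" using \<sigma>[of "2 * b" z] s0 x(1) q bb jz by (simp add: load_low_def csp_ml_def)
    moreover have "?l ?k z (\<not> \<sigma> ?k z) = 0" using \<sigma>[of "2 * b' + 1" z'] s1 s2 x(2) q bb z' by (simp add: load_low_def csp_ml_def)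
    ultimately have "?l ?k z True = 0" by (cases "\<sigma> ?k z") auto
    then show ?thesis using k by (simp add: csp_lw_def b_def b'_def z'_def split: if_splits)
  qed
  then show csp_sat unfolding csp_sat_def using c[of 0] c[of 1] by (intro exI[of _ "c 0"] exI[of _ "c 1"]) auto
qed

lemma T_sum_le:
  assumes "\<And>k. k \<in> A \<Longrightarrow> k < csp_U Q d \<and> \<not> k < 2 * Q \<and> f k \<le> (1::nat)"
  shows "(\<Sum>k\<in>A. f k) \<le> h"
proof -
  have "A \<subseteq> {2 * Q..<csp_U Q d}" using assms by force
  then have "card A \<le> card {2 * Q..<csp_U Q d}" by (intro card_mono) auto
  then have "card A \<le> h" by (simp add: csp_U_def)
  moreover have "(\<Sum>k\<in>A. f k) \<le> (\<Sum>k\<in>A. 1)" by (rule sum_mono) (use assms in auto)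
  ultimately show ?thesis by simp
qed

lemma csp_imp_sat: "csp_sat \<Longrightarrow> switch_sat"
proof -
  assume csp_sat
  then obtain c0 c1 where c: "\<And>z. z < n \<Longrightarrow> c0 z < Q \<and> c1 z < Q"
    "\<And>j z. j < d \<Longrightarrow> z < n \<Longrightarrow> ok j z (c0 z) (c1 ((z + off j) mod n))" unfolding csp_sat_def by blast
  \<comment> \<open>The weighted item of a pair (b, b') goes to the bin of b unless b is chosen
    there. In that case, if the pair is forbidden, b' is not chosen at the other end, so that the
    bin of b' has room.\<close>
  define \<sigma> where "\<sigma> k z = (if k < 2 * Q then (if k mod 2 = 0 then c0 z else c1 z) = k div 2 else c0 z \<noteq> (k - 2 * Q) mod Q)" for k z
  let ?l = "csp_lw Q d ok"
  have q: "Q * h = (Q - 1) * h + h" using Q2 by (metis Suc_diff_1 add.commute less_le_trans mult_Suc pos2)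
  have mQ: "a mod Q < Q" for a using Q2 by simp
  have m2: "2 * (a mod Q) < 2 * Q" "Suc (2 * (a mod Q)) < 2 * Q" for a using mQ[of a] by linarith+
  have "load_low \<sigma> P z \<le> Q * h" if Pz: "P < 2 * Q + 2" "z < n" for P z
  proof -
    consider (top) s where "s < 2" "P = 2 * Q + s" | (even) b where "b < Q" "P = 2 * b" | (odd) b where "b < Q" "P = 2 * b + 1"
    proof -
      have "P = 2 * (P div 2) + P mod 2" "P mod 2 < 2" by simp_all
      then show ?thesis using that(1)[of "P - 2 * Q"] that(2)[of "P div 2"] that(3)[of "P div 2"] Pz
        by (cases "P < 2 * Q") (cases "P mod 2 = 0"; force)+
    qed
    then show ?thesis
    proof cases
      case top
      define b where "b = (if s = 0 then c0 z else c1 z)"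
      have b: "b < Q" using c(1)[OF Pz(2)] by (simp add: b_def)
      have \<sigma>s: "\<sigma> (2 * b' + s) z \<longleftrightarrow> b' = b" if "b' < Q" for b'
      proof -
        have "2 * b' + s < 2 * Q" "(2 * b' + s) div 2 = b'" "(2 * b' + s) mod 2 = s" using that top(1) by auto
        then show ?thesis by (auto simp: \<sigma>_def b_def)
      qed
      have "(\<Sum>b'<Q. if \<sigma> (2 * b' + s) z then 0 else h) = (\<Sum>b'\<in>{..<Q} - {b}. h)"
        by (rule sum.mono_neutral_cong_right) (auto simp: \<sigma>s)
      also have "\<dots> = (Q - 1) * h" using b by simp
      finally show ?thesis unfolding top(2) load_low_top[OF top(1) Pz(2)] q by simp
    next
      case even
      have P2e: "{k. k < csp_U Q d \<and> csp_P2 Q k = P} = {}"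
        using even by (auto simp: csp_P2_def double_not_Suc_double)
      let ?A = "{k. k < csp_U Q d \<and> \<not> k < 2 * Q \<and> csp_P1 Q k = P}"
      have A: "{k. k < csp_U Q d \<and> csp_P1 Q k = P} = insert P ?A"
        using even by (auto simp: csp_P1_def csp_U_def)
      have e: "load_low \<sigma> P z = (Q - 1) * h + (?l P z (\<sigma> P z) + (\<Sum>k\<in>?A. ?l k z (\<sigma> k z)))"
        unfolding load_low_def P2e A using even by (subst sum.insert) (auto simp: csp_ml_def)
      have "?l P z (\<sigma> P z) + (\<Sum>k\<in>?A. ?l k z (\<sigma> k z)) \<le> h"
      proof (cases "c0 z = b")
        case True
        have "?l k z (\<sigma> k z) = 0" if "k \<in> ?A" for k
          using that True even by (auto simp: \<sigma>_def csp_lw_def csp_P1_def)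
        then have "(\<Sum>k\<in>?A. ?l k z (\<sigma> k z)) = 0" by (intro sum.neutral) blast
        moreover have "?l P z (\<sigma> P z) \<le> h" using even by (simp add: csp_lw_def)
        ultimately show ?thesis by linarith
      next
        case False
        then have "?l P z (\<sigma> P z) = 0" using even by (auto simp: \<sigma>_def csp_lw_def)
        moreover have "(\<Sum>k\<in>?A. ?l k z (\<sigma> k z)) \<le> h" by (rule T_sum_le) (auto simp: csp_lw_def)
        ultimately show ?thesis by simp
      qed
      then show ?thesis unfolding q e by linarith
    next
      case odd
      have P1o: "{k. k < csp_U Q d \<and> csp_P1 Q k = P} = {P}"
        using odd by (auto simp: csp_P1_def csp_U_def double_not_Suc_double split: if_splits)
      let ?B = "{k. k < csp_U Q d \<and> csp_P2 Q k = P}"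
      have B: "k < csp_U Q d \<and> \<not> k < 2 * Q \<and> (k - 2 * Q) div Q mod Q = b" if "k \<in> ?B" for k
        using that odd by (auto simp: csp_P2_def split: if_splits)
      have e: "load_low \<sigma> P z = (Q - 1) * h + (?l P z (\<sigma> P z) + (\<Sum>k\<in>?B. ?l k (bk k z) (\<not> \<sigma> k (bk k z))))"
        unfolding load_low_def P1o using odd by (simp add: csp_ml_def)
      have "?l P z (\<sigma> P z) + (\<Sum>k\<in>?B. ?l k (bk k z) (\<not> \<sigma> k (bk k z))) \<le> h"
      proof (cases "c1 z = b")
        case True
        have "?l k (bk k z) (\<not> \<sigma> k (bk k z)) = 0" if k: "k \<in> ?B" for k
        proof -
          note k' = B[OF k]
          let ?j = "(k - 2 * Q) div (Q * Q)"
          have "(bk k z + off ?j) mod n = z" using fw_bk[of k z] k' Pz(2) by (simp add: fw_def csp_sh_def)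
          then have "ok ?j (bk k z) (c0 (bk k z)) b" using c(2)[OF T_index_less, of k "bk k z"] k' True by simp
          then show ?thesis using k' by (auto simp: csp_lw_def \<sigma>_def)
        qed
        then have "(\<Sum>k\<in>?B. ?l k (bk k z) (\<not> \<sigma> k (bk k z))) = 0" by (intro sum.neutral) blast
        moreover have "?l P z (\<sigma> P z) \<le> h" using odd by (simp add: csp_lw_def)
        ultimately show ?thesis by linarith
      next
        case False
        then have "?l P z (\<sigma> P z) = 0" using odd by (auto simp: \<sigma>_def csp_lw_def)
        moreover have "(\<Sum>k\<in>?B. ?l k (bk k z) (\<not> \<sigma> k (bk k z))) \<le> h"
        proof (rule T_sum_le)
          fix k assume "k \<in> ?B"
          from B[OF this] show "k < csp_U Q d \<and> \<not> k < 2 * Q \<and> ?l k (bk k z) (\<not> \<sigma> k (bk k z)) \<le> 1"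
            by (simp add: csp_lw_def)
        qed
        ultimately show ?thesis by simp
      qed
      then show ?thesis unfolding q e by linarith
    qed
  qed
  then show switch_sat unfolding switch_sat_def by blast
qed

theorem packable_iff_csp: "packable \<longleftrightarrow> csp_sat"
  using packable_iff sat_imp_csp csp_imp_sat by blast

text \<open>This holds for satisfiable and unsatisfiable systems alike; it guarantees that the
  sources of the instance fit into the sinks when groups may be split.\<close>

lemma csp_total_low: "(\<Sum>i\<in>items. low i) \<le> (2 * Q + 2) * n * (Q * h)"
proof -
  have "(\<Sum>P<2 * Q + 2. csp_ml Q d P) = 2 * Q * ((Q - 1) * h) + 2 * h"
    by (simp add: csp_ml_def)
  moreover have "(\<Sum>z<n. csp_lw Q d ok k z True + csp_lw Q d ok k z False) \<le> n * (if k < 2 * Q then h else 1)" for k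
    using sum_mono[of "{..<n}" "\<lambda>z. csp_lw Q d ok k z True + csp_lw Q d ok k z False" "\<lambda>_. if k < 2 * Q then h else 1"]
    by (auto simp: csp_lw_def)
  then have "(\<Sum>k<csp_U Q d. \<Sum>z<n. csp_lw Q d ok k z True + csp_lw Q d ok k z False)
      \<le> (\<Sum>k<csp_U Q d. n * (if k < 2 * Q then h else 1))" by (intro sum_mono) simp
  moreover have "(\<Sum>k<csp_U Q d. n * (if k < 2 * Q then h else 1)) = n * (2 * Q * h + h)"
  proof -
    have "(\<Sum>k<csp_U Q d. n * (if k < 2 * Q then h else 1)) = (\<Sum>k<2 * Q. n * (if k < 2 * Q then h else 1)) +
      (\<Sum>k\<in>{2 * Q..<csp_U Q d}. n * (if k < 2 * Q then h else 1))"
      unfolding lessThan_atLeast0 by (rule sum.atLeastLessThan_concat[symmetric]) (auto simp: csp_U_def)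
    also have "(\<Sum>k\<in>{2 * Q..<csp_U Q d}. n * (if k < 2 * Q then h else 1)) = n * h" by (simp add: csp_U_def)
    finally show ?thesis by (simp add: algebra_simps)
  qed
  ultimately have "(\<Sum>i\<in>items. low i) \<le> n * (2 * Q * ((Q - 1) * h) + 2 * h) + n * (2 * Q * h + h)"
    unfolding total_low by simp
  also have "\<dots> = n * (2 * Q * (Q * h) + 3 * h)"
  proof -
    obtain q where q: "Q = Suc q" using Q2 by (cases Q) auto
    show ?thesis by (simp add: q algebra_simps)
  qed
  also have "\<dots> \<le> n * (2 * Q * (Q * h) + 2 * (Q * h))"
  proof -
    have "2 * 2 * h \<le> 2 * Q * h" by (rule mult_right_mono) (use Q2 in auto)
    then have "3 * h \<le> 2 * (Q * h)" by linarith
    then show ?thesis by (intro mult_left_mono add_left_mono) auto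
  qed
  also have "\<dots> = (2 * Q + 2) * n * (Q * h)" by (simp add: algebra_simps)
  finally show ?thesis .
qed

lemma csp_total_size: "(\<Sum>g<(2 * Q + 2 + 2 * csp_U Q d) * n. gsize g) \<le> (2 * Q + 2) * n * cap"
  unfolding total_gsize by (rule total_size_le[OF csp_total_low])

end

section \<open>Geometry of equally spaced groups\<close>

text \<open>The constant 5/6 comes from the beginning \<open>x - x ^ 3 / 6\<close> of the sine
  series on the interval from 0 to 1; beyond 1 the sine is still increasing.\<close>

lemma sin_ge_min: "0 \<le> x \<Longrightarrow> x \<le> pi / 2 \<Longrightarrow> 5 / 6 * min x 1 \<le> sin x"
proof -
  assume x: "0 \<le> x" "x \<le> pi / 2"
  have *: "5 / 6 * y \<le> sin y" if "0 \<le> y" "y \<le> 1" for y :: real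
  proof -
    have "\<bar>sin y - (\<Sum>m<3. sin_coeff m * y ^ m)\<bar> \<le> inverse (fact 3) * \<bar>y\<bar> ^ 3"
      by (rule Maclaurin_sin_bound)
    then have "\<bar>sin y - y\<bar> \<le> y ^ 3 / 6"
      using that by (simp add: eval_nat_numeral sin_coeff_def)
    moreover have "y ^ 3 \<le> y"
    proof -
      have "y * (y * y) \<le> y * 1" using that by (intro mult_left_mono mult_le_one) auto
      then show ?thesis by (simp add: power3_eq_cube)
    qed
    ultimately show ?thesis by linarith
  qed
  show ?thesis
  proof (cases "x \<le> 1")
    case True
    then show ?thesis using * x by (simp add: min_def)
  next
    case False
    then have "sin 1 \<le> sin x" using x by (intro sin_monotone_2pi_le) (use pi_ge_two in linarith)+
    then show ?thesis using *[of 1] False by simp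
  qed
qed

definition gpt :: "nat \<Rightarrow> nat \<Rightarrow> point" where
  "gpt m g = circle_point (0, 0) 1 (2 * pi * real g / real m)"

lemma norm_gpt: "norm (gpt m g) = 1"
  by (simp add: gpt_def circle_point_def norm_Pair)

lemma dist_gpt: "norm (gpt m g - gpt m g') = 2 * \<bar>sin (pi * (real g - real g') / real m)\<bar>"
proof -
  define a b where "a = 2 * pi * real g / real m" and "b = 2 * pi * real g' / real m"
  define t where "t = pi * (real g - real g') / real m"
  have ab: "a - b = 2 * t" by (simp add: a_def b_def t_def diff_divide_distrib right_diff_distrib)
  have "(cos a - cos b)\<^sup>2 + (sin a - sin b)\<^sup>2 = 2 - 2 * cos (a - b)"
    using sin_cos_squared_add[of a] sin_cos_squared_add[of b]
    by (simp add: cos_diff power2_eq_square algebra_simps)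
  also have "\<dots> = (2 * sin t)\<^sup>2" unfolding ab cos_double_sin by (simp add: power2_eq_square)
  finally have "norm (gpt m g - gpt m g') = sqrt ((2 * sin t)\<^sup>2)"
    by (simp add: gpt_def circle_point_def norm_Pair a_def b_def)
  then have "norm (gpt m g - gpt m g') = \<bar>2 * sin t\<bar>" by (simp only: real_sqrt_abs)
  then show ?thesis by (simp add: t_def abs_mult)
qed

text \<open>Angles beyond a right angle are reflected. For the others \<open>pi \<ge> 2\<close>
  gives an angle of at least 2 / m, and 5/6 of this is still more than 1 / m.\<close>

lemma sin_group_ge:
  assumes "0 < d" "d < m"
  shows "1 / real m \<le> sin (pi * real d / real m)"
proof -
  have *: "1 / real m \<le> sin (pi * real d / real m)" if d: "0 < d" "2 * d \<le> m" "2 \<le> m" for d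
  proof -
    let ?x = "pi * real d / real m"
    have m: "real m \<ge> 2" using d by simp
    have "pi * (2 * real d) \<le> pi * real m" using d by (intro mult_left_mono) auto
    then have x: "0 \<le> ?x" "?x \<le> pi / 2" using d by (simp_all add: field_simps)
    have "2 * 1 \<le> pi * real d" by (rule mult_mono) (use d pi_ge_two in auto)
    then have "2 / real m \<le> ?x" by (intro divide_right_mono) auto
    moreover have "2 / real m \<le> 1" using m by (simp add: field_simps)
    ultimately have "2 / real m \<le> min ?x 1" by simp
    then have "5 / 6 * (2 / real m) \<le> 5 / 6 * min ?x 1" by (intro mult_left_mono) auto
    also have "\<dots> \<le> sin ?x" by (rule sin_ge_min[OF x])
    finally have "5 / 6 * (2 / real m) \<le> sin ?x" .
    moreover have "1 / real m \<le> 5 / 6 * (2 / real m)" using m by (simp add: field_simps)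
    ultimately show ?thesis by linarith
  qed
  show ?thesis
  proof (cases "2 * d \<le> m")
    case True
    then show ?thesis using * assms by simp
  next
    case False
    have "pi * real (m - d) / real m = pi - pi * real d / real m"
      using assms by (simp add: of_nat_diff field_simps)
    then have "sin (pi * real (m - d) / real m) = sin (pi * real d / real m)" by simp
    then show ?thesis using *[of "m - d"] assms False by simp
  qed
qed

lemma dist_gpt_ge:
  assumes "g < m" "g' < m" "g \<noteq> g'"
  shows "2 / real m \<le> norm (gpt m g - gpt m g')"
proof -
  have *: "1 / real m \<le> \<bar>sin (pi * (real g - real g') / real m)\<bar>" if "g' < g" "g < m" for g g'
  proof -
    have "1 / real m \<le> sin (pi * (real g - real g') / real m)"
      using sin_group_ge[of "g - g'" m] that by (simp add: of_nat_diff less_imp_diff_less)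
    then show ?thesis by linarith
  qed
  have "1 / real m \<le> \<bar>sin (pi * (real g - real g') / real m)\<bar>"
  proof (cases "g' < g")
    case True
    then show ?thesis using * assms by simp
  next
    case False
    have "sin (pi * (real g' - real g) / real m) = - sin (pi * (real g - real g') / real m)"
      by (metis minus_diff_eq minus_divide_left mult_minus_right sin_minus)
    then show ?thesis using *[of g g'] assms False by simp
  qed
  then show ?thesis unfolding dist_gpt by simp
qed

text \<open>Think of \<open>x\<close> out of \<open>a\<close> sources of a group that are joined
  without the others. Their share \<open>x * a powr (\<alpha> - 1)\<close> in the cost of the whole
  group is \<open>x powr \<alpha>\<close> times \<open>(x / a) powr (1 - \<alpha>)\<close>, and as
  \<open>x \<le> a - 1\<close> this factor stays below 1 by at least
  \<open>(1 - \<alpha>) / (2 * a)\<close>.\<close>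

lemma powr_split_gap:
  fixes x a \<alpha> :: real
  assumes "1 \<le> x" "x \<le> a - 1" "0 \<le> \<alpha>" "\<alpha> < 1"
  shows "x * a powr (\<alpha> - 1) + (1 - \<alpha>) / (2 * a) \<le> x powr \<alpha>"
proof -
  define \<beta> where "\<beta> = 1 - \<alpha>"
  have \<beta>: "0 < \<beta>" "\<beta> \<le> 1" using assms by (auto simp: \<beta>_def)
  have a: "a \<ge> 2" using assms by simp
  have "(x / a) powr \<beta> \<le> (1 - 1 / a) powr \<beta>"
    using assms \<beta> a by (intro powr_mono2) (auto simp: field_simps)
  also have "\<dots> = exp (\<beta> * ln (1 - 1 / a))" using a by (simp add: powr_def)
  also have "\<dots> \<le> exp (- (\<beta> / a))"
  proof -
    have "ln (1 - 1 / a) \<le> (1 - 1 / a) - 1" using a by (intro ln_le_minus_one) (simp add: field_simps)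
    then have "\<beta> * ln (1 - 1 / a) \<le> \<beta> * (- (1 / a))" using \<beta> by (intro mult_left_mono) auto
    then show ?thesis by simp
  qed
  also have "\<dots> \<le> 1 - \<beta> / (2 * a)"
  proof -
    define y where "y = \<beta> / a"
    have y: "0 \<le> y" "y \<le> 1" using \<beta> a by (auto simp: y_def field_simps)
    have "exp (- y) \<le> 1 / (1 + y)" using exp_ge_add_one_self[of y] y by (simp add: exp_minus field_simps)
    also have "\<dots> \<le> 1 - y / 2"
    proof -
      have "y * y \<le> 1 * y" using y by (intro mult_right_mono) auto
      then have "1 \<le> (1 - y / 2) * (1 + y)" by (simp add: algebra_simps)
      then show ?thesis using y by (simp add: field_simps)
    qed
    finally show ?thesis by (simp add: y_def)
  qed
  finally have 1: "(x / a) powr \<beta> \<le> 1 - \<beta> / (2 * a)" .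
  have x1: "1 \<le> x powr \<alpha>" using assms by (simp add: ge_one_powr_ge_zero)
  have "x * a powr (\<alpha> - 1) = x powr \<alpha> * (x / a) powr \<beta>"
  proof -
    have "a powr (\<alpha> - 1) = 1 / a powr \<beta>" using powr_minus_divide[of a \<beta>] by (simp add: \<beta>_def)
    then have "(x / a) powr \<beta> = x powr (1 - \<alpha>) * a powr (\<alpha> - 1)"
      using powr_divide[of x a \<beta>] assms a by (simp add: \<beta>_def)
    moreover have "x powr \<alpha> * x powr (1 - \<alpha>) = x" using assms by (simp flip: powr_add)
    ultimately show ?thesis by (metis mult.assoc)
  qed
  also have "\<dots> \<le> x powr \<alpha> * (1 - \<beta> / (2 * a))" by (rule mult_left_mono[OF 1]) simp
  finally have "x * a powr (\<alpha> - 1) + x powr \<alpha> * (\<beta> / (2 * a)) \<le> x powr \<alpha>" by (simp add: algebra_simps)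
  moreover have "1 * (\<beta> / (2 * a)) \<le> x powr \<alpha> * (\<beta> / (2 * a))"
    by (rule mult_right_mono[OF x1]) (use \<beta> a in auto)
  ultimately show ?thesis by (simp add: \<beta>_def)
qed

lemma powr_price_le:
  fixes x a \<alpha> :: real
  assumes "0 < x" "x \<le> a" "\<alpha> \<le> 1"
  shows "x * a powr (\<alpha> - 1) \<le> x powr \<alpha>"
proof -
  have "a powr (\<alpha> - 1) \<le> x powr (\<alpha> - 1)" using assms by (intro powr_mono2') auto
  then have "x * a powr (\<alpha> - 1) \<le> x * x powr (\<alpha> - 1)" using assms by (intro mult_left_mono) auto
  also have "\<dots> = x powr \<alpha>" using assms powr_add[of x 1 "\<alpha> - 1"] by simp
  finally show ?thesis .
qed

text \<open>Here \<open>\<pi>\<close> is an upper bound of the prices, not the constant of the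
  circle. Its bound \<open>1 / (2 * real m)\<close> makes it small against the distance of two
  groups, and \<open>2 * \<pi> < 1 - \<alpha>\<close> makes it small against the gap in
  \<open>powr_split_gap\<close>.\<close>

locale groups =
  fixes Src :: "nat set" and grp :: "nat \<Rightarrow> nat" and m k B :: nat and \<alpha> \<pi> :: real
  assumes fin: "finite Src" and grp: "grp ` Src = {..<m}" and B1: "B \<ge> 1" and m1: "m \<ge> 1"
    and \<alpha>: "0 \<le> \<alpha>" "\<alpha> < 1" and \<pi>0: "0 < \<pi>"
    and price: "\<And>g. g < m \<Longrightarrow> real (card {s \<in> Src. grp s = g}) powr (\<alpha> - 1) \<le> \<pi>"
    and \<pi>m: "\<pi> \<le> 1 / (2 * real m)" and \<pi>\<alpha>: "2 * \<pi> < 1 - \<alpha>"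
begin

definition sz :: "nat \<Rightarrow> nat" where "sz g = card {s \<in> Src. grp s = g}"

definition inst :: flamecast where
  "inst = \<lparr>sources = Src, sinks = {..<k}, src_pos = (\<lambda>s. gpt m (grp s)), snk_pos = (\<lambda>_. (0, 0)),
     caps = [B, B, B], cost_exp = \<alpha>\<rparr>"

text \<open>This is the cost if every group has a hub at its own position, at distance 1 from the
  centre.\<close>

definition base_cost :: real where "base_cost = (\<Sum>g<m. real (sz g) powr \<alpha>)"

lemma grp_less: "s \<in> Src \<Longrightarrow> grp s < m" using grp by auto

lemma sz_pos: "g < m \<Longrightarrow> sz g > 0"
proof -
  assume "g < m"
  then obtain s where "s \<in> Src" "grp s = g" using grp by (metis imageE lessThan_iff)
  then have "{s \<in> Src. grp s = g} \<noteq> {}" by blast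
  then show ?thesis using fin by (simp add: sz_def card_gt_0_iff)
qed

lemma flamecast_inst: "flamecast_instance inst" "intermediate_layers inst = 1" "sources inst \<noteq> {}"
  "equally_spaced inst (0, 0) 1 0 m grp"
proof -
  show "flamecast_instance inst" "intermediate_layers inst = 1"
    using fin B1 \<alpha> by (auto simp: flamecast_instance_def inst_def intermediate_layers_def)
  have "0 \<in> grp ` Src" using grp m1 by auto
  then show "sources inst \<noteq> {}" by (auto simp: inst_def)
  have "dist (gpt m g) (0, 0) = 1" for g using norm_gpt by (simp add: dist_norm zero_prod_def[symmetric])
  then show "equally_spaced inst (0, 0) 1 0 m grp"
    using grp by (auto simp: equally_spaced_def circular_def inst_def gpt_def)
qed

definition sprice :: "nat \<Rightarrow> real" where "sprice s = real (sz (grp s)) powr (\<alpha> - 1)"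

lemma sprice_le: "s \<in> Src \<Longrightarrow> sprice s \<le> \<pi>"
  using price[OF grp_less] by (simp add: sprice_def sz_def)

lemma sum_sprice: "(\<Sum>s\<in>Src. sprice s) = base_cost"
proof -
  have "(\<Sum>s\<in>Src. sprice s) = (\<Sum>g<m. \<Sum>s\<in>{s \<in> Src. grp s = g}. sprice s)"
    using sum.group[of Src "{..<m}" grp sprice] fin grp by simp
  also have "\<dots> = base_cost"
    unfolding base_cost_def
  proof (rule sum.cong)
    fix g assume g: "g \<in> {..<m}"
    have "(\<Sum>s\<in>{s \<in> Src. grp s = g}. sprice s) = (\<Sum>s\<in>{s \<in> Src. grp s = g}. real (sz g) powr (\<alpha> - 1))"
      by (rule sum.cong) (auto simp: sprice_def)
    also have "\<dots> = real (sz g) * real (sz g) powr (\<alpha> - 1)" by (simp add: sz_def)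
    also have "\<dots> = real (sz g) powr \<alpha>"
      using sz_pos[of g] g powr_add[of "real (sz g)" 1 "\<alpha> - 1"] by simp
    finally show "(\<Sum>s\<in>{s \<in> Src. grp s = g}. sprice s) = real (sz g) powr \<alpha>" .
  qed simp
  finally show ?thesis .
qed

lemma base_cost_le: "base_cost \<le> real (card Src) * \<pi>"
  unfolding sum_sprice[symmetric] using sum_mono[of Src sprice "\<lambda>_. \<pi>"] sprice_le by simp

lemma sz_le: "sz g \<le> card Src"
  unfolding sz_def by (rule card_mono) (use fin in auto)

abbreviation spt :: "nat \<Rightarrow> point" where "spt s \<equiv> gpt m (grp s)"

text \<open>
  At most one group has its position closer than 1/m to p; every other source pays more than
  twice its price for the way to p.
\<close>
lemma hub_cost:
  assumes H: "H \<subseteq> Src" "H \<noteq> {}" and l: "card H \<le> l"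
  shows "(\<Sum>s\<in>H. sprice s) \<le> (\<Sum>s\<in>H. norm (spt s - p)) + norm p * real l powr \<alpha>"
    and "\<not> (\<exists>g. H = {s \<in> Src. grp s = g}) \<Longrightarrow>
      (\<Sum>s\<in>H. sprice s) + \<pi> / real (card Src) < (\<Sum>s\<in>H. norm (spt s - p)) + norm p * real l powr \<alpha>"
proof -
  have finH: "finite H" using H fin finite_subset by blast
  have nS: "real (card Src) \<ge> 1" using H fin by (metis One_nat_def Suc_leI card_gt_0_iff of_nat_1 of_nat_le_iff subset_empty)
  have "\<exists>g0. (\<exists>s\<in>H. grp s = g0) \<and> (\<forall>s\<in>H. grp s \<noteq> g0 \<longrightarrow> 1 / real m \<le> norm (spt s - p))"
  proof (cases "\<exists>s\<in>H. norm (spt s - p) < 1 / real m")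
    case True
    then obtain s0 where s0: "s0 \<in> H" "norm (spt s0 - p) < 1 / real m" by blast
    have "1 / real m \<le> norm (spt s - p)" if "s \<in> H" "grp s \<noteq> grp s0" for s
    proof -
      have "2 / real m \<le> norm (spt s - spt s0)" using that s0 H grp_less by (intro dist_gpt_ge) auto
      also have "\<dots> \<le> norm (spt s - p) + norm (spt s0 - p)"
        using norm_triangle_ineq4[of "spt s - p" "spt s0 - p"] by simp
      finally show ?thesis using s0(2) by linarith
    qed
    then show ?thesis using s0(1) by blast
  next
    \<comment> \<open>If no source is close to \<open>p\<close>, any group that occurs in
      \<open>H\<close> can take the place of the close one.\<close>
    case False
    then show ?thesis using H(2) by fastforce
  qed
  then obtain g0 where g0: "\<exists>s\<in>H. grp s = g0" "\<And>s. s \<in> H \<Longrightarrow> grp s \<noteq> g0 \<Longrightarrow> 1 / real m \<le> norm (spt s - p)" by blast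
  define H0 H1 where "H0 = {s \<in> H. grp s = g0}" and "H1 = {s \<in> H. grp s \<noteq> g0}"
  have H01: "H = H0 \<union> H1" "H0 \<inter> H1 = {}" "finite H0" "finite H1" using finH by (auto simp: H0_def H1_def)
  have split: "(\<Sum>s\<in>H. F s) = (\<Sum>s\<in>H0. F s) + (\<Sum>s\<in>H1. F s)" for F :: "nat \<Rightarrow> real"
    unfolding H01(1) by (rule sum.union_disjoint) (use H01 in auto)
  have g0m: "g0 < m" using g0(1) H(1) grp_less by blast
  define x where "x = card H0"
  have x1: "x \<ge> 1" using g0(1) H01(3) by (auto simp: x_def H0_def card_gt_0_iff Suc_le_eq)
  have H0sub: "H0 \<subseteq> {s \<in> Src. grp s = g0}" using H(1) by (auto simp: H0_def)
  have xa: "x \<le> sz g0" unfolding x_def sz_def by (rule card_mono[OF _ H0sub]) (use fin in auto)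
  have xl: "x \<le> l" using l card_mono[OF finH, of H0] H01 unfolding x_def by auto
  \<comment> \<open>Since \<open>real x powr \<alpha>\<close> is at most \<open>real x\<close> and
    at most \<open>real l powr \<alpha>\<close>, both the ways of the sources to \<open>p\<close>
    and the way from \<open>p\<close> to the centre cost at least
    \<open>real x powr \<alpha>\<close> per unit of length, and these two lengths add up to at least
    1.\<close>
  have c0: "real x powr \<alpha> \<le> (\<Sum>s\<in>H0. norm (spt s - p)) + norm p * real l powr \<alpha>"
  proof -
    have "(\<Sum>s\<in>H0. norm (spt s - p)) = real x * norm (gpt m g0 - p)" by (simp add: H0_def x_def)
    moreover have "real x powr \<alpha> \<le> real x" using x1 \<alpha> powr_mono[of \<alpha> 1 "real x"] by simp
    moreover have "real x powr \<alpha> \<le> real l powr \<alpha>" using xl x1 \<alpha> by (intro powr_mono2) auto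
    moreover have "1 \<le> norm (gpt m g0 - p) + norm p" using norm_triangle_sub[of "gpt m g0" p] norm_gpt[of m g0] by simp
    ultimately have "real x powr \<alpha> * 1 \<le> real x powr \<alpha> * (norm (gpt m g0 - p) + norm p)"
      "real x powr \<alpha> * norm (gpt m g0 - p) \<le> (\<Sum>s\<in>H0. norm (spt s - p))"
      "norm p * real x powr \<alpha> \<le> norm p * real l powr \<alpha>"
      using mult_left_mono[of 1 "norm (gpt m g0 - p) + norm p" "real x powr \<alpha>"]
      by (auto intro: mult_left_mono mult_right_mono simp del: mult_cancel_left1 mult_le_cancel_left1)
    then show ?thesis by (simp add: algebra_simps)
  qed
  have p0: "(\<Sum>s\<in>H0. sprice s) = real x * real (sz g0) powr (\<alpha> - 1)" by (simp add: H0_def x_def sprice_def)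
  have c1: "(\<Sum>s\<in>H1. sprice s) + real (card H1) * \<pi> \<le> (\<Sum>s\<in>H1. norm (spt s - p))"
  proof -
    have "sprice s + \<pi> \<le> norm (spt s - p)" if "s \<in> H1" for s
    proof -
      have "sprice s \<le> \<pi>" using that H by (intro sprice_le) (auto simp: H1_def)
      moreover have "2 * \<pi> \<le> 1 / real m" using \<pi>m by (simp add: field_simps)
      moreover have "1 / real m \<le> norm (spt s - p)" using g0(2) that by (auto simp: H1_def)
      ultimately show ?thesis by linarith
    qed
    then have "(\<Sum>s\<in>H1. sprice s + \<pi>) \<le> (\<Sum>s\<in>H1. norm (spt s - p))" by (intro sum_mono) auto
    then show ?thesis by (simp add: sum.distrib)
  qed
  have p0': "real x * real (sz g0) powr (\<alpha> - 1) \<le> real x powr \<alpha>" using x1 xa \<alpha> by (intro powr_price_le) auto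
  have c1': "0 \<le> real (card H1) * \<pi>" using \<pi>0 by simp
  show "(\<Sum>s\<in>H. sprice s) \<le> (\<Sum>s\<in>H. norm (spt s - p)) + norm p * real l powr \<alpha>"
    unfolding split using c0 c1 p0 p0' c1' by linarith
  assume nf: "\<not> (\<exists>g. H = {s \<in> Src. grp s = g})"
  show "(\<Sum>s\<in>H. sprice s) + \<pi> / real (card Src) < (\<Sum>s\<in>H. norm (spt s - p)) + norm p * real l powr \<alpha>"
  \<comment> \<open>Either all sources are from one group that is not complete, and
    \<open>powr_split_gap\<close> applies, or some source belongs to another group and pays an extra
    \<open>\<pi>\<close>, which is at least twice the claimed excess because there are two sources
    or more.\<close>
  proof (cases "H1 = {}")
    case True
    then have "H0 \<noteq> {s \<in> Src. grp s = g0}" using nf H01(1) by auto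
    then have "x < sz g0" unfolding x_def sz_def using H0sub fin by (intro psubset_card_mono) auto
    then have "real x * real (sz g0) powr (\<alpha> - 1) + (1 - \<alpha>) / (2 * real (sz g0)) \<le> real x powr \<alpha>"
      using x1 \<alpha> by (intro powr_split_gap) auto
    moreover have "\<pi> / real (card Src) < (1 - \<alpha>) / (2 * real (sz g0))"
    proof -
      have "\<pi> / real (card Src) < (1 - \<alpha>) / 2 / real (card Src)" using \<pi>\<alpha> nS by (intro divide_strict_right_mono) auto
      also have "\<dots> \<le> (1 - \<alpha>) / 2 / real (sz g0)"
        using \<alpha> sz_le[of g0] sz_pos[OF g0m] by (intro divide_left_mono) auto
      finally show ?thesis by simp
    qed
    ultimately show ?thesis unfolding split True using c0 p0 by simp
  next
    case False
    have "2 \<le> card Src"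
    proof -
      have "1 \<le> card H1" using False H01 by (simp add: card_gt_0_iff Suc_le_eq)
      moreover have "card H0 + card H1 = card H" using H01 card_Un_disjoint[of H0 H1] by simp
      moreover have "card H \<le> card Src" using H fin by (intro card_mono) auto
      ultimately show ?thesis using x1 unfolding x_def by linarith
    qed
    then have "\<pi> / real (card Src) \<le> \<pi> / 2" using \<pi>0 by (intro divide_left_mono) auto
    moreover have "1 * \<pi> \<le> real (card H1) * \<pi>"
      using False H01 \<pi>0 by (intro mult_right_mono) (auto simp: card_gt_0_iff Suc_le_eq)
    ultimately show ?thesis unfolding split using c0 c1 p0 p0' \<pi>0 by linarith
  qed
qed

end

section \<open>Layouts\<close>

lemma relpow_single_valued:
  assumes "single_valued R" "(v, a) \<in> R ^^ k" "(v, b) \<in> R ^^ (k + j)"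
  shows "(a, b) \<in> R ^^ j"
  using assms(2,3)
proof (induction k arbitrary: v)
  case 0
  then show ?case by simp
next
  case (Suc k)
  from relpow_Suc_D2[OF Suc.prems(1)] obtain y where y: "(v, y) \<in> R" "(y, a) \<in> R ^^ k" by blast
  from Suc.prems(2) have "(v, b) \<in> R ^^ Suc (k + j)" by simp
  from relpow_Suc_D2[OF this] obtain y' where y': "(v, y') \<in> R" "(y', b) \<in> R ^^ (k + j)" by blast
  have "y = y'" using assms(1) y(1) y'(1) by (auto dest: single_valuedD)
  with Suc.IH y y' show ?case by blast
qed

text \<open>Paths in a forest are determined by their start, and a path that has reached a root
  cannot be continued, so \<open>THE\<close> in the definition of the layer has a unique
  solution.\<close>

lemma layer_eq:
  assumes F: "rooted_forest L" and r: "r \<in> roots L" "(v, r) \<in> arcs L ^^ k"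
  shows "layer L v = k"
  unfolding layer_def
proof (rule the_equality)
  show "\<exists>r\<in>roots L. (v, r) \<in> arcs L ^^ k" using r by blast
next
  fix k' assume "\<exists>r\<in>roots L. (v, r) \<in> arcs L ^^ k'"
  then obtain r' where r': "r' \<in> roots L" "(v, r') \<in> arcs L ^^ k'" by blast
  have sv: "single_valued (arcs L)" using F by (simp add: rooted_forest_def)
  have z: "j = 0" if ar: "a \<in> roots L" "(a, b) \<in> arcs L ^^ j" for a b j
  proof (cases j)
    case (Suc i)
    then obtain y where "(a, y) \<in> arcs L" using ar(2) relpow_Suc_D2 by metis
    then show ?thesis using ar(1) by (simp add: roots_def)
  qed simp
  show "k' = k"
  proof (cases "k \<le> k'")
    case True
    then show ?thesis using relpow_single_valued[OF sv r(2), of r' "k' - k"] r' z[OF r(1)] by fastforce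
  next
    case False
    then show ?thesis using relpow_single_valued[OF sv r'(2), of r "k - k'"] r z[OF r'(1)] by fastforce
  qed
qed

lemma reach_root:
  assumes F: "rooted_forest L" and v: "v \<in> verts L"
  shows "\<exists>k. \<exists>r\<in>roots L. (v, r) \<in> arcs L ^^ k"
proof -
  have sub: "arcs L \<subseteq> verts L \<times> verts L" using F by (simp add: rooted_forest_def)
  have "finite (arcs L)" using F finite_subset[OF sub] by (simp add: rooted_forest_def)
  then have "wf ((arcs L)\<inverse>)" using F by (intro finite_acyclic_wf_converse) (auto simp: rooted_forest_def)
  then show ?thesis using v
  proof (induction v rule: wf_induct_rule)
    case (less v)
    show ?case
    proof (cases "v \<in> roots L")
      case True
      then show ?thesis by (intro exI[of _ 0]) auto
    next
      case False
      then obtain u where u: "(v, u) \<in> arcs L" using less.prems by (auto simp: roots_def)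
      then obtain k r where "r \<in> roots L" "(u, r) \<in> arcs L ^^ k" using less.IH[of u] sub by blast
      then show ?thesis using relpow_Suc_I2[OF u] by blast
    qed
  qed
qed

context groups
begin

definition pure :: "layout \<Rightarrow> bool" where
  "pure L \<longleftrightarrow> (\<forall>s\<in>Src. \<forall>s'\<in>Src. grp s = grp s' \<longrightarrow> (\<exists>p. (Source s, p) \<in> arcs L \<and> (Source s', p) \<in> arcs L))"

definition packing :: bool where
  "packing \<longleftrightarrow> (\<exists>f. (\<forall>g<m. f g < k) \<and> (\<forall>t<k. (\<Sum>g | g < m \<and> f g = t. sz g) \<le> B))"

lemma sum_sz: "(\<Sum>g | g < m \<and> f g = t. sz g) = card {s \<in> Src. f (grp s) = t}"
proof -
  have "card {s \<in> Src. f (grp s) = t} = card (\<Union>g\<in>{g. g < m \<and> f g = t}. {s \<in> Src. grp s = g})"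
    by (rule arg_cong[where f = card]) (use grp_less in auto)
  also have "\<dots> = (\<Sum>g | g < m \<and> f g = t. card {s \<in> Src. grp s = g})"
    by (rule card_UN_disjoint) (use fin in auto)
  finally show ?thesis by (simp add: sz_def)
qed

section \<open>Lower bounds for an arbitrary valid layout\<close>

context
  fixes L assumes V: "valid_layout inst L"
begin

lemma forest: "rooted_forest L" and layer_le: "v \<in> verts L \<Longrightarrow> layer L v \<le> 2"
  and leaves_eq: "leaves L = Source ` Src" and roots_sub: "roots L \<subseteq> Sink ` {..<k}"
  and place_src: "s \<in> Src \<Longrightarrow> place L (Source s) = spt s" and load_le: "v \<in> verts L \<Longrightarrow> load L v \<le> B"
  and place_root: "v \<in> roots L \<Longrightarrow> place L v = 0"
proof -
  have T: "is_topology inst L" using V by (simp add: valid_layout_def valid_topology_def)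
  have E: "is_embedding inst L" using V by (simp add: valid_layout_def)
  show "rooted_forest L" "leaves L = Source ` Src" "roots L \<subseteq> Sink ` {..<k}"
    using T by (auto simp: is_topology_def inst_def)
  show l: "layer L v \<le> 2" if "v \<in> verts L" for v
    using T that by (auto simp: is_topology_def inst_def intermediate_layers_def)
  show "place L (Source s) = spt s" if "s \<in> Src" using E that by (simp add: is_embedding_def inst_def)
  show "place L v = 0" if "v \<in> roots L" for v
    using E that T by (auto simp: is_embedding_def is_topology_def inst_def zero_prod_def)
  show "load L v \<le> B" if "v \<in> verts L" for v
  proof -
    have "[B, B, B] ! layer L v = B" using l[OF that] by (auto simp: le_Suc_eq numeral_2_eq_2)
    then show ?thesis using V that by (auto simp: valid_layout_def valid_topology_def inst_def)
  qed
qed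

lemma arcs_verts: "(u, v) \<in> arcs L \<Longrightarrow> u \<in> verts L \<and> v \<in> verts L"
  using forest by (auto simp: rooted_forest_def)

lemma finite_arcs: "finite (arcs L)"
  using forest finite_subset[of "arcs L" "verts L \<times> verts L"] by (simp add: rooted_forest_def)

lemma arcs_unique: "(u, v) \<in> arcs L \<Longrightarrow> (u, v') \<in> arcs L \<Longrightarrow> v = v'"
  using forest by (auto simp: rooted_forest_def dest: single_valuedD)

definition par :: "vertex \<Rightarrow> vertex" where "par v = (THE p. (v, p) \<in> arcs L)"

lemma par_eq: "(u, v) \<in> arcs L \<Longrightarrow> par u = v"
  unfolding par_def using arcs_unique by blast

lemma src_arc: "s \<in> Src \<Longrightarrow> (Source s, par (Source s)) \<in> arcs L"
proof -
  assume s: "s \<in> Src"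
  then have v: "Source s \<in> verts L" using leaves_eq by (auto simp: leaves_def)
  have "Source s \<notin> roots L" using roots_sub by auto
  then obtain p where "(Source s, p) \<in> arcs L" using v by (auto simp: roots_def)
  then show ?thesis using par_eq by metis
qed

abbreviation spar :: "nat \<Rightarrow> vertex" where "spar s \<equiv> par (Source s)"

text \<open>With one intermediate layer a source has depth at most 2, so a parent that is not a root
  hangs directly below one.\<close>

lemma hub_arc: "s \<in> Src \<Longrightarrow> spar s \<notin> roots L \<Longrightarrow> (spar s, par (spar s)) \<in> arcs L \<and> par (spar s) \<in> roots L"
proof -
  assume s: "s \<in> Src" and nr: "spar s \<notin> roots L"
  have pv: "spar s \<in> verts L" using src_arc[OF s] arcs_verts by blast
  then obtain p where p: "(spar s, p) \<in> arcs L" using nr by (auto simp: roots_def)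
  have "p \<in> roots L"
  proof (rule ccontr)
    assume "p \<notin> roots L"
    then obtain p3 where p3: "(p, p3) \<in> arcs L" using arcs_verts[OF p] by (auto simp: roots_def)
    then obtain j r where r: "r \<in> roots L" "(p3, r) \<in> arcs L ^^ j" using reach_root[OF forest] arcs_verts by blast
    have "(Source s, r) \<in> arcs L ^^ Suc (Suc (Suc j))"
      using relpow_Suc_I2[OF src_arc[OF s] relpow_Suc_I2[OF p relpow_Suc_I2[OF p3 r(2)]]] .
    from layer_eq[OF forest r(1) this] layer_le[of "Source s"] arcs_verts[OF src_arc[OF s]] show False by simp
  qed
  then show ?thesis using p par_eq by metis
qed

lemma not_source: "s \<in> Src \<Longrightarrow> s' \<in> Src \<Longrightarrow> spar s \<noteq> Source s'"
  using src_arc[of s] leaves_eq by (auto simp: leaves_def)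

lemma load_ge: "S \<subseteq> Src \<Longrightarrow> (\<And>s. s \<in> S \<Longrightarrow> (Source s, v) \<in> (arcs L)\<^sup>*) \<Longrightarrow> card S \<le> load L v"
proof -
  assume S: "S \<subseteq> Src" "\<And>s. s \<in> S \<Longrightarrow> (Source s, v) \<in> (arcs L)\<^sup>*"
  have "finite {s. Source s \<in> verts L}"
    using forest finite_vimageI[of "verts L" Source] by (auto simp: rooted_forest_def vimage_def inj_on_def)
  then have f: "finite {s. Source s \<in> verts L \<and> (Source s, v) \<in> (arcs L)\<^sup>*}" by simp
  show ?thesis unfolding load_def
    by (rule card_mono[OF f]) (use S leaves_eq in \<open>auto simp: leaves_def\<close>)
qed

definition kids :: "vertex \<Rightarrow> nat set" where "kids v = {s \<in> Src. spar s = v}"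

definition arc_cost :: "vertex \<times> vertex \<Rightarrow> real" where
  "arc_cost = (\<lambda>(u, v). norm (place L u - place L v) * real (load L u) powr \<alpha>)"

text \<open>The arcs of the layout are charged to the parents of sources. An arc that leaves a
  source is counted with load 1, and since the centre is the origin, the length of the arc to the
  root is a norm.\<close>

definition local_cost :: "vertex \<Rightarrow> real" where
  "local_cost v = (\<Sum>s\<in>kids v. norm (spt s - place L v)) +
     (if v \<in> roots L then 0 else norm (place L v) * real (load L v) powr \<alpha>)"

lemma layout_cost_ge: "(\<Sum>v\<in>spar ` Src. local_cost v) \<le> layout_cost inst L"
proof -
  let ?A1 = "(\<lambda>s. (Source s, spar s)) ` Src" and ?H = "spar ` Src - roots L"
  let ?A2 = "(\<lambda>v. (v, par v)) ` ?H"
  have fH: "finite ?H" using fin by simp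
  have nn: "0 \<le> arc_cost e" for e by (cases e) (simp add: arc_cost_def)
  have "(\<Sum>v\<in>spar ` Src. local_cost v) = (\<Sum>v\<in>spar ` Src. \<Sum>s\<in>kids v. norm (spt s - place L (spar s))) +
      (\<Sum>v\<in>spar ` Src. if v \<in> roots L then 0 else norm (place L v) * real (load L v) powr \<alpha>)"
    unfolding local_cost_def sum.distrib by (simp add: kids_def)
  also have "(\<Sum>v\<in>spar ` Src. \<Sum>s\<in>kids v. norm (spt s - place L (spar s))) = (\<Sum>s\<in>Src. norm (spt s - place L (spar s)))"
    unfolding kids_def using sum.group[of Src "spar ` Src" spar "\<lambda>s. norm (spt s - place L (spar s))"] fin by simp
  also have "\<dots> \<le> (\<Sum>s\<in>Src. arc_cost (Source s, spar s))"
  proof (rule sum_mono)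
    fix s assume s: "s \<in> Src"
    have "card {s} \<le> load L (Source s)" by (rule load_ge) (use s in auto)
    then have "1 \<le> real (load L (Source s)) powr \<alpha>" using \<alpha> by (intro ge_one_powr_ge_zero) auto
    then have "norm (spt s - place L (spar s)) * 1 \<le> norm (spt s - place L (spar s)) * real (load L (Source s)) powr \<alpha>"
      by (intro mult_left_mono) auto
    then show "norm (spt s - place L (spar s)) \<le> arc_cost (Source s, spar s)"
      using place_src[OF s] by (simp add: arc_cost_def)
  qed
  also have "\<dots> = sum arc_cost ?A1" by (subst sum.reindex) (auto simp: inj_on_def)
  also have "(\<Sum>v\<in>spar ` Src. if v \<in> roots L then 0 else norm (place L v) * real (load L v) powr \<alpha>) =
      (\<Sum>v\<in>?H. norm (place L v) * real (load L v) powr \<alpha>)"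
    by (rule sum.mono_neutral_cong_right) (use fin in auto)
  also have "\<dots> = (\<Sum>v\<in>?H. arc_cost (v, par v))"
    by (rule sum.cong) (auto simp: arc_cost_def place_root hub_arc)
  also have "\<dots> = sum arc_cost ?A2" by (subst sum.reindex) (auto simp: inj_on_def)
  finally have "(\<Sum>v\<in>spar ` Src. local_cost v) \<le> sum arc_cost ?A1 + sum arc_cost ?A2" by simp
  also have "\<dots> = sum arc_cost (?A1 \<union> ?A2)"
    by (rule sum.union_disjoint[symmetric]) (use fin not_source in force)+
  also have "\<dots> \<le> sum arc_cost (arcs L)"
    by (rule sum_mono2[OF finite_arcs]) (use nn src_arc hub_arc in auto)
  finally show ?thesis by (simp add: layout_cost_def arc_cost_def inst_def)
qed

definition good :: "vertex \<Rightarrow> bool" where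
  "good v \<longleftrightarrow> v \<notin> roots L \<and> (\<exists>g. kids v = {s \<in> Src. grp s = g})"

text \<open>Steiner vertices are settled by \<open>hub_cost\<close>. A source whose parent is a root
  pays the full radius 1, which exceeds its price by at least 1 - \<pi>; as \<pi> < 1 / 2, this is
  more than the claimed excess.\<close>

lemma local_cost_ge:
  assumes "v \<in> spar ` Src"
  shows "(\<Sum>s\<in>kids v. sprice s) \<le> local_cost v"
    "\<not> good v \<Longrightarrow> (\<Sum>s\<in>kids v. sprice s) + \<pi> / real (card Src) < local_cost v"
proof -
  have K: "kids v \<subseteq> Src" "kids v \<noteq> {}" "finite (kids v)" using assms fin by (auto simp: kids_def)
  have cl: "card (kids v) \<le> load L v"
    by (rule load_ge[OF K(1)]) (use src_arc in \<open>auto simp: kids_def\<close>)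
  have *: "(\<Sum>s\<in>kids v. sprice s) + \<pi> / real (card Src) < local_cost v" if r: "v \<in> roots L"
  proof -
    have lc: "local_cost v = (\<Sum>s\<in>kids v. 1)" using r place_root[OF r] by (simp add: local_cost_def norm_gpt)
    have p4: "\<pi> \<le> 1 / 2"
    proof -
      have "1 / (2 * real m) \<le> 1 / 2" using m1 by (simp add: field_simps)
      then show ?thesis using \<pi>m by linarith
    qed
    have "(\<Sum>s\<in>kids v. sprice s) \<le> (\<Sum>s\<in>kids v. \<pi>)" by (rule sum_mono) (use K sprice_le in auto)
    then have 1: "(\<Sum>s\<in>kids v. sprice s) \<le> real (card (kids v)) * \<pi>" by simp
    have n1: "1 \<le> card (kids v)" using K by (simp add: Suc_le_eq card_gt_0_iff)
    have "card (kids v) \<le> card Src" using K fin by (intro card_mono) auto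
    then have nS: "real (card Src) \<ge> 1" using n1 by simp
    have "\<pi> / real (card Src) \<le> \<pi> / 1" using nS \<pi>0 by (intro divide_left_mono) auto
    moreover have "1 * (1 - \<pi>) \<le> real (card (kids v)) * (1 - \<pi>)" using n1 p4 by (intro mult_right_mono) auto
    moreover have "\<pi> / real (card Src) < 1 - \<pi> \<or> \<pi> = 1 / 2"
      using p4 calculation(1) by linarith
    moreover have "\<pi> \<noteq> 1 / 2" using \<pi>\<alpha> \<alpha> by auto
    ultimately show ?thesis using 1 by (simp add: lc algebra_simps)
  qed
  show "(\<Sum>s\<in>kids v. sprice s) \<le> local_cost v"
  proof (cases "v \<in> roots L")
    case True
    moreover have "0 \<le> \<pi> / real (card Src)" using \<pi>0 by simp
    ultimately show ?thesis using * by linarith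
  next
    case False
    then show ?thesis using hub_cost(1)[OF K(1,2) cl] by (simp add: local_cost_def)
  qed
  show "(\<Sum>s\<in>kids v. sprice s) + \<pi> / real (card Src) < local_cost v" if "\<not> good v"
  proof (cases "v \<in> roots L")
    case True
    then show ?thesis using * by simp
  next
    case False
    then show ?thesis using hub_cost(2)[OF K(1,2) cl] that by (simp add: local_cost_def good_def)
  qed
qed

text \<open>If every parent had exactly one complete group below it, no group would be divided. So
  some parent exceeds the prices of its sources, and all the others at least reach them.\<close>

lemma impure_cost:
  assumes "\<not> pure L"
  shows "base_cost + \<pi> / real (card Src) < layout_cost inst L"
proof -
  have "\<exists>v\<in>spar ` Src. \<not> good v"
  proof (rule ccontr)
    assume "\<not> (\<exists>v\<in>spar ` Src. \<not> good v)"
    then have g: "good (spar s)" if "s \<in> Src" for s using that by blast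
    have "(Source s', spar s) \<in> arcs L" if "s \<in> Src" "s' \<in> Src" "grp s = grp s'" for s s'
    proof -
      from g[OF that(1)] obtain h where h: "kids (spar s) = {s \<in> Src. grp s = h}" by (auto simp: good_def)
      have "s \<in> kids (spar s)" using that by (simp add: kids_def)
      then have "s' \<in> kids (spar s)" using h that by auto
      then show ?thesis using src_arc[OF that(2)] by (simp add: kids_def)
    qed
    then have "pure L" unfolding pure_def using src_arc by blast
    with assms show False by simp
  qed
  then obtain v0 where v0: "v0 \<in> spar ` Src" "\<not> good v0" by blast
  have fV: "finite (spar ` Src)" using fin by simp
  have "base_cost = (\<Sum>v\<in>spar ` Src. \<Sum>s\<in>kids v. sprice s)"
    unfolding sum_sprice[symmetric] kids_def using sum.group[of Src "spar ` Src" spar sprice] fin by simp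
  also have "\<dots> = (\<Sum>s\<in>kids v0. sprice s) + (\<Sum>v\<in>spar ` Src - {v0}. \<Sum>s\<in>kids v. sprice s)"
    by (rule sum.remove[OF fV v0(1)])
  finally have "base_cost + \<pi> / real (card Src) < local_cost v0 + (\<Sum>v\<in>spar ` Src - {v0}. \<Sum>s\<in>kids v. sprice s)"
    using local_cost_ge(2)[OF v0] by linarith
  also have "\<dots> \<le> local_cost v0 + (\<Sum>v\<in>spar ` Src - {v0}. local_cost v)"
    by (intro add_left_mono sum_mono local_cost_ge(1)) auto
  also have "\<dots> = (\<Sum>v\<in>spar ` Src. local_cost v)" by (rule sum.remove[OF fV v0(1), symmetric])
  also have "\<dots> \<le> layout_cost inst L" by (rule layout_cost_ge)
  finally show ?thesis .
qed

text \<open>A group with a common parent ends in a single sink, and the load of a sink counts the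
  sizes of all groups that end there.\<close>

lemma pure_imp_packing:
  assumes P: "pure L"
  shows packing
proof -
  define rt where "rt s = (if spar s \<in> roots L then spar s else par (spar s))" for s
  have rt: "rt s \<in> roots L" "(Source s, rt s) \<in> (arcs L)\<^sup>*" if s: "s \<in> Src" for s
  proof -
    show "rt s \<in> roots L" using hub_arc[OF s] by (auto simp: rt_def)
    show "(Source s, rt s) \<in> (arcs L)\<^sup>*" using src_arc[OF s] hub_arc[OF s]
      by (auto simp: rt_def intro: rtrancl_into_rtrancl)
  qed
  have same: "rt s = rt s'" if ss: "s \<in> Src" "s' \<in> Src" "grp s = grp s'" for s s'
  proof -
    obtain p where "(Source s, p) \<in> arcs L" "(Source s', p) \<in> arcs L" using P[unfolded pure_def, rule_format, OF ss] by blast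
    then have "spar s = spar s'" using par_eq by metis
    then show ?thesis by (simp add: rt_def)
  qed
  define f where "f g = (THE t. \<exists>s\<in>Src. grp s = g \<and> rt s = Sink t)" for g
  have f: "rt s = Sink (f (grp s)) \<and> f (grp s) < k" if s: "s \<in> Src" for s
  proof -
    obtain t where t: "t < k" "rt s = Sink t" using rt(1)[OF s] roots_sub by blast
    have "f (grp s) = t" unfolding f_def
    proof (rule the_equality)
      show "\<exists>s'\<in>Src. grp s' = grp s \<and> rt s' = Sink t" using s t by blast
    next
      fix t' assume "\<exists>s'\<in>Src. grp s' = grp s \<and> rt s' = Sink t'"
      then show "t' = t" using same[OF s] t by force
    qed
    with t show ?thesis by simp
  qed
  have "f g < k" if "g < m" for g
  proof -
    have "g \<in> grp ` Src" using grp that by simp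
    then show ?thesis using f by auto
  qed
  moreover have "(\<Sum>g | g < m \<and> f g = t. sz g) \<le> B" if "t < k" for t
  proof (cases "{s \<in> Src. f (grp s) = t} = {}")
    case True
    then show ?thesis unfolding sum_sz by (simp only: card.empty le0)
  next
    case False
    then obtain s where s: "s \<in> Src" "f (grp s) = t" by blast
    then have "Sink t \<in> roots L" using f rt by metis
    then have "Sink t \<in> verts L" by (simp add: roots_def)
    moreover have "card {s \<in> Src. f (grp s) = t} \<le> load L (Sink t)"
    proof (rule load_ge)
      fix s assume "s \<in> {s \<in> Src. f (grp s) = t}"
      then show "(Source s, Sink t) \<in> (arcs L)\<^sup>*" using rt(2)[of s] f[of s] by auto
    qed auto
    ultimately show ?thesis unfolding sum_sz using load_le by force
  qed
  ultimately show ?thesis unfolding packing_def by blast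
qed

end

text \<open>The construction serves twice: with \<open>grp\<close> for \<open>hb\<close> it attains
  \<open>base_cost\<close> for a given packing, and with a hub for every single source it shows that
  valid layouts exist. In the second case the positions of the hubs are arbitrary.\<close>

definition mk_layout :: "(nat \<Rightarrow> nat) \<Rightarrow> (nat \<Rightarrow> nat) \<Rightarrow> layout" where
  "mk_layout hb f = \<lparr>verts = Source ` Src \<union> Steiner ` hb ` Src \<union> Sink ` f ` hb ` Src,
     arcs = (\<lambda>s. (Source s, Steiner (hb s))) ` Src \<union> (\<lambda>h. (Steiner h, Sink (f h))) ` hb ` Src,
     place = (\<lambda>v. case v of Source s \<Rightarrow> spt s | Steiner h \<Rightarrow> gpt m h | Sink t \<Rightarrow> (0, 0))\<rparr>"

lemma acyclic_rank:
  assumes "\<And>u v. (u, v) \<in> R \<Longrightarrow> rk u < (rk v :: nat)"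
  shows "acyclic R"
proof (rule acyclicI, intro allI notI)
  fix x assume "(x, x) \<in> R\<^sup>+"
  moreover have "rk x < rk y" if "(x, y) \<in> R\<^sup>+" for y
    using that by (induction rule: trancl_induct) (use assms in force)+
  ultimately show False by blast
qed

context
  fixes hb f :: "nat \<Rightarrow> nat"
  assumes fk: "\<And>s. s \<in> Src \<Longrightarrow> f (hb s) < k"
    and hB: "\<And>h. card {s \<in> Src. hb s = h} \<le> B" and tB: "\<And>t. card {s \<in> Src. f (hb s) = t} \<le> B"
begin

abbreviation "L0 \<equiv> mk_layout hb f"

lemma arcs_L0 [simp]: "(Source s, v) \<in> arcs L0 \<longleftrightarrow> s \<in> Src \<and> v = Steiner (hb s)"
  "(Steiner h, v) \<in> arcs L0 \<longleftrightarrow> h \<in> hb ` Src \<and> v = Sink (f h)" "(Sink t, v) \<in> arcs L0 \<longleftrightarrow> False"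
  by (auto simp: mk_layout_def)

lemma arcs_L0_src [simp]: "(v, Source s) \<in> arcs L0 \<longleftrightarrow> False"
  by (cases v) auto

lemma verts_L0 [simp]: "Source s \<in> verts L0 \<longleftrightarrow> s \<in> Src" "Steiner h \<in> verts L0 \<longleftrightarrow> h \<in> hb ` Src"
  "Sink t \<in> verts L0 \<longleftrightarrow> t \<in> f ` hb ` Src"
  by (auto simp: mk_layout_def)

lemma forest_L0: "rooted_forest L0"
  unfolding rooted_forest_def
proof (intro conjI)
  show "finite (verts L0)" "arcs L0 \<subseteq> verts L0 \<times> verts L0" "single_valued (arcs L0)"
    using fin by (auto simp: mk_layout_def single_valued_def)
  show "acyclic (arcs L0)"
    by (rule acyclic_rank[where rk = "\<lambda>v. case v of Source _ \<Rightarrow> 0 | Steiner _ \<Rightarrow> 1 | Sink _ \<Rightarrow> 2"])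
      (auto simp: mk_layout_def)
qed

lemma roots_L0: "roots L0 = Sink ` f ` hb ` Src"
proof (rule set_eqI)
  fix v show "v \<in> roots L0 \<longleftrightarrow> v \<in> Sink ` f ` hb ` Src" by (cases v) (auto simp: roots_def)
qed

lemma leaves_L0: "leaves L0 = Source ` Src"
proof (rule set_eqI)
  fix v
  have a: "(Source s, Steiner (hb s)) \<in> arcs L0" "(Steiner (hb s), Sink (f (hb s))) \<in> arcs L0" if "s \<in> Src" for s using that by auto
  show "v \<in> leaves L0 \<longleftrightarrow> v \<in> Source ` Src"
  proof (cases v)
    case (Source s)
    then show ?thesis by (auto simp: leaves_def)
  next
    case (Sink t)
    then have "v \<notin> leaves L0" using a(2) unfolding leaves_def by (auto simp del: arcs_L0)
    then show ?thesis using Sink by auto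
  next
    case (Steiner h)
    then have "v \<notin> leaves L0" using a(1) unfolding leaves_def by (auto simp del: arcs_L0)
    then show ?thesis using Steiner by auto
  qed
qed

lemma layer_L0: "s \<in> Src \<Longrightarrow> layer L0 (Source s) = 2" "h \<in> hb ` Src \<Longrightarrow> layer L0 (Steiner h) = 1"
  "t \<in> f ` hb ` Src \<Longrightarrow> layer L0 (Sink t) = 0"
proof -
  show 1: "layer L0 (Steiner h) = 1" if "h \<in> hb ` Src" for h
    by (rule layer_eq[OF forest_L0, of "Sink (f h)"]) (use that in \<open>auto simp: roots_L0\<close>)
  show "layer L0 (Sink t) = 0" if "t \<in> f ` hb ` Src" for t
    by (rule layer_eq[OF forest_L0, of "Sink t"]) (use that in \<open>auto simp: roots_L0\<close>)
  show "layer L0 (Source s) = 2" if "s \<in> Src" for s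
  proof (rule layer_eq[OF forest_L0, of "Sink (f (hb s))"])
    have "(Source s, Steiner (hb s)) \<in> arcs L0" "(Steiner (hb s), Sink (f (hb s))) \<in> arcs L0" using that by auto
    then show "(Source s, Sink (f (hb s))) \<in> arcs L0 ^^ 2" by (auto simp: numeral_2_eq_2 relcomp_unfold)
  qed (use that in \<open>auto simp: roots_L0\<close>)
qed

lemma reach_L0:
  assumes "s \<in> Src"
  shows "(Source s, v) \<in> (arcs L0)\<^sup>* \<longleftrightarrow> v \<in> {Source s, Steiner (hb s), Sink (f (hb s))}"
proof
  assume "(Source s, v) \<in> (arcs L0)\<^sup>*"
  then show "v \<in> {Source s, Steiner (hb s), Sink (f (hb s))}"
    by (induction rule: rtrancl_induct) auto
next
  have a: "(Source s, Steiner (hb s)) \<in> arcs L0" "(Steiner (hb s), Sink (f (hb s))) \<in> arcs L0" using assms by auto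
  have "(Source s, Sink (f (hb s))) \<in> (arcs L0)\<^sup>*"
    by (rule converse_rtrancl_into_rtrancl[OF a(1) r_into_rtrancl[OF a(2)]])
  then show "v \<in> {Source s, Steiner (hb s), Sink (f (hb s))} \<Longrightarrow> (Source s, v) \<in> (arcs L0)\<^sup>*"
    using r_into_rtrancl[OF a(1)] by blast
qed

lemma load_L0: "load L0 (Source s) \<le> 1" "load L0 (Steiner h) = card {s \<in> Src. hb s = h}"
  "load L0 (Sink t) = card {s \<in> Src. f (hb s) = t}"
proof -
  have "{s'. Source s' \<in> verts L0 \<and> (Source s', Source s) \<in> (arcs L0)\<^sup>*} \<subseteq> {s}" using reach_L0 by auto
  then show "load L0 (Source s) \<le> 1" unfolding load_def by (metis card.empty card_insert_disjoint card_mono finite.intros empty_iff One_nat_def)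
  have "{s. Source s \<in> verts L0 \<and> (Source s, Steiner h) \<in> (arcs L0)\<^sup>*} = {s \<in> Src. hb s = h}"
    using reach_L0 by auto
  then show "load L0 (Steiner h) = card {s \<in> Src. hb s = h}" by (simp add: load_def)
  have "{s. Source s \<in> verts L0 \<and> (Source s, Sink t) \<in> (arcs L0)\<^sup>*} = {s \<in> Src. f (hb s) = t}"
    using reach_L0 by auto
  then show "load L0 (Sink t) = card {s \<in> Src. f (hb s) = t}" by (simp add: load_def)
qed

lemma valid_L0: "valid_layout inst L0"
  unfolding valid_layout_def valid_topology_def is_topology_def
proof (intro conjI ballI)
  show "rooted_forest L0" by (rule forest_L0)
  fix v assume v: "v \<in> verts L0"
  show "layer L0 v \<le> intermediate_layers inst + 1"
    using v layer_L0 flamecast_inst(2) by (cases v) auto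
  have "[B, B, B] ! layer L0 v = B" using v layer_L0 by (cases v) (auto simp: numeral_2_eq_2)
  moreover have "load L0 v \<le> B" using v load_L0 hB tB B1 by (cases v) (auto intro: le_trans)
  ultimately show "load L0 v \<le> caps inst ! layer L0 v" by (simp add: inst_def)
next
  show "leaves L0 = Source ` sources inst" by (simp add: leaves_L0 inst_def)
  show "roots L0 \<subseteq> Sink ` sinks inst" using fk by (auto simp: roots_L0 inst_def)
  fix v assume "v \<in> verts L0 - leaves L0 - roots L0"
  then show "v \<in> range Steiner" by (cases v) (auto simp: leaves_L0 roots_L0)
next
  show "is_embedding inst L0" by (auto simp: is_embedding_def inst_def mk_layout_def)
qed

end

lemma cost_L0:
  assumes fk: "\<And>g. g < m \<Longrightarrow> f g < k" and tB: "\<And>t. t < k \<Longrightarrow> (\<Sum>g | g < m \<and> f g = t. sz g) \<le> B"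
  shows "valid_layout inst (mk_layout grp f)" "layout_cost inst (mk_layout grp f) = base_cost"
proof -
  have tB': "card {s \<in> Src. f (grp s) = t} \<le> B" for t
  proof (cases "t < k")
    case True
    then show ?thesis using tB[of t] sum_sz[of f t] by simp
  next
    case False
    then have "{s \<in> Src. f (grp s) = t} = {}" using fk grp_less by auto
    then show ?thesis by (simp only: card.empty le0)
  qed
  have hB: "card {s \<in> Src. grp s = h} \<le> B" for h
    using card_mono[of "{s \<in> Src. f (grp s) = f h}" "{s \<in> Src. grp s = h}"] fin tB'[of "f h"] by force
  have fk': "f (grp s) < k" if "s \<in> Src" for s using fk grp_less that by blast
  show "valid_layout inst (mk_layout grp f)" by (rule valid_L0[OF fk' hB tB'])
  have pl: "place (mk_layout grp f) (Steiner h) = gpt m h" "place (mk_layout grp f) (Sink t) = 0" for h t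
    by (simp_all add: mk_layout_def zero_prod_def)
  let ?c = "\<lambda>(u, v). norm (place (mk_layout grp f) u - place (mk_layout grp f) v) * real (load (mk_layout grp f) u) powr \<alpha>"
  let ?A = "(\<lambda>s. (Source s, Steiner (grp s))) ` Src" and ?B = "(\<lambda>h. (Steiner h, Sink (f h))) ` {..<m}"
  have arcs: "arcs (mk_layout grp f) = ?A \<union> ?B" unfolding grp[symmetric] by (simp add: mk_layout_def)
  have "layout_cost inst (mk_layout grp f) = sum ?c (?A \<union> ?B)" unfolding layout_cost_def arcs by (simp add: inst_def)
  also have "\<dots> = sum ?c ?A + sum ?c ?B" by (rule sum.union_disjoint) (use fin in auto)
  also have "sum ?c ?A = 0" by (rule sum.neutral) (auto simp: mk_layout_def)
  also have "sum ?c ?B = (\<Sum>h<m. norm (gpt m h) * real (load (mk_layout grp f) (Steiner h)) powr \<alpha>)"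
    by (subst sum.reindex) (auto simp: inj_on_def pl)
  also have "\<dots> = base_cost"
    unfolding base_cost_def by (rule sum.cong) (auto simp: norm_gpt load_L0[OF fk' hB tB'] sz_def)
  finally show "layout_cost inst (mk_layout grp f) = base_cost" by simp
qed

text \<open>Every source gets a hub of its own, and the hubs are assigned to the sinks in blocks of
  \<open>B\<close>. Splitting the groups removes the difficulty of packing them.\<close>

theorem valid_layout_exists:
  assumes "card Src \<le> k * B"
  shows "\<exists>L. valid_layout inst L"
proof -
  obtain e where e: "inj_on e Src" "e ` Src = {..<card Src}"
    using ex_bij_betw_finite_nat[OF fin] unfolding bij_betw_def by (auto simp: atLeast0LessThan)
  have "card {s \<in> Src. e s = h} \<le> 1" for h
    using e(1) fin by (auto simp: card_le_Suc0_iff_eq inj_on_def)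
  then have 1: "card {s \<in> Src. e s = h} \<le> B" for h using B1 le_trans by blast
  have 2: "card {s \<in> Src. e s div B = t} \<le> B" for t
  proof -
    have "e ` {s \<in> Src. e s div B = t} \<subseteq> {t * B..<t * B + B}"
    proof
      fix y assume "y \<in> e ` {s \<in> Src. e s div B = t}"
      then have "y div B = t" by auto
      then have "t * B + y mod B = y" using div_mult_mod_eq[of y B] by simp
      moreover have "y mod B < B" using B1 by simp
      ultimately show "y \<in> {t * B..<t * B + B}" by (metis atLeastLessThan_iff le_add1 nat_add_left_cancel_less)
    qed
    then have "card (e ` {s \<in> Src. e s div B = t}) \<le> B" using card_mono[of "{t * B..<t * B + B}"] by fastforce
    moreover have "card (e ` {s \<in> Src. e s div B = t}) = card {s \<in> Src. e s div B = t}"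
      by (rule card_image) (use e(1) in \<open>auto simp: inj_on_def\<close>)
    ultimately show ?thesis by simp
  qed
  have 3: "e s div B < k" if "s \<in> Src" for s
  proof -
    have "e s \<in> {..<card Src}" using e(2) that by blast
    then have "e s < k * B" using assms by simp
    then show ?thesis by (rule less_mult_imp_div_less)
  qed
  show ?thesis using valid_L0[of "\<lambda>i. i div B" e, OF 3 1 2] by blast
qed

text \<open>Let n be the number of sources. If a packing exists, the optimum is at most
  \<open>base_cost\<close>, which is at most n * \<pi>. The tolerance 1 / n^2 thus allows for an
  excess of at most \<pi> / n, and an impure layout has more than that.\<close>

theorem pure_iff_packing:
  assumes V: "valid_layout inst L" and c: "layout_cost inst L \<le> (1 + 1 / real (card Src) ^ 2) * opt_cost inst"
  shows "pure L \<longleftrightarrow> packing"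
proof
  assume "pure L"
  then show packing by (rule pure_imp_packing[OF V])
next
  assume packing
  then obtain f where f: "\<And>g. g < m \<Longrightarrow> f g < k" "\<And>t. t < k \<Longrightarrow> (\<Sum>g | g < m \<and> f g = t. sz g) \<le> B"
    unfolding packing_def by blast
  have nn: "0 \<le> layout_cost inst L" for L
    unfolding layout_cost_def by (rule sum_nonneg) auto
  have "opt_cost inst \<le> layout_cost inst (mk_layout grp f)"
    unfolding opt_cost_def by (rule cInf_lower) (use cost_L0(1)[of f] f nn in \<open>auto intro!: bdd_belowI2[of _ 0]\<close>)
  then have o: "opt_cost inst \<le> base_cost" using cost_L0(2)[of f] f by simp
  let ?n = "real (card Src)"
  have n1: "?n > 0" using flamecast_inst(3) fin by (auto simp: inst_def card_gt_0_iff)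
  show "pure L"
  proof (rule ccontr)
    assume "\<not> pure L"
    from impure_cost[OF V this] have "base_cost + \<pi> / ?n < (1 + 1 / ?n ^ 2) * base_cost"
      using c mult_left_mono[OF o, of "1 + 1 / ?n ^ 2"] by simp
    then have "\<pi> / ?n < base_cost / ?n ^ 2" by (simp add: algebra_simps)
    also have "\<dots> \<le> (?n * \<pi>) / ?n ^ 2" by (rule divide_right_mono[OF base_cost_le]) simp
    also have "\<dots> = \<pi> / ?n" using n1 by (simp add: power2_eq_square)
    finally show False by simp
  qed
qed

end

section \<open>Computations as constraint satisfaction\<close>

type_synonym cell = "nat \<times> nat list \<times> nat list \<times> bool list"

text \<open>
  Every cell of the tableau contains the state and the list of the symbols under the heads, which
  are the same in a whole row, and for each tape the symbol at its position and whether the head is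
  there. Broadcasting the symbols that are read makes the transition of a multi-tape machine local.
\<close>
definition cells :: "tm \<Rightarrow> cell set" where
  "cells N = {..<num_states N} \<times> {r. set r \<subseteq> {..<num_symbols N} \<and> length r = num_tapes N} \<times>
     {s. set s \<subseteq> {..<num_symbols N} \<and> length s = num_tapes N} \<times> {h. set h \<subseteq> UNIV \<and> length h = num_tapes N}"

definition csts :: "tm \<Rightarrow> nat" where "csts N = card (cells N)"

text \<open>An arbitrary enumeration is good enough: \<open>N\<close> is fixed during the reduction,
  so programs contain the decoded cells as constants.\<close>

definition cdec :: "tm \<Rightarrow> nat \<Rightarrow> cell" where
  "cdec N = (SOME f. bij_betw f {..<csts N} (cells N))"

lemma finite_cells: "finite (cells N)"
  unfolding cells_def by (intro finite_cartesian_product finite_lists_length_eq) auto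

lemma bij_cdec: "bij_betw (cdec N) {..<csts N} (cells N)"
  unfolding cdec_def csts_def lessThan_atLeast0
  by (rule someI_ex[OF ex_bij_betw_nat_finite[OF finite_cells]])

definition cq :: "cell \<Rightarrow> nat" where "cq a = fst a"
definition cr :: "cell \<Rightarrow> nat list" where "cr a = fst (snd a)"
definition cs :: "cell \<Rightarrow> nat list" where "cs a = fst (snd (snd a))"
definition ch :: "cell \<Rightarrow> bool list" where "ch a = snd (snd (snd a))"

lemma csts_ge2: "wf_tm N \<Longrightarrow> csts N \<ge> 2"
proof -
  assume "wf_tm N"
  then have N: "num_states N \<ge> 2" "num_symbols N \<ge> 3" by (auto simp: wf_tm_def)
  let ?a = "\<lambda>q :: nat. (q, replicate (num_tapes N) (0 :: nat), replicate (num_tapes N) (0 :: nat), replicate (num_tapes N) False)"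
  have sub: "{?a 0, ?a 1} \<subseteq> cells N" using N by (auto simp: cells_def)
  have "card {?a 0, ?a 1} \<le> csts N" unfolding csts_def by (rule card_mono[OF finite_cells sub])
  then show ?thesis by simp
qed

text \<open>A halted machine repeats its configuration, which makes it possible to use the same
  number of rows for all runs on a given input.\<close>

definition ndelta :: "tm \<Rightarrow> cell \<Rightarrow> nat \<times> (nat \<times> move) list" where
  "ndelta N a = (if cq a = 1 then (1, keep (cr a)) else delta N (cq a) (cr a))"

text \<open>The direction \<open>D\<close> is a parameter because a constraint relates two cells at
  one fixed distance only, so each direction of a head needs a constraint of its own.\<close>

definition cmove :: "tm \<Rightarrow> int \<Rightarrow> cell \<Rightarrow> cell \<Rightarrow> bool" where
  "cmove N D a a' \<longleftrightarrow> (\<forall>i<num_tapes N. move_offset (snd (snd (ndelta N a) ! i)) = D \<longrightarrow> ch a' ! i = ch a ! i)"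

definition cwrite :: "tm \<Rightarrow> cell \<Rightarrow> cell \<Rightarrow> bool" where
  "cwrite N a a' \<longleftrightarrow> cq a' = fst (ndelta N a) \<and>
     (\<forall>i<num_tapes N. cs a' ! i = (if ch a ! i then fst (snd (ndelta N a) ! i) else cs a ! i))"

text \<open>Formula for bit \<open>p\<close> of \<open>enc_word x\<close>: even positions carry the
  flags, the last of which is False, and odd positions the bits of \<open>x\<close>. It allows a
  constraint to be evaluated from \<open>x\<close> and the position without building the
  word.\<close>

definition ebit :: "bool list \<Rightarrow> nat \<Rightarrow> bool" where
  "ebit x p \<longleftrightarrow> p \<noteq> 2 * length x \<and> (even p \<or> p div 2 < length x \<and> x ! (p div 2))"

lemma length_enc_word: "length (enc_word x) = 2 * length x + 1"
  by (induction x) (auto simp: enc_word_def)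

lemma enc_word_Cons: "enc_word (b # x) = True # b # enc_word x"
  by (simp add: enc_word_def)

lemma enc_word_nth: "p < 2 * length x + 1 \<Longrightarrow> enc_word x ! p = ebit x p"
proof (induction x arbitrary: p)
  case Nil
  then show ?case by (simp add: enc_word_def ebit_def)
next
  case (Cons b x)
  show ?case
  proof (cases "p < 2")
    case True
    then show ?thesis by (auto simp: less_2_cases_iff enc_word_Cons ebit_def)
  next
    case False
    then obtain p' where p: "p = Suc (Suc p')" by (metis add_2_eq_Suc le_Suc_ex not_less)
    then show ?thesis using Cons by (simp add: enc_word_Cons ebit_def)
  qed
qed

text \<open>Column \<open>T + 1\<close> is tape cell 0. In the part for the certificate bits and
  blanks are left open, which is where the tableau guesses; that no bit follows a blank is left to
  constraint 1 of \<open>okc\<close>.\<close>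

definition init_sym :: "nat \<Rightarrow> nat \<Rightarrow> bool list \<Rightarrow> nat \<Rightarrow> nat \<Rightarrow> bool" where
  "init_sym T q x i a \<longleftrightarrow>
     (if i < T + 1 then a = 0
      else if i < T + 1 + (2 * length x + 1) then a = (if ebit x (i - (T + 1)) then 2 else 1)
      else if i < T + 1 + (2 * length x + 1) + q then a \<le> 2
      else a = 0)"

text \<open>Constraint 0 equates the two assignments, so that the others become relations inside one
  tableau. Constraint 1 compares a cell with its right neighbour, constraint 2 with the cell in the
  next row, and constraints 3 and 4 with the diagonal neighbours there, which a moving head enters.
  The guards on \<open>t\<close> and \<open>i\<close> discard the pairs that arise by running over
  the end of a row or of the whole tableau.\<close>

definition okc :: "tm \<Rightarrow> nat \<Rightarrow> nat \<Rightarrow> bool list \<Rightarrow> nat \<Rightarrow> nat \<Rightarrow> nat \<Rightarrow> nat \<Rightarrow> cell \<Rightarrow> cell \<Rightarrow> bool" where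
  "okc N T q x j z t i a a' \<longleftrightarrow>
     (j = 0 \<longrightarrow> a = a' \<and>
        (t = 0 \<longrightarrow> cq a = 0 \<and> (\<forall>k<num_tapes N. 1 \<le> k \<longrightarrow> cs a ! k = 0) \<and>
           (i = T + 1 \<longrightarrow> (\<forall>k<num_tapes N. ch a ! k)) \<and> (i \<noteq> T + 1 \<longrightarrow> (\<forall>k<num_tapes N. \<not> ch a ! k)) \<and>
           init_sym T q x i (cs a ! 0)) \<and>
        (i = 0 \<or> i = 2 * T + 2 \<longrightarrow> (\<forall>k<num_tapes N. \<not> ch a ! k)) \<and>
        (\<forall>k<num_tapes N. ch a ! k \<longrightarrow> cs a ! k = cr a ! k) \<and>
        (t = T \<and> i = T + 1 \<longrightarrow> cq a = 1 \<and> last (cs a) = 2)) \<and>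
     (j = 1 \<longrightarrow> i < 2 * T + 2 \<longrightarrow> cq a = cq a' \<and> cr a = cr a' \<and>
        (t = 0 \<and> T + 1 + (2 * length x + 1) \<le> i \<longrightarrow> cs a ! 0 = 0 \<longrightarrow> cs a' ! 0 = 0)) \<and>
     (j = 2 \<longrightarrow> t < T \<longrightarrow> cwrite N a a' \<and> cmove N 0 a a') \<and>
     (j = 3 \<longrightarrow> t < T \<and> i < 2 * T + 2 \<longrightarrow> cmove N 1 a a') \<and>
     (j = 4 \<longrightarrow> t < T \<and> 1 \<le> i \<longrightarrow> cmove N (-1) a a')"

text \<open>Rows are written one after another, so every neighbour lies at a fixed distance. The
  columns stand for the tape cells from -T - 1 to T + 1, hence no head reaches the first or the last
  column within T steps.\<close>

definition offc :: "nat \<Rightarrow> nat \<Rightarrow> nat" where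
  "offc T j = (if j = 0 then 0 else if j = 1 then 1 else if j = 2 then 2 * T + 3 else if j = 3 then 2 * T + 4 else 2 * T + 2)"

definition okn :: "tm \<Rightarrow> nat \<Rightarrow> nat \<Rightarrow> bool list \<Rightarrow> nat \<Rightarrow> nat \<Rightarrow> nat \<Rightarrow> nat \<Rightarrow> bool" where
  "okn N T q x j z b b' = okc N T q x j z (z div (2 * T + 3)) (z mod (2 * T + 3)) (cdec N b) (cdec N b')"

lemma tm_step_ndelta:
  assumes "wf_tm N" "conf_ok N c" "cq a = fst c" "cr a = map read_tape (snd c)"
  shows "tm_step N c = (fst (ndelta N a), map2 act_tape (snd (ndelta N a)) (snd c))"
proof (cases "fst c = 1")
  case True
  then show ?thesis using assms by (cases c) (simp add: ndelta_def tm_step_halted)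
next
  case False
  then show ?thesis using assms by (simp add: ndelta_def tm_step_eq)
qed

lemma length_ndelta:
  assumes "wf_tm N" "conf_ok N c" "cq a = fst c" "cr a = map read_tape (snd c)"
  shows "length (snd (ndelta N a)) = num_tapes N"
  using assms conf_ok_delta(2)[OF assms(1,2)] by (simp add: ndelta_def conf_ok_def)

lemma tm_run_tape_Suc:
  assumes "wf_tm N" "cq a = fst (tm_run N w t)" "cr a = map read_tape (snd (tm_run N w t))" "k < num_tapes N"
  shows "snd (tm_run N w (Suc t)) ! k = act_tape (snd (ndelta N a) ! k) (snd (tm_run N w t) ! k)"
    "fst (tm_run N w (Suc t)) = fst (ndelta N a)"
proof -
  have ok: "conf_ok N (tm_run N w t)" using conf_ok_run[OF assms(1)] .
  have l: "length (snd (tm_run N w t)) = num_tapes N" using ok by (simp add: conf_ok_def)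
  show "snd (tm_run N w (Suc t)) ! k = act_tape (snd (ndelta N a) ! k) (snd (tm_run N w t) ! k)"
    "fst (tm_run N w (Suc t)) = fst (ndelta N a)"
    using tm_step_ndelta[OF assms(1) ok assms(2,3)] length_ndelta[OF assms(1) ok assms(2,3)] l assms(4)
    by (simp_all add: tm_run_Suc)
qed

lemma head_bound:
  assumes "wf_tm N" "k < num_tapes N"
  shows "\<bar>snd (snd (tm_run N w t) ! k)\<bar> \<le> int t"
  using tape_unchanged_far[OF assms] by blast

section \<open>Correctness of the tableau\<close>

definition accepts :: "tm \<Rightarrow> nat \<Rightarrow> bool list \<Rightarrow> bool" where
  "accepts N T w \<longleftrightarrow> fst (tm_run N w T) = 1 \<and> fst (last (snd (tm_run N w T))) 0 = 2"

locale tableau =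
  fixes N :: tm and x :: "bool list" and q T :: nat
  assumes wf: "wf_tm N" and T: "2 * length x + 1 + q \<le> T"
begin

abbreviation "S \<equiv> 2 * T + 3"
abbreviation "n \<equiv> (T + 1) * S"
abbreviation "L \<equiv> 2 * length x + 1"

lemma tapes1: "num_tapes N \<ge> 1" using wf by (simp add: wf_tm_def)

lemma index:
  assumes "t \<le> T" "i < S"
  shows "t * S + i < n" "(t * S + i) div S = t" "(t * S + i) mod S = i"
proof -
  have "t * S + i < Suc t * S" using assms by simp
  also have "\<dots> \<le> n" using assms by (intro mult_right_mono) auto
  finally show "t * S + i < n" .
  show "(t * S + i) div S = t" "(t * S + i) mod S = i" using assms(2) by (simp_all add: div_mult_self3)
qed

definition trow :: "bool list \<Rightarrow> nat \<Rightarrow> nat \<Rightarrow> cell" where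
  "trow w t i = (let c = tm_run N w t; p = int i - int (T + 1) in
     (fst c, map read_tape (snd c), map (\<lambda>tp. fst tp p) (snd c), map (\<lambda>tp. snd tp = p) (snd c)))"

lemma trow_sel:
  "cq (trow w t i) = fst (tm_run N w t)" "cr (trow w t i) = map read_tape (snd (tm_run N w t))"
  "k < num_tapes N \<Longrightarrow> cs (trow w t i) ! k = fst (snd (tm_run N w t) ! k) (int i - int (T + 1))"
  "k < num_tapes N \<Longrightarrow> ch (trow w t i) ! k = (snd (snd (tm_run N w t) ! k) = int i - int (T + 1))"
  using conf_ok_run[OF wf, of w t] by (simp_all add: trow_def Let_def cq_def cr_def cs_def ch_def conf_ok_def)

lemma trow_step:
  assumes "k < num_tapes N"
  shows "snd (tm_run N w (Suc t)) ! k = act_tape (snd (ndelta N (trow w t i)) ! k) (snd (tm_run N w t) ! k)"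
    "fst (tm_run N w (Suc t)) = fst (ndelta N (trow w t i))"
  using tm_run_tape_Suc[OF wf _ _ assms, of "trow w t i" w t] trow_sel(1,2) by blast+

lemma trow_cells: "trow w t i \<in> cells N"
  using conf_ok_run[OF wf, of w t] by (auto simp: trow_def Let_def cells_def conf_ok_def read_tape_eq)

lemma cell_eqI:
  assumes "a \<in> cells N" "a' \<in> cells N" "cq a = cq a'" "cr a = cr a'"
    "\<And>k. k < num_tapes N \<Longrightarrow> cs a ! k = cs a' ! k" "\<And>k. k < num_tapes N \<Longrightarrow> ch a ! k = ch a' ! k"
  shows "a = a'"
proof -
  have "cs a = cs a'" by (rule nth_equalityI) (use assms in \<open>auto simp: cells_def cs_def\<close>)
  moreover have "ch a = ch a'" by (rule nth_equalityI) (use assms in \<open>auto simp: cells_def ch_def\<close>)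
  ultimately show ?thesis using assms(3,4) by (simp add: cq_def cr_def cs_def ch_def prod_eq_iff)
qed

lemma cmove_trow: "cmove N D (trow w t i) (trow w (Suc t) i')" if "int i' = int i + D"
  unfolding cmove_def
proof (intro allI impI)
  fix k assume k: "k < num_tapes N" "move_offset (snd (snd (ndelta N (trow w t i)) ! k)) = D"
  have "snd (snd (tm_run N w (Suc t)) ! k) = snd (snd (tm_run N w t) ! k) + D"
    using trow_step(1)[OF k(1), of w t i] k(2) by (simp add: act_tape_eq')
  then show "ch (trow w (Suc t) i') ! k = ch (trow w t i) ! k" using that k(1) by (auto simp: trow_sel)
qed

lemma cwrite_trow: "cwrite N (trow w t i) (trow w (Suc t) i)"
  unfolding cwrite_def
proof (intro conjI allI impI)
  show "cq (trow w (Suc t) i) = fst (ndelta N (trow w t i))"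
    using trow_step(2)[of 0 w t i] tapes1 by (simp add: trow_sel)
  fix k assume k: "k < num_tapes N"
  show "cs (trow w (Suc t) i) ! k =
      (if ch (trow w t i) ! k then fst (snd (ndelta N (trow w t i)) ! k) else cs (trow w t i) ! k)"
    using trow_step(1)[OF k, of w t i] k by (simp add: trow_sel act_tape_eq')
qed

lemma init_tape: "k < num_tapes N \<Longrightarrow> snd (tm_run N w 0) ! k = (if k = 0 then input_tape w else blank_tape)"
  by (auto simp: tm_run_def init_config_def nth_Cons')

lemma input_enc_pair:
  "fst (input_tape (enc_pair x u)) p =
     (if p < 0 then 0 else if p < int L then (if ebit x (nat p) then 2 else 1)
      else if p < int L + int (length u) then bit_symbol (u ! (nat p - L)) else 0)"
proof -
  have "nat p < L \<Longrightarrow> 0 \<le> p \<Longrightarrow> enc_pair x u ! nat p = ebit x (nat p)"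
    by (simp add: enc_pair_def nth_append length_enc_word enc_word_nth)
  moreover have "\<not> nat p < L \<Longrightarrow> 0 \<le> p \<Longrightarrow> enc_pair x u ! nat p = u ! (nat p - L)"
    by (simp add: enc_pair_def nth_append length_enc_word)
  ultimately show ?thesis by (auto simp: input_tape_def enc_pair_def length_enc_word bit_symbol_def)
qed

lemma trow_ok:
  assumes u: "length u \<le> q" and acc: "accepts N T (enc_pair x u)" and t: "t \<le> T" "i < S" and j: "j < 5"
    and t': "t' \<le> T" "i' < S" and eq: "t' * S + i' = (t * S + i + offc T j) mod n"
  shows "okc N T q x j z t i (trow (enc_pair x u) t i) (trow (enc_pair x u) t' i')"
proof -
  let ?w = "enc_pair x u"
  \<comment> \<open>Reduction modulo \<open>n\<close> takes effect only for pairs that wrap around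
    the end of the tableau, and these are excluded by the guards of \<open>okc\<close>.\<close>
  have small: "offc T j + i < n - t * S \<Longrightarrow> t' * S + i' = t * S + i + offc T j" using eq by simp
  have row: "n - t * S = (T + 1 - t) * S" by (simp add: diff_mult_distrib)
  have row1: "t < T \<Longrightarrow> 2 * S \<le> n - t * S" unfolding row by (rule mult_right_mono) auto
  have ge: "S \<le> n - t * S" unfolding row using mult_right_mono[of 1 "T + 1 - t" S] t by simp
  have pos: "t' = a \<and> i' = b" if "t' * S + i' = a * S + b" "a \<le> T" "b < S" for a b
    using index(2,3)[OF that(2,3)] index(2,3)[OF t'] that(1) by metis
  consider "j = 0" | "j = 1" | "j = 2" | "j = 3" | "j = 4" using j by linarith
  then show ?thesis
  proof cases
    case 1
    have "t' = t \<and> i' = i" by (rule pos) (use small ge t 1 in \<open>auto simp: offc_def\<close>)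
    moreover have "(\<forall>k<num_tapes N. \<not> ch (trow ?w t i) ! k)" if "i = 0 \<or> i = 2 * T + 2"
      using head_bound[OF wf, of _ ?w t] that t(1) by (fastforce simp: trow_sel)
    moreover have "cs (trow ?w t i) ! k = cr (trow ?w t i) ! k" if "k < num_tapes N" "ch (trow ?w t i) ! k" for k
      using that conf_ok_run[OF wf, of ?w t] by (auto simp: trow_sel conf_ok_def read_tape_eq)
    moreover have "cq (trow ?w t i) = 1 \<and> last (cs (trow ?w t i)) = 2" if "t = T" "i = T + 1"
    proof -
      have "snd (tm_run N ?w t) \<noteq> []" using conf_ok_run[OF wf, of ?w t] tapes1 by (auto simp: conf_ok_def)
      then have "last (cs (trow ?w t i)) = fst (last (snd (tm_run N ?w t))) 0"
        using that by (simp add: trow_def Let_def cs_def last_map)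
      then show ?thesis using acc that by (simp add: accepts_def trow_sel)
    qed
    moreover have "cq (trow ?w 0 i) = 0 \<and> (\<forall>k<num_tapes N. 1 \<le> k \<longrightarrow> cs (trow ?w 0 i) ! k = 0) \<and>
           (i = T + 1 \<longrightarrow> (\<forall>k<num_tapes N. ch (trow ?w 0 i) ! k)) \<and> (i \<noteq> T + 1 \<longrightarrow> (\<forall>k<num_tapes N. \<not> ch (trow ?w 0 i) ! k)) \<and>
           init_sym T q x i (cs (trow ?w 0 i) ! 0)"
    proof (intro conjI)
      show "cq (trow ?w 0 i) = 0" by (simp add: trow_sel tm_run_def init_config_def)
      show "\<forall>k<num_tapes N. 1 \<le> k \<longrightarrow> cs (trow ?w 0 i) ! k = 0" by (auto simp: trow_sel init_tape blank_tape_def)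
      show "i = T + 1 \<longrightarrow> (\<forall>k<num_tapes N. ch (trow ?w 0 i) ! k)" "i \<noteq> T + 1 \<longrightarrow> (\<forall>k<num_tapes N. \<not> ch (trow ?w 0 i) ! k)"
        by (auto simp: trow_sel init_tape blank_tape_def input_tape_def)
      have "cs (trow ?w 0 i) ! 0 = fst (input_tape ?w) (int i - int (T + 1))" using tapes1 by (simp add: trow_sel init_tape)
      moreover have "nat (int i - int (T + 1)) = i - (T + 1)" by simp
      ultimately show "init_sym T q x i (cs (trow ?w 0 i) ! 0)"
        using u by (auto simp: input_enc_pair init_sym_def bit_symbol_def simp del: of_nat_Suc of_nat_add)
    qed
    ultimately show ?thesis using 1 by (auto simp: okc_def)
  next
    case 2
    have "t' = t \<and> i' = i + 1" if "i < 2 * T + 2"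
      by (rule pos) (use small ge t 2 that in \<open>auto simp: offc_def\<close>)
    moreover have "cs (trow ?w 0 (Suc i)) ! 0 = 0" if "T + 1 + L \<le> i" "cs (trow ?w 0 i) ! 0 = 0"
      using that tapes1 by (auto simp: trow_sel init_tape input_enc_pair bit_symbol_def split: if_splits)
    ultimately show ?thesis using 2 by (auto simp: okc_def trow_sel)
  next
    case 3
    have "t' = Suc t \<and> i' = i" if "t < T"
      by (rule pos) (use small row1[OF that] t 3 that in \<open>auto simp: offc_def\<close>)
    then show ?thesis using 3 cwrite_trow cmove_trow[of i i 0] by (auto simp: okc_def)
  next
    case 4
    have "t' = Suc t \<and> i' = i + 1" if "t < T" "i < 2 * T + 2"
      by (rule pos) (use small row1[OF that(1)] t 4 that in \<open>auto simp: offc_def\<close>)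
    then show ?thesis using 4 cmove_trow[of "i + 1" i 1] by (auto simp: okc_def)
  next
    case 5
    have "t' = Suc t \<and> i' = i - 1" if "t < T" "1 \<le> i"
      by (rule pos) (use small row1[OF that(1)] t 5 that in \<open>auto simp: offc_def\<close>)
    then show ?thesis using 5 cmove_trow[of "i - 1" i "-1"] by (auto simp: okc_def)
  qed
qed

lemma accepts_imp_csp:
  assumes u: "length u \<le> q" and acc: "accepts N T (enc_pair x u)"
  shows "\<exists>c. (\<forall>z<n. c z < csts N) \<and> (\<forall>j<5. \<forall>z<n. okn N T q x j z (c z) (c ((z + offc T j) mod n)))"
proof -
  let ?w = "enc_pair x u"
  define c where "c z = inv_into {..<csts N} (cdec N) (trow ?w (z div S) (z mod S))" for z
  note b = bij_cdec[of N, unfolded bij_betw_def]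
  have dec: "cdec N (c z) = trow ?w (z div S) (z mod S)" for z
    unfolding c_def by (rule f_inv_into_f) (use b trow_cells in auto)
  have "c z < csts N" for z
    using inv_into_into[of "trow ?w (z div S) (z mod S)" "cdec N" "{..<csts N}"] b trow_cells by (auto simp: c_def)
  moreover have "okn N T q x j z (c z) (c ((z + offc T j) mod n))" if "j < 5" "z < n" for j z
  proof -
    let ?z = "(z + offc T j) mod n"
    have z: "z div S \<le> T" "z mod S < S" if "z < n" for z
    proof -
      have "z div S < T + 1" using that by (rule less_mult_imp_div_less)
      then show "z div S \<le> T" by simp
    qed simp
    have "?z < n" by simp
    from trow_ok[OF u acc z[OF that(2)] that(1) z[OF this], of z] show ?thesis
      unfolding okn_def dec div_mult_mod_eq by blast
  qed
  ultimately show ?thesis by blast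
qed

text \<open>The first row determines a certificate, and for the remaining rows the constraints leave
  no other choice than the run of \<open>N\<close> with it.\<close>

lemma csp_imp_accepts:
  assumes c: "\<And>z. z < n \<Longrightarrow> c0 z < csts N \<and> c1 z < csts N"
    and ok: "\<And>j z. j < 5 \<Longrightarrow> z < n \<Longrightarrow> okn N T q x j z (c0 z) (c1 ((z + offc T j) mod n))"
  shows "\<exists>u. length u \<le> q \<and> accepts N T (enc_pair x u)"
proof -
  define A where "A t i = cdec N (c0 (t * S + i))" for t i
  note b = bij_cdec[of N, unfolded bij_betw_def]
  have Ac: "A t i \<in> cells N" if "t \<le> T" "i < S" for t i
    using index(1)[OF that] c b by (auto simp: A_def)
  have c01: "cdec N (c1 z) = cdec N (c0 z)" if "z < n" for z
    using ok[of 0 z] that by (simp add: okn_def okc_def offc_def)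
  have okA: "okc N T q x j (t * S + i) t i (A t i) (A t' i')"
    if "j < 5" "t \<le> T" "i < S" "t' \<le> T" "i' < S" "t' * S + i' = t * S + i + offc T j" for j t i t' i'
  proof -
    have lt: "t' * S + i' < n" by (rule index(1)[OF that(4,5)])
    then have "(t * S + i + offc T j) mod n = t' * S + i'" using that(6) by simp
    then show ?thesis using ok[OF that(1) index(1)[OF that(2,3)]] c01[OF lt]
      unfolding okn_def A_def index(2,3)[OF that(2,3)] by simp
  qed
  have ok0: "okc N T q x 0 (t * S + i) t i (A t i) (A t i)" if "t \<le> T" "i < S" for t i
    by (rule okA) (use that in \<open>auto simp: offc_def\<close>)
  have ok1: "okc N T q x 1 (t * S + i) t i (A t i) (A t (i + 1))" if "t \<le> T" "i < 2 * T + 2" for t i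
    by (rule okA) (use that in \<open>auto simp: offc_def\<close>)
  have ok2: "okc N T q x 2 (t * S + i) t i (A t i) (A (t + 1) i)" if "t < T" "i < S" for t i
    by (rule okA) (use that in \<open>auto simp: offc_def\<close>)
  have ok3: "okc N T q x 3 (t * S + i) t i (A t i) (A (t + 1) (i + 1))" if "t < T" "i < 2 * T + 2" for t i
    by (rule okA) (use that in \<open>auto simp: offc_def\<close>)
  have ok4: "okc N T q x 4 (t * S + i) t i (A t i) (A (t + 1) (i - 1))" if "t < T" "i < S" "1 \<le> i" for t i
    by (rule okA) (use that in \<open>auto simp: offc_def\<close>)
  have bc: "cq (A t i) = cq (A t 0) \<and> cr (A t i) = cr (A t 0)" if "t \<le> T" "i < S" for t i
    using that(2)
  proof (induction i)
    case (Suc i)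
    then show ?case using ok1[OF that(1), of i] by (auto simp: okc_def)
  qed simp
  define f where "f p = cs (A 0 (T + 1 + L + p)) ! 0" for p
  have f_le: "f p \<le> 2" if "p < q" for p
    using ok0[of 0 "T + 1 + L + p"] that T by (auto simp: okc_def init_sym_def f_def)
  have f_0: "f p = 0" if "q \<le> p" "T + 1 + L + p < S" for p
    using ok0[of 0 "T + 1 + L + p"] that by (auto simp: okc_def init_sym_def f_def)
  have f_Suc: "f (Suc p) = 0" if "f p = 0" "T + 1 + L + Suc p < S" for p
    using ok1[of 0 "T + 1 + L + p"] that by (auto simp: okc_def f_def)
  \<comment> \<open>The certificate ends before the first blank, or after \<open>q\<close> symbols
    if there is none; the constraint on neighbours makes all later symbols blank.\<close>
  define l where "l = (LEAST p. q \<le> p \<or> f p = 0)"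
  have l: "q \<le> l \<or> f l = 0" unfolding l_def by (rule LeastI[of _ q]) simp
  have l_le: "l \<le> q" unfolding l_def by (rule Least_le) simp
  have l_lt: "p < q \<and> f p \<noteq> 0" if "p < l" for p using not_less_Least[of p] that unfolding l_def by fastforce
  have f_ge: "f p = 0" if "l \<le> p" "T + 1 + L + p < S" for p
    using that
  proof (induction p rule: dec_induct)
    case base
    then show ?case using l f_0 l_le by force
  next
    case (step p)
    then show ?case using f_Suc by simp
  qed
  define u where "u = map (\<lambda>p. f p = 2) [0..<l]"
  have ul: "length u = l" by (simp add: u_def)
  let ?w = "enc_pair x u"
  have sym0: "cs (A 0 i) ! 0 = fst (input_tape ?w) (int i - int (T + 1))" if i: "i < S" for i
  proof -
    have ini: "init_sym T q x i (cs (A 0 i) ! 0)" using ok0[of 0 i] i by (simp add: okc_def)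
    consider "i < T + 1" | "T + 1 \<le> i" "i < T + 1 + L" | p where "i = T + 1 + L + p" by (metis le_Suc_ex not_less)
    then show ?thesis
    proof cases
      case 1
      then show ?thesis using ini by (auto simp: init_sym_def input_enc_pair)
    next
      case 2
      then have "int i - int (T + 1) = int (i - (T + 1))" by simp
      then show ?thesis using ini 2 by (auto simp: init_sym_def input_enc_pair simp del: of_nat_diff)
    next
      case 3
      have e: "int i - int (T + 1) = int (L + p)" using 3 by simp
      have "fst (input_tape ?w) (int (L + p)) = (if p < l then bit_symbol (u ! p) else 0)"
        unfolding input_enc_pair nat_int ul by auto
      also have "\<dots> = f p"
      proof (cases "p < l")
        case True
        then have "f p = 1 \<or> f p = 2" using l_lt[OF True] f_le[of p] by linarith
        then show ?thesis using True by (auto simp: u_def bit_symbol_def)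
      next
        case False
        then show ?thesis using f_ge[of p] i 3 by simp
      qed
      finally show ?thesis unfolding e by (simp add: f_def 3)
    qed
  qed
  have main: "A t i = trow ?w t i" if "t \<le> T" "i < S" for t i
    using that
  proof (induction t arbitrary: i)
    case 0
    have A0: "cq (A 0 i) = 0 \<and> (\<forall>k<num_tapes N. 1 \<le> k \<longrightarrow> cs (A 0 i) ! k = 0) \<and> (\<forall>k<num_tapes N. ch (A 0 i) ! k = (i = T + 1))"
      if "i < S" for i using ok0[of 0 i] that by (cases "i = T + 1") (auto simp: okc_def)
    have s: "cs (A 0 i) ! k = cs (trow ?w 0 i) ! k" if "i < S" "k < num_tapes N" for i k
      using that A0[OF that(1)] sym0[OF that(1)] by (cases "k = 0") (auto simp: trow_sel init_tape blank_tape_def)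
    have h: "ch (A 0 i) ! k = ch (trow ?w 0 i) ! k" if "i < S" "k < num_tapes N" for i k
      using that A0[OF that(1)] by (auto simp: trow_sel init_tape blank_tape_def input_tape_def)
    have r: "cr (A 0 i) = cr (trow ?w 0 i)" if i: "i < S" for i
    proof (rule nth_equalityI)
      have la: "length (cr (A 0 i)) = num_tapes N" using Ac[of 0 i] i by (auto simp: cells_def cr_def)
      show "length (cr (A 0 i)) = length (cr (trow ?w 0 i))"
        using la conf_ok_run[OF wf, of ?w 0] by (simp add: trow_sel conf_ok_def)
      fix k assume "k < length (cr (A 0 i))"
      then have k: "k < num_tapes N" using la by simp
      have "ch (A 0 (T + 1)) ! k" using A0[of "T + 1"] k by simp
      then have "cs (A 0 (T + 1)) ! k = cr (A 0 (T + 1)) ! k" using ok0[of 0 "T + 1"] k by (simp add: okc_def)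
      moreover have "cr (A 0 i) = cr (A 0 (T + 1))" using bc[of 0 i] bc[of 0 "T + 1"] i by simp
      moreover have "cr (trow ?w 0 i) ! k = cs (trow ?w 0 (T + 1)) ! k"
        using k conf_ok_run[OF wf, of ?w 0]
        by (auto simp: trow_sel conf_ok_def read_tape_eq init_tape blank_tape_def input_tape_def)
      ultimately show "cr (A 0 i) ! k = cr (trow ?w 0 i) ! k" using s[of "T + 1" k] k by simp
    qed
    show ?case
      by (rule cell_eqI[OF Ac trow_cells]) (use 0 A0[OF 0(2)] s h r in \<open>auto simp: trow_sel tm_run_def init_config_def\<close>)
  next
    case (Suc t)
    have IH: "A t i = trow ?w t i" if "i < S" for i using Suc that by simp
    have t: "t < T" "Suc t \<le> T" using Suc by auto
    have w: "cwrite N (trow ?w t i) (A (Suc t) i)" "cmove N 0 (trow ?w t i) (A (Suc t) i)" if "i < S" for i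
      using ok2[OF t(1) that] IH[OF that] t by (auto simp: okc_def)
    have m1: "cmove N 1 (trow ?w t i) (A (Suc t) (i + 1))" if "i < 2 * T + 2" for i
      using ok3[OF t(1) that] IH[of i] t that by (auto simp: okc_def)
    have m2: "cmove N (-1) (trow ?w t i) (A (Suc t) (i - 1))" if "i < S" "1 \<le> i" for i
      using ok4[OF t(1) that] IH[of i] t that by (auto simp: okc_def)
    have nd: "ndelta N (trow ?w t i) = ndelta N (trow ?w t 0)" for i
      by (simp add: ndelta_def trow_sel)
    have s: "cs (A (Suc t) i) ! k = cs (trow ?w (Suc t) i) ! k" if "i < S" "k < num_tapes N" for i k
      using w(1)[OF that(1)] cwrite_trow[of ?w t i] that(2) by (simp add: cwrite_def)
    have qq: "cq (A (Suc t) i) = cq (trow ?w (Suc t) i)" if "i < S" for i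
      using w(1)[OF that(1)] cwrite_trow[of ?w t i] by (simp add: cwrite_def)
    have h: "ch (A (Suc t) i) ! k = ch (trow ?w (Suc t) i) ! k" if i: "i < S" and k: "k < num_tapes N" for i k
    proof -
      let ?D = "move_offset (snd (snd (ndelta N (trow ?w t 0)) ! k))"
      \<comment> \<open>A head moving right into column 0 or left into the last column would come
        from outside of the tableau. There constraint 0 replaces the diagonal constraints.\<close>
      have edge: "\<not> ch (A (Suc t) i) ! k" "\<not> ch (trow ?w (Suc t) i) ! k" if "i = 0 \<or> i = 2 * T + 2"
      proof -
        show "\<not> ch (A (Suc t) i) ! k" using ok0[OF t(2) i] that k by (auto simp: okc_def)
        show "\<not> ch (trow ?w (Suc t) i) ! k" using head_bound[OF wf k, of ?w "Suc t"] that t k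
          by (auto simp: trow_sel simp del: of_nat_Suc)
      qed
      consider "?D = 0" | "?D = 1" | "?D = -1" by (cases "snd (snd (ndelta N (trow ?w t 0)) ! k)") auto
      then show ?thesis
      proof cases
        case 1
        then show ?thesis using w(2)[OF i] cmove_trow[of i i 0 ?w t] k nd[of i] by (simp add: cmove_def)
      next
        case 2
        show ?thesis
        proof (cases "i = 0")
          case True
          then show ?thesis using edge by simp
        next
          case False
          then obtain i0 where i0: "i = i0 + 1" by (metis Suc_eq_plus1 not0_implies_Suc)
          then show ?thesis using m1[of i0] cmove_trow[of "i0 + 1" i0 1 ?w t] k nd[of i0] 2 i by (simp add: cmove_def)
        qed
      next
        case 3
        show ?thesis
        proof (cases "i = 2 * T + 2")
          case True
          then show ?thesis using edge by simp
        next
          case False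
          then show ?thesis using m2[of "i + 1"] cmove_trow[of i "i + 1" "-1" ?w t] k nd[of "i + 1"] 3 i by (simp add: cmove_def)
        qed
      qed
    qed
    \<comment> \<open>By constraint 0 the symbol read on a tape is correct in the column of its
      head, and constraint 1 carries it through the whole row.\<close>
    have r: "cr (A (Suc t) i) = cr (trow ?w (Suc t) i)" if i: "i < S" for i
    proof (rule nth_equalityI)
      have la: "length (cr (A (Suc t) i)) = num_tapes N" using Ac[OF t(2) i] by (auto simp: cells_def cr_def)
      have ok: "length (snd (tm_run N ?w (Suc t))) = num_tapes N" using conf_ok_run[OF wf, of ?w "Suc t"] by (simp add: conf_ok_def)
      show "length (cr (A (Suc t) i)) = length (cr (trow ?w (Suc t) i))" using la ok by (simp add: trow_sel)
      fix k assume "k < length (cr (A (Suc t) i))"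
      then have k: "k < num_tapes N" using la by simp
      define p where "p = snd (snd (tm_run N ?w (Suc t)) ! k)"
      define i0 where "i0 = nat (p + int (T + 1))"
      have pb: "\<bar>p\<bar> \<le> int T" using head_bound[OF wf k, of ?w "Suc t"] t unfolding p_def by linarith
      have i0: "i0 < S" "int i0 - int (T + 1) = p" using pb by (auto simp: i0_def)
      have "ch (trow ?w (Suc t) i0) ! k" using k i0(2) by (simp add: trow_sel p_def)
      then have "ch (A (Suc t) i0) ! k" using h[OF i0(1) k] by simp
      then have "cs (A (Suc t) i0) ! k = cr (A (Suc t) i0) ! k" using ok0[OF t(2) i0(1)] k by (simp add: okc_def)
      moreover have "cr (A (Suc t) i) = cr (A (Suc t) i0)" using bc[OF t(2) i] bc[OF t(2) i0(1)] by simp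
      moreover have "cr (trow ?w (Suc t) i) ! k = cs (trow ?w (Suc t) i0) ! k"
        using k ok i0(2) by (simp add: trow_sel read_tape_eq p_def)
      ultimately show "cr (A (Suc t) i) ! k = cr (trow ?w (Suc t) i) ! k" using s[OF i0(1) k] by simp
    qed
    show ?case
      by (rule cell_eqI[OF Ac trow_cells]) (use Suc.prems qq s h r in auto)
  qed
  have "cq (A T (T + 1)) = 1 \<and> last (cs (A T (T + 1))) = 2" using ok0[of T "T + 1"] by (simp add: okc_def)
  then have "cq (trow ?w T (T + 1)) = 1" "last (cs (trow ?w T (T + 1))) = 2" using main[of T "T + 1"] by auto
  moreover have "snd (tm_run N ?w T) \<noteq> []" using conf_ok_run[OF wf, of ?w T] tapes1 by (auto simp: conf_ok_def)
  then have "last (cs (trow ?w T (T + 1))) = fst (last (snd (tm_run N ?w T))) 0"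
    by (simp add: trow_def Let_def cs_def last_map)
  ultimately have "accepts N T ?w" by (simp add: accepts_def trow_sel)
  then show ?thesis using ul l_le by blast
qed

theorem tableau:
  "(\<exists>u. length u \<le> q \<and> accepts N T (enc_pair x u)) \<longleftrightarrow>
   (\<exists>c0 c1. (\<forall>z<n. c0 z < csts N \<and> c1 z < csts N) \<and>
      (\<forall>j<5. \<forall>z<n. okn N T q x j z (c0 z) (c1 ((z + offc T j) mod n))))"
proof
  assume "\<exists>u. length u \<le> q \<and> accepts N T (enc_pair x u)"
  then obtain c where "\<forall>z<n. c z < csts N" "\<forall>j<5. \<forall>z<n. okn N T q x j z (c z) (c ((z + offc T j) mod n))"
    using accepts_imp_csp by blast
  then show "\<exists>c0 c1. (\<forall>z<n. c0 z < csts N \<and> c1 z < csts N) \<and>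
      (\<forall>j<5. \<forall>z<n. okn N T q x j z (c0 z) (c1 ((z + offc T j) mod n)))"
    by (intro exI[of _ c]) auto
qed (use csp_imp_accepts in blast)

end

section \<open>Decoding\<close>

lemma pp_if: "pp W \<Gamma> P \<Longrightarrow> pp W \<Gamma> Q \<Longrightarrow> pp W \<Gamma> R \<Longrightarrow> pp W \<Gamma> (\<lambda>s. if P s then Q s else R s)"
  by (rule pf_cong[OF pf_if[of W \<Gamma> P "\<lambda>s. of_bool (Q s)" "\<lambda>s. of_bool (R s)"]]) auto

lemma pf_rec_bounded:
  assumes "pf W \<Gamma> n" "pf W \<Gamma> B" "pf W \<Gamma> g"
    and h: "pf (\<lambda>p. W (fst (fst p))) (\<lambda>p. snd p # snd (fst p) # \<Gamma> (fst (fst p))) (\<lambda>p. h (fst (fst p)) (snd (fst p)) (snd p))"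
    and "\<And>s. g s \<le> B s" "\<And>s i r. h s i r \<le> B s"
  shows "pf W \<Gamma> (\<lambda>s. rec_nat (g s) (h s) (n s))"
proof (rule pf_rec[OF assms(1,3) h pf_pbd[OF assms(2)]])
  fix s i
  show "rec_nat (g s) (h s) i \<le> B s" using assms(5,6) by (cases i) auto
qed

lemma nat_bits_inj: "nat_bits a = nat_bits b \<Longrightarrow> a = b"
proof (induction a arbitrary: b rule: nat_bits.induct)
  case (1 a)
  show ?case
  proof (cases "a = 0 \<or> b = 0")
    case True
    then show ?thesis using 1(2) by (auto simp: nat_bits.simps[of a] nat_bits.simps[of b] split: if_splits)
  next
    case False
    then have "odd a = odd b" "nat_bits (a div 2) = nat_bits (b div 2)"
      using 1(2) by (simp_all add: nat_bits.simps[of a] nat_bits.simps[of b])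
    moreover from this(2) False have "a div 2 = b div 2" using 1(1) by blast
    ultimately show ?thesis by (metis bit_eq_rec)
  qed
qed

lemma nat_bits_eq_Nil [simp]: "nat_bits v = [] \<longleftrightarrow> v = 0" "[] = nat_bits v \<longleftrightarrow> v = 0"
  by (auto simp: nat_bits.simps[of v])

text \<open>A block at \<open>p\<close> has its flags at every second position, so its length is the
  number of True flags before the first False. It is written as a sum in order to be computable by
  \<open>pf_sum\<close>.\<close>

definition blen :: "bool list \<Rightarrow> nat \<Rightarrow> nat" where
  "blen y p = (\<Sum>i<length y. of_bool (\<forall>i'<Suc i. bit_at y (p + 2 * i')))"

text \<open>The minimum changes nothing for the blocks of an encoding. It keeps the recursion
  bounded on all other words, where a polynomial running time is required as well.\<close>

definition bstart :: "bool list \<Rightarrow> nat \<Rightarrow> nat" where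
  "bstart y j = rec_nat 0 (\<lambda>_ p. min (Suc (p + 2 * blen y p)) (length y)) j"

definition beq :: "bool list \<Rightarrow> nat \<Rightarrow> nat \<Rightarrow> bool" where
  "beq y p p' \<longleftrightarrow> blen y p = blen y p' \<and>
     (\<forall>i<blen y p. bit_at y (Suc (p + 2 * i)) = bit_at y (Suc (p' + 2 * i)))"

definition bnat :: "bool list \<Rightarrow> nat \<Rightarrow> nat \<Rightarrow> bool" where
  "bnat y p v \<longleftrightarrow> blen y p = length (nat_bits v) \<and>
     (\<forall>i<blen y p. bit_at y (Suc (p + 2 * i)) = odd (v div 2 ^ i))"

lemma enc_words_append: "enc_words (us @ vs) = enc_words us @ enc_words vs"
  by (simp add: enc_words_def)

lemma enc_words_Cons: "enc_words (u # vs) = enc_word u @ enc_words vs"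
  by (simp add: enc_words_def)

lemma enc_word_flag: "i < length w \<Longrightarrow> enc_word w ! (2 * i)"
  by (simp add: enc_word_nth ebit_def)

lemma enc_word_end: "\<not> enc_word w ! (2 * length w)"
  by (simp add: enc_word_nth ebit_def)

lemma enc_word_data: "i < length w \<Longrightarrow> enc_word w ! Suc (2 * i) = w ! i"
  by (auto simp: enc_word_nth ebit_def)

lemma block:
  assumes y: "y = enc_words us @ enc_word w @ v"
  defines "p \<equiv> length (enc_words us)"
  shows "blen y p = length w" "i < length w \<Longrightarrow> bit_at y (Suc (p + 2 * i)) = w ! i"
proof -
  have at: "bit_at y (p + i) = enc_word w ! i" if "i < 2 * length w + 1" for i
    using that by (simp add: y p_def bit_at_def nth_append length_enc_word)
  have len: "length y \<ge> p + 2 * length w + 1" by (simp add: y p_def length_enc_word)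
  have all: "(\<forall>i'<Suc i. bit_at y (p + 2 * i')) \<longleftrightarrow> i < length w" for i
  proof
    assume a: "\<forall>i'<Suc i. bit_at y (p + 2 * i')"
    show "i < length w"
    proof (rule ccontr)
      assume "\<not> i < length w"
      then have "bit_at y (p + 2 * length w)" using a by simp
      then show False using at[of "2 * length w"] enc_word_end[of w] by simp
    qed
  next
    assume "i < length w"
    then show "\<forall>i'<Suc i. bit_at y (p + 2 * i')" using at enc_word_flag[of _ w] by auto
  qed
  have "{i. i < length y \<and> i < length w} = {..<length w}" using len by auto
  then show "blen y p = length w" unfolding blen_def all by (simp add: of_bool_def sum.If_cases Int_def)
  show "bit_at y (Suc (p + 2 * i)) = w ! i" if "i < length w"
    using at[of "Suc (2 * i)"] that enc_word_data[OF that] by simp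
qed

lemma bstart_eq:
  assumes "y = enc_words ws" "j \<le> length ws"
  shows "bstart y j = length (enc_words (take j ws))"
  using assms(2)
proof (induction j)
  case 0
  then show ?case by (simp add: bstart_def enc_words_def)
next
  case (Suc j)
  then have IH: "bstart y j = length (enc_words (take j ws))" by simp
  have y: "y = enc_words (take j ws) @ enc_word (ws ! j) @ enc_words (drop (Suc j) ws)"
    unfolding assms(1) using Suc.prems
    by (metis Cons_nth_drop_Suc Suc_le_lessD append_take_drop_id enc_words_Cons enc_words_append)
  have t: "enc_words (take (Suc j) ws) = enc_words (take j ws) @ enc_word (ws ! j)"
    using Suc.prems by (simp add: take_Suc_conv_app_nth enc_words_append enc_words_Cons enc_words_def)
  have "bstart y (Suc j) = min (Suc (bstart y j + 2 * blen y (bstart y j))) (length y)" by (simp add: bstart_def)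
  also have "\<dots> = length (enc_words (take (Suc j) ws))"
    unfolding IH block(1)[OF y] t by (subst y) (simp add: length_enc_word)
  finally show ?case .
qed

lemma block_at:
  assumes "y = enc_words ws" "j < length ws"
  shows "blen y (bstart y j) = length (ws ! j)"
    "i < length (ws ! j) \<Longrightarrow> bit_at y (Suc (bstart y j + 2 * i)) = ws ! j ! i"
proof -
  have y: "y = enc_words (take j ws) @ enc_word (ws ! j) @ enc_words (drop (Suc j) ws)"
    unfolding assms(1) using assms(2)
    by (metis Cons_nth_drop_Suc append_take_drop_id enc_words_Cons enc_words_append)
  have s: "bstart y j = length (enc_words (take j ws))" using bstart_eq[OF assms(1), of j] assms(2) by simp
  show "blen y (bstart y j) = length (ws ! j)"
    "i < length (ws ! j) \<Longrightarrow> bit_at y (Suc (bstart y j + 2 * i)) = ws ! j ! i"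
    unfolding s using block[OF y] by auto
qed

lemma beq_iff:
  assumes "y = enc_words ws" "j < length ws" "j' < length ws"
  shows "beq y (bstart y j) (bstart y j') \<longleftrightarrow> ws ! j = ws ! j'"
  unfolding beq_def block_at(1)[OF assms(1,2)] block_at(1)[OF assms(1,3)] list_eq_iff_nth_eq
  using block_at(2)[OF assms(1,2)] block_at(2)[OF assms(1,3)] by auto

lemma bnat_iff:
  assumes "y = enc_words ws" "j < length ws"
  shows "bnat y (bstart y j) v \<longleftrightarrow> ws ! j = nat_bits v"
proof -
  have "nat_bits v ! i = odd (v div 2 ^ i)" if "i < length (nat_bits v)" for i
    using that by (subst nat_bits_conv) simp
  then show ?thesis
    unfolding bnat_def block_at(1)[OF assms] list_eq_iff_nth_eq using block_at(2)[OF assms] by auto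
qed

lemma pp_bit: "pf W \<Gamma> f \<Longrightarrow> pp W \<Gamma> (\<lambda>s. bit_at (W s) (f s))"
  by (rule pf_bit)

lemma pf_blen:
  assumes "pf W \<Gamma> p"
  shows "pf W \<Gamma> (\<lambda>s. blen (W s) (p s))"
  unfolding blen_def
  by (intro pf_sum pf_length pp_all pf_Suc pp_bit pf_add pf_mult pf_const pf_vars pf_weaken2[OF assms])

lemma pf_bstart:
  assumes "pf W \<Gamma> j"
  shows "pf W \<Gamma> (\<lambda>s. bstart (W s) (j s))"
  unfolding bstart_def
  by (rule pf_rec_bounded[OF assms pf_length pf_zero])
    (auto intro!: pf_min pf_Suc pf_add pf_mult pf_const pf_vars pf_blen pf_length)

lemma pp_beq:
  assumes "pf W \<Gamma> p" "pf W \<Gamma> p'"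
  shows "pp W \<Gamma> (\<lambda>s. beq (W s) (p s) (p' s))"
  unfolding beq_def
  by (intro pp_and pp_eq pf_blen assms pp_all pp_iff pp_bit pf_Suc pf_add pf_mult pf_const pf_vars
      pf_weaken[OF assms(1)] pf_weaken[OF assms(2)])

lemma pp_bnat:
  assumes "pf W \<Gamma> p" "pf W \<Gamma> v"
  shows "pp W \<Gamma> (\<lambda>s. bnat (W s) (p s) (v s))"
  unfolding bnat_def
  by (intro pp_and pp_eq pf_blen assms pf_length_nat_bits pp_all pp_iff pp_bit pp_odd pf_iterate_div2 pf_Suc pf_add
      pf_mult pf_const pf_vars pf_weaken[OF assms(1)] pf_weaken[OF assms(2)])

text \<open>Sources are numbered in such a way that the group can be read off the number.\<close>
definition sid :: "nat \<Rightarrow> nat \<Rightarrow> nat" where "sid g c = (g + c) ^ 2 + g"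

text \<open>The number lies between the square of g + c and the next square, so it determines g + c
  and then g.\<close>

lemma sid_inj: "sid g c = sid g' c' \<Longrightarrow> g = g' \<and> c = c'"
proof -
  assume e: "sid g c = sid g' c'"
  have *: "g + c \<le> g' + c'" if "sid g c = sid g' c'" for g c g' c'
  proof (rule ccontr)
    assume "\<not> g + c \<le> g' + c'"
    then have "(Suc (g' + c')) ^ 2 \<le> (g + c) ^ 2" by (intro power_mono) auto
    with that show False by (simp add: sid_def power2_eq_square)
  qed
  from *[OF e] *[OF e[symmetric]] have "g + c = g' + c'" by simp
  with e show ?thesis by (simp add: sid_def)
qed

definition gid :: "nat \<Rightarrow> nat" where "gid s = (THE g. \<exists>c. s = sid g c)"

lemma gid_sid [simp]: "gid (sid g c) = g"
  unfolding gid_def by (rule the_equality) (auto dest: sid_inj)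

text \<open>Identifiers in a word are binary and may have values too large for a register. Instead
  of decoding them, all candidates with g and c up to \<open>E\<close> are compared with
  them.\<close>

definition same_grp :: "bool list \<Rightarrow> nat \<Rightarrow> nat \<Rightarrow> nat \<Rightarrow> bool" where
  "same_grp y E p p' \<longleftrightarrow> (\<exists>g<Suc E. (\<exists>c<Suc E. bnat y p (sid g c)) \<and> (\<exists>c<Suc E. bnat y p' (sid g c)))"

text \<open>Block 0 is the number of arcs, and arc a takes the blocks \<open>4 * a + 1\<close> to
  \<open>4 * a + 4\<close>, two for the child and two for the parent; the kind 0 marks a source. The
  number \<open>E\<close> of arcs is found by trying all values up to the length of the
  word.\<close>

definition dtest :: "bool list \<Rightarrow> bool" where
  "dtest y \<longleftrightarrow> (\<exists>E<Suc (length y). bnat y (bstart y 0) E \<and> (\<forall>a<E. \<forall>b<E.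
     bnat y (bstart y (4 * a + 1)) 0 \<and> bnat y (bstart y (4 * b + 1)) 0 \<and>
     same_grp y E (bstart y (4 * a + 2)) (bstart y (4 * b + 2)) \<longrightarrow>
     beq y (bstart y (4 * a + 3)) (bstart y (4 * b + 3)) \<and> beq y (bstart y (4 * a + 4)) (bstart y (4 * b + 4))))"

lemma pf_sid: "pf W \<Gamma> g \<Longrightarrow> pf W \<Gamma> c \<Longrightarrow> pf W \<Gamma> (\<lambda>s. sid (g s) (c s))"
  unfolding sid_def by (intro pf_add pf_power)

lemma pp_same_grp:
  assumes "pf W \<Gamma> E" "pf W \<Gamma> p" "pf W \<Gamma> p'"
  shows "pp W \<Gamma> (\<lambda>s. same_grp (W s) (E s) (p s) (p' s))"
  unfolding same_grp_def
  by (intro pp_ex pp_and pf_Suc assms pp_bnat pf_sid pf_vars pf_weaken[OF assms(1)] pf_weaken2[OF assms(2)] pf_weaken2[OF assms(3)])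

lemma pp_dtest: "pp (\<lambda>y. y) (\<lambda>y. []) dtest"
proof -
  have "pp (\<lambda>y. y) (\<lambda>y. []) (\<lambda>y. dtest y)"
    unfolding dtest_def
    by (intro pp_ex pp_all pp_and pp_imp pf_Suc pf_length pp_bnat pp_same_grp pp_beq pf_bstart pf_add pf_mult pf_const pf_vars)
  then show ?thesis .
qed

lemma nth_concat4:
  assumes "\<And>e. e \<in> set es \<Longrightarrow> length (F e) = 4" "a < length es" "i < 4"
  shows "(concat (map F es) @ zs) ! (4 * a + i) = F (es ! a) ! i"
  using assms
proof (induction es arbitrary: a)
  case (Cons e es)
  show ?case
  proof (cases a)
    case 0
    then show ?thesis using Cons.prems by (simp add: nth_append)
  next
    case (Suc a')
    then have "4 * a + i = 4 + (4 * a' + i)" by simp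
    then show ?thesis using Cons Suc by (simp add: nth_append)
  qed
qed simp

lemma length_concat4: "(\<And>e. e \<in> set es \<Longrightarrow> length (F e) = 4) \<Longrightarrow> length (concat (map F es)) = 4 * length es"
  by (induction es) auto

lemma length_vertex_words [simp]: "length (vertex_words v) = 2"
  by (cases v) auto

lemma vertex_words_inj: "vertex_words u = vertex_words v \<Longrightarrow> u = v"
  by (cases u; cases v) (auto dest: nat_bits_inj)

lemma vertex_words_source: "vertex_words u ! 0 = nat_bits 0 \<longleftrightarrow> (\<exists>s. u = Source s)"
proof -
  have "nat_bits 1 \<noteq> nat_bits 0" "nat_bits 2 \<noteq> nat_bits 0" using nat_bits_inj[of 1 0] nat_bits_inj[of 2 0] by auto
  then show ?thesis by (cases u) auto
qed

lemma length_enc_words_ge: "length ws \<le> length (enc_words ws)"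
  by (induction ws) (auto simp: enc_words_def length_enc_word)

theorem dtest_layout:
  assumes enc: "encodes_layout pt y L"
    and ids: "\<And>s p. (Source s, p) \<in> arcs L \<Longrightarrow> \<exists>g c. s = sid g c \<and> g \<le> card (arcs L) \<and> c \<le> card (arcs L)"
  shows "dtest y \<longleftrightarrow> (\<forall>s p s' p'. (Source s, p) \<in> arcs L \<longrightarrow> (Source s', p') \<in> arcs L \<longrightarrow> gid s = gid s' \<longrightarrow> p = p')"
proof -
  let ?F = "\<lambda>(u, v). vertex_words u @ vertex_words v"
  from enc obtain es ps where es: "set es = arcs L"
    and y: "y = enc_words (list_words ?F es @ list_words (\<lambda>(i, u). [nat_bits i, u]) ps)"
    unfolding encodes_layout_def by blast
  define zs where "zs = list_words (\<lambda>(i, u). [nat_bits i, u]) ps"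
  define ws where "ws = nat_bits (length es) # concat (map ?F es) @ zs"
  have yw: "y = enc_words ws" by (simp add: y ws_def zs_def list_words_def)
  have F4: "length (?F e) = 4" for e by (cases e) simp
  define E where "E = length es"
  have wsE: "length ws \<ge> 4 * E + 1" using length_concat4[of es ?F] F4 by (simp add: ws_def E_def)
  then have Ey: "E < Suc (length y)" using length_enc_words_ge[of ws] yw by simp
  \<comment> \<open>The list may repeat arcs, but it is at least as long as the set of arcs is
    large, so the search range of \<open>same_grp\<close> is wide enough.\<close>
  have cE: "card (arcs L) \<le> E" unfolding es[symmetric] E_def by (rule card_length)
  have w: "ws ! (4 * a + Suc i) = ?F (es ! a) ! i" if "a < E" "i < 4" for a i
    using nth_concat4[of es ?F a i zs] F4 that by (simp add: ws_def E_def)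
  have lt: "4 * a + Suc i < length ws" if "a < E" "i < 4" for a i using that wsE by linarith
  have w0: "ws ! 0 = nat_bits E" by (simp add: ws_def E_def)
  have src: "bnat y (bstart y (4 * a + 1)) 0 \<longleftrightarrow> (\<exists>s. fst (es ! a) = Source s)" if "a < E" for a
    using bnat_iff[OF yw lt[OF that, of 0], of 0] w[OF that, of 0] vertex_words_source[of "fst (es ! a)"]
    by (auto simp: nth_append split: prod.splits)
  have idw: "bnat y (bstart y (4 * a + 2)) v \<longleftrightarrow> v = s" if "a < E" "fst (es ! a) = Source s" for a s v
    using bnat_iff[OF yw lt[OF that(1), of 1], of v] w[OF that(1), of 1] that(2)
    by (auto simp: nth_append numeral_2_eq_2 dest: nat_bits_inj split: prod.splits)
  have sg: "same_grp y E (bstart y (4 * a + 2)) (bstart y (4 * b + 2)) \<longleftrightarrow> gid s = gid s'"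
    if ab: "a < E" "b < E" "fst (es ! a) = Source s" "fst (es ! b) = Source s'" for a b s s'
  proof -
    have "(Source s, snd (es ! a)) \<in> arcs L" "(Source s', snd (es ! b)) \<in> arcs L"
      using ab nth_mem[of a es] nth_mem[of b es] unfolding es[symmetric] E_def by (metis prod.collapse)+
    then obtain g c g' c' where gc: "s = sid g c" "g \<le> E" "c \<le> E" "s' = sid g' c'" "g' \<le> E" "c' \<le> E"
      using ids cE by (meson le_trans)
    show ?thesis unfolding same_grp_def idw[OF ab(1,3)] idw[OF ab(2,4)] gc(1,4) gid_sid
    proof
      assume "\<exists>x<Suc E. (\<exists>c''<Suc E. sid x c'' = sid g c) \<and> (\<exists>c''<Suc E. sid x c'' = sid g' c')"
      then show "g = g'" using sid_inj by metis
    next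
      assume "g = g'"
      then show "\<exists>x<Suc E. (\<exists>c''<Suc E. sid x c'' = sid g c) \<and> (\<exists>c''<Suc E. sid x c'' = sid g' c')"
        by (rule_tac exI[of _ g], intro conjI, use gc in simp, rule_tac exI[of _ c], use gc in simp,
            rule_tac exI[of _ c'], use gc in simp)
    qed
  qed
  have par: "beq y (bstart y (4 * a + 3)) (bstart y (4 * b + 3)) \<and> beq y (bstart y (4 * a + 4)) (bstart y (4 * b + 4))
      \<longleftrightarrow> snd (es ! a) = snd (es ! b)" if ab: "a < E" "b < E" for a b
  proof -
    have i: "ws ! (4 * a + 3) = vertex_words (snd (es ! a)) ! 0" "ws ! (4 * a + 4) = vertex_words (snd (es ! a)) ! 1" if "a < E" for a
      using w[OF that, of 2] w[OF that, of 3] by (auto simp: nth_append numeral_3_eq_3 eval_nat_numeral split: prod.splits)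
    have b: "beq y (bstart y (4 * a + 3)) (bstart y (4 * b + 3)) \<longleftrightarrow> ws ! (4 * a + 3) = ws ! (4 * b + 3)"
      "beq y (bstart y (4 * a + 4)) (bstart y (4 * b + 4)) \<longleftrightarrow> ws ! (4 * a + 4) = ws ! (4 * b + 4)"
      by (rule beq_iff[OF yw]; use ab wsE in linarith)+
    have "vertex_words u = vertex_words v" if "vertex_words u ! 0 = vertex_words v ! 0" "vertex_words u ! 1 = vertex_words v ! 1" for u v
      using that by (intro nth_equalityI) (auto simp: less_2_cases_iff)
    then show ?thesis unfolding b i[OF ab(1)] i[OF ab(2)] using vertex_words_inj by metis
  qed
  have E0: "bnat y (bstart y 0) E' \<longleftrightarrow> E' = E" for E'
  proof -
    have "0 < length ws" using wsE by linarith
    from bnat_iff[OF yw this, of E'] w0 show ?thesis by (auto dest: nat_bits_inj)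
  qed
  have step: "(bnat y (bstart y (4 * a + 1)) 0 \<and> bnat y (bstart y (4 * b + 1)) 0 \<and>
     same_grp y E (bstart y (4 * a + 2)) (bstart y (4 * b + 2)) \<longrightarrow> snd (es ! a) = snd (es ! b)) \<longleftrightarrow>
     (\<forall>s s'. fst (es ! a) = Source s \<longrightarrow> fst (es ! b) = Source s' \<longrightarrow> gid s = gid s' \<longrightarrow> snd (es ! a) = snd (es ! b))"
    if ab: "a < E" "b < E" for a b
  proof (cases "\<exists>s s'. fst (es ! a) = Source s \<and> fst (es ! b) = Source s'")
    case True
    then obtain s s' where s: "fst (es ! a) = Source s" "fst (es ! b) = Source s'" by blast
    show ?thesis unfolding src[OF ab(1)] src[OF ab(2)] sg[OF ab s] by (simp add: s)
  next
    case False
    then show ?thesis unfolding src[OF ab(1)] src[OF ab(2)] by blast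
  qed
  have "dtest y \<longleftrightarrow> (\<forall>a<E. \<forall>b<E. bnat y (bstart y (4 * a + 1)) 0 \<and> bnat y (bstart y (4 * b + 1)) 0 \<and>
     same_grp y E (bstart y (4 * a + 2)) (bstart y (4 * b + 2)) \<longrightarrow> snd (es ! a) = snd (es ! b))"
    unfolding dtest_def E0 using par Ey by auto
  also have "\<dots> \<longleftrightarrow> (\<forall>a<E. \<forall>b<E. \<forall>s s'. fst (es ! a) = Source s \<longrightarrow> fst (es ! b) = Source s' \<longrightarrow> gid s = gid s' \<longrightarrow> snd (es ! a) = snd (es ! b))"
    by (intro all_cong1 imp_cong refl step)
  also have "\<dots> \<longleftrightarrow> (\<forall>s p s' p'. (Source s, p) \<in> arcs L \<longrightarrow> (Source s', p') \<in> arcs L \<longrightarrow> gid s = gid s' \<longrightarrow> p = p')"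
  proof
    assume l: "\<forall>a<E. \<forall>b<E. \<forall>s s'. fst (es ! a) = Source s \<longrightarrow> fst (es ! b) = Source s' \<longrightarrow> gid s = gid s' \<longrightarrow> snd (es ! a) = snd (es ! b)"
    show "\<forall>s p s' p'. (Source s, p) \<in> arcs L \<longrightarrow> (Source s', p') \<in> arcs L \<longrightarrow> gid s = gid s' \<longrightarrow> p = p'"
    proof (intro allI impI)
      fix s p s' p' assume a: "(Source s, p) \<in> arcs L" "(Source s', p') \<in> arcs L" "gid s = gid s'"
      from a(1,2) obtain i j where "i < E" "es ! i = (Source s, p)" "j < E" "es ! j = (Source s', p')"
        unfolding es[symmetric] E_def by (auto simp: in_set_conv_nth)
      with l a(3) show "p = p'" by (metis fst_conv snd_conv)
    qed
  next
    assume r: "\<forall>s p s' p'. (Source s, p) \<in> arcs L \<longrightarrow> (Source s', p') \<in> arcs L \<longrightarrow> gid s = gid s' \<longrightarrow> p = p'"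
    show "\<forall>a<E. \<forall>b<E. \<forall>s s'. fst (es ! a) = Source s \<longrightarrow> fst (es ! b) = Source s' \<longrightarrow> gid s = gid s' \<longrightarrow> snd (es ! a) = snd (es ! b)"
    proof (intro allI impI)
      fix a b s s' assume a: "a < E" "b < E" "fst (es ! a) = Source s" "fst (es ! b) = Source s'" "gid s = gid s'"
      then have "(Source s, snd (es ! a)) \<in> arcs L" "(Source s', snd (es ! b)) \<in> arcs L"
        using nth_mem[of a es] nth_mem[of b es] unfolding es[symmetric] E_def by (metis prod.collapse)+
      with r a(5) show "snd (es ! a) = snd (es ! b)" by blast
    qed
  qed
  finally show ?thesis .
qed

definition dec_word :: "bool list \<Rightarrow> bool list" where
  "dec_word y = concat (map (\<lambda>i. [bit_at y (Suc (2 * i))]) [0..<blen y 0])"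

lemma dec_word_enc_pair: "dec_word (enc_pair x u) = x"
proof -
  have y: "enc_pair x u = enc_words [] @ enc_word x @ u" by (simp add: enc_pair_def enc_words_def)
  note b = block[OF y, unfolded enc_words_def, simplified]
  have "dec_word (enc_pair x u) = map (\<lambda>i. bit_at (enc_pair x u) (Suc (2 * i))) [0..<length x]"
    by (simp add: dec_word_def b(1))
  also have "\<dots> = x" by (rule nth_equalityI) (auto simp: b(2))
  finally show ?thesis .
qed

lemma em_dec_word: "em (\<lambda>y. y) (\<lambda>y. []) dec_word"
proof -
  have "em (\<lambda>y. y) (\<lambda>y. []) (\<lambda>y. dec_word y)"
    unfolding dec_word_def by (intro em_concat em_bool pp_bit pf_Suc pf_mult pf_const pf_vars pf_blen pf_zero)
  then show ?thesis .
qed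

section \<open>The reduction\<close>

text \<open>For fixed \<open>j\<close>, \<open>b\<close> and \<open>b'\<close> the cells are
  constants, and what remains are comparisons of the position with \<open>T\<close>,
  \<open>q\<close> and the bits of the input.\<close>

lemma pp_okn:
  assumes T: "pf W \<Gamma> T" and q: "pf W \<Gamma> q" and z: "pf W \<Gamma> z"
  shows "pp W \<Gamma> (\<lambda>s. okn N (T s) (q s) (W s) j (z s) b b')"
proof -
  have eb: "ebit x p \<longleftrightarrow> p \<noteq> 2 * length x \<and> (\<not> odd p \<or> bit_at x (p div 2))" for x p
    by (simp add: ebit_def bit_at_def)
  show ?thesis unfolding okn_def okc_def init_sym_def eb
    by (intro pp_const pp_and pp_imp pp_or pp_not pp_if pp_eq pp_less pp_le pp_odd pp_bit pf_if pf_div pf_mod pf_add pf_mult pf_diff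
        pf_length T q z pf_const)
qed

text \<open>The polynomial \<open>p\<close> is for the running time of the verifier \<open>N\<close>
  and \<open>qq\<close> for the length of the certificates; \<open>K\<close> and \<open>e\<close>
  determine the factor by which the item sizes are scaled.\<close>

locale reduction =
  fixes N :: tm and p qq :: "nat poly" and K e :: nat
  assumes wfN: "wf_tm N" and K1: "K \<ge> 1"
begin

abbreviation "Q \<equiv> csts N"
abbreviation "NB \<equiv> 2 * Q + 2"
abbreviation "UU \<equiv> csp_U Q 5"

definition wl :: "bool list \<Rightarrow> nat" where "wl x = poly qq (length x)"
text \<open>The second summand makes room for the input and the certificate in a row of the
  tableau.\<close>

definition tt :: "bool list \<Rightarrow> nat" where
  "tt x = poly p (2 * length x + 1 + wl x) + (2 * length x + 1 + wl x)"
definition nn :: "bool list \<Rightarrow> nat" where "nn x = (tt x + 1) * (2 * tt x + 3)"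

lemma tt_ge: "2 * length x + 1 + wl x \<le> tt x" by (simp add: tt_def)

lemma csp_ok: "csp (nn x) Q 5 (offc (tt x))"
proof
  show "nn x > 0" by (simp add: nn_def)
  show "Q \<ge> 2" by (rule csts_ge2[OF wfN])
  fix j :: nat
  have t: "tt x \<ge> 1" using tt_ge[of x] by simp
  have "offc (tt x) j \<le> 2 * tt x + 4" by (simp add: offc_def)
  also have "\<dots> < 2 * (2 * tt x + 3)" by simp
  also have "\<dots> \<le> nn x" unfolding nn_def by (rule mult_right_mono) (use t in auto)
  finally show "offc (tt x) j < nn x" .
qed simp

text \<open>The input \<open>x\<close> varies here, so the constants of the locale
  \<open>switch\<close> are written with explicit parameters; otherwise the size could not be
  treated as a function of \<open>x\<close> that is to be computed.\<close>

definition gsz :: "bool list \<Rightarrow> nat \<Rightarrow> nat" where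
  "gsz x = switch.gsize (nn x) UU NB (Q * csp_h Q 5) (csp_P1 Q) (csp_P2 Q) (csp_sh Q (offc (tt x)))
     (csp_lw Q 5 (okn N (tt x) (wl x) x)) (csp_ml Q 5)"

definition bcap :: "bool list \<Rightarrow> nat" where "bcap x = switch.cap (nn x) UU (Q * csp_h Q 5)"

definition mm :: "bool list \<Rightarrow> nat" where "mm x = (NB + 2 * UU) * nn x"
definition kk :: "bool list \<Rightarrow> nat" where "kk x = NB * nn x"
definition scale :: "bool list \<Rightarrow> nat" where "scale x = (K * mm x) ^ e"
definition asz :: "bool list \<Rightarrow> nat \<Rightarrow> nat" where "asz x g = scale x * gsz x g"
definition BB :: "bool list \<Rightarrow> nat" where "BB x = scale x * bcap x"

lemma pf_wl: "pf W \<Gamma> (\<lambda>s. wl (W s))"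
  unfolding wl_def by (intro pf_poly pf_length)

lemma pf_tt: "pf W \<Gamma> (\<lambda>s. tt (W s))"
  unfolding tt_def by (intro pf_add pf_poly pf_mult pf_const pf_length pf_wl)

lemma pf_nn: "pf W \<Gamma> (\<lambda>s. nn (W s))"
  unfolding nn_def by (intro pf_add pf_mult pf_const pf_tt)

lemma pf_mm: "pf W \<Gamma> (\<lambda>s. mm (W s))"
  unfolding mm_def by (intro pf_mult pf_const pf_nn)

lemma pf_kk: "pf W \<Gamma> (\<lambda>s. kk (W s))"
  unfolding kk_def by (intro pf_mult pf_const pf_nn)

lemma pf_scale: "pf W \<Gamma> (\<lambda>s. scale (W s))"
  unfolding scale_def by (intro pf_power pf_mult pf_const pf_mm)

lemma csp_switch: "switch (nn x) UU NB (csp_P1 Q) (csp_P2 Q) (csp_sh Q (offc (tt x)))"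
proof -
  interpret csp "nn x" Q 5 "offc (tt x)" "okn N (tt x) (wl x) x" by (rule csp_ok)
  show ?thesis by (rule switch_axioms)
qed

lemma pf_bas: "pf W \<Gamma> (\<lambda>s. switch.bas (nn (W s)) UU)"
  unfolding switch.bas_def[OF csp_switch] by (intro pf_add pf_mult pf_const pf_nn)

lemma pf_bcap: "pf W \<Gamma> (\<lambda>s. bcap (W s))"
proof -
  have "pf W \<Gamma> (\<lambda>s. (Q * csp_h Q 5 + 1) * (\<Sum>k<Suc UU. (if k < UU then 2 * nn (W s) else 2 * UU + 1) *
      switch.bas (nn (W s)) UU ^ k) + Q * csp_h Q 5)"
    by (intro pf_add pf_mult pf_const pf_sum_fixed pf_power pf_bas pf_if pp_const pf_nn)
  moreover have "bcap (W s) = (Q * csp_h Q 5 + 1) * (\<Sum>k<Suc UU. (if k < UU then 2 * nn (W s) else 2 * UU + 1) *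
      switch.bas (nn (W s)) UU ^ k) + Q * csp_h Q 5" for s
    unfolding bcap_def switch.cap_def[OF csp_switch] switch.Hi_def[OF csp_switch] switch.tgt_def[OF csp_switch] lessThan_Suc_atMost ..
  ultimately show ?thesis by simp
qed

text \<open>The kind \<open>g div nn x\<close> of an item takes a constant number of values and the
  number of digits is constant, so the formula for every kind is written out in the program. The
  guard returns 0 where this list of cases ends.\<close>

lemma pf_gsz:
  assumes g: "pf W \<Gamma> g"
  shows "pf W \<Gamma> (\<lambda>s. if g s div nn (W s) < NB + 2 * UU then gsz (W s) (g s) else 0)"
proof -
  let ?z = "\<lambda>s. g s mod nn (W s)"
  let ?low = "csp_lw Q 5"
  note sw = csp_switch
  have z: "pf W \<Gamma> ?z" by (intro pf_mod g pf_nn)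
  have bk: "pf W \<Gamma> (\<lambda>s. (?z s + nn (W s) - csp_sh Q (offc (tt (W s))) k) mod nn (W s))" for k
    unfolding csp_sh_def offc_def by (intro pf_mod pf_diff pf_add z pf_nn pf_if pp_const pf_const pf_tt pf_mult)
  define hM where "hM P s = (\<Sum>k<Suc UU. (if k < UU then if P = csp_P1 Q k then nn (W s) - ?z s
       else if P = csp_P2 Q k then nn (W s) - (?z s + nn (W s) - csp_sh Q (offc (tt (W s))) k) mod nn (W s) else 2 * nn (W s)
     else 2 * UU + 1 - switch.cnt UU (csp_P1 Q) (csp_P2 Q) P) * switch.bas (nn (W s)) UU ^ k)" for P s
  define hI where "hI k' s = (\<Sum>k<Suc UU. (if k < UU then if k = k' then nn (W s) + ?z s else 0 else 1) * switch.bas (nn (W s)) UU ^ k)" for k' s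
  have hM: "pf W \<Gamma> (hM P)" for P unfolding hM_def
    by (intro pf_sum_fixed pf_mult pf_if pp_const pf_diff bk pf_nn z pf_const pf_power pf_bas)
  have hI: "pf W \<Gamma> (hI k)" for k unfolding hI_def
    by (intro pf_sum_fixed pf_mult pf_if pp_const pf_add pf_nn z pf_const pf_power pf_bas)
  have lw: "pf W \<Gamma> (\<lambda>s. csp_lw Q 5 (okn N (tt (W s)) (wl (W s)) (W s)) k (?z s) w)" for k w
    unfolding csp_lw_def by (intro pf_if pp_const pf_const pp_and pp_not pp_okn pf_tt pf_wl z)
  define F where "F kd s = (if kd < NB then (Q * csp_h Q 5 + 1) * hM kd s + csp_ml Q 5 kd
    else (Q * csp_h Q 5 + 1) * hI ((kd - NB) div 2) s + csp_lw Q 5 (okn N (tt (W s)) (wl (W s)) (W s)) ((kd - NB) div 2) (?z s) (odd (kd - NB)))" for kd s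
  have "pf W \<Gamma> (F kd)" for kd unfolding F_def by (intro pf_if pp_const pf_add pf_mult pf_const hM hI lw)
  from pf_cases[OF pf_div[OF g pf_nn] this, of "NB + 2 * UU"]
  have *: "pf W \<Gamma> (\<lambda>s. if g s div nn (W s) < NB + 2 * UU then F (g s div nn (W s)) s else 0)" .
  have eq: "gsz (W s) (g s) = F (g s div nn (W s)) s" for s
  proof (cases "g s div nn (W s) < NB")
    case True
    show ?thesis unfolding gsz_def switch.gsize_def[OF sw] switch.itm_of_def[OF sw] Let_def
      by (simp only: True if_True F_def hM_def switch.isize_def[OF sw] switch.high_def[OF sw] switch.low.simps[OF sw]
          switch.vec.simps[OF sw] switch.bk_def[OF sw] lessThan_Suc_atMost)
  next
    case False
    show ?thesis unfolding gsz_def switch.gsize_def[OF sw] switch.itm_of_def[OF sw] Let_def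
      by (simp only: False if_False F_def hI_def switch.isize_def[OF sw] switch.high_def[OF sw] switch.low.simps[OF sw]
          switch.vec.simps[OF sw] switch.bk_def[OF sw] lessThan_Suc_atMost)
  qed
  show ?thesis by (rule pf_cong[OF *]) (simp only: eq)
qed

lemma pf_asz:
  assumes "pf W \<Gamma> g"
  shows "pf W \<Gamma> (\<lambda>s. if g s div nn (W s) < NB + 2 * UU then asz (W s) (g s) else 0)"
proof -
  have "pf W \<Gamma> (\<lambda>s. scale (W s) * (if g s div nn (W s) < NB + 2 * UU then gsz (W s) (g s) else 0))"
    by (intro pf_mult pf_scale pf_gsz assms)
  then show ?thesis by (rule pf_cong) (simp add: asz_def)
qed

lemma asz_guard: "g < mm x \<Longrightarrow> (if g div nn x < NB + 2 * UU then asz x g else 0) = asz x g"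
  by (simp add: mm_def less_mult_imp_div_less)

definition srcs :: "bool list \<Rightarrow> nat list" where
  "srcs x = concat (map (\<lambda>g. map (sid g) [0..<asz x g]) [0..<mm x])"

definition fixed_words :: "bool list list" where
  "fixed_words = point_words (0, 0) @ point_words (1, 0)"

definition red :: "bool list \<Rightarrow> bool list" where
  "red x = enc_words (fixed_words @ [nat_bits (mm x)] @
     list_words (\<lambda>s. [nat_bits s, nat_bits (gid s)]) (srcs x) @
     list_words (\<lambda>t. [nat_bits t]) [0..<kk x] @ list_words (\<lambda>c. [nat_bits c]) [BB x, BB x, BB x])"

lemma enc_words_concat: "enc_words (concat (map f xs)) = concat (map (\<lambda>x. enc_words (f x)) xs)"
  by (induction xs) (auto simp: enc_words_def)

lemma concat_concat_map:
  "concat (concat (map (\<lambda>g. map (f g) (h g)) xs)) = concat (map (\<lambda>g. concat (map (f g) (h g))) xs)"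
  by (induction xs) auto

lemma length_srcs: "length (srcs x) = (\<Sum>g<mm x. asz x g)"
  by (simp add: srcs_def length_concat comp_def interv_sum_list_conv_sum_set_nat lessThan_atLeast0)

text \<open>\<open>gid\<close> is never computed: the sources are written group by group, and the
  group is the variable of the outer loop.\<close>

lemma em_red: "em (\<lambda>x. x) (\<lambda>x. []) red"
proof -
  let ?a = "\<lambda>x g. if g div nn x < NB + 2 * UU then asz x g else 0"
  have "em (\<lambda>x. x) (\<lambda>x. []) (\<lambda>x. enc_words fixed_words @ enc_word (nat_bits (mm x)) @
      enc_word (nat_bits (\<Sum>g<mm x. ?a x g)) @
      concat (map (\<lambda>g. concat (map (\<lambda>c. enc_word (nat_bits (sid g c)) @ enc_word (nat_bits g)) [0..<?a x g])) [0..<mm x]) @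
      enc_word (nat_bits (kk x)) @ concat (map (\<lambda>t. enc_word (nat_bits t)) [0..<kk x]) @
      enc_word (nat_bits 3) @ enc_word (nat_bits (scale x * bcap x)) @ enc_word (nat_bits (scale x * bcap x)) @
      enc_word (nat_bits (scale x * bcap x)))" (is "em _ _ ?f")
    by (intro em_append em_const em_nat em_concat pf_sum pf_asz pf_mm pf_kk pf_vars pf_sid pf_const pf_mult pf_scale pf_bcap)
  moreover have "red = ?f"
  proof
    fix x
    have len: "length (srcs x) = (\<Sum>g<mm x. ?a x g)"
      unfolding length_srcs by (rule sum.cong) (use asz_guard in auto)
    have "concat (map (\<lambda>s. enc_word (nat_bits s) @ enc_word (nat_bits (gid s))) (srcs x)) =
      concat (map (\<lambda>g. concat (map (\<lambda>c. enc_word (nat_bits (sid g c)) @ enc_word (nat_bits g)) [0..<asz x g])) [0..<mm x])"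
      by (simp add: srcs_def map_concat comp_def concat_concat_map)
    also have "\<dots> = concat (map (\<lambda>g. concat (map (\<lambda>c. enc_word (nat_bits (sid g c)) @ enc_word (nat_bits g)) [0..<?a x g])) [0..<mm x])"
    proof (rule arg_cong[where f = concat], rule map_cong[OF refl])
      fix g assume "g \<in> set [0..<mm x]"
      then have "g < mm x" by simp
      from asz_guard[OF this]
      show "concat (map (\<lambda>c. enc_word (nat_bits (sid g c)) @ enc_word (nat_bits g)) [0..<asz x g]) =
        concat (map (\<lambda>c. enc_word (nat_bits (sid g c)) @ enc_word (nat_bits g)) [0..<?a x g])" by (simp only:)
    qed
    finally have src: "concat (map (\<lambda>s. enc_word (nat_bits s) @ enc_word (nat_bits (gid s))) (srcs x)) = \<dots>" .
    show "red x = ?f x" unfolding red_def list_words_def enc_words_append enc_words_Cons enc_words_concat src len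
      by (simp add: enc_words_Cons BB_def) (simp add: enc_words_def numeral_3_eq_3 src)
  qed
  ultimately show ?thesis by (simp only:)
qed

lemma set_srcs: "set (srcs x) = {sid g c | g c. g < mm x \<and> c < asz x g}"
  by (auto simp: srcs_def) blast

lemma mm_pos: "mm x > 0"
  using csts_ge2[OF wfN] by (auto simp: nn_def mm_def)

lemma scale_pos: "scale x > 0"
  using K1 mm_pos by (simp add: scale_def)

lemma asz_ge: "scale x \<le> asz x g"
proof -
  interpret csp "nn x" Q 5 "offc (tt x)" "okn N (tt x) (wl x) x" by (rule csp_ok)
  have "1 \<le> gsz x g" unfolding gsz_def gsize_def by (rule isize_pos)
  then show ?thesis by (simp add: asz_def)
qed

lemma asz_pos: "asz x g > 0"
  using asz_ge[of x g] scale_pos[of x] by linarith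

lemma group_card: "g < mm x \<Longrightarrow> card {s \<in> set (srcs x). gid s = g} = asz x g"
proof -
  assume g: "g < mm x"
  have "{s \<in> set (srcs x). gid s = g} = sid g ` {..<asz x g}" using g by (auto simp: set_srcs)
  moreover have "inj (sid g)" by (auto simp: inj_on_def dest: sid_inj)
  ultimately show ?thesis by (simp add: card_image inj_on_subset)
qed

lemma gid_image: "gid ` set (srcs x) = {..<mm x}"
proof
  show "{..<mm x} \<subseteq> gid ` set (srcs x)"
  proof
    fix g assume "g \<in> {..<mm x}"
    then have "sid g 0 \<in> set (srcs x)" using asz_pos by (auto simp: set_srcs)
    then show "g \<in> gid ` set (srcs x)" by (metis gid_sid imageI)
  qed
qed (auto simp: set_srcs)

lemma card_srcs: "card (set (srcs x)) = (\<Sum>g<mm x. asz x g)"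
proof -
  have "card (set (srcs x)) = (\<Sum>s\<in>set (srcs x). 1)" by simp
  also have "\<dots> = (\<Sum>g<mm x. \<Sum>s | s \<in> set (srcs x) \<and> gid s = g. 1)"
    by (rule sum.group[symmetric]) (auto simp: gid_image)
  also have "\<dots> = (\<Sum>g<mm x. asz x g)" by (rule sum.cong) (auto simp: group_card)
  finally show ?thesis .
qed

lemma distinct_srcs: "distinct (srcs x)"
  by (rule card_distinct) (simp add: card_srcs length_srcs)

lemma bcap_pos: "bcap x > 0"
proof -
  interpret csp "nn x" Q 5 "offc (tt x)" "okn N (tt x) (wl x) x" by (rule csp_ok)
  have "0 < Q * csp_h Q 5" using h_pos Q2 by simp
  then show ?thesis unfolding bcap_def cap_def by simp
qed

theorem packing_iff:
  "(\<exists>f. (\<forall>g<mm x. f g < kk x) \<and> (\<forall>t<kk x. (\<Sum>g | g < mm x \<and> f g = t. asz x g) \<le> BB x)) \<longleftrightarrow>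
   (\<exists>u. length u \<le> wl x \<and> accepts N (tt x) (enc_pair x u))"
proof -
  interpret csp "nn x" Q 5 "offc (tt x)" "okn N (tt x) (wl x) x" by (rule csp_ok)
  interpret tb: tableau N x "wl x" "tt x" by unfold_locales (rule wfN, rule tt_ge)
  \<comment> \<open>Sizes and capacity are scaled by the same positive factor, so the scaling lowers
    the prices without affecting the packings.\<close>
  have eq: "(\<Sum>g | g < mm x \<and> f g = t. asz x g) \<le> BB x \<longleftrightarrow> (\<Sum>g | g < mm x \<and> f g = t. gsz x g) \<le> bcap x" for f t
    unfolding asz_def BB_def sum_distrib_left[symmetric] using scale_pos[of x] by simp
  have "(\<exists>f. (\<forall>g<mm x. f g < kk x) \<and> (\<forall>t<kk x. (\<Sum>g | g < mm x \<and> f g = t. asz x g) \<le> BB x)) \<longleftrightarrow> packable"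
    unfolding eq unfolding packable_index mm_def kk_def gsz_def bcap_def ..
  also have "\<dots> \<longleftrightarrow> csp_sat" by (rule packable_iff_csp)
  also have "\<dots> \<longleftrightarrow> (\<exists>u. length u \<le> wl x \<and> accepts N (tt x) (enc_pair x u))"
    unfolding csp_sat_def unfolding tb.tableau nn_def ..
  finally show ?thesis .
qed

lemma card_srcs_le: "card (set (srcs x)) \<le> kk x * BB x"
proof -
  interpret csp "nn x" Q 5 "offc (tt x)" "okn N (tt x) (wl x) x" by (rule csp_ok)
  have "(\<Sum>g<mm x. gsz x g) \<le> kk x * bcap x"
    using csp_total_size unfolding mm_def kk_def gsz_def bcap_def .
  then have "scale x * (\<Sum>g<mm x. gsz x g) \<le> scale x * (kk x * bcap x)" by simp
  then show ?thesis unfolding card_srcs asz_def BB_def sum_distrib_left by (simp add: ac_simps)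
qed

end

section \<open>The instance for a fixed cost exponent\<close>

locale reduction_alpha = reduction +
  fixes \<alpha> :: real
  assumes al: "0 \<le> \<alpha>" "\<alpha> < 1" and K: "2 / (1 - \<alpha>) < real K" "2 \<le> K" and e: "1 \<le> real e * (1 - \<alpha>)"
begin

text \<open>With m groups every group has at least \<open>(K * m) ^ e\<close> sources, and
  \<open>e * (1 - \<alpha>) \<ge> 1\<close> turns this into prices of at most
  \<open>1 / (K * m)\<close>. The two bounds on \<open>K\<close> yield the two smallness conditions
  on this number.\<close>

lemma groups_ok: "groups (set (srcs x)) gid (mm x) (BB x) \<alpha> (1 / (real K * real (mm x)))"
proof
  show "finite (set (srcs x))" by simp
  show "gid ` set (srcs x) = {..<mm x}" by (rule gid_image)
  show "1 \<le> BB x" using scale_pos[of x] bcap_pos[of x] by (simp add: BB_def Suc_le_eq)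
  show "1 \<le> mm x" using mm_pos[of x] by simp
  show "0 \<le> \<alpha>" "\<alpha> < 1" using al by auto
  have m: "real (mm x) \<ge> 1" using mm_pos[of x] by simp
  have k: "real K \<ge> 2" using K by simp
  have km: "real K * real (mm x) \<ge> 1" using mult_mono[of 1 "real K" 1 "real (mm x)"] m k by simp
  then show "0 < 1 / (real K * real (mm x))" by simp
  show "1 / (real K * real (mm x)) \<le> 1 / (2 * real (mm x))"
    using m k by (intro divide_left_mono mult_right_mono) auto
  have "2 < (1 - \<alpha>) * real K" using K(1) al by (simp add: field_simps)
  moreover have "(1 - \<alpha>) * real K * 1 \<le> (1 - \<alpha>) * real K * real (mm x)" using m k al by (intro mult_left_mono) auto
  ultimately have "2 < (1 - \<alpha>) * (real K * real (mm x))" by simp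
  moreover have "0 < real K * real (mm x)" using km by linarith
  ultimately have "2 / (real K * real (mm x)) < 1 - \<alpha>" by (simp only: pos_divide_less_eq)
  then show "2 * (1 / (real K * real (mm x))) < 1 - \<alpha>" by simp
  fix g assume g: "g < mm x"
  have s: "real (asz x g) \<ge> (real K * real (mm x)) ^ e"
  proof -
    have "real (scale x) \<le> real (asz x g)" using asz_ge by simp
    then show ?thesis by (simp add: scale_def)
  qed
  have "real (asz x g) powr (\<alpha> - 1) \<le> ((real K * real (mm x)) ^ e) powr (\<alpha> - 1)"
    using s km al by (intro powr_mono2') auto
  also have "\<dots> = (real K * real (mm x)) powr (real e * (\<alpha> - 1))"
    using km by (simp add: powr_powr flip: powr_realpow)
  also have "\<dots> \<le> (real K * real (mm x)) powr (-1)"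
    using km e by (intro powr_mono) (auto simp: algebra_simps)
  also have "\<dots> = 1 / (real K * real (mm x))" using km by (simp add: powr_minus_divide)
  finally show "real (card {s \<in> set (srcs x). gid s = g}) powr (\<alpha> - 1) \<le> 1 / (real K * real (mm x))"
    using group_card[OF g] by simp
qed

definition ins :: "bool list \<Rightarrow> flamecast" where
  "ins x = groups.inst (set (srcs x)) gid (mm x) (kk x) (BB x) \<alpha>"

lemma ins_class:
  "flamecast_instance (ins x)" "cost_exp (ins x) = \<alpha>" "sources (ins x) = set (srcs x)" "sources (ins x) \<noteq> {}"
  "group_equally_spaced_circular (ins x)" "intermediate_layers (ins x) = 1" "encodes_instance (red x) (ins x)"
proof -
  interpret groups "set (srcs x)" gid "mm x" "kk x" "BB x" \<alpha> "1 / (real K * real (mm x))" by (rule groups_ok)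
  show "flamecast_instance (ins x)" "sources (ins x) \<noteq> {}" "intermediate_layers (ins x) = 1"
    unfolding ins_def by (rule flamecast_inst)+
  show "cost_exp (ins x) = \<alpha>" "sources (ins x) = set (srcs x)" by (simp_all add: ins_def inst_def)
  show "group_equally_spaced_circular (ins x)"
    unfolding group_equally_spaced_circular_def ins_def using flamecast_inst(4) by blast
  show "encodes_instance (red x) (ins x)"
    unfolding encodes_instance_def
  proof (intro exI conjI)
    show "equally_spaced (ins x) (rat_point (0, 0)) 1 0 (mm x) gid"
      using flamecast_inst(4) by (simp add: ins_def rat_point_def)
    show "circle_point (rat_point (0, 0)) 1 0 = rat_point (1, 0)" by (simp add: circle_point_def rat_point_def)
    show "distinct (srcs x)" by (rule distinct_srcs)
    show "set (srcs x) = sources (ins x)" by (simp add: ins_def inst_def)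
    show "distinct [0..<kk x]" by simp
    show "set [0..<kk x] = sinks (ins x)" by (auto simp: ins_def inst_def)
    show "red x = enc_words (point_words (0, 0) @ point_words (1, 0) @ [nat_bits (mm x)] @
      list_words (\<lambda>s. [nat_bits s, nat_bits (gid s)]) (srcs x) @ list_words (\<lambda>t. [nat_bits t]) [0..<kk x] @
      list_words (\<lambda>c. [nat_bits c]) (caps (ins x)))"
      by (simp add: red_def fixed_words_def ins_def inst_def)
  qed
qed

lemma ins_valid: "\<exists>L. valid_layout (ins x) L"
proof -
  interpret groups "set (srcs x)" gid "mm x" "kk x" "BB x" \<alpha> "1 / (real K * real (mm x))" by (rule groups_ok)
  show ?thesis unfolding ins_def by (rule valid_layout_exists[OF card_srcs_le])
qed

theorem dtest_correct:
  assumes enc: "encodes_layout pt y L" and V: "valid_layout (ins x) L"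
    and c: "layout_cost (ins x) L \<le> (1 + 1 / real (card (sources (ins x))) ^ 2) * opt_cost (ins x)"
  shows "dtest y \<longleftrightarrow> (\<exists>u. length u \<le> wl x \<and> accepts N (tt x) (enc_pair x u))"
proof -
  interpret groups "set (srcs x)" gid "mm x" "kk x" "BB x" \<alpha> "1 / (real K * real (mm x))" by (rule groups_ok)
  note V' = V[unfolded ins_def]
  have T: "is_topology inst L" using V' by (simp add: valid_layout_def valid_topology_def)
  have src: "s \<in> set (srcs x)" if "(Source s, p) \<in> arcs L" for s p
  proof -
    have "Source s \<in> verts L" using arcs_verts[OF V' that] by simp
    moreover have "Source s \<notin> roots L" using roots_sub[OF V'] by auto
    ultimately have "Source s \<in> leaves L" using T unfolding is_topology_def by blast
    then show ?thesis using leaves_eq[OF V'] by auto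
  qed
  \<comment> \<open>Every source has an arc of its own. As m and each group size are at most the
    number of sources, the group and the index of a source lie within the search range of
    \<open>dtest\<close>.\<close>
  have cA: "card (set (srcs x)) \<le> card (arcs L)"
  proof -
    have "card (set (srcs x)) = card ((\<lambda>s. (Source s, par L (Source s))) ` set (srcs x))"
      by (rule card_image[symmetric]) (auto simp: inj_on_def)
    also have "\<dots> \<le> card (arcs L)" by (rule card_mono[OF finite_arcs[OF V']]) (use src_arc[OF V'] in auto)
    finally show ?thesis .
  qed
  have ids: "\<exists>g c. s = sid g c \<and> g \<le> card (arcs L) \<and> c \<le> card (arcs L)" if a: "(Source s, p) \<in> arcs L" for s p
  proof -
    from src[OF a] obtain g c where gc: "s = sid g c" "g < mm x" "c < asz x g" by (auto simp: set_srcs)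
    have "asz x g \<le> card (set (srcs x))" unfolding card_srcs
      by (rule member_le_sum) (use gc in auto)
    moreover have "mm x \<le> card (set (srcs x))"
      using sum_mono[of "{..<mm x}" "\<lambda>_. 1" "asz x"] asz_pos unfolding card_srcs by (simp add: Suc_le_eq)
    ultimately show ?thesis using gc cA by (intro exI[of _ g] exI[of _ c]) auto
  qed
  have "dtest y \<longleftrightarrow> (\<forall>s p s' p'. (Source s, p) \<in> arcs L \<longrightarrow> (Source s', p') \<in> arcs L \<longrightarrow> gid s = gid s' \<longrightarrow> p = p')"
    by (rule dtest_layout[OF enc ids])
  also have "\<dots> \<longleftrightarrow> pure L"
  proof
    assume l: "\<forall>s p s' p'. (Source s, p) \<in> arcs L \<longrightarrow> (Source s', p') \<in> arcs L \<longrightarrow> gid s = gid s' \<longrightarrow> p = p'"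
    show "pure L" unfolding pure_def
    proof (intro ballI impI)
      fix s s' assume s: "s \<in> set (srcs x)" "s' \<in> set (srcs x)" "gid s = gid s'"
      from l src_arc[OF V' s(1)] src_arc[OF V' s(2)] s(3) show "\<exists>p. (Source s, p) \<in> arcs L \<and> (Source s', p) \<in> arcs L"
        by metis
    qed
  next
    assume P: "pure L"
    show "\<forall>s p s' p'. (Source s, p) \<in> arcs L \<longrightarrow> (Source s', p') \<in> arcs L \<longrightarrow> gid s = gid s' \<longrightarrow> p = p'"
    proof (intro allI impI)
      fix s p s' p' assume a: "(Source s, p) \<in> arcs L" "(Source s', p') \<in> arcs L" "gid s = gid s'"
      obtain r where "(Source s, r) \<in> arcs L" "(Source s', r) \<in> arcs L"
        using P[unfolded pure_def, rule_format, OF src[OF a(1)] src[OF a(2)] a(3)] by blast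
      then show "p = p'" using arcs_unique[OF V'] a(1,2) by metis
    qed
  qed
  also have "\<dots> \<longleftrightarrow> packing"
    by (rule pure_iff_packing[OF V']) (use c in \<open>simp add: ins_class(3)[unfolded ins_def] ins_def\<close>)
  also have "\<dots> \<longleftrightarrow> (\<exists>f. (\<forall>g<mm x. f g < kk x) \<and> (\<forall>t<kk x. (\<Sum>g | g < mm x \<and> f g = t. asz x g) \<le> BB x))"
  proof -
    have eq: "(\<Sum>g | g < mm x \<and> f g = t. sz g) = (\<Sum>g | g < mm x \<and> f g = t. asz x g)" for f t
      by (rule sum.cong) (auto simp: sz_def group_card)
    show ?thesis unfolding packing_def by (simp only: eq)
  qed
  finally show ?thesis unfolding packing_iff .
qed

end

section \<open>The classes P and NP\<close>

lemma class_P_I: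
  assumes "wf_tm M" "\<And>w. prod_in M w [w \<in> A] ((length w + 2) ^ d)"
  shows "A \<in> class_P"
proof -
  have "poly ([:2, 1:] ^ d) n = (n + 2) ^ d" for n :: nat by (simp add: poly_power add.commute)
  then have "polytime_on M UNIV"
    unfolding polytime_on_def halts_within_def using assms(2) by (intro exI[of _ "[:2, 1:] ^ d"]) (simp add: prod_in_def)
  then show ?thesis unfolding class_P_def using assms prod_in_outputs by blast
qed

text \<open>Powers of n + 2 are monotone and easy to compose, so they replace polynomials in all
  time bounds.\<close>

lemma poly_le_power: "\<exists>d. \<forall>n. poly p n \<le> (n + 2 :: nat) ^ d"
proof -
  have "pbd (\<lambda>n. replicate n True) (\<lambda>n. []) (\<lambda>n. poly p n)"
  proof (induction p)
    case 0
    then show ?case by (simp add: pbd_const)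
  next
    case (pCons a p)
    have "pbd (\<lambda>n. replicate n True) (\<lambda>n. []) (\<lambda>n. n)"
      by (rule pbd_mono[OF pbd_size]) (simp add: ctx_size_def)
    then show ?case using pCons by (auto intro!: pbd_add pbd_mult pbd_const)
  qed
  then show ?thesis by (simp add: pbd_def ctx_size_def)
qed

lemma poly_mono_nat: "m \<le> n \<Longrightarrow> poly p m \<le> poly p (n :: nat)"
  by (induction p) (auto intro!: add_mono mult_mono)

text \<open>The time of the second machine is measured in the length of the intermediate word, which
  is at most the length of the input plus the time of the first machine.\<close>

lemma comp_poly:
  assumes "wf_tm M1" "wf_tm M2" "\<And>x. prod_in M1 x (f x) ((length x + 2) ^ a)"
    "\<And>x. prod_in M2 (f x) (y x) ((length (f x) + 2) ^ b)"
  shows "\<exists>d. \<forall>x. prod_in (comp_tm M1 M2) x (y x) ((length x + 2) ^ d)"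
proof -
  let ?t = "\<lambda>x :: bool list. 2 * length x + 5 * (length x + 2) ^ a + (length x + (length x + 2) ^ a + 2) ^ b + 10"
  have "pbd (\<lambda>x. x) (\<lambda>x. []) (\<lambda>x :: bool list. length x)" by (rule pbd_mono[OF pbd_size]) (simp add: ctx_size_def)
  then have "pbd (\<lambda>x. x) (\<lambda>x. []) ?t" by (intro pbd_intros)
  then obtain d where d: "\<And>x. ?t x \<le> (length x + 2) ^ d" by (auto simp: pbd_def ctx_size_def)
  have "prod_in (comp_tm M1 M2) x (y x) ((length x + 2) ^ d)" for x
  proof -
    have "length (f x) \<le> length x + (length x + 2) ^ a" by (rule prod_in_length[OF assms(1,3)])
    then have "(length (f x) + 2) ^ b \<le> (length x + (length x + 2) ^ a + 2) ^ b" by (intro power_mono) auto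
    from prod_in_comp[OF assms(1,2,3) prod_in_mono[OF assms(4) this]] show ?thesis
      by (rule prod_in_mono) (rule d)
  qed
  then show ?thesis by blast
qed

lemma class_P_tm:
  assumes "A \<in> class_P"
  obtains M d where "wf_tm M" "\<And>w. prod_in M w [w \<in> A] ((length w + 2) ^ d)"
proof -
  from assms obtain M p where M: "wf_tm M" "\<And>w. halts_within M w (poly p (length w))" "\<And>w. outputs M w [w \<in> A]"
    unfolding class_P_def polytime_on_def by auto
  obtain d where "\<And>n. poly p n \<le> (n + 2) ^ d" using poly_le_power by blast
  then have "prod_in M w [w \<in> A] ((length w + 2) ^ d)" for w using prod_in_mono[OF prod_inI[OF M(2,3)]] by blast
  with M(1) that show ?thesis by blast
qed

text \<open>The verifier drops the certificate and decides the first component of the pair. The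
  inclusion is needed because the assumption on the classes only says that they differ.\<close>

lemma class_P_subset_NP: "class_P \<subseteq> class_NP"
proof
  fix A assume "A \<in> class_P"
  then obtain M a where M: "wf_tm M" "\<And>w. prod_in M w [w \<in> A] ((length w + 2) ^ a)"
    using class_P_tm by metis
  from em_tm[OF em_dec_word] obtain D b where D: "wf_tm D" "\<And>y. prod_in D y (dec_word y) ((length y + 2) ^ b)" by blast
  from comp_poly[OF D(1) M(1) D(2) M(2)] obtain d
    where "\<And>y. prod_in (comp_tm D M) y [dec_word y \<in> A] ((length y + 2) ^ d)" by blast
  then have "{y. dec_word y \<in> A} \<in> class_P" by (intro class_P_I[OF wf_comp_tm[OF D(1) M(1)]]) simp
  moreover have "x \<in> A \<longleftrightarrow> (\<exists>u. length u \<le> poly 0 (length x) \<and> enc_pair x u \<in> {y. dec_word y \<in> A})" for x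
    by (auto simp: dec_word_enc_pair)
  ultimately show "A \<in> class_NP" unfolding class_NP_def by blast
qed

theorem theorem24:
  fixes \<alpha> :: real and pt :: "bool list \<Rightarrow> real \<times> real"
  assumes "0 \<le> \<alpha>" and "\<alpha> < 1"
    and "class_P \<noteq> class_NP"
  shows "\<not> (\<exists>M. polytime_approximation pt
            {I. flamecast_instance I \<and> cost_exp I = \<alpha> \<and> sources I \<noteq> {} \<and>
                group_equally_spaced_circular I \<and> intermediate_layers I = 1}
            (\<lambda>I. 1 + 1 / real (card (sources I)) ^ 2) M)"
proof
  let ?\<I> = "{I. flamecast_instance I \<and> cost_exp I = \<alpha> \<and> sources I \<noteq> {} \<and>
                group_equally_spaced_circular I \<and> intermediate_layers I = 1}"
  assume "\<exists>M. polytime_approximation pt ?\<I> (\<lambda>I. 1 + 1 / real (card (sources I)) ^ 2) M"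
  then obtain M where M: "polytime_approximation pt ?\<I> (\<lambda>I. 1 + 1 / real (card (sources I)) ^ 2) M" ..
  have "class_NP \<subseteq> class_P"
  proof
    fix A assume "A \<in> class_NP"
    then obtain R qq where R: "R \<in> class_P" and
      A: "\<And>x. x \<in> A \<longleftrightarrow> (\<exists>u. length u \<le> poly qq (length x) \<and> enc_pair x u \<in> R)"
      unfolding class_NP_def by blast
    from R obtain N p where N: "wf_tm N" "\<And>w. halts_within N w (poly p (length w))" "\<And>w. outputs N w [w \<in> R]"
      unfolding class_P_def polytime_on_def by auto
    define K where "K = nat \<lceil>2 / (1 - \<alpha>)\<rceil> + 2"
    define e where "e = nat \<lceil>1 / (1 - \<alpha>)\<rceil>"
    interpret reduction_alpha N p qq K e \<alpha>
    proof
      show "wf_tm N" by (rule N(1))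
      show "1 \<le> K" "2 \<le> K" by (simp_all add: K_def)
      show "0 \<le> \<alpha>" "\<alpha> < 1" by (rule assms)+
      show "2 / (1 - \<alpha>) < real K" unfolding K_def by linarith
      have "1 / (1 - \<alpha>) \<le> real e" unfolding e_def by linarith
      then show "1 \<le> real e * (1 - \<alpha>)" using assms(2) by (simp add: field_simps)
    qed
    \<comment> \<open>On all words in question \<open>N\<close> halts within \<open>tt x\<close>
      steps, and its output is the single bit \<open>[w \<in> R]\<close>, so the symbol 2 in cell 0
      of the last tape means acceptance.\<close>
    have acc: "x \<in> A \<longleftrightarrow> (\<exists>u. length u \<le> wl x \<and> accepts N (tt x) (enc_pair x u))" for x
    proof -
      have "accepts N (tt x) (enc_pair x u) \<longleftrightarrow> enc_pair x u \<in> R" if "length u \<le> wl x" for u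
      proof -
        let ?w = "enc_pair x u"
        have "length ?w \<le> 2 * length x + 1 + wl x" using that by (simp add: enc_pair_def length_enc_word)
        from poly_mono_nat[OF this, of p] have "poly p (length ?w) \<le> tt x" unfolding tt_def by linarith
        then have "prod_in N ?w [?w \<in> R] (tt x)" using prod_in_mono[OF prod_inI[OF N(2,3)]] by blast
        then show ?thesis by (auto simp: accepts_def prod_in_def tape_holds_def bit_symbol_def)
      qed
      then show ?thesis unfolding A wl_def by blast
    qed
    have wfM: "wf_tm M" using M by (simp add: polytime_approximation_def)
    have ins: "ins x \<in> ?\<I>" for x using ins_class by simp
    from M obtain pM where pM: "\<And>w. \<exists>I\<in>?\<I>. encodes_instance w I \<Longrightarrow> halts_within M w (poly pM (length w))"
      unfolding polytime_approximation_def polytime_on_def by auto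
    obtain b where b: "\<And>n. poly pM n \<le> (n + 2) ^ b" using poly_le_power by blast
    have "\<exists>y. prod_in M (red x) y ((length (red x) + 2) ^ b) \<and> (dtest y \<longleftrightarrow> x \<in> A)" for x
    proof -
      have "\<exists>y L. outputs M (red x) y \<and> encodes_layout pt y L \<and> valid_layout (ins x) L \<and>
               layout_cost (ins x) L \<le> (1 + 1 / real (card (sources (ins x))) ^ 2) * opt_cost (ins x)"
        using M ins[of x] ins_class(7)[of x] ins_valid[of x] unfolding polytime_approximation_def by blast
      then obtain y L where y: "outputs M (red x) y" "encodes_layout pt y L" "valid_layout (ins x) L"
        "layout_cost (ins x) L \<le> (1 + 1 / real (card (sources (ins x))) ^ 2) * opt_cost (ins x)" by blast
      have "halts_within M (red x) (poly pM (length (red x)))" using pM ins ins_class(7) by blast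
      from prod_in_mono[OF prod_inI[OF this y(1)] b] dtest_correct[OF y(2-4)] show ?thesis unfolding acc by blast
    qed
    \<comment> \<open>One suitable output is chosen for every \<open>x\<close>. This is enough,
      since the composition of machines refers to the words on the tapes and not to a function given
      in advance.\<close>
    then obtain y where y: "\<And>x. prod_in M (red x) (y x) ((length (red x) + 2) ^ b)" "\<And>x. dtest (y x) \<longleftrightarrow> x \<in> A"
      by metis
    from em_tm[OF em_red] obtain M1 a where M1: "wf_tm M1" "\<And>x. prod_in M1 x (red x) ((length x + 2) ^ a)" by blast
    from em_tm[OF em_bool[OF pp_dtest]] obtain D c where D: "wf_tm D" "\<And>w. prod_in D w [dtest w] ((length w + 2) ^ c)" by blast
    from comp_poly[OF M1(1) wfM M1(2) y(1)] obtain d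
      where d: "\<And>x. prod_in (comp_tm M1 M) x (y x) ((length x + 2) ^ d)" by blast
    note wf2 = wf_comp_tm[OF M1(1) wfM]
    from comp_poly[OF wf2 D(1) d D(2)] obtain f
      where f: "\<And>x. prod_in (comp_tm (comp_tm M1 M) D) x [dtest (y x)] ((length x + 2) ^ f)" by blast
    show "A \<in> class_P"
      by (rule class_P_I[OF wf_comp_tm[OF wf2 D(1)]]) (use f y(2) in simp)
  qed
  with class_P_subset_NP assms(3) show False by blast
qed

end
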